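(* Let $u\in U_{ad}$, $y_0\in\mathcal V$, $y_d\in H$ with compact support, and let $y\in W(V)\cap L^\infty(V)$ be the solution of the viscous Burgers state equation associated with $u$. Then the adjoint equation $$\tfrac{d}{dt}\langle p(t),\varphi\rangle_H+\langle y(t)\partial_x p(t),\varphi\rangle_H-\nu\langle\partial_x p(t),\partial_x\varphi\rangle_H=0,\qquad \langle p(T),\psi\rangle_H=\langle y_d-y(T),\psi\rangle_H$$ for all $\varphi\in V$, $\psi\in H$ and a.e. $t\in(0,T)$, has a unique solution $p\in W(V)$. Moreover, there exists a constant $C>0$ such that $$\|p\|_{W(V)}\le C\|y(T)-y_d\|_H.$$
   Context: $T>0$, $\nu>0$, $-\infty<u_l\le u_u<\infty$ are fixed. $V:=H^1(\mathbb R)$, $H:=L^2(\mathbb R)$, $L^2(V):=L^2(0,T;V)$, $L^\infty(V):=L^\infty(0,T;V)$, $W(V):=\{y\in L^2(V): \partial_t y\in L^2(0,T;V^* )\}$ with its natural (graph) norm, and $V\hookrightarrow H=H^*\hookrightarrow V^*$. $\mathcal V\subset V$ is the set of functions in $V$ with support in a bounded interval $[a,b]$, $-\infty<a\le b<\infty$. $U_{ad}:=\{u\in H^1(0,T): u_l\le u(t)\le u_u\text{ a.e.}\}$. With $\chi_c\in C_0^\infty(\mathbb R)$ fixed and $(\mathcal Bu)(x,t)=\chi_c(x)u(t)$, the state equation is: for all $\varphi\in V$, $\psi\in H$, a.e. $t\in(0,T)$, $\frac{d}{dt}\langle y(t),\varphi\rangle_H+\langle y(t)\partial_x y(t),\varphi\rangle_H+\nu\langle\partial_x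 y(t),\partial_x\varphi\rangle_H=\langle\mathcal Bu(t),\varphi\rangle_H$ and $\langle y(0),\psi\rangle_H=\langle y_0,\psi\rangle_H$. *)

theory Defs
  imports "HOL-Analysis.Analysis"
begin

section \<open>Lebesgue and Sobolev spaces on an open set of the line\<close>

text \<open>
  Elements of \<open>L\<^sup>2\<close>, \<open>H\<^sup>1\<close> and of the Bochner spaces below are represented by functions; the
  members of one equivalence class are the functions that agree almost everywhere, and
  the norms below are seminorms on these representatives.
\<close>

definition L2 :: "real set \<Rightarrow> (real \<Rightarrow> real) set" where
  "L2 \<Omega> = {f \<in> borel_measurable (lebesgue_on \<Omega>). integrable (lebesgue_on \<Omega>) (\<lambda>x. (f x)\<^sup>2)}"

definition test_functions :: "real set \<Rightarrow> (real \<Rightarrow> real) set" where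
  "test_functions \<Omega> =
     {\<theta>. (\<forall>k x. (deriv ^^ k) \<theta> differentiable (at x)) \<and>
          (\<exists>K. compact K \<and> K \<subseteq> \<Omega> \<and> (\<forall>x. x \<notin> K \<longrightarrow> \<theta> x = 0))}"

definition locally_integrable :: "real set \<Rightarrow> (real \<Rightarrow> real) \<Rightarrow> bool" where
  "locally_integrable \<Omega> f \<longleftrightarrow> (\<forall>K. compact K \<and> K \<subseteq> \<Omega> \<longrightarrow> integrable (lebesgue_on K) f)"

definition has_weak_deriv :: "real set \<Rightarrow> (real \<Rightarrow> real) \<Rightarrow> (real \<Rightarrow> real) \<Rightarrow> bool" where
  "has_weak_deriv \<Omega> f g \<longleftrightarrow> locally_integrable \<Omega> f \<and> locally_integrable \<Omega> g \<and>
     (\<forall>\<theta>\<in>test_functions \<Omega>.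
        (LINT x|lebesgue_on \<Omega>. f x * deriv \<theta> x) = - (LINT x|lebesgue_on \<Omega>. g x * \<theta> x))"

text \<open>The weak derivative is determined only up to a null set; any representative will do.\<close>

definition weak_deriv :: "real set \<Rightarrow> (real \<Rightarrow> real) \<Rightarrow> real \<Rightarrow> real" where
  "weak_deriv \<Omega> f = (SOME g. has_weak_deriv \<Omega> f g)"

definition H1 :: "real set \<Rightarrow> (real \<Rightarrow> real) set" where
  "H1 \<Omega> = {f \<in> L2 \<Omega>. \<exists>g\<in>L2 \<Omega>. has_weak_deriv \<Omega> f g}"


section \<open>The Gelfand triple \<open>V = H\<^sup>1(\<real>)\<close>, \<open>H = L\<^sup>2(\<real>)\<close>, \<open>V\<^sup>*\<close>\<close>

abbreviation H :: "(real \<Rightarrow> real) set" where "H \<equiv> L2 UNIV"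

abbreviation V :: "(real \<Rightarrow> real) set" where "V \<equiv> H1 UNIV"

abbreviation Dx :: "(real \<Rightarrow> real) \<Rightarrow> real \<Rightarrow> real" where "Dx \<equiv> weak_deriv UNIV"

definition inner_H :: "(real \<Rightarrow> real) \<Rightarrow> (real \<Rightarrow> real) \<Rightarrow> real" where
  "inner_H f g = (LINT x|lebesgue. f x * g x)"

definition norm_H :: "(real \<Rightarrow> real) \<Rightarrow> real" where
  "norm_H f = sqrt (inner_H f f)"

definition norm_V :: "(real \<Rightarrow> real) \<Rightarrow> real" where
  "norm_V f = sqrt ((norm_H f)\<^sup>2 + (norm_H (Dx f))\<^sup>2)"

text \<open>
  Bounded linear functionals on \<open>V\<close>; their values outside \<open>V\<close> are irrelevant. Boundedness
  forces them to take the same value on almost everywhere equal functions.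
\<close>

definition V_dual :: "((real \<Rightarrow> real) \<Rightarrow> real) set" where
  "V_dual = {F. (\<forall>f\<in>V. \<forall>g\<in>V. F (\<lambda>x. f x + g x) = F f + F g) \<and>
                (\<forall>c. \<forall>f\<in>V. F (\<lambda>x. c * f x) = c * F f) \<and>
                (\<exists>C. \<forall>f\<in>V. \<bar>F f\<bar> \<le> C * norm_V f)}"

definition norm_V_dual :: "((real \<Rightarrow> real) \<Rightarrow> real) \<Rightarrow> real" where
  "norm_V_dual F = (SUP f\<in>{f \<in> V. norm_V f \<le> 1}. \<bar>F f\<bar>)"

definition V_bounded_support :: "(real \<Rightarrow> real) set" where
  "V_bounded_support = {f \<in> V. \<exists>a b. a \<le> b \<and> (AE x in lebesgue. x \<notin> {a..b} \<longrightarrow> f x = 0)}"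

definition H_compact_support :: "(real \<Rightarrow> real) set" where
  "H_compact_support = {f \<in> H. \<exists>K. compact K \<and> (AE x in lebesgue. x \<notin> K \<longrightarrow> f x = 0)}"


section \<open>Bochner spaces on the time interval\<close>

text \<open>
  The set \<open>X\<close> with seminorm \<open>N\<close> is \<open>V\<close> with \<^const>\<open>norm_V\<close>, or \<^const>\<open>V_dual\<close> with
  \<^const>\<open>norm_V_dual\<close>. As the elements of both are real-valued functions, one definition
  serves for both.
\<close>

abbreviation time_measure :: "real \<Rightarrow> real measure" where
  "time_measure T \<equiv> lebesgue_on {0<..<T}"

definition strongly_measurable ::
    "real \<Rightarrow> ('a \<Rightarrow> real) set \<Rightarrow> (('a \<Rightarrow> real) \<Rightarrow> real) \<Rightarrow> (real \<Rightarrow> 'a \<Rightarrow> real) \<Rightarrow> bool" where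
  "strongly_measurable T X N w \<longleftrightarrow>
     (\<exists>s. (\<forall>n. simple_function (time_measure T) (s n) \<and> (\<forall>t\<in>{0<..<T}. s n t \<in> X)) \<and>
          (AE t in time_measure T. (\<lambda>n. N (\<lambda>a. s n t a - w t a)) \<longlonglongrightarrow> 0))"

definition bochner_L2 ::
    "real \<Rightarrow> ('a \<Rightarrow> real) set \<Rightarrow> (('a \<Rightarrow> real) \<Rightarrow> real) \<Rightarrow> (real \<Rightarrow> 'a \<Rightarrow> real) set" where
  "bochner_L2 T X N =
     {w. (AE t in time_measure T. w t \<in> X) \<and> strongly_measurable T X N w \<and>
         integrable (time_measure T) (\<lambda>t. (N (w t))\<^sup>2)}"

definition bochner_Linf ::
    "real \<Rightarrow> ('a \<Rightarrow> real) set \<Rightarrow> (('a \<Rightarrow> real) \<Rightarrow> real) \<Rightarrow> (real \<Rightarrow> 'a \<Rightarrow> real) set" where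
  "bochner_Linf T X N =
     {w. (AE t in time_measure T. w t \<in> X) \<and> strongly_measurable T X N w \<and>
         (\<exists>C. AE t in time_measure T. N (w t) \<le> C)}"

definition bochner_L2_norm ::
    "real \<Rightarrow> (('a \<Rightarrow> real) \<Rightarrow> real) \<Rightarrow> (real \<Rightarrow> 'a \<Rightarrow> real) \<Rightarrow> real" where
  "bochner_L2_norm T N w = sqrt (LINT t|time_measure T. (N (w t))\<^sup>2)"

text \<open>
  With \<open>V \<hookrightarrow> H = H\<^sup>* \<hookrightarrow> V\<^sup>*\<close>, the function \<open>y(t)\<close> is the functional \<open>\<phi> \<mapsto> \<langle>y(t), \<phi>\<rangle>\<close>, taken in \<open>H\<close>.
  So \<open>v = \<partial>\<^sub>t y\<close> is the identity \<open>\<integral> y \<theta>' dt = - \<integral> v \<theta> dt\<close> in \<open>V\<^sup>*\<close> for all test functions \<open>\<theta>\<close>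
  on \<open>(0,T)\<close>; an identity in \<open>V\<^sup>*\<close> is checked on every \<open>\<phi>\<close> in \<open>V\<close>, and evaluation at \<open>\<phi>\<close>
  commutes with the integral.
\<close>

definition has_time_deriv ::
    "real \<Rightarrow> (real \<Rightarrow> real \<Rightarrow> real) \<Rightarrow> (real \<Rightarrow> (real \<Rightarrow> real) \<Rightarrow> real) \<Rightarrow> bool" where
  "has_time_deriv T y v \<longleftrightarrow>
     (\<forall>\<phi>\<in>V. has_weak_deriv {0<..<T} (\<lambda>t. inner_H (y t) \<phi>) (\<lambda>t. v t \<phi>))"

definition time_deriv :: "real \<Rightarrow> (real \<Rightarrow> real \<Rightarrow> real) \<Rightarrow> real \<Rightarrow> (real \<Rightarrow> real) \<Rightarrow> real" where
  "time_deriv T y = (SOME v. v \<in> bochner_L2 T V_dual norm_V_dual \<and> has_time_deriv T y v)"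

definition W_space :: "real \<Rightarrow> (real \<Rightarrow> real \<Rightarrow> real) set" where
  "W_space T = {y \<in> bochner_L2 T V norm_V.
                  \<exists>v \<in> bochner_L2 T V_dual norm_V_dual. has_time_deriv T y v}"

definition W_norm :: "real \<Rightarrow> (real \<Rightarrow> real \<Rightarrow> real) \<Rightarrow> real" where
  "W_norm T y = sqrt ((bochner_L2_norm T norm_V y)\<^sup>2
                      + (bochner_L2_norm T norm_V_dual (time_deriv T y))\<^sup>2)"

definition eq_ae :: "real \<Rightarrow> (real \<Rightarrow> real \<Rightarrow> real) \<Rightarrow> (real \<Rightarrow> real \<Rightarrow> real) \<Rightarrow> bool" where
  "eq_ae T y z \<longleftrightarrow> (AE t in time_measure T. AE x in lebesgue. y t x = z t x)"

text \<open>
  Point values in time, such as \<open>y(0)\<close> and \<open>p(T)\<close>, are those of the representative in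
  \<open>C([0,T]; H)\<close>, which every element of \<open>W(V)\<close> has and which is unique in \<open>C([0,T]; H)\<close>.
\<close>

definition is_cont_rep :: "real \<Rightarrow> (real \<Rightarrow> real \<Rightarrow> real) \<Rightarrow> (real \<Rightarrow> real \<Rightarrow> real) \<Rightarrow> bool" where
  "is_cont_rep T y z \<longleftrightarrow>
     (\<forall>t\<in>{0..T}. z t \<in> H) \<and>
     (\<forall>s\<in>{0..T}. ((\<lambda>t. norm_H (\<lambda>x. z t x - z s x)) \<longlongrightarrow> 0) (at s within {0..T})) \<and>
     eq_ae T z y"

definition cont_rep :: "real \<Rightarrow> (real \<Rightarrow> real \<Rightarrow> real) \<Rightarrow> real \<Rightarrow> real \<Rightarrow> real" where
  "cont_rep T y = (SOME z. is_cont_rep T y z)"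


section \<open>State and adjoint equation\<close>

definition U_ad :: "real \<Rightarrow> real \<Rightarrow> real \<Rightarrow> (real \<Rightarrow> real) set" where
  "U_ad T ul uu = {u \<in> H1 {0<..<T}. AE t in time_measure T. ul \<le> u t \<and> u t \<le> uu}"

text \<open>\<open>\<kappa>\<close> is the cut-off function \<open>\<chi>\<^sub>c\<close> in \<open>(\<B> u)(x,t) = \<chi>\<^sub>c(x) u(t)\<close>.\<close>

definition state_solution ::
    "real \<Rightarrow> real \<Rightarrow> (real \<Rightarrow> real) \<Rightarrow> (real \<Rightarrow> real) \<Rightarrow> (real \<Rightarrow> real) \<Rightarrow> (real \<Rightarrow> real \<Rightarrow> real) \<Rightarrow> bool" where
  "state_solution T \<nu> \<kappa> u y0 y \<longleftrightarrow>
     (\<forall>\<phi>\<in>V. AE t in time_measure T.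
        weak_deriv {0<..<T} (\<lambda>s. inner_H (y s) \<phi>) t
          + inner_H (\<lambda>x. y t x * Dx (y t) x) \<phi>
          + \<nu> * inner_H (Dx (y t)) (Dx \<phi>)
        = inner_H (\<lambda>x. \<kappa> x * u t) \<phi>) \<and>
     (\<forall>\<psi>\<in>H. inner_H (cont_rep T y 0) \<psi> = inner_H y0 \<psi>)"

definition adjoint_solution ::
    "real \<Rightarrow> real \<Rightarrow> (real \<Rightarrow> real \<Rightarrow> real) \<Rightarrow> (real \<Rightarrow> real) \<Rightarrow> (real \<Rightarrow> real \<Rightarrow> real) \<Rightarrow> bool" where
  "adjoint_solution T \<nu> y yd p \<longleftrightarrow>
     (\<forall>\<phi>\<in>V. AE t in time_measure T.
        weak_deriv {0<..<T} (\<lambda>s. inner_H (p s) \<phi>) t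
          + inner_H (\<lambda>x. y t x * Dx (p t) x) \<phi>
          - \<nu> * inner_H (Dx (p t)) (Dx \<phi>)
        = 0) \<and>
     (\<forall>\<psi>\<in>H. inner_H (cont_rep T p T) \<psi> = inner_H (\<lambda>x. yd x - cont_rep T y T x) \<psi>)"

end

theory Submission
  imports Defs
begin

text \<open>
  Representatives are replaced by elements of Hilbert space types: \<open>'b l2\<close> is \<open>L\<^sup>2(\<real>; 'b)\<close>, its
  instance at \<open>real\<close> is \<open>H\<close>, and \<open>vq\<close> is the graph of the weak derivative in \<open>H \<times> H\<close>, that is \<open>V\<close>;
  by Riesz' theorem \<open>vq\<close> also serves as \<open>V\<^sup>*\<close>. Since \<open>H\<^sup>1(\<real>)\<close> embeds into \<open>L\<^sup>\<infinity>\<close> and \<open>y\<close> is bounded in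
  \<open>V\<close>, the form \<open>\<nu>\<langle>p\<^sub>x, \<phi>\<^sub>x\<rangle> - \<langle>y p\<^sub>x, \<phi>\<rangle>\<close> is bounded on \<open>V\<close> and satisfies a Garding inequality,
  uniformly in time.

  Existence is Lions' projection argument: testing the adjoint problem with \<open>exp (-2 \<mu> t) \<phi>\<close> bounds
  \<open>\<phi>(T)\<close> by the norm of the transposed operator applied to \<open>\<phi>\<close>, so the functional
  \<open>\<phi> \<mapsto> \<langle>y\<^sub>d - y(T), \<phi>(T)\<rangle>\<close> is represented by an element of \<open>L\<^sup>2(V)\<close>, and the bound is the claimed
  estimate. The energy identity \<open>|w(t)|\<^sup>2 - |w(s)|\<^sup>2 = 2 \<integral> \<langle>w', w\<rangle>\<close> in \<open>W(V)\<close> comes from a symmetric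
  difference quotient of \<open>|w|\<^sup>2\<close>; it yields the representative in \<open>C([0,T]; H)\<close> and, by Gronwall's
  argument, uniqueness.
\<close>

section \<open>Hilbert spaces: Riesz representation, separability, weak measurability\<close>

text \<open>Time runs backwards: the equation reads p' = a(p) with \<open>a\<close> coercive up to
  the norm of \<open>H\<close>, which can be solved from the terminal value down. The test functions
  in Lions' argument therefore vanish at time \<open>0\<close> and are free at time
  \<open>T\<close>, so that the terminal condition appears as a natural boundary condition.

  The obstacle in the energy identity is that a function in W(V) has values in \<open>V\<close> but
  its derivative only in the dual of \<open>V\<close>, so no product rule applies to |w|^2. In the
  symmetric quotient the difference w(t+h) - w(t), an increment of the primitive of the derivative,
  is paired with the sum w(t+h) + w(t), which still lies in \<open>V\<close>; no smoothing of w
  itself is involved.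

  Separability belongs to the class because vector statements are reduced to scalar ones: what holds
  almost everywhere for each fixed test vector, with a null set depending on the vector, holds
  outside one null set for a countable dense set of vectors, and then for all by continuity. Types
  in place of sets of representatives make Bochner integration and completeness available through
  type classes.\<close>

class sep_hilbert = real_inner + banach + second_countable_topology

instance real :: sep_hilbert ..

instance prod :: (sep_hilbert, sep_hilbert) sep_hilbert ..

text \<open>A functional is given as a set of pairs of argument and value, so neither a closed
  domain nor its well-definedness has to be settled beforehand; the bound takes care of both.
  Minimising \<open>(norm x)\<^sup>2 - 2 * l\<close> over \<open>R\<close> gives a Cauchy sequence
  of first components by the parallelogram law, and \<open>p\<close> is its limit. The clause on the
  closure is what yields orthogonal projections.\<close>

lemma riesz_linear_relation:
  fixes R :: "('a::{real_inner,complete_space} \<times> real) set"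
  assumes R: "subspace R" and M: "0 \<le> M"
    and bd: "\<And>x l. (x, l) \<in> R \<Longrightarrow> \<bar>l\<bar> \<le> M * norm x"
  obtains p where "norm p \<le> M" "p \<in> closure (fst ` R)" "\<And>x l. (x, l) \<in> R \<Longrightarrow> l = p \<bullet> x"
proof -
  define f :: "'a \<times> real \<Rightarrow> real" where "f z = (norm (fst z))\<^sup>2 - 2 * snd z" for z
  have low: "- M\<^sup>2 \<le> f z" if "z \<in> R" for z
  proof -
    have "\<bar>snd z\<bar> \<le> M * norm (fst z)" using bd[of "fst z" "snd z"] that by simp
    moreover have "0 \<le> (norm (fst z) - M)\<^sup>2" by simp
    ultimately show ?thesis unfolding f_def by (simp add: power2_diff field_simps)
  qed
  have zR: "0 \<in> R" using R by (rule subspace_0)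
  define d where "d = Inf (f ` R)"
  have dle: "d \<le> f z" if "z \<in> R" for z
    unfolding d_def by (rule cInf_lower) (use low that in \<open>auto intro!: bdd_belowI\<close>)
  have "\<exists>z\<in>R. f z < d + 1 / real (Suc n)" for n
  proof -
    have "Inf (f ` R) < d + 1 / real (Suc n)" unfolding d_def by simp
    then show ?thesis using cInf_lessD[of "f ` R"] zR by blast
  qed
  then obtain z where z: "\<And>n. z n \<in> R" "\<And>n. f (z n) < d + 1 / real (Suc n)" by metis
  define x where "x n = fst (z n)" for n
  define l where "l n = snd (z n)" for n
  have xl: "(x n, l n) \<in> R" for n using z by (simp add: x_def l_def)
  \<comment> \<open>The midpoint of two almost minimisers lies in \<open>R\<close>, so its
    \<open>f\<close>-value is at least \<open>d\<close>; the parallelogram identity turns this into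
    a bound on their distance.\<close>
  have par: "(norm (x n - x m))\<^sup>2 \<le> 2 / real (Suc n) + 2 / real (Suc m)" for n m
  proof -
    have "(1/2) *\<^sub>R (z n + z m) \<in> R"
      using R z by (intro subspace_scale subspace_add)
    from dle[OF this] have "d \<le> (norm (x n + x m))\<^sup>2 / 4 - (2 * l n + 2 * l m) / 2"
      by (simp add: f_def x_def l_def power_mult_distrib power_divide)
    then have mid: "4 * d \<le> (norm (x n + x m))\<^sup>2 - 4 * (l n + l m)"
      by argo
    have "(norm (x n - x m))\<^sup>2 = 2 * (norm (x n))\<^sup>2 + 2 * (norm (x m))\<^sup>2 - (norm (x n + x m))\<^sup>2"
      by (simp add: power2_norm_eq_inner inner_simps inner_commute)
    also have "\<dots> = 2 * f (z n) + 2 * f (z m) - ((norm (x n + x m))\<^sup>2 - 4 * (l n + l m))"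
      by (simp add: f_def x_def l_def)
    also have "\<dots> \<le> 2 * f (z n) + 2 * f (z m) - 4 * d" using mid by simp
    also have "\<dots> \<le> 2 / real (Suc n) + 2 / real (Suc m)"
    proof -
      have "2 / real (Suc k) = 2 * (1 / real (Suc k))" for k by simp
      then show ?thesis using z(2)[of n] z(2)[of m] by linarith
    qed
    finally show ?thesis .
  qed
  have "Cauchy x"
  proof (rule metric_CauchyI)
    fix e :: real assume e: "0 < e"
    obtain N :: nat where N: "4 / e\<^sup>2 < real N" using reals_Archimedean2 by blast
    have "dist (x m) (x n) < e" if "m \<ge> N" "n \<ge> N" for m n
    proof -
      have *: "2 / real (Suc k) < e\<^sup>2 / 2" if "k \<ge> N" for k
      proof -
        have "4 / e\<^sup>2 < real (Suc k)" using N that by linarith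
        then show ?thesis using e by (simp add: field_simps del: of_nat_Suc)
      qed
      have "(norm (x m - x n))\<^sup>2 < e\<^sup>2" using par[of m n] *[OF that(1)] *[OF that(2)] by linarith
      then show ?thesis using e power2_less_imp_less[of "norm (x m - x n)" e] by (simp add: dist_norm)
    qed
    then show "\<exists>M. \<forall>m\<ge>M. \<forall>n\<ge>M. dist (x m) (x n) < e" by blast
  qed
  then obtain p where p: "x \<longlonglongrightarrow> p" using convergent_eq_Cauchy by blast
  have eq: "k = p \<bullet> u" if uk: "(u, k) \<in> R" for u k
  proof -
    \<comment> \<open>First variation: moving the almost minimiser \<open>z n\<close> in direction
      \<open>(u, k)\<close> lowers \<open>f\<close> by less than
      \<open>1 / real (Suc n)\<close>.\<close>
    have ineq: "0 \<le> 2 * t * (p \<bullet> u - k) + t\<^sup>2 * (norm u)\<^sup>2" for t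
    proof (rule LIMSEQ_le_const)
      show "(\<lambda>n. 1 / real (Suc n) + (2 * t * (x n \<bullet> u - k) + t\<^sup>2 * (norm u)\<^sup>2))
          \<longlonglongrightarrow> 2 * t * (p \<bullet> u - k) + t\<^sup>2 * (norm u)\<^sup>2"
      proof -
        have "(\<lambda>n. 1 / real (Suc n)) \<longlonglongrightarrow> 0" using LIMSEQ_Suc[OF lim_1_over_n] by simp
        moreover have "(\<lambda>n. 2 * t * (x n \<bullet> u - k) + t\<^sup>2 * (norm u)\<^sup>2)
            \<longlonglongrightarrow> 2 * t * (p \<bullet> u - k) + t\<^sup>2 * (norm u)\<^sup>2"
          by (intro tendsto_intros p)
        ultimately show ?thesis using tendsto_add by force
      qed
      have "0 \<le> 1 / real (Suc n) + (2 * t * (x n \<bullet> u - k) + t\<^sup>2 * (norm u)\<^sup>2)" for n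
      proof -
        have "z n + t *\<^sub>R (u, k) \<in> R" using R z uk by (intro subspace_scale subspace_add)
        from dle[OF this] have "d \<le> (norm (x n + t *\<^sub>R u))\<^sup>2 - 2 * (l n + t * k)"
          by (simp add: f_def x_def l_def)
        also have "(norm (x n + t *\<^sub>R u))\<^sup>2 = (norm (x n))\<^sup>2 + 2 * t * (x n \<bullet> u) + t\<^sup>2 * (norm u)\<^sup>2"
          unfolding power2_norm_eq_inner
          by (simp add: inner_simps inner_commute power2_eq_square algebra_simps)
        finally have "d \<le> f (z n) + (2 * t * (x n \<bullet> u - k) + t\<^sup>2 * (norm u)\<^sup>2)"
          by (simp add: f_def x_def l_def algebra_simps)
        then show ?thesis using z(2)[of n] by linarith
      qed
      then show "\<exists>N. \<forall>n\<ge>N. 0 \<le> 1 / real (Suc n) + (2 * t * (x n \<bullet> u - k) + t\<^sup>2 * (norm u)\<^sup>2)"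
        by blast
    qed
    define b where "b = p \<bullet> u - k"
    \<comment> \<open>The quadratic in \<open>t\<close> is tested at \<open>- b / A\<close>; the
      added \<open>1\<close> keeps the quotient meaningful for \<open>u = 0\<close>.\<close>
    define A where "A = (norm u)\<^sup>2 + 1"
    have A: "A > 0" unfolding A_def by (simp add: add_nonneg_pos)
    have "0 \<le> 2 * (- b / A) * b + (- b / A)\<^sup>2 * (A - 1)"
      using ineq[of "- b / A"] by (simp add: b_def A_def)
    also have "\<dots> = - (b\<^sup>2 / A) - (b / A)\<^sup>2"
      using A by (simp add: field_simps power2_eq_square)
    finally have "b\<^sup>2 / A \<le> 0" using zero_le_power2[of "b / A"] by linarith
    then have "b = 0" using A by (auto simp: divide_le_0_iff power2_eq_square mult_le_0_iff)
    then show ?thesis by (simp add: b_def)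
  qed
  have "(norm p)\<^sup>2 \<le> M * norm p"
  proof (rule LIMSEQ_le)
    show "(\<lambda>n. p \<bullet> x n) \<longlonglongrightarrow> (norm p)\<^sup>2"
      unfolding power2_norm_eq_inner by (intro tendsto_intros p)
    show "(\<lambda>n. M * norm (x n)) \<longlonglongrightarrow> M * norm p" by (intro tendsto_intros p)
    have "p \<bullet> x n \<le> M * norm (x n)" for n
      using bd[OF xl[of n]] eq[OF xl[of n]] by simp
    then show "\<exists>N. \<forall>n\<ge>N. p \<bullet> x n \<le> M * norm (x n)" by blast
  qed
  then have "norm p \<le> M"
    using M by (cases "norm p = 0") (auto simp: power2_eq_square)
  moreover have "p \<in> closure (fst ` R)"
    unfolding closure_sequential using p xl by (metis fst_conv image_eqI)
  ultimately show ?thesis using eq that by blast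
qed

lemma riesz_representation:
  fixes L :: "'a::{real_inner,complete_space} \<Rightarrow> real"
  assumes L: "linear L" and M: "0 \<le> M" and bd: "\<And>x. \<bar>L x\<bar> \<le> M * norm x"
  shows "\<exists>p. norm p \<le> M \<and> (\<forall>x. L x = x \<bullet> p)"
proof -
  have "subspace (range (\<lambda>x. (x, L x)))"
    by (rule linear_subspace_image)
      (use L in \<open>auto simp: linear_iff scaleR_prod_def\<close>)
  moreover have "\<bar>l\<bar> \<le> M * norm x" if "(x, l) \<in> range (\<lambda>x. (x, L x))" for x l
    using that bd by auto
  ultimately obtain p where "norm p \<le> M" "\<And>x l. (x, l) \<in> range (\<lambda>x. (x, L x)) \<Longrightarrow> l = p \<bullet> x"
    using riesz_linear_relation[OF _ M] by (metis (no_types, lifting))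
  then show ?thesis by (metis inner_commute rangeI)
qed

text \<open>Representing the restriction of \<open>x \<bullet> _\<close> to \<open>S\<close> gives
  the orthogonal projection \<open>p\<close> of \<open>x\<close>. It lies in \<open>S\<close>
  because \<open>S\<close> is closed, and \<open>x - p\<close> annihilates \<open>S\<close>, hence
  vanishes.\<close>

lemma closed_subspace_total:
  fixes S :: "'a::{real_inner,complete_space} set"
  assumes S: "subspace S" "closed S" and total: "\<And>x. (\<And>b. b \<in> S \<Longrightarrow> x \<bullet> b = 0) \<Longrightarrow> x = 0"
  shows "x \<in> S"
proof -
  have sub: "subspace ((\<lambda>s. (s, x \<bullet> s)) ` S)"
    by (rule linear_subspace_image[OF _ S(1)]) (intro linearI; simp add: inner_add_right)
  have bd: "\<bar>l\<bar> \<le> norm x * norm s" if "(s, l) \<in> (\<lambda>s. (s, x \<bullet> s)) ` S" for s l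
    using that by (auto simp: Cauchy_Schwarz_ineq2)
  obtain p where "norm p \<le> norm x" and p: "p \<in> closure (fst ` (\<lambda>s. (s, x \<bullet> s)) ` S)"
    "\<And>s l. (s, l) \<in> (\<lambda>s. (s, x \<bullet> s)) ` S \<Longrightarrow> l = p \<bullet> s"
    by (rule riesz_linear_relation[OF sub norm_ge_zero[of x] bd]) blast+
  have "p \<in> S" using p(1) S(2) by (simp add: image_image)
  moreover have "x - p = 0"
  proof (rule total)
    fix b assume "b \<in> S"
    then have "x \<bullet> b = p \<bullet> b" using p(2) by blast
    then show "(x - p) \<bullet> b = 0" by (simp add: inner_simps)
  qed
  ultimately show ?thesis by simp
qed

section \<open>Separability from a total set\<close>

lemma dense_imp_countable_subbasis:
  fixes D :: "'a::metric_space set"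
  assumes D: "countable D" and dense: "\<And>x. x \<in> closure D"
  shows "\<exists>B::'a set set. countable B \<and> open = generate_topology B"
proof -
  define B where "B = (\<lambda>(d, n). ball d (1 / real (Suc n))) ` (D \<times> (UNIV :: nat set))"
  have "countable B" unfolding B_def using D by auto
  moreover have "topological_basis B"
  proof (rule topological_basisI)
    fix S :: "'a set" and x assume S: "open S" "x \<in> S"
    then obtain e where e: "0 < e" "ball x e \<subseteq> S" using openE by blast
    obtain n where n: "1 / real (Suc n) < e / 2" using nat_approx_posE[of "e/2"] e by auto
    obtain d where d: "d \<in> D" "dist d x < 1 / real (Suc n)"
      using dense[of x] unfolding closure_approachable by (meson of_nat_0_less_iff zero_less_Suc zero_less_divide_1_iff)
    have "ball d (1 / real (Suc n)) \<subseteq> ball x e"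
    proof
      fix z assume "z \<in> ball d (1 / real (Suc n))"
      then have "dist d z < 1 / real (Suc n)" by simp
      moreover have "dist x z \<le> dist x d + dist d z" by (rule dist_triangle)
      ultimately show "z \<in> ball x e" using d n by (simp add: dist_commute)
    qed
    then have "x \<in> ball d (1 / real (Suc n)) \<and> ball d (1 / real (Suc n)) \<subseteq> S"
      using d e by auto
    moreover have "ball d (1 / real (Suc n)) \<in> B" using d by (auto simp: B_def)
    ultimately show "\<exists>b\<in>B. x \<in> b \<and> b \<subseteq> S" by blast
  qed (auto simp: B_def)
  ultimately show ?thesis
    using topological_basis_imp_subbasis by blast
qed

text \<open>Rational combinations are coded as lists of coefficient-vector pairs: countability is
  that of lists, and sums are concatenations. The closure of their set is a closed subspace
  containing \<open>B\<close>, hence everything by \<open>closed_subspace_total\<close>.\<close>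

lemma total_imp_countable_dense:
  fixes B :: "'a::{real_inner,complete_space} set"
  assumes B: "countable B" and total: "\<And>x. (\<And>b. b \<in> B \<Longrightarrow> x \<bullet> b = 0) \<Longrightarrow> x = 0"
  shows "\<exists>D::'a set. countable D \<and> (\<forall>x. x \<in> closure D)"
proof -
  define g :: "(rat \<times> 'a) list \<Rightarrow> 'a" where "g xs = (\<Sum>(q, b)\<leftarrow>xs. of_rat q *\<^sub>R b)" for xs
  define D where "D = g ` lists (UNIV \<times> B)"
  have cD: "countable D" unfolding D_def using B by auto
  have D0: "0 \<in> D" unfolding D_def g_def by (intro image_eqI[of _ _ "[]"]) auto
  have Dadd: "x + y \<in> D" if xy: "x \<in> D" "y \<in> D" for x y
  proof -
    obtain xs ys where "xs \<in> lists (UNIV \<times> B)" "ys \<in> lists (UNIV \<times> B)" "x = g xs" "y = g ys"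
      using xy unfolding D_def by blast
    then show ?thesis unfolding D_def by (intro image_eqI[of _ _ "xs @ ys"]) (auto simp: g_def)
  qed
  have gscale: "g (map (\<lambda>(r, b). (q * r, b)) xs) = of_rat q *\<^sub>R g xs" for q xs
    by (induction xs) (auto simp: g_def of_rat_mult scaleR_add_right)
  have Dscale: "of_rat q *\<^sub>R x \<in> D" if x: "x \<in> D" for q x
  proof -
    obtain xs where xs: "xs \<in> lists (UNIV \<times> B)" "x = g xs" using x unfolding D_def by blast
    then show ?thesis unfolding D_def xs gscale[symmetric]
      by (intro imageI) (auto simp: lists_eq_set)
  qed
  have BD: "b \<in> D" if "b \<in> B" for b
    using that unfolding D_def by (intro image_eqI[of _ _ "[(1, b)]"]) (auto simp: g_def)
  have S: "subspace (closure D)"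
    unfolding subspace_def
  proof (intro conjI ballI allI)
    show "0 \<in> closure D" using D0 closure_subset by blast
  next
    fix x y assume "x \<in> closure D" "y \<in> closure D"
    then obtain f h where "\<And>n. f n \<in> D" "f \<longlonglongrightarrow> x" "\<And>n. h n \<in> D" "h \<longlonglongrightarrow> y"
      unfolding closure_sequential by blast
    then show "x + y \<in> closure D" unfolding closure_sequential
      by (intro exI[of _ "\<lambda>n. f n + h n"]) (auto intro: Dadd tendsto_add)
  next
    fix c :: real and x assume "x \<in> closure D"
    then obtain f where f: "\<And>n. f n \<in> D" "f \<longlonglongrightarrow> x"
      unfolding closure_sequential by blast
    have "c \<in> closure \<rat>" by (simp add: Rats_closure_real)
    then obtain q where q: "\<And>n. q n \<in> \<rat>" "q \<longlonglongrightarrow> c" unfolding closure_sequential by blast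
    have "q n *\<^sub>R f n \<in> D" for n
      using q(1)[of n] Dscale[OF f(1)] by (auto elim!: Rats_cases)
    moreover have "(\<lambda>n. q n *\<^sub>R f n) \<longlonglongrightarrow> c *\<^sub>R x" using q f by (intro tendsto_intros)
    ultimately show "c *\<^sub>R x \<in> closure D" unfolding closure_sequential by (intro exI[of _ "\<lambda>n. q n *\<^sub>R f n"]) simp
  qed
  have "x \<in> closure D" for x
    using closed_subspace_total[OF S closed_closure] total BD closure_subset by (metis subsetD)
  then show ?thesis using cD by blast
qed

lemma countable_dense_closure:
  obtains D :: "'a::{second_countable_topology,metric_space} set" where "countable D" "\<And>x. x \<in> closure D"
proof -
  obtain D :: "'a set" where D: "countable D" "\<And>X. open X \<Longrightarrow> X \<noteq> {} \<Longrightarrow> \<exists>d\<in>D. d \<in> X"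
    using countable_dense_exists by (metis)
  have "x \<in> closure D" for x
    unfolding closure_approachable
  proof (intro allI impI)
    fix e :: real assume "0 < e"
    then show "\<exists>y\<in>D. dist y x < e"
      using D(2)[of "ball x e"] by (auto simp: dist_commute)
  qed
  then show ?thesis using D that by blast
qed

text \<open>Pettis' theorem. A bound on the norm amounts to countably many inequalities between
  inner products with a dense set, so preimages of closed balls are measurable, and an open set is a
  countable union of closed balls with centres in \<open>D\<close>.\<close>

lemma borel_measurable_weak:
  fixes f :: "'x \<Rightarrow> 'a::{real_inner,second_countable_topology}"
  assumes f: "\<And>x. (\<lambda>t. f t \<bullet> x) \<in> borel_measurable M"
  shows "f \<in> borel_measurable M"
proof (rule borel_measurableI)
  fix S :: "'a set" assume S: "open S"
  obtain D :: "'a set" where D: "countable D" "\<And>x. x \<in> closure D"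
    using countable_dense_closure by blast
  have le_iff: "norm v \<le> r \<longleftrightarrow> 0 \<le> r \<and> (\<forall>d\<in>D. v \<bullet> d \<le> r * norm d)" for v :: 'a and r
  proof (intro iffI conjI ballI)
    assume "norm v \<le> r"
    then show "0 \<le> r" using norm_ge_zero order_trans by blast
    show "v \<bullet> d \<le> r * norm d" for d
    proof -
      have "v \<bullet> d \<le> norm v * norm d" by (rule norm_cauchy_schwarz)
      also have "\<dots> \<le> r * norm d" using \<open>norm v \<le> r\<close> by (intro mult_right_mono) auto
      finally show ?thesis .
    qed
  next
    assume a: "0 \<le> r \<and> (\<forall>d\<in>D. v \<bullet> d \<le> r * norm d)"
    obtain h where h: "\<And>n. h n \<in> D" "h \<longlonglongrightarrow> v" using D(2)[of v] unfolding closure_sequential by blast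
    have "v \<bullet> v \<le> r * norm v"
      by (rule LIMSEQ_le[of "\<lambda>n. v \<bullet> h n" _ "\<lambda>n. r * norm (h n)"])
        (use a h in \<open>auto intro!: tendsto_intros\<close>)
    then show "norm v \<le> r" using a
      by (cases "v = 0") (auto simp: power2_norm_eq_inner[symmetric] power2_eq_square)
  qed
  have cb: "f t \<in> cball c r \<longleftrightarrow> norm (f t - c) \<le> r" for t c r
    by (simp add: dist_norm norm_minus_commute)
  have meas: "{t \<in> space M. f t \<in> cball c r} \<in> sets M" for c r
  proof -
    have "{t \<in> space M. f t \<in> cball c r} =
        {t \<in> space M. 0 \<le> r \<and> (\<forall>d\<in>D. f t \<bullet> d - c \<bullet> d \<le> r * norm d)}"
      unfolding cb le_iff inner_diff_left ..
    also have "\<dots> \<in> sets M"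
      using f D(1) by measurable
    finally show ?thesis .
  qed
  have "S = (\<Union>p\<in>{(d, n). d \<in> D \<and> cball d (1 / real (Suc n)) \<subseteq> S}. cball (fst p) (1 / real (Suc (snd p))))"
    (is "S = ?U")
  proof (intro equalityI subsetI)
    fix x assume "x \<in> S"
    then obtain e where e: "0 < e" "ball x e \<subseteq> S" using S openE by blast
    obtain n where n: "1 / real (Suc n) < e / 2" using nat_approx_posE[of "e/2"] e by auto
    obtain d where d: "d \<in> D" "dist d x < 1 / real (Suc n)"
      using D(2)[of x] unfolding closure_approachable by (meson of_nat_0_less_iff zero_less_Suc zero_less_divide_1_iff)
    have "cball d (1 / real (Suc n)) \<subseteq> S"
    proof
      fix z assume "z \<in> cball d (1 / real (Suc n))"
      then have "dist d z \<le> 1 / real (Suc n)" by simp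
      moreover have "dist x z \<le> dist x d + dist d z" by (rule dist_triangle)
      ultimately have "z \<in> ball x e" using d n by (simp add: dist_commute)
      then show "z \<in> S" using e by blast
    qed
    moreover have "x \<in> cball d (1 / real (Suc n))" using d(2) by simp
    ultimately show "x \<in> ?U" using d(1)
      by (intro UN_I[of "(d, n)"]) (simp_all del: of_nat_Suc)
  qed auto
  then have "f -` S \<inter> space M = (\<Union>p\<in>{(d, n). d \<in> D \<and> cball d (1 / real (Suc n)) \<subseteq> S}.
      {t \<in> space M. f t \<in> cball (fst p) (1 / real (Suc (snd p)))})" by blast
  also have "\<dots> \<in> sets M"
  proof (rule sets.countable_UN'')
    show "countable {(d, n::nat). d \<in> D \<and> cball d (1 / real (Suc n)) \<subseteq> S}"
      by (rule countable_subset[of _ "D \<times> UNIV"]) (use D(1) in auto)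
  qed (rule meas)
  finally show "f -` S \<inter> space M \<in> sets M" .
qed

section \<open>Square integrable functions with values in a Hilbert space\<close>

text \<open>Borel functions with \<open>lborel\<close> in place of Lebesgue measurable ones:
  composition and Fubini's theorem then need no completion. Lebesgue measurable representatives are
  exchanged for Borel ones in \<open>H_obtain\<close> and \<open>models_exists\<close>.\<close>

definition sqi :: "(real \<Rightarrow> 'b::sep_hilbert) \<Rightarrow> bool" where
  "sqi f \<longleftrightarrow> f \<in> borel_measurable borel \<and> integrable lborel (\<lambda>x. (norm (f x))\<^sup>2)"

lemma sqiD: "sqi f \<Longrightarrow> f \<in> borel_measurable borel" "sqi f \<Longrightarrow> integrable lborel (\<lambda>x. (norm (f x))\<^sup>2)"
  by (auto simp: sqi_def)

lemma sqi_bound: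
  assumes f: "f \<in> borel_measurable borel" and g: "integrable lborel g"
    and b: "AE x in lborel. (norm (f x))\<^sup>2 \<le> g x"
  shows "sqi f"
  unfolding sqi_def
proof
  show "integrable lborel (\<lambda>x. (norm (f x))\<^sup>2)"
    by (rule Bochner_Integration.integrable_bound[OF g])
      (use f b in \<open>auto elim!: eventually_mono\<close>)
qed (rule f)

lemma norm_inner_le_squares: "norm (x \<bullet> y) \<le> (norm x)\<^sup>2 + (norm y)\<^sup>2"
proof -
  have "norm (x \<bullet> y) \<le> norm x * norm y" by (simp add: Cauchy_Schwarz_ineq2)
  also have "\<dots> \<le> (norm x)\<^sup>2 + (norm y)\<^sup>2"
    using sum_squares_bound[of "norm x" "norm y"] mult_nonneg_nonneg[OF norm_ge_zero[of x] norm_ge_zero[of y]]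
    by linarith
  finally show ?thesis .
qed

lemma norm_add_square_le: "(norm (x + y))\<^sup>2 \<le> 2 * (norm x)\<^sup>2 + 2 * (norm (y::'a::real_normed_vector))\<^sup>2"
proof -
  have "(norm (x + y))\<^sup>2 \<le> (norm x + norm y)\<^sup>2" by (simp add: norm_triangle_ineq power_mono)
  also have "\<dots> \<le> 2 * (norm x)\<^sup>2 + 2 * (norm y)\<^sup>2"
    using sum_squares_bound[of "norm x" "norm y"] by (simp add: power2_sum)
  finally show ?thesis .
qed

lemma sqi_inner:
  assumes "sqi f" "sqi g" shows "integrable lborel (\<lambda>x. f x \<bullet> g x)"
proof (rule Bochner_Integration.integrable_bound)
  show "integrable lborel (\<lambda>x. (norm (f x))\<^sup>2 + (norm (g x))\<^sup>2)"
    using assms by (auto simp: sqi_def)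
  have [measurable]: "f \<in> borel_measurable borel" "g \<in> borel_measurable borel"
    using assms by (simp_all add: sqi_def)
  show "(\<lambda>x. f x \<bullet> g x) \<in> borel_measurable lborel" by simp
  show "AE x in lborel. norm (f x \<bullet> g x) \<le> norm ((norm (f x))\<^sup>2 + (norm (g x))\<^sup>2)"
    using norm_inner_le_squares by (auto simp: abs_of_nonneg)
qed

lemma sqi_zero [simp]: "sqi (\<lambda>_. 0)" by (simp add: sqi_def)

lemma sqi_add: assumes "sqi f" "sqi g" shows "sqi (\<lambda>x. f x + g x)"
  by (rule sqi_bound[of _ "\<lambda>x. 2 * (norm (f x))\<^sup>2 + 2 * (norm (g x))\<^sup>2"])
    (use assms norm_add_square_le in \<open>auto simp: sqi_def\<close>)

lemma sqi_scaleR: assumes "sqi f" shows "sqi (\<lambda>x. c *\<^sub>R f x)"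
  using assms by (auto simp: sqi_def power_mult_distrib)

lemma sqi_minus: "sqi f \<Longrightarrow> sqi (\<lambda>x. - f x)" by (simp add: sqi_def)

lemma sqi_diff: "sqi f \<Longrightarrow> sqi g \<Longrightarrow> sqi (\<lambda>x. f x - g x)"
  using sqi_add[OF _ sqi_minus, of f g] by simp

text \<open>Riesz-Fischer. A subsequence with squared steps below \<open>(1/4)^k\<close> converges
  almost everywhere, and Fatou's lemma transfers the Cauchy estimate to its limit.\<close>

lemma sqi_complete:
  fixes f :: "nat \<Rightarrow> real \<Rightarrow> 'b::sep_hilbert"
  assumes f: "\<And>n. sqi (f n)"
    and cau: "\<And>e. 0 < e \<Longrightarrow> \<exists>N. \<forall>m\<ge>N. \<forall>n\<ge>N. (LINT x|lborel. (norm (f m x - f n x))\<^sup>2) < e"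
  shows "\<exists>g. sqi g \<and> (\<lambda>n. LINT x|lborel. (norm (f n x - g x))\<^sup>2) \<longlonglongrightarrow> 0"
proof -
  have fm [measurable]: "f n \<in> borel_measurable borel" for n using f by (simp add: sqi_def)
  have int: "integrable lborel (\<lambda>x. (norm (f m x - f n x))\<^sup>2)" for m n
    using sqiD(2)[OF sqi_diff[OF f f]] .
  obtain N where N: "\<And>k m n. m \<ge> N k \<Longrightarrow> n \<ge> N k \<Longrightarrow> (LINT x|lborel. (norm (f m x - f n x))\<^sup>2) < (1/4)^k"
  proof -
    have "\<exists>N. \<forall>m\<ge>N. \<forall>n\<ge>N. (LINT x|lborel. (norm (f m x - f n x))\<^sup>2) < (1/4)^k" for k
      using cau[of "(1/4)^k"] by simp
    then show ?thesis using that by metis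
  qed
  \<comment> \<open>Partial sums of the thresholds give indices that are monotone and still at least
    \<open>N k\<close>.\<close>
  define r where "r k = (\<Sum>i\<le>k. N i)" for k
  have rN: "r k \<ge> N k" for k unfolding r_def by (rule member_le_sum) auto
  have rmono: "r k \<le> r l" if "k \<le> l" for k l unfolding r_def by (rule sum_mono2) (use that in auto)
  define d where "d k x = f (r (Suc k)) x - f (r k) x" for k x
  have dm [measurable]: "d k \<in> borel_measurable borel" for k unfolding d_def by measurable
  have dint: "integrable lborel (\<lambda>x. (norm (d k x))\<^sup>2)" "(LINT x|lborel. (norm (d k x))\<^sup>2) \<le> (1/4)^k" for k
    using int N[of k "r (Suc k)" "r k"] rN[of k] rmono[of k "Suc k"] unfolding d_def by (auto simp: less_imp_le)
  \<comment> \<open>The weight \<open>2^k\<close> spends half of the decay \<open>(1/4)^k\<close>: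
    the integral of the weighted series stays finite, and finiteness of the series at
    \<open>x\<close> makes the steps at \<open>x\<close> decay geometrically.\<close>
  have "(\<integral>\<^sup>+x. (\<Sum>k. ennreal (2^k * (norm (d k x))\<^sup>2)) \<partial>lborel) = (\<Sum>k. \<integral>\<^sup>+x. ennreal (2^k * (norm (d k x))\<^sup>2) \<partial>lborel)"
    by (rule nn_integral_suminf) simp
  also have "\<dots> = (\<Sum>k. ennreal (2^k * (LINT x|lborel. (norm (d k x))\<^sup>2)))"
    by (subst nn_integral_eq_integral) (use dint in auto)
  also have "\<dots> \<le> (\<Sum>k. ennreal ((1/2)^k))"
  proof (intro suminf_le ennreal_leI)
    fix k
    have "2^k * (LINT x|lborel. (norm (d k x))\<^sup>2) \<le> 2^k * (1/4)^k" using dint by (intro mult_left_mono) auto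
    also have "\<dots> = (1/2)^k" by (simp add: power_mult_distrib[symmetric])
    finally show "2^k * (LINT x|lborel. (norm (d k x))\<^sup>2) \<le> (1/2)^k" .
  qed auto
  also have "\<dots> = ennreal (\<Sum>k. (1/2)^k)" by (rule suminf_ennreal2) auto
  also have "\<dots> < \<infinity>" by simp
  finally have "(\<integral>\<^sup>+x. (\<Sum>k. ennreal (2^k * (norm (d k x))\<^sup>2)) \<partial>lborel) \<noteq> \<infinity>" by simp
  then have ae: "AE x in lborel. (\<Sum>k. ennreal (2^k * (norm (d k x))\<^sup>2)) \<noteq> \<infinity>"
    by (intro nn_integral_noteq_infinite) auto
  have conv: "convergent (\<lambda>k. f (r k) x)" if "(\<Sum>k. ennreal (2^k * (norm (d k x))\<^sup>2)) \<noteq> \<infinity>" for x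
  proof -
    define C where "C = enn2real (\<Sum>k. ennreal (2^k * (norm (d k x))\<^sup>2))"
    have bd: "norm (d k x) \<le> sqrt C * (sqrt (1/2))^k" for k
    proof -
      define F where "F k = ennreal (2^k * (norm (d k x))\<^sup>2)" for k
      have C0: "0 \<le> C" unfolding C_def by (rule enn2real_nonneg)
      have "sum F {k} \<le> suminf F" by (rule sum_le_suminf) (auto intro: summableI)
      also have "suminf F = ennreal C"
      proof -
        have "F = (\<lambda>k. ennreal (2^k * (norm (d k x))\<^sup>2))" by (rule ext) (rule F_def)
        then have "suminf F \<noteq> top" "C = enn2real (suminf F)" using that unfolding C_def infinity_ennreal_def by metis+
        then show ?thesis by (metis ennreal_enn2real less_top)
      qed
      finally have "F k \<le> ennreal C" by simp
      then have "ennreal (2^k * (norm (d k x))\<^sup>2) \<le> ennreal C" unfolding F_def .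
      then have "2^k * (norm (d k x))\<^sup>2 \<le> C" using ennreal_le_iff[OF C0] by blast
      then have "(norm (d k x))\<^sup>2 \<le> C * (1/2)^k"
        by (simp add: power_one_over pos_le_divide_eq mult.commute)
      then have "norm (d k x) \<le> sqrt (C * (1/2)^k)" by (rule real_le_rsqrt)
      then show ?thesis by (simp only: real_sqrt_mult real_sqrt_power)
    qed
    have "summable (\<lambda>k. d k x)"
    proof (rule summable_comparison_test')
      show "summable (\<lambda>k. sqrt C * (sqrt (1/2))^k)" by (intro summable_mult summable_geometric) simp
      show "norm (d n x) \<le> sqrt C * (sqrt (1/2))^n" if "n \<ge> 0" for n by (rule bd)
    qed
    then have "convergent (\<lambda>n. \<Sum>k<n. d k x)" by (simp add: summable_iff_convergent)
    then have "convergent (\<lambda>n. f (r 0) x + (\<Sum>k<n. d k x))"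
      by (intro convergent_add convergent_const)
    moreover have "f (r 0) x + (\<Sum>k<n. d k x) = f (r n) x" for n
    proof -
      have "(\<Sum>k<n. d k x) = f (r n) x - f (r 0) x" unfolding d_def by (rule sum_lessThan_telescope)
      then show ?thesis by (simp only: add.commute[of "f (r 0) x"] diff_add_cancel)
    qed
    ultimately show ?thesis by (simp only:)
  qed
  define g where "g x = lim (\<lambda>k. f (r k) x)" for x
  have gm [measurable]: "g \<in> borel_measurable borel" unfolding g_def
    by (rule borel_measurable_lim_metric) measurable
  have lim: "AE x in lborel. (\<lambda>k. f (r k) x) \<longlonglongrightarrow> g x"
    using ae
  proof eventually_elim
    case (elim x)
    from conv[OF elim] show ?case unfolding g_def by (simp only: convergent_LIMSEQ_iff)
  qed
  \<comment> \<open>Fatou's lemma along the subsequence, for every large index \<open>n\<close>: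
    this gives both integrability of the difference and the rate.\<close>
  have fatou: "(\<integral>\<^sup>+x. ennreal ((norm (f n x - g x))\<^sup>2) \<partial>lborel) \<le> ennreal ((1/4)^k)" if n: "n \<ge> N k" for n k
  proof -
    have "(\<integral>\<^sup>+x. ennreal ((norm (f n x - g x))\<^sup>2) \<partial>lborel)
       = (\<integral>\<^sup>+x. liminf (\<lambda>l. ennreal ((norm (f n x - f (r l) x))\<^sup>2)) \<partial>lborel)"
    proof (rule nn_integral_cong_AE)
      show "AE x in lborel. ennreal ((norm (f n x - g x))\<^sup>2) = liminf (\<lambda>l. ennreal ((norm (f n x - f (r l) x))\<^sup>2))"
        using lim
      proof eventually_elim
        case (elim x)
        have "(\<lambda>l. ennreal ((norm (f n x - f (r l) x))\<^sup>2)) \<longlonglongrightarrow> ennreal ((norm (f n x - g x))\<^sup>2)"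
          by (intro tendsto_intros elim)
        then show ?case by (intro lim_imp_Liminf[symmetric]) auto
      qed
    qed
    also have "\<dots> \<le> liminf (\<lambda>l. \<integral>\<^sup>+x. ennreal ((norm (f n x - f (r l) x))\<^sup>2) \<partial>lborel)"
      by (rule nn_integral_liminf) measurable
    also have "\<dots> = liminf (\<lambda>l. ennreal (LINT x|lborel. (norm (f n x - f (r l) x))\<^sup>2))"
      by (subst nn_integral_eq_integral) (use int in auto)
    also have "\<dots> \<le> ennreal ((1/4)^k)"
    proof (rule Liminf_le)
      show "\<forall>\<^sub>F l in sequentially. ennreal (LINT x|lborel. (norm (f n x - f (r l) x))\<^sup>2) \<le> ennreal ((1/4)^k)"
        unfolding eventually_sequentially
        using N[OF n, of "r _"] rN rmono by (intro exI[of _ k] allI impI ennreal_leI less_imp_le) (meson order_trans)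
    qed auto
    finally show ?thesis .
  qed
  have fin: "integrable lborel (\<lambda>x. (norm (f n x - g x))\<^sup>2)" if "n \<ge> N k" for n k
    using fatou[OF that] by (intro integrableI_bounded) (auto simp: top_unique intro: le_less_trans)
  have "sqi (\<lambda>x. f (N 0) x - g x)" unfolding sqi_def using fin[of 0 "N 0"] by simp
  from sqi_diff[OF f[of "N 0"] this] have "sqi g" by simp
  moreover have "(\<lambda>n. LINT x|lborel. (norm (f n x - g x))\<^sup>2) \<longlonglongrightarrow> 0"
  proof (rule LIMSEQ_I)
    fix e :: real assume "0 < e"
    then obtain k where k: "(1/4::real)^k < e" using real_arch_pow_inv[of e "1/4"] by auto
    have "norm ((LINT x|lborel. (norm (f n x - g x))\<^sup>2) - 0) < e" if "n \<ge> N k" for n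
    proof -
      have "ennreal (LINT x|lborel. (norm (f n x - g x))\<^sup>2) \<le> ennreal ((1/4)^k)"
        using fatou[OF that] fin[OF that] by (subst (asm) nn_integral_eq_integral) auto
      then have "(LINT x|lborel. (norm (f n x - g x))\<^sup>2) \<le> (1/4)^k" by simp
      moreover have "0 \<le> (LINT x|lborel. (norm (f n x - g x))\<^sup>2)" by simp
      ultimately show ?thesis using k by (simp add: abs_of_nonneg)
    qed
    then show "\<exists>no. \<forall>n\<ge>no. norm ((LINT x|lborel. (norm (f n x - g x))\<^sup>2) - 0) < e" by blast
  qed
  ultimately show ?thesis by blast
qed

section \<open>Classes modulo equality almost everywhere\<close>

definition l2_rel :: "(real \<Rightarrow> 'b::sep_hilbert) \<Rightarrow> (real \<Rightarrow> 'b) \<Rightarrow> bool" where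
  "l2_rel f g \<longleftrightarrow> sqi f \<and> sqi g \<and> (AE x in lborel. f x = g x)"

\<comment> \<open>The relation is reflexive exactly on the square integrable functions, so a partial
  quotient discards all other functions without an intermediate subtype.\<close>
quotient_type (overloaded) 'b l2 = "real \<Rightarrow> 'b::sep_hilbert" / partial: l2_rel
proof (rule part_equivpI)
  show "\<exists>x. l2_rel x x" by (rule exI[of _ "\<lambda>_. 0"]) (simp add: l2_rel_def)
  show "symp l2_rel" by (auto simp: symp_def l2_rel_def elim: eventually_mono)
  show "transp l2_rel" by (auto simp: transp_def l2_rel_def)
qed

instantiation l2 :: (sep_hilbert) real_vector
begin

lift_definition zero_l2 :: "'a l2" is "\<lambda>_. 0" by (simp add: l2_rel_def)

lift_definition plus_l2 :: "'a l2 \<Rightarrow> 'a l2 \<Rightarrow> 'a l2" is "\<lambda>f g x. f x + g x"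
  by (auto simp: l2_rel_def intro: sqi_add)

lift_definition minus_l2 :: "'a l2 \<Rightarrow> 'a l2 \<Rightarrow> 'a l2" is "\<lambda>f g x. f x - g x"
  by (auto simp: l2_rel_def intro: sqi_diff)

lift_definition uminus_l2 :: "'a l2 \<Rightarrow> 'a l2" is "\<lambda>f x. - f x"
  by (auto simp: l2_rel_def intro: sqi_minus)

lift_definition scaleR_l2 :: "real \<Rightarrow> 'a l2 \<Rightarrow> 'a l2" is "\<lambda>c f x. c *\<^sub>R f x"
  by (auto simp: l2_rel_def intro: sqi_scaleR)

instance
  by standard (transfer; auto simp: l2_rel_def algebra_simps intro: sqi_add sqi_diff sqi_minus sqi_scaleR; fail)+

end

instantiation l2 :: (sep_hilbert) real_inner
begin

lift_definition inner_l2 :: "'a l2 \<Rightarrow> 'a l2 \<Rightarrow> real" is "\<lambda>f g. LINT x|lborel. f x \<bullet> g x"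
  by (auto simp: l2_rel_def intro!: integral_cong_AE dest!: sqiD(1))

definition norm_l2 :: "'a l2 \<Rightarrow> real" where "norm_l2 x = sqrt (x \<bullet> x)"

definition dist_l2 :: "'a l2 \<Rightarrow> 'a l2 \<Rightarrow> real" where "dist_l2 x y = norm (x - y)"

definition sgn_l2 :: "'a l2 \<Rightarrow> 'a l2" where "sgn_l2 x = x /\<^sub>R norm x"

definition uniformity_l2 :: "('a l2 \<times> 'a l2) filter"
  where "uniformity_l2 = (INF e\<in>{0 <..}. principal {(x, y). dist x y < e})"

definition open_l2 :: "'a l2 set \<Rightarrow> bool"
  where "open_l2 S \<longleftrightarrow> (\<forall>x\<in>S. \<forall>\<^sub>F (x', y) in uniformity. x' = x \<longrightarrow> y \<in> S)"

instance
proof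
  fix x y z :: "'a l2" and r :: real
  show "dist x y = norm (x - y)" by (rule dist_l2_def)
  show "sgn x = x /\<^sub>R norm x" by (rule sgn_l2_def)
  show "(uniformity :: ('a l2 \<times> 'a l2) filter) = (INF e\<in>{0 <..}. principal {(x, y). dist x y < e})"
    by (rule uniformity_l2_def)
  show "open S = (\<forall>x\<in>S. \<forall>\<^sub>F (x', y) in uniformity. x' = x \<longrightarrow> y \<in> S)" for S :: "'a l2 set"
    by (rule open_l2_def)
  show "norm x = sqrt (x \<bullet> x)" by (rule norm_l2_def)
  show "x \<bullet> y = y \<bullet> x" by transfer (simp add: inner_commute)
  show "(x + y) \<bullet> z = x \<bullet> z + y \<bullet> z"
    by transfer (simp add: l2_rel_def inner_add_left sqi_inner)
  show "r *\<^sub>R x \<bullet> y = r * (x \<bullet> y)" by transfer simp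
  show "0 \<le> x \<bullet> x" by transfer simp
  show "(x \<bullet> x = 0) = (x = 0)"
  proof transfer
    fix f :: "real \<Rightarrow> 'a" assume f: "l2_rel f f"
    have "(LINT x|lborel. f x \<bullet> f x) = 0 \<longleftrightarrow> (AE x in lborel. f x \<bullet> f x = 0)"
      by (rule integral_nonneg_eq_0_iff_AE) (use f in \<open>auto simp: l2_rel_def sqi_inner\<close>)
    then show "((LINT x|lborel. f x \<bullet> f x) = 0) = l2_rel f (\<lambda>_. 0)"
      using f by (simp add: l2_rel_def)
  qed
qed

end

lemma l2_rel_refl: "l2_rel f f \<longleftrightarrow> sqi f" by (simp add: l2_rel_def)

lemma sqi_rep_l2: "sqi (rep_l2 x)"
  using Quotient3_rep_reflp[OF Quotient3_l2, of x] by (simp add: l2_rel_refl)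

lemma abs_rep_l2 [simp]: "abs_l2 (rep_l2 x) = x"
  by (rule Quotient3_abs_rep[OF Quotient3_l2])

lemma rep_abs_l2: "sqi f \<Longrightarrow> AE x in lborel. rep_l2 (abs_l2 f) x = f x"
  using Quotient3_rep_abs[OF Quotient3_l2, of f] by (auto simp: l2_rel_def)

lemma abs_l2_eqI: "sqi f \<Longrightarrow> sqi g \<Longrightarrow> AE x in lborel. f x = g x \<Longrightarrow> abs_l2 f = abs_l2 g"
  by (intro Quotient3_rel_abs[OF Quotient3_l2]) (simp add: l2_rel_def)

lemma inner_abs_l2: "sqi f \<Longrightarrow> sqi g \<Longrightarrow> abs_l2 f \<bullet> abs_l2 g = (LINT x|lborel. f x \<bullet> g x)"
  by (rule inner_l2.abs_eq) (auto simp: l2_rel_refl)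

lemma norm_abs_l2: "sqi f \<Longrightarrow> norm (abs_l2 f) = sqrt (LINT x|lborel. (norm (f x))\<^sup>2)"
  by (simp add: norm_eq_sqrt_inner inner_abs_l2 power2_norm_eq_inner)

lemma plus_abs_l2: "sqi f \<Longrightarrow> sqi g \<Longrightarrow> abs_l2 f + abs_l2 g = abs_l2 (\<lambda>x. f x + g x)"
  by (rule plus_l2.abs_eq) (auto simp: l2_rel_refl)

lemma minus_abs_l2: "sqi f \<Longrightarrow> sqi g \<Longrightarrow> abs_l2 f - abs_l2 g = abs_l2 (\<lambda>x. f x - g x)"
  by (rule minus_l2.abs_eq) (auto simp: l2_rel_refl)

lemma scaleR_abs_l2: "sqi f \<Longrightarrow> c *\<^sub>R abs_l2 f = abs_l2 (\<lambda>x. c *\<^sub>R f x)"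
  by (rule scaleR_l2.abs_eq) (auto simp: l2_rel_refl)

lemma dist_abs_l2: "sqi f \<Longrightarrow> sqi g \<Longrightarrow> dist (abs_l2 f) (abs_l2 g) = sqrt (LINT x|lborel. (norm (f x - g x))\<^sup>2)"
  by (simp add: dist_norm minus_abs_l2 norm_abs_l2 sqi_diff)

lemma sqi_cauchy_schwarz:
  assumes "sqi f" "sqi g"
  shows "\<bar>LINT x|lborel. f x \<bullet> g x\<bar> \<le> sqrt (LINT x|lborel. (norm (f x))\<^sup>2) * sqrt (LINT x|lborel. (norm (g x))\<^sup>2)"
  using Cauchy_Schwarz_ineq2[of "abs_l2 f" "abs_l2 g"] assms by (simp add: inner_abs_l2 norm_abs_l2)

instance l2 :: (sep_hilbert) complete_space
proof
  fix X :: "nat \<Rightarrow> 'a l2" assume X: "Cauchy X"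
  define f where "f n = rep_l2 (X n)" for n
  have f: "sqi (f n)" and Xf: "X n = abs_l2 (f n)" for n by (simp_all add: f_def sqi_rep_l2)
  have "\<exists>N. \<forall>m\<ge>N. \<forall>n\<ge>N. (LINT x|lborel. (norm (f m x - f n x))\<^sup>2) < e" if "0 < e" for e
  proof -
    obtain N where "\<And>m n. m \<ge> N \<Longrightarrow> n \<ge> N \<Longrightarrow> dist (X m) (X n) < sqrt e"
      using X \<open>0 < e\<close> unfolding Cauchy_def by (meson real_sqrt_gt_zero)
    then show ?thesis by (auto simp: Xf f dist_abs_l2)
  qed
  from sqi_complete[OF f this] obtain g where g: "sqi g"
    "(\<lambda>n. LINT x|lborel. (norm (f n x - g x))\<^sup>2) \<longlonglongrightarrow> 0" by blast
  have "(\<lambda>n. dist (X n) (abs_l2 g)) \<longlonglongrightarrow> 0"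
    using tendsto_real_sqrt[OF g(2)] by (simp add: Xf f g dist_abs_l2)
  then show "convergent X" using convergent_def tendsto_dist_iff by blast
qed

instance l2 :: (sep_hilbert) banach ..

section \<open>Step functions are total\<close>

lemma integrable_indicator_mult:
  fixes h :: "real \<Rightarrow> real"
  shows "integrable lborel h \<Longrightarrow> A \<in> sets borel \<Longrightarrow> integrable lborel (\<lambda>x. indicator A x * h x)"
  using integrable_mult_indicator[of A lborel h] by simp

text \<open>The positive and the negative part of \<open>f\<close> are densities of two finite
  measures that agree on all half-lines \<open>{a<..}\<close> and therefore coincide; uniqueness of
  densities gives the claim.\<close>

lemma borel_AE_zero_intervals:
  fixes f :: "real \<Rightarrow> real"
  assumes f: "integrable lborel f"
    and z: "\<And>a b. a < b \<Longrightarrow> (LINT x|lborel. indicator {a<..<b} x * f x) = 0"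
  shows "AE x in lborel. f x = 0"
proof -
  have fm [measurable]: "f \<in> borel_measurable borel" using f by simp
  define p where "p x = max 0 (f x)" for x
  define q where "q x = max 0 (- f x)" for x
  have pq: "f x = p x - q x" for x by (simp add: p_def q_def)
  have pm [measurable]: "p \<in> borel_measurable borel" "q \<in> borel_measurable borel"
    unfolding p_def q_def by measurable
  have pqi: "integrable lborel p" "integrable lborel q"
    unfolding p_def q_def using f by auto
  have nn: "0 \<le> p x" "0 \<le> q x" for x by (auto simp: p_def q_def)
  have em: "emeasure (density lborel (\<lambda>x. ennreal (h x))) {a<..} = ennreal (LINT x|lborel. indicator {a<..} x * h x)"
    if h: "integrable lborel h" "\<And>x. 0 \<le> h x" for h :: "real \<Rightarrow> real" and a
  proof -
    have [measurable]: "h \<in> borel_measurable borel" using h by simp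
    have i: "integrable lborel (\<lambda>x. indicator {a<..} x * h x)"
      by (rule integrable_indicator_mult[OF h(1)]) measurable
    have "emeasure (density lborel (\<lambda>x. ennreal (h x))) {a<..} = (\<integral>\<^sup>+x. ennreal (indicator {a<..} x * h x) \<partial>lborel)"
    proof -
      have "emeasure (density lborel (\<lambda>x. ennreal (h x))) {a<..}
          = (\<integral>\<^sup>+x. ennreal (h x) * indicator {a<..} x \<partial>lborel)"
        by (rule emeasure_density) measurable
      also have "\<dots> = (\<integral>\<^sup>+x. ennreal (indicator {a<..} x * h x) \<partial>lborel)"
        by (rule nn_integral_cong) (simp split: split_indicator)
      finally show ?thesis .
    qed
    also have "\<dots> = ennreal (LINT x|lborel. indicator {a<..} x * h x)"
      by (rule nn_integral_eq_integral[OF i]) (use h in auto)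
    finally show ?thesis .
  qed
  \<comment> \<open>Half-lines are limits of bounded intervals, with the norm of \<open>f\<close> as
    integrable majorant.\<close>
  have tail: "(LINT x|lborel. indicator {a<..} x * f x) = 0" for a
  proof -
    have "(\<lambda>n. LINT x|lborel. indicator {a<..<a + real (Suc n)} x * f x) \<longlonglongrightarrow> (LINT x|lborel. indicator {a<..} x * f x)"
    proof (rule integral_dominated_convergence[where w="\<lambda>x. norm (f x)"])
      show "AE x in lborel. (\<lambda>n. indicator {a<..<a + real (Suc n)} x * f x) \<longlonglongrightarrow> indicator {a<..} x * f x"
      proof (rule AE_I2)
        fix x
        obtain N :: nat where N: "x - a < real N" using reals_Archimedean2 by blast
        have "indicator {a<..<a + real (Suc n)} x * f x = indicator {a<..} x * f x" if "n \<ge> N" for n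
          using N that by (auto simp: indicator_def)
        then show "(\<lambda>n. indicator {a<..<a + real (Suc n)} x * f x) \<longlonglongrightarrow> indicator {a<..} x * f x"
          by (intro tendsto_eventually) (auto simp: eventually_sequentially)
      qed
    qed (use f in \<open>auto simp: indicator_def\<close>)
    moreover have "(LINT x|lborel. indicator {a<..<a + real (Suc n)} x * f x) = 0" for n by (rule z) simp
    ultimately show ?thesis by (simp add: LIMSEQ_const_iff)
  qed
  have "density lborel (\<lambda>x. ennreal (p x)) = density lborel (\<lambda>x. ennreal (q x))"
  proof (rule measure_eqI_lessThan)
    fix a
    have "(LINT x|lborel. indicator {a<..} x * p x) - (LINT x|lborel. indicator {a<..} x * q x)
        = (LINT x|lborel. indicator {a<..} x * f x)"
    proof -
      have "integrable lborel (\<lambda>x. indicator {a<..} x * p x)" "integrable lborel (\<lambda>x. indicator {a<..} x * q x)"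
        by (simp_all only: integrable_indicator_mult[OF pqi(1)] integrable_indicator_mult[OF pqi(2)] greaterThan_borel)
      from Bochner_Integration.integral_diff[OF this]
      show ?thesis by (simp only: pq right_diff_distrib)
    qed
    then show "emeasure (density lborel (\<lambda>x. ennreal (p x))) {a<..} = emeasure (density lborel (\<lambda>x. ennreal (q x))) {a<..}"
      using em[OF pqi(1) nn(1)] em[OF pqi(2) nn(2)] tail[of a] by simp
    show "emeasure (density lborel (\<lambda>x. ennreal (p x))) {a<..} < \<infinity>" using em[OF pqi(1) nn(1)] by simp
  qed auto
  then have "AE x in lborel. ennreal (p x) = ennreal (q x)"
  proof (rule sigma_finite_measure.density_unique[OF sigma_finite_lborel, rotated 2])
    show "(\<lambda>x. ennreal (p x)) \<in> borel_measurable lborel" "(\<lambda>x. ennreal (q x)) \<in> borel_measurable lborel"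
      by measurable
  qed
  then show ?thesis
  proof eventually_elim
    case (elim x)
    then have "p x = q x" using ennreal_inj[OF nn] by blast
    then show ?case by (simp only: pq diff_self)
  qed
qed

lemma borel_AE_zero_intervals_local:
  fixes f :: "real \<Rightarrow> real"
  assumes f: "\<And>n::nat. integrable lborel (\<lambda>x. indicator {-real n<..<real n} x * f x)"
    and z: "\<And>a b. a < b \<Longrightarrow> (LINT x|lborel. indicator {a<..<b} x * f x) = 0"
  shows "AE x in lborel. f x = 0"
proof -
  have "AE x in lborel. indicator {-real n<..<real n} x * f x = 0" for n :: nat
  proof (rule borel_AE_zero_intervals[OF f])
    fix a b :: real assume "a < b"
    show "(LINT x|lborel. indicator {a<..<b} x * (indicator {-real n<..<real n} x * f x)) = 0"
    proof (cases "max a (-real n) < min b (real n)")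
      case True
      have "(\<lambda>x. indicator {a<..<b} x * (indicator {-real n<..<real n} x * f x))
          = (\<lambda>x. indicator {max a (-real n)<..<min b (real n)} x * f x)"
        by (rule ext) (auto simp: indicator_def)
      then show ?thesis using z[OF True] by simp
    next
      case False
      have "(\<lambda>x. indicator {a<..<b} x * (indicator {-real n<..<real n} x * f x)) = (\<lambda>x. 0)"
        by (rule ext) (use False in \<open>auto simp: indicator_def\<close>)
      then show ?thesis by simp
    qed
  qed
  then have "AE x in lborel. \<forall>n::nat. indicator {-real n<..<real n} x * f x = 0"
    unfolding AE_all_countable by blast
  then show ?thesis
  proof eventually_elim
    case (elim x)
    obtain n :: nat where "\<bar>x\<bar> < real n" using reals_Archimedean2 by blast
    then show ?case using elim[rule_format, of n] by (auto simp: indicator_def split: if_splits)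
  qed
qed

lemma emeasure_lborel_Ioo_finite: "emeasure lborel {a<..<b::real} < top"
  by (cases "a \<le> b") simp_all

lemma sqi_indicator: "sqi (\<lambda>x. indicator {a<..<b} x *\<^sub>R c)"
proof (rule sqi_bound[of _ "\<lambda>x. indicator {a<..<b} x *\<^sub>R (norm c)\<^sup>2"])
  show "integrable lborel (\<lambda>x. indicator {a<..<b} x *\<^sub>R (norm c)\<^sup>2)"
    by (intro integrable_scaleR_left integrable_real_indicator) (auto simp: emeasure_lborel_Ioo_finite)
qed (auto simp: indicator_def)

lemma sqi_indicator_mult: "sqi f \<Longrightarrow> A \<in> sets borel \<Longrightarrow> sqi (\<lambda>x. indicator A x *\<^sub>R f x)"
  by (rule sqi_bound[of _ "\<lambda>x. (norm (f x))\<^sup>2"]) (auto simp: sqi_def indicator_def)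

lemma sqi_interval_integrable:
  fixes f :: "real \<Rightarrow> 'b::sep_hilbert"
  assumes f: "sqi f" shows "integrable lborel (\<lambda>x. indicator {a<..<b} x *\<^sub>R f x)"
proof (rule Bochner_Integration.integrable_bound)
  have [measurable]: "f \<in> borel_measurable borel" using f by (simp add: sqi_def)
  show "integrable lborel (\<lambda>x. indicator {a<..<b} x + (norm (f x))\<^sup>2 :: real)"
    using sqiD(2)[OF f] by (intro Bochner_Integration.integrable_add integrable_real_indicator) (auto simp: emeasure_lborel_Ioo_finite)
  show "(\<lambda>x. indicator {a<..<b} x *\<^sub>R f x) \<in> borel_measurable lborel" by measurable
  have "norm y \<le> 1 + (norm y)\<^sup>2" for y :: 'b
    using sum_squares_bound[of "norm y" 1] norm_ge_zero[of y] unfolding power_one mult_1_right by linarith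
  then show "AE x in lborel. norm (indicator {a<..<b} x *\<^sub>R f x) \<le> norm (indicator {a<..<b} x + (norm (f x))\<^sup>2 :: real)"
    by (auto simp: indicator_def abs_of_nonneg)
qed

text \<open>Separability of \<open>'b l2\<close> rests on this, since rational endpoints and values
  in \<open>D\<close> leave only countably many step functions; it also reduces the continuity of
  translations to indicators. The scalar functions \<open>f x \<bullet> c\<close> have vanishing
  integrals over all bounded intervals, hence vanish almost everywhere.\<close>

lemma l2_total:
  fixes u :: "'b::sep_hilbert l2"
  assumes D: "countable D" "\<And>x. x \<in> closure D"
    and u: "\<And>a b c. a \<in> \<rat> \<Longrightarrow> b \<in> \<rat> \<Longrightarrow> c \<in> D \<Longrightarrow>
      u \<bullet> abs_l2 (\<lambda>x. indicator {a<..<b} x *\<^sub>R c) = 0"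
  shows "u = 0"
proof -
  define f where "f = rep_l2 u"
  have f: "sqi f" and uf: "u = abs_l2 f" by (simp_all add: f_def sqi_rep_l2)
  have [measurable]: "f \<in> borel_measurable borel" using f by (simp add: sqi_def)
  have intc: "integrable lborel (\<lambda>x. indicator {a<..<b} x * (f x \<bullet> c))" for a b c
    using sqi_inner[OF f sqi_indicator[of a b c]] by simp
  have zero: "(LINT x|lborel. indicator {a<..<b} x * (f x \<bullet> c)) = 0" if "c \<in> D" "a \<in> \<rat>" "b \<in> \<rat>" for a b c
  proof -
    from u[OF that(2,3,1)] show ?thesis by (simp add: uf inner_abs_l2 f sqi_indicator)
  qed
  \<comment> \<open>The rational endpoints approach from inside the interval, so the integrand over
    \<open>{a<..<b}\<close> dominates.\<close>
  have zero': "(LINT x|lborel. indicator {a<..<b} x * (f x \<bullet> c)) = 0" if "c \<in> D" for a b c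
  proof -
    have "\<exists>q\<in>\<rat>. a < q \<and> q < a + 1 / real (Suc n)" for n by (rule Rats_dense_in_real) simp
    then obtain p where p: "\<And>n. p n \<in> \<rat>" "\<And>n. a < p n" "\<And>n. p n < a + 1 / real (Suc n)" by metis
    have "\<exists>q\<in>\<rat>. b - 1 / real (Suc n) < q \<and> q < b" for n by (rule Rats_dense_in_real) simp
    then obtain q where q: "\<And>n. q n \<in> \<rat>" "\<And>n. q n < b" "\<And>n. b - 1 / real (Suc n) < q n" by metis
    have "p \<longlonglongrightarrow> a"
    proof (rule tendsto_sandwich[of "\<lambda>_. a" _ _ "\<lambda>n. a + 1 / real (Suc n)"])
      show "(\<lambda>n. a + 1 / real (Suc n)) \<longlonglongrightarrow> a"
        using tendsto_add[OF tendsto_const LIMSEQ_Suc[OF lim_1_over_n], of a] by simp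
    qed (use p in \<open>simp_all only: less_imp_le always_eventually tendsto_const simp_thms\<close>)
    have "q \<longlonglongrightarrow> b"
    proof (rule tendsto_sandwich[of "\<lambda>n. b - 1 / real (Suc n)" _ _ "\<lambda>_. b"])
      show "(\<lambda>n. b - 1 / real (Suc n)) \<longlonglongrightarrow> b"
        using tendsto_diff[OF tendsto_const LIMSEQ_Suc[OF lim_1_over_n], of b] by simp
    qed (use q in \<open>simp_all only: less_imp_le always_eventually tendsto_const simp_thms\<close>)
    have "(\<lambda>n. LINT x|lborel. indicator {p n<..<q n} x * (f x \<bullet> c)) \<longlonglongrightarrow> (LINT x|lborel. indicator {a<..<b} x * (f x \<bullet> c))"
    proof (rule integral_dominated_convergence[where w="\<lambda>x. norm (indicator {a<..<b} x * (f x \<bullet> c))"])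
      show "AE x in lborel. (\<lambda>n. indicator {p n<..<q n} x * (f x \<bullet> c)) \<longlonglongrightarrow> indicator {a<..<b} x * (f x \<bullet> c)"
      proof (rule AE_I2)
        fix x
        show "(\<lambda>n. indicator {p n<..<q n} x * (f x \<bullet> c)) \<longlonglongrightarrow> indicator {a<..<b} x * (f x \<bullet> c)"
        proof (cases "x \<in> {a<..<b}")
          case True
          have "\<forall>\<^sub>F n in sequentially. p n < x" "\<forall>\<^sub>F n in sequentially. x < q n"
            using True order_tendstoD(2)[OF \<open>p \<longlonglongrightarrow> a\<close>] order_tendstoD(1)[OF \<open>q \<longlonglongrightarrow> b\<close>] by auto
          then have "\<forall>\<^sub>F n in sequentially. indicator {p n<..<q n} x * (f x \<bullet> c) = indicator {a<..<b} x * (f x \<bullet> c)"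
            by eventually_elim (use True in auto)
          then show ?thesis by (rule tendsto_eventually)
        next
          case False
          then have "indicator {p n<..<q n} x * (f x \<bullet> c) = indicator {a<..<b} x * (f x \<bullet> c)" for n
            using p(2)[of n] q(2)[of n] by (auto simp: indicator_def)
          then show ?thesis by (simp only: tendsto_const)
        qed
      qed
      show "AE x in lborel. norm (indicator {p n<..<q n} x * (f x \<bullet> c)) \<le> norm (indicator {a<..<b} x * (f x \<bullet> c))" for n
        using p(2)[of n] q(2)[of n] by (auto simp: indicator_def)
    qed (use intc in auto)
    then show ?thesis using zero[OF that p(1) q(1)] by (simp add: LIMSEQ_const_iff)
  qed
  have "AE x in lborel. f x \<bullet> c = 0" if "c \<in> D" for c
    by (rule borel_AE_zero_intervals_local) (use intc zero'[OF that] in auto)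
  then have "AE x in lborel. \<forall>c\<in>D. f x \<bullet> c = 0" using D(1) by (simp add: AE_ball_countable)
  then have "AE x in lborel. f x = 0"
  proof eventually_elim
    case (elim x)
    obtain h where h: "\<And>n. h n \<in> D" "h \<longlonglongrightarrow> f x" using D(2)[of "f x"] unfolding closure_sequential by blast
    have "(\<lambda>n. f x \<bullet> h n) \<longlonglongrightarrow> f x \<bullet> f x" by (intro tendsto_intros h)
    then show ?case using elim h(1) by (simp add: LIMSEQ_const_iff)
  qed
  then have "abs_l2 f = abs_l2 (\<lambda>_. 0)" by (intro abs_l2_eqI f) auto
  then show ?thesis by (simp add: uf zero_l2.abs_eq)
qed

instance l2 :: (sep_hilbert) second_countable_topology
proof
  obtain D :: "'a set" where D: "countable D" "\<And>x. x \<in> closure D" using countable_dense_closure by blast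
  define B where "B = (\<lambda>(a, b, c). abs_l2 (\<lambda>x::real. indicator {a<..<b} x *\<^sub>R c)) ` (\<rat> \<times> \<rat> \<times> D)"
  have "countable B" unfolding B_def using D(1) countable_rat by auto
  moreover have "u = 0" if u: "\<And>b. b \<in> B \<Longrightarrow> u \<bullet> b = 0" for u :: "'a l2"
  proof (rule l2_total[OF D])
    fix a b :: real and c assume "a \<in> \<rat>" "b \<in> \<rat>" "c \<in> D"
    then have "abs_l2 (\<lambda>x::real. indicator {a<..<b} x *\<^sub>R c) \<in> B"
      by (auto simp: B_def intro!: image_eqI[of _ _ "(a, b, c)"])
    then show "u \<bullet> abs_l2 (\<lambda>x. indicator {a<..<b} x *\<^sub>R c) = 0" by (rule u)
  qed
  ultimately obtain E :: "'a l2 set" where "countable E" "\<And>x. x \<in> closure E"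
    using total_imp_countable_dense[of B] by blast
  then show "\<exists>B::'a l2 set set. countable B \<and> open = generate_topology B"
    by (rule dense_imp_countable_subbasis)
qed

instance l2 :: (sep_hilbert) sep_hilbert ..

section \<open>Smooth cut-off functions and the fundamental lemma\<close>

definition smooth :: "(real \<Rightarrow> real) \<Rightarrow> bool" where
  "smooth f \<longleftrightarrow> (\<forall>k x. (deriv ^^ k) f differentiable (at x))"

text \<open>Coinduction in place of formulas for higher derivatives: each closure property of smooth
  functions below only has to exhibit a set that is invariant under differentiation.\<close>

lemma smoothI:
  assumes f: "f \<in> S" and S: "\<And>g. g \<in> S \<Longrightarrow> \<exists>g'\<in>S. \<forall>x. (g has_field_derivative g' x) (at x)"
  shows "smooth f"
proof -
  have d: "deriv g \<in> S \<and> (\<forall>x. g differentiable (at x))" if g: "g \<in> S" for g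
  proof -
    obtain g' where g': "g' \<in> S" "\<And>x. (g has_field_derivative g' x) (at x)" using S[OF g] by blast
    have "deriv g = g'" by (rule ext) (rule DERIV_imp_deriv[OF g'(2)])
    then show ?thesis using g' real_differentiable_def by blast
  qed
  have "(deriv ^^ k) f \<in> S" for k by (induction k) (auto simp: f d)
  then show ?thesis unfolding smooth_def using d by blast
qed

lemma smooth_has_deriv:
  assumes "smooth f" shows "(f has_field_derivative deriv f x) (at x)"
proof -
  have "f differentiable (at x)" using assms unfolding smooth_def by (metis funpow_0)
  then show ?thesis by (simp add: DERIV_deriv_iff_real_differentiable)
qed

lemma smooth_deriv: "smooth f \<Longrightarrow> smooth (deriv f)"
  unfolding smooth_def by (metis comp_apply funpow_Suc_right)

lemma smooth_isCont: "smooth f \<Longrightarrow> isCont f x"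
  using DERIV_isCont smooth_has_deriv by blast

lemma smooth_continuous_on: "smooth f \<Longrightarrow> continuous_on A f"
  by (simp add: continuous_at_imp_continuous_on smooth_isCont)

lemma smooth_measurable: "smooth f \<Longrightarrow> f \<in> borel_measurable borel"
  by (rule borel_measurable_continuous_onI) (rule smooth_continuous_on)

lemma smooth_const: "smooth (\<lambda>_. c)"
  by (rule smoothI[of _ "{\<lambda>_. c, \<lambda>_. 0}"]) (auto intro!: derivative_eq_intros)

lemma smooth_add:
  assumes "smooth f" "smooth g" shows "smooth (\<lambda>x. f x + g x)"
proof (rule smoothI[of _ "{h. \<exists>u v. smooth u \<and> smooth v \<and> h = (\<lambda>x. u x + v x)}"])
  fix h assume "h \<in> {h. \<exists>u v. smooth u \<and> smooth v \<and> h = (\<lambda>x. u x + v x)}"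
  then obtain u v where uv: "smooth u" "smooth v" "h = (\<lambda>x. u x + v x)" by blast
  have "(h has_field_derivative deriv u x + deriv v x) (at x)" for x
    unfolding uv(3) by (intro DERIV_add smooth_has_deriv uv)
  then show "\<exists>g'\<in>{h. \<exists>u v. smooth u \<and> smooth v \<and> h = (\<lambda>x. u x + v x)}. \<forall>x. (h has_field_derivative g' x) (at x)"
    using uv smooth_deriv by (intro bexI[of _ "\<lambda>x. deriv u x + deriv v x"]) blast+
qed (use assms in blast)

text \<open>The derivative of a product is no longer a product but a sum of products: this is the
  invariant set required by \<open>smoothI\<close>.\<close>

inductive_set product_sums :: "(real \<Rightarrow> real) set" where
  mult: "smooth u \<Longrightarrow> smooth v \<Longrightarrow> (\<lambda>x. u x * v x) \<in> product_sums"
| add: "f \<in> product_sums \<Longrightarrow> g \<in> product_sums \<Longrightarrow> (\<lambda>x. f x + g x) \<in> product_sums"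

lemma smooth_mult:
  assumes "smooth f" "smooth g" shows "smooth (\<lambda>x. f x * g x)"
proof (rule smoothI[of _ product_sums])
  fix h assume "h \<in> product_sums"
  then show "\<exists>g'\<in>product_sums. \<forall>x. (h has_field_derivative g' x) (at x)"
  proof induction
    case (mult u v)
    have "(\<lambda>x. deriv u x * v x + deriv v x * u x) \<in> product_sums"
      by (intro product_sums.intros smooth_deriv mult)
    moreover have "((\<lambda>x. u x * v x) has_field_derivative deriv u x * v x + deriv v x * u x) (at x)" for x
      by (intro DERIV_mult smooth_has_deriv mult)
    ultimately show ?case by (intro bexI[of _ "\<lambda>x. deriv u x * v x + deriv v x * u x"]) blast+
  next
    case (add f g)
    then obtain f' g' where fg: "f' \<in> product_sums" "g' \<in> product_sums"
      "\<And>x. (f has_field_derivative f' x) (at x)" "\<And>x. (g has_field_derivative g' x) (at x)" by blast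
    have "((\<lambda>x. f x + g x) has_field_derivative f' x + g' x) (at x)" for x
      by (intro DERIV_add fg)
    then show ?case using product_sums.add[OF fg(1,2)] by (intro bexI[of _ "\<lambda>x. f' x + g' x"]) blast+
  qed
qed (use assms product_sums.mult in blast)

lemma smooth_affine:
  assumes "smooth f" shows "smooth (\<lambda>x. f (a * x + b))"
proof (rule smoothI[of _ "{h. \<exists>c u. smooth u \<and> h = (\<lambda>x. c * u (a * x + b))}"])
  fix h assume "h \<in> {h. \<exists>c u. smooth u \<and> h = (\<lambda>x. c * u (a * x + b))}"
  then obtain c u where u: "smooth u" "h = (\<lambda>x. c * u (a * x + b))" by blast
  have "(h has_field_derivative (c * a) * deriv u (a * x + b)) (at x)" for x
  proof -
    have "((\<lambda>x. a * x + b) has_field_derivative a) (at x)" by (auto intro!: derivative_eq_intros)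
    from DERIV_cmult[OF DERIV_chain2[OF smooth_has_deriv[OF u(1)] this], of c]
    show ?thesis unfolding u(2) by (simp only: mult_ac)
  qed
  then show "\<exists>g'\<in>{h. \<exists>c u. smooth u \<and> h = (\<lambda>x. c * u (a * x + b))}. \<forall>x. (h has_field_derivative g' x) (at x)"
    using smooth_deriv[OF u(1)] by (intro bexI[of _ "\<lambda>x. (c * a) * deriv u (a * x + b)"]) blast+
next
  show "(\<lambda>x. f (a * x + b)) \<in> {h. \<exists>c u. smooth u \<and> h = (\<lambda>x. c * u (a * x + b))}"
    using assms by (intro CollectI exI[of _ 1] exI[of _ f]) simp
qed

lemma smooth_primitive:
  assumes "\<And>x. (f has_field_derivative g x) (at x)" "smooth g" shows "smooth f"
proof (rule smoothI[of _ "insert f (Collect smooth)"])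
  fix h assume "h \<in> insert f (Collect smooth)"
  then show "\<exists>g'\<in>insert f (Collect smooth). \<forall>x. (h has_field_derivative g' x) (at x)"
    using assms smooth_deriv smooth_has_deriv by (cases "h = f") blast+
qed simp

text \<open>The classical function \<open>exp (- (1 / x))\<close>, extended by zero, times powers of
  \<open>1 / x\<close>. The powers make the family closed under differentiation up to linear
  combinations, and every member vanishes at the origin faster than \<open>x\<close>.\<close>

definition flat :: "nat \<Rightarrow> real \<Rightarrow> real" where
  "flat k x = (if x \<le> 0 then 0 else (1 / x) ^ k * exp (- (1 / x)))"

lemma flat_quotient_limit: "((\<lambda>x. flat k x / x) \<longlongrightarrow> 0) (at 0)"
proof (rule filterlim_split_at)
  show "((\<lambda>x. flat k x / x) \<longlongrightarrow> 0) (at_left 0)"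
    by (rule tendsto_eventually) (auto simp: flat_def eventually_at_filter)
  have "((\<lambda>y. y ^ Suc k / exp y) \<longlongrightarrow> (0::real)) at_top" by (rule tendsto_power_div_exp_0)
  then have "((\<lambda>y. flat k (inverse y) / inverse y) \<longlongrightarrow> 0) at_top"
    by (rule Lim_transform_eventually)
      (use eventually_gt_at_top[of "0::real"] in eventually_elim,
        simp add: flat_def exp_minus field_simps)
  then show "((\<lambda>x. flat k x / x) \<longlongrightarrow> 0) (at_right 0)"
    by (simp only: filterlim_at_right_to_top)
qed

lemma flat_deriv: "(flat k has_field_derivative flat (k + 2) x - real k * flat (k + 1) x) (at x)"
proof -
  consider "x < 0" | "x = 0" | "0 < x" by linarith
  then show ?thesis
  proof cases
    case 1
    have "(flat k has_field_derivative 0) (at x)"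
      by (rule has_field_derivative_transform_within_open[of "\<lambda>_. 0" _ _ "{..<0}"])
        (use 1 in \<open>auto simp: flat_def\<close>)
    then show ?thesis using 1 by (simp add: flat_def)
  next
    case 2
    have "(flat k has_field_derivative 0) (at 0)"
      unfolding has_field_derivative_iff using flat_quotient_limit[of k] by (simp add: flat_def[of k 0])
    then show ?thesis using 2 by (simp add: flat_def)
  next
    case 3
    have "((\<lambda>x. (1 / x) ^ k * exp (- (1 / x))) has_field_derivative
        (1/x)^(k+2) * exp (- (1/x)) - real k * ((1/x)^(k+1) * exp (- (1/x)))) (at x)"
    proof -
      have i: "((\<lambda>x. 1 / x) has_field_derivative - ((1/x)^2)) (at x)"
        using 3 by (auto intro!: derivative_eq_intros simp: power2_eq_square)
      have e: "((\<lambda>x. exp (- (1 / x))) has_field_derivative exp (- (1/x)) * (1/x)^2) (at x)"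
        using DERIV_chain2[OF DERIV_exp DERIV_minus[OF i]] by simp
      have p: "((\<lambda>x. (1 / x)^k) has_field_derivative real k * ((1/x)^(k - 1) * - ((1/x)^2))) (at x)"
        using DERIV_power[OF i, of k] by (simp add: mult_ac)
      \<comment> \<open>For \<open>k = 0\<close> the exponent \<open>k - 1\<close> is truncated,
        which is harmless because of the factor \<open>real k\<close>.\<close>
      have "real k * (y^(k - 1) * - (y^2)) * E + E * y^2 * y^k = y^(k+2) * E - real k * (y^(k+1) * E)" for y E :: real
        by (cases k) (simp_all add: power2_eq_square algebra_simps)
      note eq = this[of "1/x" "exp (- (1/x))"]
      show ?thesis using DERIV_mult[OF p e] unfolding eq .
    qed
    then have "(flat k has_field_derivative
        (1/x)^(k+2) * exp (- (1/x)) - real k * ((1/x)^(k+1) * exp (- (1/x)))) (at x)"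
      by (rule has_field_derivative_transform_within_open[of _ _ _ "{0<..}"])
        (use 3 in \<open>auto simp: flat_def\<close>)
    then show ?thesis using 3 by (simp add: flat_def)
  qed
qed

inductive_set flat_span :: "(real \<Rightarrow> real) set" where
  base: "flat k \<in> flat_span"
| comb: "f \<in> flat_span \<Longrightarrow> g \<in> flat_span \<Longrightarrow> (\<lambda>x. f x - c * g x) \<in> flat_span"

lemma smooth_flat: "smooth (flat k)"
proof (rule smoothI[of _ flat_span])
  fix h assume "h \<in> flat_span"
  then show "\<exists>g'\<in>flat_span. \<forall>x. (h has_field_derivative g' x) (at x)"
  proof induction
    case (base k)
    have "(\<lambda>x. flat (k + 2) x - real k * flat (k + 1) x) \<in> flat_span" by (intro flat_span.intros)
    then show ?case using flat_deriv
      by (intro bexI[of _ "\<lambda>x. flat (k + 2) x - real k * flat (k + 1) x"]) blast+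
  next
    case (comb f g c)
    then obtain f' g' where fg: "f' \<in> flat_span" "g' \<in> flat_span"
      "\<And>x. (f has_field_derivative f' x) (at x)" "\<And>x. (g has_field_derivative g' x) (at x)" by blast
    have "((\<lambda>x. f x - c * g x) has_field_derivative f' x - c * g' x) (at x)" for x
      by (intro DERIV_diff DERIV_cmult fg)
    then show ?case using flat_span.comb[OF fg(1,2), of c] by (intro bexI[of _ "\<lambda>x. f' x - c * g' x"]) blast+
  qed
qed (rule flat_span.base)

text \<open>A smooth substitute for the indicator of \<open>{a<..<b}\<close>: each factor switches
  off one side, the values lie between \<open>0\<close> and \<open>1\<close>, and the indicator is
  the limit as \<open>n\<close> grows.\<close>

definition cutoff :: "real \<Rightarrow> real \<Rightarrow> nat \<Rightarrow> real \<Rightarrow> real" where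
  "cutoff a b n x = flat 0 (real n * x + (- real n * a)) * flat 0 ((- real n) * x + real n * b)"

lemma smooth_cutoff: "smooth (cutoff a b n)"
  unfolding cutoff_def[abs_def] by (intro smooth_mult smooth_affine smooth_flat)

lemma flat0_bounds: "0 \<le> flat 0 x" "flat 0 x \<le> 1" by (auto simp: flat_def)

lemma cutoff_bounds: "0 \<le> cutoff a b n x" "cutoff a b n x \<le> 1"
  using flat0_bounds by (auto simp: cutoff_def intro!: mult_nonneg_nonneg mult_le_one)

lemma cutoff_outside:
  assumes "x \<le> a \<or> b \<le> x" shows "cutoff a b n x = 0"
proof -
  have "real n * x + (- real n * a) \<le> 0 \<or> (- real n) * x + real n * b \<le> 0"
  proof (cases "x \<le> a")
    case True
    then have "real n * x \<le> real n * a" by (rule mult_left_mono) simp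
    then show ?thesis by simp
  next
    case False
    then have "real n * b \<le> real n * x" using assms by (intro mult_left_mono) simp_all
    then show ?thesis by simp
  qed
  then show ?thesis by (auto simp: cutoff_def flat_def)
qed

lemma cutoff_pos: "a < x \<Longrightarrow> x < b \<Longrightarrow> 0 < n \<Longrightarrow> 0 < cutoff a b n x"
proof -
  assume "a < x" "x < b" "0 < n"
  then have "0 < real n * (x - a)" "0 < real n * (b - x)" by simp_all
  then show ?thesis by (simp add: cutoff_def flat_def algebra_simps)
qed

lemma flat0_limit:
  assumes "0 < y" shows "(\<lambda>n. flat 0 (real (Suc n) * y)) \<longlonglongrightarrow> 1"
proof -
  have "(\<lambda>n. exp (- (1 / real (Suc n) * (1 / y)))) \<longlonglongrightarrow> exp (- (0 * (1 / y)))"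
    by (intro tendsto_exp tendsto_minus tendsto_mult tendsto_const LIMSEQ_Suc[OF lim_1_over_n])
  moreover have "flat 0 (real (Suc n) * y) = exp (- (1 / real (Suc n) * (1 / y)))" for n
  proof -
    have "\<not> real (Suc n) * y \<le> 0" using assms by (simp add: not_le del: of_nat_Suc)
    then show ?thesis by (simp add: flat_def del: of_nat_Suc)
  qed
  ultimately show ?thesis by simp
qed

lemma cutoff_limit: "(\<lambda>n. cutoff a b (Suc n) x) \<longlonglongrightarrow> indicator {a<..<b} x"
proof (cases "x \<in> {a<..<b}")
  case True
  then have "(\<lambda>n. flat 0 (real (Suc n) * (x - a)) * flat 0 (real (Suc n) * (b - x))) \<longlonglongrightarrow> 1 * 1"
    by (intro tendsto_mult flat0_limit) auto
  then show ?thesis using True by (simp add: cutoff_def algebra_simps)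
next
  case False
  then have "(\<lambda>n. cutoff a b (Suc n) x) = (\<lambda>n. 0)" by (intro ext cutoff_outside) auto
  then show ?thesis using False by simp
qed

section \<open>Test functions\<close>

lemma test_functions_iff:
  "\<theta> \<in> test_functions \<Omega> \<longleftrightarrow> smooth \<theta> \<and> (\<exists>K. compact K \<and> K \<subseteq> \<Omega> \<and> (\<forall>x. x \<notin> K \<longrightarrow> \<theta> x = 0))"
  by (simp add: test_functions_def smooth_def)

lemma cutoff_test: "{a..b} \<subseteq> \<Omega> \<Longrightarrow> cutoff a b n \<in> test_functions \<Omega>"
  unfolding test_functions_iff
  by (intro conjI smooth_cutoff exI[of _ "{a..b}"]) (auto intro: cutoff_outside)

lemma test_deriv_outside:
  assumes "compact K" "\<And>x. x \<notin> K \<Longrightarrow> \<theta> x = 0" "x \<notin> K" shows "deriv \<theta> x = (0::real)"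
proof (rule DERIV_imp_deriv)
  show "(\<theta> has_field_derivative 0) (at x)"
    by (rule has_field_derivative_transform_within_open[of "\<lambda>_. 0" _ _ "- K"])
      (use assms compact_imp_closed in \<open>auto simp: open_Compl\<close>)
qed

lemma test_deriv: "\<theta> \<in> test_functions \<Omega> \<Longrightarrow> deriv \<theta> \<in> test_functions \<Omega>"
  unfolding test_functions_iff using smooth_deriv test_deriv_outside by blast

lemma test_outside: "\<theta> \<in> test_functions \<Omega> \<Longrightarrow> x \<notin> \<Omega> \<Longrightarrow> \<theta> x = 0"
  unfolding test_functions_iff by blast

lemma test_smooth: "\<theta> \<in> test_functions \<Omega> \<Longrightarrow> smooth \<theta>"
  unfolding test_functions_iff by blast

lemma test_mono: "\<Omega> \<subseteq> \<Omega>' \<Longrightarrow> \<theta> \<in> test_functions \<Omega> \<Longrightarrow> \<theta> \<in> test_functions \<Omega>'"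
  unfolding test_functions_iff by blast

lemma test_comb:
  assumes "\<theta> \<in> test_functions \<Omega>" "\<eta> \<in> test_functions \<Omega>"
  shows "(\<lambda>x. \<theta> x - c * \<eta> x) \<in> test_functions \<Omega>"
proof -
  obtain K L where K: "compact K" "K \<subseteq> \<Omega>" "\<And>x. x \<notin> K \<Longrightarrow> \<theta> x = 0"
    and L: "compact L" "L \<subseteq> \<Omega>" "\<And>x. x \<notin> L \<Longrightarrow> \<eta> x = 0"
    using assms unfolding test_functions_iff by blast
  have "smooth (\<lambda>x. \<theta> x + (- c) * \<eta> x)"
    using assms by (intro smooth_add smooth_mult smooth_const test_smooth)
  moreover have "compact (K \<union> L)" using K L by blast
  ultimately show ?thesis unfolding test_functions_iff using K L
    by (intro conjI exI[of _ "K \<union> L"]) auto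
qed

lemma test_bounded:
  assumes "\<theta> \<in> test_functions \<Omega>" obtains B where "0 \<le> B" "\<And>x. \<bar>\<theta> x\<bar> \<le> B"
proof -
  obtain K where K: "compact K" "\<And>x. x \<notin> K \<Longrightarrow> \<theta> x = 0"
    using assms unfolding test_functions_iff by blast
  have "bounded (\<theta> ` K)"
    using compact_continuous_image[OF smooth_continuous_on[OF test_smooth[OF assms]] K(1)] compact_imp_bounded by blast
  then obtain B where B: "\<And>x. x \<in> K \<Longrightarrow> \<bar>\<theta> x\<bar> \<le> B" unfolding bounded_iff by auto
  have "\<bar>\<theta> x\<bar> \<le> max B 0" for x using B[of x] K(2)[of x] by (cases "x \<in> K") auto
  then show ?thesis using that[of "max B 0"] by auto
qed

text \<open>The strict inequalities leave a gap between the support and the ends of the interval,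
  which is the room for time shifts in \<open>energy_weak\<close>.\<close>

lemma test_support_interval:
  assumes "\<theta> \<in> test_functions {a<..<b}" "a < b"
  obtains c d where "a < c" "c < d" "d < b" "\<And>x. x \<le> c \<or> d \<le> x \<Longrightarrow> \<theta> x = 0"
proof -
  obtain K where K: "compact K" "K \<subseteq> {a<..<b}" "\<And>x. x \<notin> K \<Longrightarrow> \<theta> x = 0"
    using assms unfolding test_functions_iff by blast
  show ?thesis
  proof (cases "K = {}")
    case True
    then have "\<theta> x = 0" for x using K(3) by simp
    moreover have "a < (2*a+b)/3" "(2*a+b)/3 < (a+2*b)/3" "(a+2*b)/3 < b"
      using assms(2) by simp_all
    ultimately show ?thesis using that by blast
  next
    case False
    have cK: "closed K" "bdd_below K" "bdd_above K"
      using K(1) by (simp_all add: compact_imp_closed compact_imp_bounded bounded_imp_bdd_above bounded_imp_bdd_below)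
    have iK: "Inf K \<in> K" "Sup K \<in> K"
      using closed_contains_Inf[OF False cK(2,1)] closed_contains_Sup[OF False cK(3,1)] by simp_all
    have bnd: "Inf K \<le> x \<and> x \<le> Sup K" if "x \<in> K" for x
      using cInf_lower[OF that cK(2)] cSup_upper[OF that cK(3)] by simp
    define c where "c = (a + Inf K) / 2"
    define d where "d = (b + Sup K) / 2"
    have *: "a < Inf K" "Sup K < b" "Inf K \<le> Sup K" using iK K(2) bnd by auto
    have "a < c" "c < Inf K" "Sup K < d" "d < b" using * by (auto simp: c_def d_def)
    moreover have "\<theta> x = 0" if "x \<le> c \<or> d \<le> x" for x
      using that bnd[of x] K(3)[of x] \<open>c < Inf K\<close> \<open>Sup K < d\<close> by (cases "x \<in> K") auto
    moreover have "c < d" using \<open>c < Inf K\<close> \<open>Sup K < d\<close> *(3) by linarith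
    ultimately show ?thesis by (intro that[of c d])
  qed
qed

text \<open>Cut-offs turn the hypothesis into vanishing integrals over all intervals inside
  \<Omega>. On each such compact interval a Borel version of \<open>f\<close> is then zero almost
  everywhere, and countably many rational intervals exhaust \<Omega>.\<close>

theorem fundamental_lemma:
  fixes f :: "real \<Rightarrow> real"
  assumes O: "open \<Omega>"
    and f: "\<And>a b. {a..b} \<subseteq> \<Omega> \<Longrightarrow> integrable lebesgue (\<lambda>x. indicator {a..b} x * f x)"
    and z: "\<And>\<theta>. \<theta> \<in> test_functions \<Omega> \<Longrightarrow> (LINT x|lebesgue. f x * \<theta> x) = 0"
  shows "AE x in lborel. x \<in> \<Omega> \<longrightarrow> f x = 0"
proof -
  have int0: "(LINT x|lebesgue. indicator {c<..<d} x * f x) = 0" if cd: "{c..d} \<subseteq> \<Omega>" for c d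
  proof -
    have "(\<lambda>n. LINT x|lebesgue. f x * cutoff c d (Suc n) x) \<longlonglongrightarrow> (LINT x|lebesgue. indicator {c<..<d} x * f x)"
    proof (rule integral_dominated_convergence[where w="\<lambda>x. norm (indicator {c..d} x * f x)"])
      have e: "f x * cutoff c d (Suc n) x = (indicator {c..d} x * f x) * cutoff c d (Suc n) x" for x n
        using cutoff_outside[of x c d "Suc n"] by (cases "x \<in> {c..d}") auto
      have e2: "indicator {c<..<d} x * f x = indicator {c<..<d} x * (indicator {c..d} x * f x)" for x
        by (simp split: split_indicator)
      have m: "(\<lambda>x. indicator {c..d} x * f x) \<in> borel_measurable lebesgue"
        using f[OF cd] by (rule borel_measurable_integrable)
      have c: "cutoff c d (Suc n) \<in> borel_measurable lebesgue" for n
        using smooth_measurable[OF smooth_cutoff] by (simp add: measurable_completion)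
      show "(\<lambda>x. f x * cutoff c d (Suc n) x) \<in> borel_measurable lebesgue" for n
        unfolding e by (rule borel_measurable_times[OF m c])
      show "(\<lambda>x. indicator {c<..<d} x * f x) \<in> borel_measurable lebesgue"
        unfolding e2 by (intro borel_measurable_times m borel_measurable_indicator) simp
      show "integrable lebesgue (\<lambda>x. norm (indicator {c..d} x * f x))"
        using f[OF cd] by (rule integrable_norm)
      show "AE x in lebesgue. (\<lambda>n. f x * cutoff c d (Suc n) x) \<longlonglongrightarrow> indicator {c<..<d} x * f x"
        using tendsto_mult[OF tendsto_const cutoff_limit] by (intro AE_I2) (simp only: mult.commute)
      show "AE x in lebesgue. norm (f x * cutoff c d (Suc n) x) \<le> norm (indicator {c..d} x * f x)" for n
      proof (rule AE_I2)
        fix x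
        show "norm (f x * cutoff c d (Suc n) x) \<le> norm (indicator {c..d} x * f x)"
          unfolding e norm_mult using cutoff_bounds[of c d "Suc n" x]
          by (intro mult_left_le) (auto intro: mult_nonneg_nonneg)
      qed
    qed
    moreover have "(LINT x|lebesgue. f x * cutoff c d (Suc n) x) = 0" for n
      by (rule z) (rule cutoff_test[OF cd])
    ultimately show ?thesis by (simp add: LIMSEQ_const_iff)
  qed
  have loc: "AE x in lborel. indicator {a..b} x * f x = 0" if ab: "{a..b} \<subseteq> \<Omega>" for a b
  proof -
    define F where "F x = indicator {a..b} x * f x" for x
    have F: "integrable lebesgue F" using f[OF ab] unfolding F_def[abs_def] .
    obtain g where g: "g \<in> borel_measurable lborel" "AE x in lborel. F x = g x"
      using completion_ex_borel_measurable_real[OF borel_measurable_integrable[OF F]] by blast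
    have g': "g \<in> borel_measurable lebesgue" using g(1) by (rule measurable_completion)
    have ae: "AE x in lebesgue. F x = g x" using g(2) by (rule AE_completion)
    have "integrable lebesgue g"
      using integrable_cong_AE[OF borel_measurable_integrable[OF F] g' ae] F by blast
    then have gi: "integrable lborel g" using integrable_completion[OF g(1)] by blast
    have "AE x in lborel. g x = 0"
    proof (rule borel_AE_zero_intervals[OF gi])
      fix c d :: real assume "c < d"
      have [measurable]: "g \<in> borel_measurable borel" using g(1) by simp
      have "(LINT x|lborel. indicator {c<..<d} x * g x) = (LINT x|lebesgue. indicator {c<..<d} x * g x)"
        by (rule integral_completion[symmetric]) measurable
      also have "\<dots> = (LINT x|lebesgue. indicator {max a c<..<min b d} x * f x)"
      proof (rule integral_cong_AE)
        show "(\<lambda>x. indicator {c<..<d} x * g x) \<in> borel_measurable lebesgue"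
          by (intro borel_measurable_times g' borel_measurable_indicator) simp
        have "indicator {max a c<..<min b d} x * f x = indicator {max a c<..<min b d} x * F x" for x
          unfolding F_def by (simp split: split_indicator)
        then show "(\<lambda>x. indicator {max a c<..<min b d} x * f x) \<in> borel_measurable lebesgue"
          using F by (simp only:) (intro borel_measurable_times borel_measurable_integrable[OF F] borel_measurable_indicator, simp)
        \<comment> \<open>The intersection of \<open>{c<..<d}\<close> with the closed interval and
          the open interval on the right differ at most in these two points.\<close>
        have "AE x in lebesgue. x \<noteq> a \<and> x \<noteq> b"
          using AE_lborel_singleton[of a] AE_lborel_singleton[of b] by (intro AE_completion) auto
        then show "AE x in lebesgue. indicator {c<..<d} x * g x = indicator {max a c<..<min b d} x * f x"
          using ae
        proof eventually_elim
          case (elim x)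
          show ?case unfolding elim(2)[symmetric] F_def using elim(1) by (auto simp: indicator_def)
        qed
      qed
      also have "\<dots> = 0"
      proof (cases "max a c \<le> min b d")
        case True
        then have "{max a c..min b d} \<subseteq> \<Omega>" using ab by auto
        then show ?thesis by (rule int0)
      next
        case False
        then have "(\<lambda>x. indicator {max a c<..<min b d} x * f x) = (\<lambda>x. 0)"
          by (intro ext) (auto simp: indicator_def)
        then show ?thesis by (simp only: Bochner_Integration.integral_zero)
      qed
      finally show "(LINT x|lborel. indicator {c<..<d} x * g x) = 0" .
    qed
    then show ?thesis using g(2) unfolding F_def by eventually_elim simp
  qed
  have "AE x in lborel. \<forall>p\<in>{(a, b). a \<in> \<rat> \<and> b \<in> \<rat> \<and> {a..b} \<subseteq> \<Omega>}. indicator {fst p..snd p} x * f x = 0"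
  proof (subst AE_ball_countable)
    show "countable {(a::real, b). a \<in> \<rat> \<and> b \<in> \<rat> \<and> {a..b} \<subseteq> \<Omega>}"
      by (rule countable_subset[of _ "\<rat> \<times> \<rat>"]) (auto simp: countable_rat)
    show "\<forall>p\<in>{(a, b). a \<in> \<rat> \<and> b \<in> \<rat> \<and> {a..b} \<subseteq> \<Omega>}. AE x in lborel. indicator {fst p..snd p} x * f x = 0"
      using loc by auto
  qed
  then show ?thesis
  proof eventually_elim
    case (elim x)
    show ?case
    proof
      assume "x \<in> \<Omega>"
      then obtain e where e: "0 < e" "ball x e \<subseteq> \<Omega>" using O openE by blast
      obtain a where a: "a \<in> \<rat>" "x - e < a" "a < x" using Rats_dense_in_real[of "x - e" x] e by auto
      obtain b where b: "b \<in> \<rat>" "x < b" "b < x + e" using Rats_dense_in_real[of x "x + e"] e by auto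
      have "{a..b} \<subseteq> ball x e" using a b by (auto simp: dist_real_def)
      then have "(a, b) \<in> {(a, b). a \<in> \<rat> \<and> b \<in> \<rat> \<and> {a..b} \<subseteq> \<Omega>}" using a b e by auto
      from bspec[OF elim this] show "f x = 0" using a b by simp
    qed
  qed
qed

section \<open>Primitives and the du Bois-Reymond lemma\<close>

lemma ftc_lborel:
  fixes F f :: "real \<Rightarrow> real"
  assumes "a \<le> b" "\<And>x. (F has_field_derivative f x) (at x)" "continuous_on UNIV f"
  shows "(LINT x|lborel. indicator {a..b} x * f x) = F b - F a"
  using integral_FTC_atLeastAtMost[of a b F f] assms
  by (simp add: has_real_derivative_iff_has_vector_derivative has_vector_derivative_at_within
      continuous_on_subset)

text \<open>With the half-open interval, increments are integrals over \<open>{s<..t}\<close>. The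
  value is zero for \<open>x \<le> a\<close>, so the averages in \<open>steklov\<close> make sense
  at every real time.\<close>

definition prim :: "real \<Rightarrow> (real \<Rightarrow> 'b::{banach,second_countable_topology}) \<Rightarrow> real \<Rightarrow> 'b" where
  "prim a g x = (LINT s|lborel. indicator {a<..x} s *\<^sub>R g s)"

lemma integrable_indicator_scaleR:
  fixes g :: "real \<Rightarrow> 'b::{banach,second_countable_topology}"
  shows "integrable lborel g \<Longrightarrow> A \<in> sets borel \<Longrightarrow> integrable lborel (\<lambda>s. indicator A s *\<^sub>R g s)"
  using integrable_mult_indicator[of A lborel g] by simp

lemma prim_diff:
  assumes g: "integrable lborel g" and st: "a \<le> s" "s \<le> t"
  shows "prim a g t - prim a g s = (LINT r|lborel. indicator {s<..t} r *\<^sub>R g r)"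
proof -
  have "prim a g t - prim a g s = (LINT r|lborel. indicator {a<..t} r *\<^sub>R g r - indicator {a<..s} r *\<^sub>R g r)"
    unfolding prim_def
    by (intro Bochner_Integration.integral_diff[symmetric] integrable_indicator_scaleR[OF g]) simp_all
  also have "(\<lambda>r. indicator {a<..t} r *\<^sub>R g r - indicator {a<..s} r *\<^sub>R g r) = (\<lambda>r. indicator {s<..t} r *\<^sub>R g r)"
    using st by (intro ext) (auto simp: indicator_def)
  finally show ?thesis .
qed

lemma prim_end:
  assumes "\<And>s. s \<notin> {a<..<b} \<Longrightarrow> g s = 0" "b \<le> t" shows "prim a g t = integral\<^sup>L lborel g"
proof -
  have "(\<lambda>s. indicator {a<..t} s *\<^sub>R g s) = g"
  proof
    fix s show "indicator {a<..t} s *\<^sub>R g s = g s"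
      using assms(1)[of s] assms(2) by (cases "s \<in> {a<..<b}") (auto simp: indicator_def)
  qed
  then show ?thesis unfolding prim_def by (simp only:)
qed

lemma prim_continuous:
  fixes g :: "real \<Rightarrow> 'b::{banach,second_countable_topology}"
  assumes g: "integrable lborel g"
  shows "continuous_on A (prim a g)"
proof (rule continuous_on_sequentiallyI)
  fix u :: "nat \<Rightarrow> real" and x assume u: "u \<longlonglongrightarrow> x"
  have gm: "g \<in> borel_measurable borel" using borel_measurable_integrable[OF g] by simp
  show "(\<lambda>n. prim a g (u n)) \<longlonglongrightarrow> prim a g x"
    unfolding prim_def
  proof (rule integral_dominated_convergence[where w="\<lambda>s. norm (g s)"])
    show "(\<lambda>s. indicator {a<..x} s *\<^sub>R g s) \<in> borel_measurable lborel"
      "\<And>i. (\<lambda>s. indicator {a<..u i} s *\<^sub>R g s) \<in> borel_measurable lborel"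
      using gm by (simp_all add: borel_measurable_scaleR borel_measurable_indicator)
    show "integrable lborel (\<lambda>s. norm (g s))" using g by (rule integrable_norm)
    show "AE s in lborel. (\<lambda>i. indicator {a<..u i} s *\<^sub>R g s) \<longlonglongrightarrow> indicator {a<..x} s *\<^sub>R g s"
      using AE_lborel_singleton[of x]
    proof eventually_elim
      case (elim s)
      have "\<forall>\<^sub>F i in sequentially. indicator {a<..u i} s = (indicator {a<..x} s :: real)"
      proof (cases "s < x")
        case True
        show ?thesis using order_tendstoD(1)[OF u True]
          by eventually_elim (use True in \<open>auto simp: indicator_def\<close>)
      next
        case False
        then have "x < s" using elim by simp
        show ?thesis using order_tendstoD(2)[OF u \<open>x < s\<close>]
          by eventually_elim (use \<open>x < s\<close> in \<open>auto simp: indicator_def\<close>)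
      qed
      then have "\<forall>\<^sub>F i in sequentially. indicator {a<..u i} s *\<^sub>R g s = indicator {a<..x} s *\<^sub>R g s"
        by eventually_elim (simp only:)
      then show ?case by (rule tendsto_eventually)
    qed
    show "AE s in lborel. norm (indicator {a<..u i} s *\<^sub>R g s) \<le> norm (g s)" for i
      by (intro AE_I2) (simp add: indicator_def)
  qed
qed

lemma prim_inner:
  fixes g :: "real \<Rightarrow> 'b::{real_inner,banach,second_countable_topology}"
  assumes g: "integrable lborel g"
  shows "prim a g t \<bullet> c = prim a (\<lambda>s. g s \<bullet> c) t"
proof -
  have "prim a g t \<bullet> c = (LINT s|lborel. (indicator {a<..t} s *\<^sub>R g s) \<bullet> c)"
    unfolding prim_def
    by (rule integral_inner_left[symmetric]) (intro integrable_indicator_scaleR[OF g] , simp)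
  then show ?thesis by (simp add: prim_def)
qed

text \<open>Fubini on the triangle \<open>a < s \<le> x \<le> b\<close> replaces the product rule,
  because the primitive of a merely integrable \<open>g\<close> need not be differentiable
  everywhere.\<close>

lemma integral_prim_by_parts:
  fixes g \<theta> \<theta>' :: "real \<Rightarrow> real"
  assumes g: "integrable lborel g" "\<And>s. s \<notin> {a<..<b} \<Longrightarrow> g s = 0" and ab: "a < b"
    and \<theta>: "\<And>x. (\<theta> has_field_derivative \<theta>' x) (at x)" "continuous_on UNIV \<theta>'"
  shows "(LINT x|lborel. indicator {a<..b} x * (prim a g x * \<theta>' x))
      = \<theta> b * (LINT s|lborel. g s) - (LINT s|lborel. g s * \<theta> s)"
proof -
  have [measurable]: "g \<in> borel_measurable borel" using borel_measurable_integrable[OF g(1)] by simp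
  have [measurable]: "\<theta>' \<in> borel_measurable borel" using \<theta>(2) by (rule borel_measurable_continuous_onI)
  obtain M where M: "0 \<le> M" "\<And>x. x \<in> {a..b} \<Longrightarrow> \<bar>\<theta>' x\<bar> \<le> M"
  proof -
    have "bounded (\<theta>' ` {a..b})"
      by (intro compact_imp_bounded compact_continuous_image continuous_on_subset[OF \<theta>(2)]) auto
    then obtain M where M: "\<forall>y\<in>\<theta>' ` {a..b}. norm y \<le> M" unfolding bounded_iff ..
    have "\<bar>\<theta>' x\<bar> \<le> max M 0" if "x \<in> {a..b}" for x
      using bspec[OF M imageI[OF that]] by simp
    then show ?thesis by (intro that[of "max M 0"]) simp_all
  qed
  define f where "f x s = (if a < x \<and> x \<le> b \<and> a < s \<and> s \<le> x then \<theta>' x * g s else 0)" for x s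
  have fm [measurable]: "case_prod f \<in> borel_measurable (lborel \<Otimes>\<^sub>M lborel)"
    unfolding f_def case_prod_beta by measurable
  have fb: "norm (f x s) \<le> indicator {a..b} x * M * norm (g s)" for x s
    using M(1) M(2)[of x] by (auto simp: f_def abs_mult indicator_def intro!: mult_right_mono)
  have fi: "integrable lborel (\<lambda>s. f x s)" for x
  proof (rule Bochner_Integration.integrable_bound)
    show "integrable lborel (\<lambda>s. indicator {a..b} x * M * norm (g s))"
      using g(1) by simp
    show "(\<lambda>s. f x s) \<in> borel_measurable lborel" unfolding f_def by measurable
    show "AE s in lborel. norm (f x s) \<le> norm (indicator {a..b} x * M * norm (g s))"
      using fb[of x] M(1) by (intro AE_I2) (auto simp: abs_mult)
  qed
  have "integrable (lborel \<Otimes>\<^sub>M lborel) (case_prod f)"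
  proof (rule lborel_pair.Fubini_integrable[OF fm])
    show "AE x in lborel. integrable lborel (\<lambda>s. case_prod f (x, s))" using fi by simp
    show "integrable lborel (\<lambda>x. LINT s|lborel. norm (case_prod f (x, s)))"
    proof (rule Bochner_Integration.integrable_bound)
      show "integrable lborel (\<lambda>x. indicator {a..b} x * (M * (LINT s|lborel. norm (g s))))"
        using ab by (intro integrable_mult_left integrable_real_indicator) (auto simp: emeasure_lborel_Icc_eq)
      show "(\<lambda>x. LINT s|lborel. norm (case_prod f (x, s))) \<in> borel_measurable lborel"
        by measurable
      show "AE x in lborel. norm (LINT s|lborel. norm (case_prod f (x, s)))
          \<le> norm (indicator {a..b} x * (M * (LINT s|lborel. norm (g s))))"
      proof (rule AE_I2)
        fix x
        have "(LINT s|lborel. norm (f x s)) \<le> (LINT s|lborel. indicator {a..b} x * M * norm (g s))"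
          using fb fi[of x] g(1) by (intro integral_mono) auto
        also have "\<dots> = indicator {a..b} x * (M * (LINT s|lborel. norm (g s)))" by simp
        finally show "norm (LINT s|lborel. norm (case_prod f (x, s)))
          \<le> norm (indicator {a..b} x * (M * (LINT s|lborel. norm (g s))))"
          by (simp add: abs_of_nonneg M(1))
      qed
    qed
  qed
  from lborel_pair.Fubini_integral[OF this]
  have sw: "(LINT s|lborel. LINT x|lborel. f x s) = (LINT x|lborel. LINT s|lborel. f x s)" .
  have "(LINT s|lborel. f x s) = indicator {a<..b} x * (prim a g x * \<theta>' x)" for x
  proof -
    have "(\<lambda>s. f x s) = (\<lambda>s. (indicator {a<..b} x * \<theta>' x) * (indicator {a<..x} s *\<^sub>R g s))"
      by (intro ext) (auto simp: f_def indicator_def)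
    then show ?thesis by (simp add: prim_def)
  qed
  moreover have "(LINT x|lborel. f x s) = g s * \<theta> b - g s * \<theta> s" for s
  proof (cases "s \<in> {a<..<b}")
    case True
    have "(\<lambda>x. f x s) = (\<lambda>x. g s * (indicator {s..b} x * \<theta>' x))"
      using True by (intro ext) (auto simp: f_def indicator_def)
    then have "(LINT x|lborel. f x s) = g s * (\<theta> b - \<theta> s)"
      using ftc_lborel[OF _ \<theta>, of s b] True by simp
    then show ?thesis by (simp add: right_diff_distrib)
  next
    case False
    then have "g s = 0" by (rule g(2))
    then have "(\<lambda>x. f x s) = (\<lambda>x. 0)" by (intro ext) (simp add: f_def)
    then show ?thesis using \<open>g s = 0\<close> by simp
  qed
  moreover have "(LINT s|lborel. g s * \<theta> b - g s * \<theta> s) = \<theta> b * (LINT s|lborel. g s) - (LINT s|lborel. g s * \<theta> s)"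
  proof (subst Bochner_Integration.integral_diff)
    have \<theta>m: "\<theta> \<in> borel_measurable borel"
      using \<theta>(1) by (intro borel_measurable_continuous_onI DERIV_continuous_on) (auto intro: has_field_derivative_at_within)
    obtain K where K: "\<And>x. x \<in> {a..b} \<Longrightarrow> \<bar>\<theta> x\<bar> \<le> K"
    proof -
      have "continuous_on {a..b} \<theta>" using \<theta>(1) by (intro DERIV_continuous_on) (auto intro: has_field_derivative_at_within)
      then have "bounded (\<theta> ` {a..b})"
        by (intro compact_imp_bounded compact_continuous_image) auto
      then obtain K where K: "\<forall>y\<in>\<theta> ` {a..b}. norm y \<le> K" unfolding bounded_iff ..
      have "\<bar>\<theta> x\<bar> \<le> K" if "x \<in> {a..b}" for x
        using bspec[OF K imageI[OF that]] by simp
      then show ?thesis by (rule that)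
    qed
    show "integrable lborel (\<lambda>s. g s * \<theta> s)"
    proof (rule Bochner_Integration.integrable_bound[of lborel "\<lambda>s. norm (g s) * K"])
      show "integrable lborel (\<lambda>s. norm (g s) * K)" using g(1) by simp
      show "AE s in lborel. norm (g s * \<theta> s) \<le> norm (norm (g s) * K)"
      proof (rule AE_I2)
        fix s
        show "norm (g s * \<theta> s) \<le> norm (norm (g s) * K)"
        proof (cases "s \<in> {a<..<b}")
          case True
          then have "\<bar>\<theta> s\<bar> \<le> \<bar>K\<bar>" using K[of s] by simp
          then show ?thesis by (simp add: abs_mult mult_left_mono)
        next
          case False
          then show ?thesis using g(2) by simp
        qed
      qed
    qed (use \<theta>m in \<open>simp_all add: borel_measurable_times\<close>)
    show "integrable lborel (\<lambda>s. g s * \<theta> b)" using g(1) by simp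
  qed simp
  ultimately show ?thesis using sw by simp
qed

lemma test_integrable: "\<theta> \<in> test_functions \<Omega> \<Longrightarrow> integrable lborel \<theta>"
proof -
  assume t: "\<theta> \<in> test_functions \<Omega>"
  then obtain K where K: "compact K" "\<And>x. x \<notin> K \<Longrightarrow> \<theta> x = 0" unfolding test_functions_iff by blast
  have "integrable lborel (\<lambda>x. indicator K x *\<^sub>R \<theta> x)"
    by (rule borel_integrable_compact[OF K(1) smooth_continuous_on[OF test_smooth[OF t]]])
  moreover have "(\<lambda>x. indicator K x *\<^sub>R \<theta> x) = \<theta>" using K(2) by (intro ext) (auto simp: indicator_def)
  ultimately show ?thesis by (simp only:)
qed

text \<open>To the right of the support of \<zeta> the primitive from the left end is constant, and
  the zero mean makes that constant vanish.\<close>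

lemma test_primitive:
  assumes ab: "a < b" and t: "\<zeta> \<in> test_functions {a<..<b}" and z: "(LINT x|lborel. \<zeta> x) = 0"
  shows "\<exists>\<theta>\<in>test_functions {a<..<b}. deriv \<theta> = \<zeta>"
proof -
  obtain c d where cd: "a < c" "c < d" "d < b" "\<And>x. x \<le> c \<or> d \<le> x \<Longrightarrow> \<zeta> x = 0"
    using test_support_interval[OF t ab] by blast
  define \<theta> where "\<theta> x = integral {a..x} \<zeta>" for x
  have cont: "continuous_on A \<zeta>" for A using smooth_continuous_on[OF test_smooth[OF t]] .
  have lo: "\<theta> x = 0" if "x \<le> c" for x
  proof -
    have "\<theta> x = integral {a..x} (\<lambda>_. 0)" unfolding \<theta>_def
      by (rule Henstock_Kurzweil_Integration.integral_cong) (use that cd in auto)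
    then show ?thesis by simp
  qed
  have hi: "\<theta> x = 0" if "d \<le> x" for x
  proof -
    have si: "set_integrable lborel {a..x} \<zeta>" by (rule borel_integrable_atLeastAtMost'[OF cont])
    have "(\<lambda>s. indicator {a..x} s *\<^sub>R \<zeta> s) = \<zeta>"
    proof
      fix s show "indicator {a..x} s *\<^sub>R \<zeta> s = \<zeta> s"
        using cd(4)[of s] cd(1) that by (cases "s \<le> c \<or> d \<le> s") auto
    qed
    then have "(LINT s:{a..x}|lborel. \<zeta> s) = 0" unfolding set_lebesgue_integral_def using z by (simp only:)
    then show ?thesis using set_borel_integral_eq_integral(2)[OF si] by (simp add: \<theta>_def)
  qed
  have der: "(\<theta> has_field_derivative \<zeta> x) (at x)" for x
  proof (cases "x < c")
    case True
    have "(\<theta> has_field_derivative 0) (at x)"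
      by (rule has_field_derivative_transform_within_open[of "\<lambda>_. 0" _ _ "{..<c}"])
        (use True lo in auto)
    then show ?thesis using True cd by simp
  next
    case False
    \<comment> \<open>The integration interval is continued to \<open>x + 1\<close> so that
      \<open>x\<close> is an interior point and the derivative is two-sided.\<close>
    have "(\<theta> has_field_derivative \<zeta> x) (at x within {a..x + 1})"
      unfolding \<theta>_def[abs_def]
      by (rule integral_has_real_derivative[OF cont]) (use False cd in auto)
    moreover have "at x within {a..x+1} = at x" by (rule at_within_Icc_at) (use False cd(1) in auto)
    ultimately show ?thesis by (simp only:)
  qed
  have "smooth \<theta>" by (rule smooth_primitive[OF der test_smooth[OF t]])
  moreover have "\<forall>x. x \<notin> {c..d} \<longrightarrow> \<theta> x = 0"
  proof (intro allI impI)
    fix x assume "x \<notin> {c..d}"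
    then have "x \<le> c \<or> d \<le> x" by auto
    then show "\<theta> x = 0" using lo hi by blast
  qed
  moreover have "{c..d} \<subseteq> {a<..<b}" using cd(1,3) by auto
  ultimately have "\<theta> \<in> test_functions {a<..<b}" unfolding test_functions_iff
    using compact_Icc by blast
  moreover have "deriv \<theta> = \<zeta>" by (rule ext) (rule DERIV_imp_deriv[OF der])
  ultimately show ?thesis by blast
qed

lemma integrable_mult_test:
  fixes f :: "real \<Rightarrow> real"
  assumes f: "integrable lborel f" and t: "\<theta> \<in> test_functions \<Omega>"
  shows "integrable lborel (\<lambda>x. f x * \<theta> x)"
proof -
  obtain B where B: "0 \<le> B" "\<And>x. \<bar>\<theta> x\<bar> \<le> B" using test_bounded[OF t] by blast
  show ?thesis
  proof (rule Bochner_Integration.integrable_bound[of lborel "\<lambda>x. norm (f x) * B"])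
    show "integrable lborel (\<lambda>x. norm (f x) * B)" using f by simp
    show "(\<lambda>x. f x * \<theta> x) \<in> borel_measurable lborel"
      using borel_measurable_integrable[OF f] smooth_measurable[OF test_smooth[OF t]] by (simp add: borel_measurable_times)
    show "AE x in lborel. norm (f x * \<theta> x) \<le> norm (norm (f x) * B)"
      using B by (intro AE_I2) (simp add: abs_mult mult_left_mono)
  qed
qed

text \<open>After subtraction of the primitive of \<open>g\<close> the rest \<open>F\<close> is
  orthogonal to derivatives of test functions, that is, to the test functions of mean zero. Any test
  function acquires mean zero when a multiple of the fixed bump \<open>\<eta>0\<close> is
  subtracted, so \<open>F - c\<close> is orthogonal to all of them.\<close>

theorem du_bois_reymond:
  fixes f g :: "real \<Rightarrow> real"
  assumes ab: "a < b"
    and f: "integrable lborel f" "\<And>x. x \<notin> {a<..<b} \<Longrightarrow> f x = 0"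
    and g: "integrable lborel g" "\<And>x. x \<notin> {a<..<b} \<Longrightarrow> g x = 0"
    and eq: "\<And>\<theta>. \<theta> \<in> test_functions {a<..<b} \<Longrightarrow>
      (LINT x|lborel. f x * deriv \<theta> x) = - (LINT x|lborel. g x * \<theta> x)"
  shows "\<exists>c. AE x in lborel. x \<in> {a<..<b} \<longrightarrow> f x = c + prim a g x"
proof -
  define F where "F x = f x - indicator {a<..b} x * prim a g x" for x
  have pm: "prim a g \<in> borel_measurable borel"
    by (rule borel_measurable_continuous_onI) (rule prim_continuous[OF g(1)])
  have ip: "integrable lborel (\<lambda>x. indicator {a<..b} x * prim a g x)"
  proof (rule Bochner_Integration.integrable_bound)
    show "integrable lborel (\<lambda>x. indicator {a..b} x *\<^sub>R prim a g x)"
      by (rule borel_integrable_compact) (auto intro: prim_continuous[OF g(1)])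
    show "(\<lambda>x. indicator {a<..b} x * prim a g x) \<in> borel_measurable lborel"
      using pm by (simp add: borel_measurable_times borel_measurable_indicator)
  qed (auto simp: indicator_def)
  have Fi: "integrable lborel F" unfolding F_def using f(1) ip by (rule Bochner_Integration.integrable_diff)
  have F0: "(LINT x|lborel. F x * deriv \<theta> x) = 0" if t: "\<theta> \<in> test_functions {a<..<b}" for \<theta>
  proof -
    have "(LINT x|lborel. F x * deriv \<theta> x)
      = (LINT x|lborel. f x * deriv \<theta> x) - (LINT x|lborel. indicator {a<..b} x * prim a g x * deriv \<theta> x)"
      unfolding F_def left_diff_distrib
      by (rule Bochner_Integration.integral_diff[OF integrable_mult_test[OF f(1) test_deriv[OF t]]
            integrable_mult_test[OF ip test_deriv[OF t]]])
    also have "(LINT x|lborel. indicator {a<..b} x * prim a g x * deriv \<theta> x)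
        = \<theta> b * (LINT s|lborel. g s) - (LINT s|lborel. g s * \<theta> s)"
      unfolding mult.assoc
      using smooth_has_deriv[OF test_smooth[OF t]] smooth_continuous_on[OF smooth_deriv[OF test_smooth[OF t]]]
      by (intro integral_prim_by_parts[OF g ab])
    also have "\<theta> b = 0" using test_outside[OF t, of b] by simp
    finally show ?thesis using eq[OF t] by simp
  qed
  \<comment> \<open>Any test function with nonzero integral would do; the closed middle third lies
    inside the open interval.\<close>
  define \<eta>0 where "\<eta>0 = cutoff ((2*a+b)/3) ((a+2*b)/3) 1"
  have "(2*a+b)/3 < (a+2*b)/3" "{(2*a+b)/3..(a+2*b)/3} \<subseteq> {a<..<b}" using ab by (auto simp: field_simps)
  then have \<eta>0: "\<eta>0 \<in> test_functions {a<..<b}" unfolding \<eta>0_def using cutoff_test by blast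
  define I where "I = (LINT x|lborel. \<eta>0 x)"
  have I: "I \<noteq> 0"
  proof
    assume "I = 0"
    have nn: "AE x in lborel. 0 \<le> \<eta>0 x" unfolding \<eta>0_def by (intro AE_I2 cutoff_bounds)
    have "AE x in lborel. \<eta>0 x = 0"
      using integral_nonneg_eq_0_iff_AE[OF test_integrable[OF \<eta>0] nn] \<open>I = 0\<close> unfolding I_def by blast
    then have "AE x in lborel. x \<notin> {(2*a+b)/3<..<(a+2*b)/3}"
    proof eventually_elim
      case (elim x)
      then show ?case using cutoff_pos[of "(2*a+b)/3" x "(a+2*b)/3" 1] unfolding \<eta>0_def by auto
    qed
    moreover have "{(2*a+b)/3<..<(a+2*b)/3} \<in> sets lborel" by simp
    ultimately have "emeasure lborel {(2*a+b)/3<..<(a+2*b)/3} = 0"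
      using AE_iff_null_sets null_setsD1 by blast
    then show False using \<open>(2*a+b)/3 < (a+2*b)/3\<close> by simp
  qed
  define c where "c = (LINT x|lborel. F x * \<eta>0 x) / I"
  have Fc0: "(LINT x|lborel. (F x - c) * \<eta> x) = 0" if t: "\<eta> \<in> test_functions {a<..<b}" for \<eta>
  proof -
    define m where "m = (LINT x|lborel. \<eta> x) / I"
    have tz: "(\<lambda>x. \<eta> x - m * \<eta>0 x) \<in> test_functions {a<..<b}" by (rule test_comb[OF t \<eta>0])
    have "(LINT x|lborel. \<eta> x - m * \<eta>0 x) = (LINT x|lborel. \<eta> x) - m * I"
      unfolding I_def using test_integrable[OF t] test_integrable[OF \<eta>0] by simp
    also have "\<dots> = 0" using I by (simp add: m_def)
    finally obtain \<theta> where \<theta>: "\<theta> \<in> test_functions {a<..<b}" "deriv \<theta> = (\<lambda>x. \<eta> x - m * \<eta>0 x)"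
      using test_primitive[OF ab tz] by blast
    have 0: "(LINT x|lborel. F x * (\<eta> x - m * \<eta>0 x)) = 0" using F0[OF \<theta>(1)] \<theta>(2) by simp
    have Fe: "integrable lborel (\<lambda>x. F x * \<eta> x)" "integrable lborel (\<lambda>x. F x * \<eta>0 x)"
      by (rule integrable_mult_test[OF Fi t], rule integrable_mult_test[OF Fi \<eta>0])
    have "(\<lambda>x. F x * (\<eta> x - m * \<eta>0 x)) = (\<lambda>x. F x * \<eta> x - m * (F x * \<eta>0 x))"
      by (intro ext) (simp add: algebra_simps)
    then have "(LINT x|lborel. F x * \<eta> x) - m * (LINT x|lborel. F x * \<eta>0 x) = 0"
      using 0 Fe by simp
    moreover have "(\<lambda>x. (F x - c) * \<eta> x) = (\<lambda>x. F x * \<eta> x - c * \<eta> x)"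
      by (intro ext) (simp add: algebra_simps)
    then have "(LINT x|lborel. (F x - c) * \<eta> x) = (LINT x|lborel. F x * \<eta> x) - c * (LINT x|lborel. \<eta> x)"
      using Fe test_integrable[OF t] by simp
    ultimately show ?thesis using I by (simp add: m_def c_def field_simps)
  qed
  have "AE x in lborel. x \<in> {a<..<b} \<longrightarrow> F x - c = 0"
  proof (rule fundamental_lemma)
    have Fm: "F \<in> borel_measurable borel" using borel_measurable_integrable[OF Fi] by simp
    show "integrable lebesgue (\<lambda>x. indicator {p..q} x * (F x - c))" for p q
    proof (subst integrable_completion)
      show "(\<lambda>x. indicator {p..q} x * (F x - c)) \<in> borel_measurable lborel"
        using Fm by (simp add: borel_measurable_times borel_measurable_indicator borel_measurable_diff)
      have "integrable lborel (\<lambda>x. indicator {p..q} x * F x - indicator {p..q} x * c)"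
      proof (rule Bochner_Integration.integrable_diff)
        show "integrable lborel (\<lambda>x. indicator {p..q} x * F x)"
          by (rule integrable_indicator_mult[OF Fi]) simp
        have "emeasure lborel {p..q} < \<infinity>" by (simp add: emeasure_lborel_Icc_eq)
        then show "integrable lborel (\<lambda>x. indicator {p..q} x * c)"
          by (intro integrable_mult_left integrable_real_indicator) simp_all
      qed
      then show "integrable lborel (\<lambda>x. indicator {p..q} x * (F x - c))" by (simp only: right_diff_distrib)
    qed
    show "(LINT x|lebesgue. (F x - c) * \<theta> x) = 0" if t: "\<theta> \<in> test_functions {a<..<b}" for \<theta>
    proof (subst integral_completion)
      show "(\<lambda>x. (F x - c) * \<theta> x) \<in> borel_measurable lborel"
        using smooth_measurable[OF test_smooth[OF t]] Fm by (simp add: borel_measurable_times borel_measurable_diff)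
    qed (rule Fc0[OF t])
  qed (rule open_greaterThanLessThan)
  then have "AE x in lborel. x \<in> {a<..<b} \<longrightarrow> f x = c + prim a g x"
  proof eventually_elim
    case (elim x)
    show ?case
    proof
      assume x: "x \<in> {a<..<b}"
      then have "F x = c" using elim by simp
      then show "f x = c + prim a g x" using x by (simp add: F_def algebra_simps)
    qed
  qed
  then show ?thesis by blast
qed

section \<open>Translations and Steklov averages\<close>

lemma AE_lborel_shift:
  fixes f g :: "real \<Rightarrow> 'b::sep_hilbert"
  assumes [measurable]: "f \<in> borel_measurable borel" "g \<in> borel_measurable borel"
    and ae: "AE x in lborel. f x = g x"
  shows "AE x in lborel. f (x + h) = g (x + h)"
proof -
  have "AE x in lborel. norm (f x - g x) = 0" using ae by eventually_elim simp
  from AE_borel_affine[OF _ _ this, of 1 h]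
  have "AE x in lborel. norm (f (h + 1 * x) - g (h + 1 * x)) = 0" by simp
  then show ?thesis by eventually_elim (simp add: add.commute)
qed

lemma AE_lborel_shift_notin:
  assumes N: "N \<in> null_sets lborel" shows "AE x in lborel. x + h \<notin> (N::real set)"
proof -
  have "N \<in> sets borel" using N by (simp add: null_sets_def)
  then have "Measurable.pred borel (\<lambda>x. x \<notin> N)" by measurable
  from AE_borel_affine[OF _ this AE_not_in[OF N], of 1 h] show ?thesis by (simp add: add.commute)
qed

lemma sqi_shift: assumes "sqi f" shows "sqi (\<lambda>t. f (t + h))"
proof -
  have [measurable]: "f \<in> borel_measurable borel" using assms by (rule sqiD)
  show ?thesis unfolding sqi_def
    using lborel_integrable_real_affine[OF sqiD(2)[OF assms], of 1 h] by (simp add: add.commute)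
qed

lift_definition shift :: "real \<Rightarrow> 'b::sep_hilbert l2 \<Rightarrow> 'b l2" is "\<lambda>h f t. f (t + h)"
  unfolding l2_rel_def by (elim conjE, intro conjI sqi_shift AE_lborel_shift; (assumption | erule sqiD))

lemma shift_abs_l2: "sqi f \<Longrightarrow> shift h (abs_l2 f) = abs_l2 (\<lambda>t. f (t + h))"
  by (rule shift.abs_eq) (simp add: l2_rel_refl)

lemma shift_comb: "shift h (u - v) = shift h u - shift h v" "shift h (u + v) = shift h u + shift h v"
  "shift h (c *\<^sub>R u) = c *\<^sub>R shift h u"
  by (transfer; simp add: l2_rel_def sqi_shift sqi_diff sqi_add sqi_scaleR sqi_shift[of "\<lambda>x. _ x - _ x"]
      sqi_shift[of "\<lambda>x. _ x + _ x"] sqi_shift[of "\<lambda>x. _ *\<^sub>R _ x"])+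

lemma norm_shift: "norm (shift h u) = norm u"
proof -
  have "shift h u \<bullet> shift h u = u \<bullet> u"
  proof transfer
    fix h and f :: "real \<Rightarrow> 'a"
    show "(LINT x|lborel. f (x + h) \<bullet> f (x + h)) = (LINT x|lborel. f x \<bullet> f x)"
      using lborel_integral_real_affine[of 1 "\<lambda>x. f x \<bullet> f x" h] by (simp add: add.commute)
  qed
  then show ?thesis by (simp add: norm_eq_sqrt_inner)
qed

text \<open>A translation by \<open>h\<close> changes the indicator only within distance
  \<open>\<bar>h\<bar>\<close> of the two endpoints.\<close>

lemma indicator_shift_bound:
  "(norm (indicator {a<..<b} (t + h) *\<^sub>R c - indicator {a<..<b} t *\<^sub>R c))\<^sup>2
    \<le> (norm c)\<^sup>2 * (indicator {a - \<bar>h\<bar>..a + \<bar>h\<bar>} t + indicator {b - \<bar>h\<bar>..b + \<bar>h\<bar>} (t::real))"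
  by (auto simp: indicator_def)

lemma shift_indicator_tendsto:
  "((\<lambda>h. shift h (abs_l2 (\<lambda>x. indicator {a<..<b} x *\<^sub>R c))) \<longlongrightarrow> abs_l2 (\<lambda>x. indicator {a<..<b} x *\<^sub>R c)) (at 0)"
proof -
  let ?f = "\<lambda>x::real. indicator {a<..<b} x *\<^sub>R c"
  have s: "sqi ?f" by (rule sqi_indicator)
  have bnd: "dist (shift h (abs_l2 ?f)) (abs_l2 ?f) \<le> sqrt ((norm c)\<^sup>2 * (4 * \<bar>h\<bar>))" for h
  proof -
    have i: "integrable lborel (\<lambda>t. indicator {x - \<bar>h\<bar>..x + \<bar>h\<bar>} t :: real)" for x :: real
      by (intro integrable_real_indicator) (simp_all add: emeasure_lborel_Icc_eq)
    have m: "(LINT t|lborel. indicator {x - \<bar>h\<bar>..x + \<bar>h\<bar>} t :: real) = 2 * \<bar>h\<bar>" for x :: real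
      by (simp add: measure_def)
    have "(LINT t|lborel. (norm (?f (t + h) - ?f t))\<^sup>2)
        \<le> (LINT t|lborel. (norm c)\<^sup>2 * (indicator {a - \<bar>h\<bar>..a + \<bar>h\<bar>} t + indicator {b - \<bar>h\<bar>..b + \<bar>h\<bar>} t))"
    proof (rule integral_mono)
      show "integrable lborel (\<lambda>t. (norm (?f (t + h) - ?f t))\<^sup>2)"
        by (rule sqiD(2)[OF sqi_diff[OF sqi_shift[OF s] s]])
      show "integrable lborel (\<lambda>t. (norm c)\<^sup>2 * (indicator {a - \<bar>h\<bar>..a + \<bar>h\<bar>} t + indicator {b - \<bar>h\<bar>..b + \<bar>h\<bar>} t))"
        by (intro integrable_mult_right Bochner_Integration.integrable_add i)
    qed (rule indicator_shift_bound)
    also have "\<dots> = (norm c)\<^sup>2 * (2 * \<bar>h\<bar> + 2 * \<bar>h\<bar>)"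
      using i[of a] i[of b] m[of a] m[of b] by simp
    finally show ?thesis
      unfolding shift_abs_l2[OF s] dist_abs_l2[OF sqi_shift[OF s] s] by (intro real_sqrt_le_mono) simp
  qed
  have "((\<lambda>h. sqrt ((norm c)\<^sup>2 * (4 * \<bar>h\<bar>))) \<longlongrightarrow> sqrt ((norm c)\<^sup>2 * (4 * \<bar>0\<bar>))) (at 0)"
    by (intro tendsto_intros)
  then have "((\<lambda>h. sqrt ((norm c)\<^sup>2 * (4 * \<bar>h\<bar>))) \<longlongrightarrow> 0) (at 0)" by simp
  then have "((\<lambda>h. dist (shift h (abs_l2 ?f)) (abs_l2 ?f)) \<longlongrightarrow> 0) (at 0)"
    by (rule tendsto_sandwich[rotated 2, OF tendsto_const]) (simp_all add: bnd)
  then show ?thesis by (subst tendsto_dist_iff)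
qed

text \<open>Translations are isometries, so the elements whose translates converge form a closed
  subspace; it contains the step functions, which are total.\<close>

lemma shift_tendsto: "((\<lambda>h. shift h u) \<longlongrightarrow> u) (at 0)"
proof -
  define S where "S = {u :: 'a l2. ((\<lambda>h. shift h u) \<longlongrightarrow> u) (at 0)}"
  have "shift h (0 :: 'a l2) = 0" for h using norm_shift[of h "0 :: 'a l2"] by simp
  then have "subspace S" unfolding S_def subspace_def
    by (auto simp: shift_comb intro!: tendsto_add tendsto_scaleR)
  moreover have "closed S"
    unfolding closed_sequential_limits
  proof (intro allI impI)
    fix x :: "nat \<Rightarrow> 'a l2" and l assume x: "(\<forall>n. x n \<in> S) \<and> x \<longlonglongrightarrow> l"
    show "l \<in> S" unfolding S_def mem_Collect_eq
    proof (rule tendstoI)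
      fix e :: real assume e: "0 < e"
      obtain n where n: "dist (x n) l < e / 3"
        using x e tendstoD[of x l sequentially "e/3"] eventually_sequentially by (metis order_refl divide_pos_pos zero_less_numeral)
      have "\<forall>\<^sub>F h in at 0. dist (shift h (x n)) (x n) < e / 3"
        using x e tendstoD[of "\<lambda>h. shift h (x n)" "x n" "at 0" "e/3"] by (auto simp: S_def)
      then show "\<forall>\<^sub>F h in at 0. dist (shift h l) l < e"
      proof eventually_elim
        case (elim h)
        have "dist (shift h l) (shift h (x n)) = dist l (x n)"
          unfolding dist_norm shift_comb(1)[symmetric] norm_shift ..
        moreover have "dist (shift h l) l \<le> dist (shift h l) (shift h (x n)) + dist (shift h (x n)) (x n) + dist (x n) l"
          by (meson add_right_mono dist_triangle order_trans)
        ultimately show ?case using elim n by (simp add: dist_commute)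
      qed
    qed
  qed
  moreover have "v = 0" if v: "\<And>b. b \<in> S \<Longrightarrow> v \<bullet> b = 0" for v :: "'a l2"
  proof -
    obtain D :: "'a set" where D: "countable D" "\<And>x. x \<in> closure D" using countable_dense_closure by blast
    show ?thesis
      by (rule l2_total[OF D]) (rule v, unfold S_def mem_Collect_eq, rule shift_indicator_tendsto)
  qed
  ultimately have "u \<in> S" by (rule closed_subspace_total)
  then show ?thesis by (simp add: S_def)
qed

lemma sqi_shift_tendsto:
  assumes f: "sqi f" shows "((\<lambda>h. LINT t|lborel. (norm (f (t + h) - f t))\<^sup>2) \<longlongrightarrow> 0) (at 0)"
proof -
  have "((\<lambda>h. (dist (shift h (abs_l2 f)) (abs_l2 f))\<^sup>2) \<longlongrightarrow> 0\<^sup>2) (at 0)"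
    by (intro tendsto_power) (subst tendsto_dist_iff[symmetric], rule shift_tendsto)
  moreover have "(dist (shift h (abs_l2 f)) (abs_l2 f))\<^sup>2 = (LINT t|lborel. (norm (f (t + h) - f t))\<^sup>2)" for h
    unfolding shift_abs_l2[OF f] dist_abs_l2[OF sqi_shift[OF f] f] by simp
  ultimately show ?thesis by simp
qed

lemma norm_interval_integral_le:
  fixes f :: "real \<Rightarrow> 'b::sep_hilbert"
  assumes ab: "a \<le> b" and f: "f \<in> borel_measurable borel"
    "integrable lborel (\<lambda>s. indicator {a<..b} s * (norm (f s))\<^sup>2)"
  shows "(norm (LINT s|lborel. indicator {a<..b} s *\<^sub>R f s))\<^sup>2
    \<le> (b - a) * (LINT s|lborel. indicator {a<..b} s * (norm (f s))\<^sup>2)"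
proof -
  define u where "u s = (indicator {a<..b} s :: real)" for s
  define v where "v s = indicator {a<..b} s * norm (f s)" for s
  have sq: "(norm (u s))\<^sup>2 = u s" "(norm (v s))\<^sup>2 = indicator {a<..b} s * (norm (f s))\<^sup>2" "u s \<bullet> v s = v s" for s
    by (simp_all add: u_def v_def indicator_def)
  have ui: "integrable lborel u" unfolding u_def[abs_def]
    using ab by (intro integrable_real_indicator) (simp_all)
  have u: "sqi u" unfolding sqi_def sq using ui by (simp add: u_def[abs_def])
  have v: "sqi v" unfolding sqi_def sq using f by (simp add: v_def[abs_def] borel_measurable_times borel_measurable_indicator)
  have ul: "(LINT s|lborel. u s) = b - a" using ab by (simp add: u_def[abs_def])
  have "norm (LINT s|lborel. indicator {a<..b} s *\<^sub>R f s) \<le> (LINT s|lborel. norm (indicator {a<..b} s *\<^sub>R f s))"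
    by (rule integral_norm_bound)
  also have "\<dots> = (LINT s|lborel. u s \<bullet> v s)" unfolding sq by (simp add: v_def)
  also have "\<dots> \<le> \<bar>LINT s|lborel. u s \<bullet> v s\<bar>" by simp
  also have "\<dots> \<le> sqrt (b - a) * sqrt (LINT s|lborel. indicator {a<..b} s * (norm (f s))\<^sup>2)"
    using sqi_cauchy_schwarz[OF u v] unfolding sq ul .
  finally have le: "norm (LINT s|lborel. indicator {a<..b} s *\<^sub>R f s)
     \<le> sqrt (b - a) * sqrt (LINT s|lborel. indicator {a<..b} s * (norm (f s))\<^sup>2)" .
  have "(norm (LINT s|lborel. indicator {a<..b} s *\<^sub>R f s))\<^sup>2
      \<le> (sqrt (b - a) * sqrt (LINT s|lborel. indicator {a<..b} s * (norm (f s))\<^sup>2))\<^sup>2"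
    by (rule power_mono[OF le norm_ge_zero])
  also have "\<dots> = (b - a) * (LINT s|lborel. indicator {a<..b} s * (norm (f s))\<^sup>2)"
    using ab by (simp add: power_mult_distrib)
  finally show ?thesis .
qed

text \<open>The average of \<open>v\<close> over \<open>{t<..t + h}\<close>, written as a difference
  quotient of the primitive because it arises from increments of a function with weak derivative
  \<open>v\<close>.\<close>

definition steklov :: "real \<Rightarrow> real \<Rightarrow> (real \<Rightarrow> 'b::sep_hilbert) \<Rightarrow> real \<Rightarrow> 'b" where
  "steklov a h v t = (1 / h) *\<^sub>R (prim a v (t + h) - prim a v t)"

text \<open>The error at \<open>t\<close> is the average of \<open>v (t + s) - v t\<close> over
  \<open>0 < s \<le> h\<close>. Cauchy-Schwarz and Tonelli bound its \<open>L\<^sup>2\<close> norm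
  by the largest translation error with \<open>s \<le> h\<close>, which is small by continuity of
  translations.\<close>

lemma steklov_tendsto:
  fixes v :: "real \<Rightarrow> 'b::sep_hilbert"
  assumes v: "sqi v" "integrable lborel v" "\<And>s. s \<le> a \<Longrightarrow> v s = 0"
  shows "((\<lambda>h. abs_l2 (steklov a h v)) \<longlongrightarrow> abs_l2 v) (at_right 0)"
    and sqi_steklov: "0 < h \<Longrightarrow> sqi (steklov a h v)"
proof -
  have vm [measurable]: "v \<in> borel_measurable borel" using v(1) by (rule sqiD)
  have pm [measurable]: "prim a v \<in> borel_measurable borel"
    by (rule borel_measurable_continuous_onI) (rule prim_continuous[OF v(2)])
  have sm [measurable]: "steklov a h v \<in> borel_measurable borel" for h unfolding steklov_def[abs_def] by measurable
  have rep: "steklov a h v t - v t = (1 / h) *\<^sub>R (LINT s|lborel. indicator {0<..h} s *\<^sub>R (v (t + s) - v t))"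
    if h: "0 < h" for h t
  proof -
    have "prim a v (t + h) - prim a v t = (LINT r|lborel. indicator {a<..t + h} r *\<^sub>R v r - indicator {a<..t} r *\<^sub>R v r)"
      unfolding prim_def
      by (intro Bochner_Integration.integral_diff[symmetric] integrable_indicator_scaleR[OF v(2)]) simp_all
    also have "(\<lambda>r. indicator {a<..t + h} r *\<^sub>R v r - indicator {a<..t} r *\<^sub>R v r) = (\<lambda>r. indicator {t<..t + h} r *\<^sub>R v r)"
    proof
      fix r show "indicator {a<..t + h} r *\<^sub>R v r - indicator {a<..t} r *\<^sub>R v r = indicator {t<..t + h} r *\<^sub>R v r"
        using v(3)[of r] h by (cases "r \<le> a") (auto simp: indicator_def)
    qed
    also have "(LINT r|lborel. indicator {t<..t + h} r *\<^sub>R v r) = (LINT s|lborel. indicator {0<..h} s *\<^sub>R v (t + s))"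
    proof -
      have "(\<lambda>s. indicator {t<..t + h} (t + 1 * s) *\<^sub>R v (t + 1 * s)) = (\<lambda>s. indicator {0<..h} s *\<^sub>R v (t + s))"
        by (intro ext) (auto simp: indicator_def)
      then show ?thesis
        using lborel_integral_real_affine[of 1 "\<lambda>r. indicator {t<..t + h} r *\<^sub>R v r" t] by simp
    qed
    finally have p: "prim a v (t + h) - prim a v t = (LINT s|lborel. indicator {0<..h} s *\<^sub>R v (t + s))" .
    have i1: "integrable lborel (\<lambda>s. indicator {0<..h} s *\<^sub>R v (t + s))"
      using lborel_integrable_real_affine[OF v(2), of 1 t] by (intro integrable_indicator_scaleR) simp_all
    have i2: "integrable lborel (\<lambda>s. indicator {0<..h} s *\<^sub>R v t)"
      using h by (intro integrable_scaleR_left integrable_real_indicator) simp_all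
    have "(LINT s|lborel. indicator {0<..h} s *\<^sub>R (v (t + s) - v t))
      = (LINT s|lborel. indicator {0<..h} s *\<^sub>R v (t + s)) - h *\<^sub>R v t"
      unfolding scaleR_diff_right Bochner_Integration.integral_diff[OF i1 i2] using h by simp
    then show ?thesis unfolding steklov_def p using h by (simp add: scaleR_diff_right)
  qed
  have pw: "(norm (steklov a h v t - v t))\<^sup>2 \<le> (1 / h) * (LINT s|lborel. indicator {0<..h} s * (norm (v (t + s) - v t))\<^sup>2)"
    and pwi: "integrable lborel (\<lambda>s. indicator {0<..h} s * (norm (v (t + s) - v t))\<^sup>2)"
    if h: "0 < h" for h t
  proof -
    show i: "integrable lborel (\<lambda>s. indicator {0<..h} s * (norm (v (t + s) - v t))\<^sup>2)"
    proof (rule Bochner_Integration.integrable_bound)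
      have "integrable lborel (\<lambda>s. (norm (v (t + 1 * s)))\<^sup>2)"
        by (rule lborel_integrable_real_affine[OF sqiD(2)[OF v(1)]]) simp
      then show "integrable lborel (\<lambda>s. 2 * (norm (v (t + s)))\<^sup>2 + indicator {0<..h} s * (2 * (norm (v t))\<^sup>2))"
        using h by (intro Bochner_Integration.integrable_add integrable_mult_right integrable_mult_left integrable_real_indicator) simp_all
      show "AE s in lborel. norm (indicator {0<..h} s * (norm (v (t + s) - v t))\<^sup>2)
         \<le> norm (2 * (norm (v (t + s)))\<^sup>2 + indicator {0<..h} s * (2 * (norm (v t))\<^sup>2))"
      proof (rule AE_I2)
        fix s
        have "(norm (v (t + s) - v t))\<^sup>2 \<le> 2 * (norm (v (t + s)))\<^sup>2 + 2 * (norm (v t))\<^sup>2"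
          using norm_add_square_le[of "v (t + s)" "- v t"] by simp
        then show "norm (indicator {0<..h} s * (norm (v (t + s) - v t))\<^sup>2)
         \<le> norm (2 * (norm (v (t + s)))\<^sup>2 + indicator {0<..h} s * (2 * (norm (v t))\<^sup>2))"
          by (simp add: indicator_def)
      qed
    qed measurable
    have "(norm (LINT s|lborel. indicator {0<..h} s *\<^sub>R (v (t + s) - v t)))\<^sup>2
        \<le> (h - 0) * (LINT s|lborel. indicator {0<..h} s * (norm (v (t + s) - v t))\<^sup>2)"
      using h i by (intro norm_interval_integral_le) simp_all
    then show "(norm (steklov a h v t - v t))\<^sup>2 \<le> (1 / h) * (LINT s|lborel. indicator {0<..h} s * (norm (v (t + s) - v t))\<^sup>2)"
      unfolding rep[OF h] using h by (simp add: power_mult_distrib power2_eq_square field_simps)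
  qed
  have main: "(\<integral>\<^sup>+t. ennreal ((norm (steklov a h v t - v t))\<^sup>2) \<partial>lborel) \<le> ennreal e"
    if h: "0 < h" and e: "0 \<le> e" "\<And>s. 0 < s \<Longrightarrow> s \<le> h \<Longrightarrow> (LINT t|lborel. (norm (v (t + s) - v t))\<^sup>2) \<le> e" for h e
  proof -
    have "(\<integral>\<^sup>+t. ennreal ((norm (steklov a h v t - v t))\<^sup>2) \<partial>lborel)
      \<le> (\<integral>\<^sup>+t. ennreal (1 / h) * (\<integral>\<^sup>+s. ennreal (indicator {0<..h} s * (norm (v (t + s) - v t))\<^sup>2) \<partial>lborel) \<partial>lborel)"
    proof (rule nn_integral_mono)
      fix t
      have "ennreal ((norm (steklov a h v t - v t))\<^sup>2)
        \<le> ennreal ((1 / h) * (LINT s|lborel. indicator {0<..h} s * (norm (v (t + s) - v t))\<^sup>2))"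
        by (rule ennreal_leI) (rule pw[OF h])
      also have "\<dots> = ennreal (1 / h) * (\<integral>\<^sup>+s. ennreal (indicator {0<..h} s * (norm (v (t + s) - v t))\<^sup>2) \<partial>lborel)"
        unfolding nn_integral_eq_integral[OF pwi[OF h] AE_I2[OF mult_nonneg_nonneg[OF indicator_pos_le zero_le_power2]]]
        using h by (intro ennreal_mult') simp
      finally show "ennreal ((norm (steklov a h v t - v t))\<^sup>2) \<le> \<dots>" .
    qed
    also have "\<dots> = ennreal (1 / h) * (\<integral>\<^sup>+t. \<integral>\<^sup>+s. ennreal (indicator {0<..h} s * (norm (v (t + s) - v t))\<^sup>2) \<partial>lborel \<partial>lborel)"
      by (rule nn_integral_cmult) measurable
    also have "(\<integral>\<^sup>+t. \<integral>\<^sup>+s. ennreal (indicator {0<..h} s * (norm (v (t + s) - v t))\<^sup>2) \<partial>lborel \<partial>lborel)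
        = (\<integral>\<^sup>+s. \<integral>\<^sup>+t. ennreal (indicator {0<..h} s * (norm (v (t + s) - v t))\<^sup>2) \<partial>lborel \<partial>lborel)"
      by (rule lborel_pair.Fubini') measurable
    also have "\<dots> \<le> (\<integral>\<^sup>+s. ennreal e * indicator {0<..h} s \<partial>lborel)"
    proof (rule nn_integral_mono)
      fix s
      show "(\<integral>\<^sup>+t. ennreal (indicator {0<..h} s * (norm (v (t + s) - v t))\<^sup>2) \<partial>lborel) \<le> ennreal e * indicator {0<..h} s"
      proof (cases "s \<in> {0<..h}")
        case True
        have "(\<integral>\<^sup>+t. ennreal ((norm (v (t + s) - v t))\<^sup>2) \<partial>lborel) = ennreal (LINT t|lborel. (norm (v (t + s) - v t))\<^sup>2)"
          by (rule nn_integral_eq_integral[OF sqiD(2)[OF sqi_diff[OF sqi_shift[OF v(1)] v(1)]]]) simp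
        also have "\<dots> \<le> ennreal e" using True by (intro ennreal_leI e(2)) simp_all
        finally show ?thesis using True by simp
      qed simp
    qed
    also have "\<dots> = ennreal e * ennreal h" using h by (simp add: nn_integral_cmult_indicator)
    finally have "(\<integral>\<^sup>+t. ennreal ((norm (steklov a h v t - v t))\<^sup>2) \<partial>lborel) \<le> ennreal (1 / h) * (ennreal e * ennreal h)"
      by (simp add: mult_left_mono)
    also have "\<dots> = ennreal ((1 / h) * (e * h))"
    proof -
      have "0 \<le> 1 / h" "0 \<le> e * h" "0 \<le> h" using h e(1) by simp_all
      then show ?thesis using e(1) by (simp only: ennreal_mult)
    qed
    also have "(1 / h) * (e * h) = e" using h by simp
    finally show ?thesis .
  qed
  \<comment> \<open>Here \<open>h\<close> need not be small: the triangle inequality and the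
    isometry of translations bound every translation error by twice the norm of \<open>v\<close>,
    whence the factor \<open>4\<close> after squaring.\<close>
  have sd: "sqi (\<lambda>t. steklov a h v t - v t)" if h: "0 < h" for h
  proof -
    define E where "E = 4 * (LINT t|lborel. (norm (v t))\<^sup>2)"
    have E: "(LINT t|lborel. (norm (v (t + s) - v t))\<^sup>2) \<le> E" for s
    proof -
      have "sqrt (LINT t|lborel. (norm (v (t + s) - v t))\<^sup>2) \<le> norm (shift s (abs_l2 v)) + norm (abs_l2 v)"
        using norm_triangle_ineq4[of "shift s (abs_l2 v)" "abs_l2 v"]
        by (simp add: shift_abs_l2 v(1) minus_abs_l2 sqi_shift norm_abs_l2 sqi_diff)
      also have "\<dots> = 2 * sqrt (LINT t|lborel. (norm (v t))\<^sup>2)" by (simp add: norm_shift norm_abs_l2 v(1))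
      finally have "(sqrt (LINT t|lborel. (norm (v (t + s) - v t))\<^sup>2))\<^sup>2 \<le> (2 * sqrt (LINT t|lborel. (norm (v t))\<^sup>2))\<^sup>2"
        by (intro power_mono) simp_all
      then show ?thesis by (simp add: E_def power_mult_distrib)
    qed
    have "(\<integral>\<^sup>+t. ennreal ((norm (steklov a h v t - v t))\<^sup>2) \<partial>lborel) \<le> ennreal E"
      by (rule main[OF h]) (use E in \<open>simp_all add: E_def\<close>)
    then have "integrable lborel (\<lambda>t. (norm (steklov a h v t - v t))\<^sup>2)"
      by (intro integrableI_bounded) (auto intro: le_less_trans)
    then show ?thesis unfolding sqi_def by simp
  qed
  show ss: "sqi (steklov a h v)" if h: "0 < h" for h
    using sqi_add[OF sd[OF h] v(1)] by simp
  have dist_eq: "dist (abs_l2 (steklov a h v)) (abs_l2 v) = sqrt (LINT t|lborel. (norm (steklov a h v t - v t))\<^sup>2)"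
    if h: "0 < h" for h by (rule dist_abs_l2[OF ss[OF h] v(1)])
  show "((\<lambda>h. abs_l2 (steklov a h v)) \<longlongrightarrow> abs_l2 v) (at_right 0)"
  proof (rule tendstoI)
    fix e :: real assume e: "0 < e"
    have "\<forall>\<^sub>F s in at 0. (LINT t|lborel. (norm (v (t + s) - v t))\<^sup>2) < e\<^sup>2 / 4"
      using order_tendstoD(2)[OF sqi_shift_tendsto[OF v(1)], of "e\<^sup>2/4"] e by simp
    then obtain d where d: "0 < d" "\<And>s. s \<noteq> 0 \<Longrightarrow> dist s 0 < d \<Longrightarrow> (LINT t|lborel. (norm (v (t + s) - v t))\<^sup>2) < e\<^sup>2 / 4"
      unfolding eventually_at by auto
    have "dist (abs_l2 (steklov a h v)) (abs_l2 v) < e" if h: "0 < h" "h < d" for h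
    proof -
      have "(\<integral>\<^sup>+t. ennreal ((norm (steklov a h v t - v t))\<^sup>2) \<partial>lborel) \<le> ennreal (e\<^sup>2 / 4)"
        by (rule main[OF h(1)]) (use d(2) h in \<open>auto intro!: less_imp_le simp: dist_real_def\<close>)
      then have "(LINT t|lborel. (norm (steklov a h v t - v t))\<^sup>2) \<le> e\<^sup>2 / 4"
        by (subst (asm) nn_integral_eq_integral[OF sqiD(2)[OF sd[OF h(1)]]]) simp_all
      then have "sqrt (LINT t|lborel. (norm (steklov a h v t - v t))\<^sup>2) \<le> sqrt ((e/2)\<^sup>2)"
        by (intro real_sqrt_le_mono) (simp add: power_divide)
      then show ?thesis unfolding dist_eq[OF h(1)] using e by simp
    qed
    then show "\<forall>\<^sub>F h in at_right 0. dist (abs_l2 (steklov a h v)) (abs_l2 v) < e"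
      unfolding eventually_at_right_field using d(1) by blast
  qed
qed

section \<open>The energy identity in a Gelfand triple\<close>

lemma sqi_bounded_mult:
  fixes \<theta> :: "real \<Rightarrow> real"
  assumes f: "sqi f" and m: "\<theta> \<in> borel_measurable borel" and B: "\<And>t. \<bar>\<theta> t\<bar> \<le> B"
  shows "sqi (\<lambda>t. \<theta> t *\<^sub>R f t)"
    and "(LINT t|lborel. (norm (\<theta> t *\<^sub>R f t))\<^sup>2) \<le> B\<^sup>2 * (LINT t|lborel. (norm (f t))\<^sup>2)"
proof -
  have le: "(norm (\<theta> t *\<^sub>R f t))\<^sup>2 \<le> B\<^sup>2 * (norm (f t))\<^sup>2" for t
  proof -
    have "\<bar>\<theta> t\<bar>\<^sup>2 \<le> B\<^sup>2" by (rule power_mono[OF B abs_ge_zero])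
    then show ?thesis unfolding norm_scaleR power_mult_distrib by (intro mult_right_mono) simp_all
  qed
  have i: "integrable lborel (\<lambda>t. B\<^sup>2 * (norm (f t))\<^sup>2)" using sqiD(2)[OF f] by simp
  show s: "sqi (\<lambda>t. \<theta> t *\<^sub>R f t)"
    by (rule sqi_bound[OF _ i]) (use m sqiD(1)[OF f] le in \<open>auto intro!: borel_measurable_scaleR\<close>)
  have "(LINT t|lborel. (norm (\<theta> t *\<^sub>R f t))\<^sup>2) \<le> (LINT t|lborel. B\<^sup>2 * (norm (f t))\<^sup>2)"
    by (rule integral_mono[OF sqiD(2)[OF s] i le])
  then show "(LINT t|lborel. (norm (\<theta> t *\<^sub>R f t))\<^sup>2) \<le> B\<^sup>2 * (LINT t|lborel. (norm (f t))\<^sup>2)" by simp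
qed

text \<open>Functions on the time interval are extended by zero, so that translations and integrals
  over the whole line apply to them.\<close>

definition sqi_on :: "real \<Rightarrow> (real \<Rightarrow> 'b::sep_hilbert) \<Rightarrow> bool" where
  "sqi_on T w \<longleftrightarrow> sqi w \<and> (\<forall>t. t \<notin> {0<..<T} \<longrightarrow> w t = 0)"

lemma sqi_onD: "sqi_on T w \<Longrightarrow> sqi w" "sqi_on T w \<Longrightarrow> t \<notin> {0<..<T} \<Longrightarrow> w t = 0"
  by (auto simp: sqi_on_def)

lemma sqi_on_integrable: assumes "sqi_on T w" shows "integrable lborel w"
proof -
  have "(\<lambda>x. indicator {0<..<T} x *\<^sub>R w x) = w"
  proof
    fix x show "indicator {0<..<T} x *\<^sub>R w x = w x"
      using sqi_onD(2)[OF assms, of x] by (cases "x \<in> {0<..<T}") simp_all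
  qed
  then show ?thesis using sqi_interval_integrable[OF sqi_onD(1)[OF assms], of 0 T] by (simp only:)
qed

lemma AE_imp_dense:
  assumes N: "N \<in> null_sets lborel" and T: "0 < T"
  shows "closure ({0<..<T} - N) = {0..T::real}"
proof
  show "closure ({0<..<T} - N) \<subseteq> {0..T}"
    by (rule closure_minimal) auto
  show "{0..T} \<subseteq> closure ({0<..<T} - N)"
  proof
    fix t assume t: "t \<in> {0..T}"
    show "t \<in> closure ({0<..<T} - N)"
      unfolding closure_approachable
    proof (intro allI impI)
      fix e :: real assume e: "0 < e"
      define p q where "p = max 0 (t - e)" and "q = min T (t + e)"
      have pq: "p < q" using t T e by (auto simp: p_def q_def)
      have "\<not> {p<..<q} \<subseteq> N"
      proof
        assume "{p<..<q} \<subseteq> N"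
        then have "{p<..<q} \<in> null_sets lborel" using null_sets_subset[OF N] by simp
        then show False using pq by (simp add: null_sets_def)
      qed
      then obtain x where "x \<in> {p<..<q}" "x \<notin> N" by blast
      then show "\<exists>y\<in>{0<..<T} - N. dist y t < e"
        by (intro bexI[of _ x]) (auto simp: p_def q_def dist_real_def)
    qed
  qed
qed

text \<open>Density of the range is expressed by orthogonality, the form in which it identifies
  elements of \<open>'h\<close>; the normalisation \<open>contr\<close> keeps embedding constants
  out of the estimates.\<close>

locale gelfand =
  fixes j :: "'v::sep_hilbert \<Rightarrow> 'h::sep_hilbert"
  assumes bl: "bounded_linear j" and contr: "norm (j x) \<le> norm x"
    and dense: "(\<And>x. z \<bullet> j x = 0) \<Longrightarrow> z = 0"
begin

lemma j_measurable [measurable]: "j \<in> borel_measurable borel"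
  by (intro borel_measurable_continuous_onI linear_continuous_on bl)

lemma j_lin: "j (x + y) = j x + j y" "j (x - y) = j x - j y" "j (c *\<^sub>R x) = c *\<^sub>R j x" "j 0 = 0"
  using bl by (simp_all add: linear_simps bounded_linear.linear linear_add linear_diff linear_scale linear_0)

lemma sqi_j: assumes "sqi w" shows "sqi (\<lambda>t. j (w t))"
proof -
  have [measurable]: "w \<in> borel_measurable borel" using assms by (rule sqiD)
  show ?thesis
    by (rule sqi_bound[OF _ sqiD(2)[OF assms]]) (use contr in \<open>auto intro!: power_mono\<close>)
qed

lemma sqi_on_j: "sqi_on T w \<Longrightarrow> sqi_on T (\<lambda>t. j (w t))"
  by (simp add: sqi_on_def sqi_j j_lin)

text \<open>\<open>v t\<close> is the Riesz representative in \<open>'v\<close> of a functional on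
  \<open>'v\<close>, hence the inner product of \<open>'h\<close> on the left and that of
  \<open>'v\<close> on the right.\<close>

definition wderiv :: "real \<Rightarrow> (real \<Rightarrow> 'v) \<Rightarrow> (real \<Rightarrow> 'v) \<Rightarrow> bool" where
  "wderiv T w v \<longleftrightarrow> (\<forall>\<phi>. \<forall>\<theta>\<in>test_functions {0<..<T}.
     (LINT t|lborel. (j (w t) \<bullet> j \<phi>) * deriv \<theta> t) = - (LINT t|lborel. (v t \<bullet> \<phi>) * \<theta> t))"

text \<open>The du Bois-Reymond lemma determines \<open>j (w t) \<bullet> j \<phi>\<close> up to a
  constant and a null set that both depend on \<phi>. Differences in time remove the constant, a
  countable dense set of \<phi> leaves one null set, and continuity in \<phi> does the rest.\<close>

lemma wderiv_increment:
  assumes T: "0 < T" and w: "sqi_on T w" and v: "sqi_on T v" and d: "wderiv T w v"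
  shows "\<exists>N\<in>null_sets lborel. \<forall>s\<in>{0<..<T} - N. \<forall>t\<in>{0<..<T} - N. \<forall>\<phi>.
    (j (w t) - j (w s)) \<bullet> j \<phi> = (prim 0 v t - prim 0 v s) \<bullet> \<phi>"
proof -
  obtain D :: "'v set" where D: "countable D" "\<And>x. x \<in> closure D" using countable_dense_closure by blast
  have "\<exists>c. AE t in lborel. t \<in> {0<..<T} \<longrightarrow> j (w t) \<bullet> j \<phi> = c + prim 0 v t \<bullet> \<phi>" for \<phi>
  proof -
    have "\<exists>c. AE t in lborel. t \<in> {0<..<T} \<longrightarrow> j (w t) \<bullet> j \<phi> = c + prim 0 (\<lambda>t. v t \<bullet> \<phi>) t"
    proof (rule du_bois_reymond[OF T])
      show "integrable lborel (\<lambda>t. j (w t) \<bullet> j \<phi>)" "integrable lborel (\<lambda>t. v t \<bullet> \<phi>)"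
        using sqi_on_integrable[OF sqi_on_j[OF w]] sqi_on_integrable[OF v] by simp_all
      show "j (w t) \<bullet> j \<phi> = 0" "v t \<bullet> \<phi> = 0" if "t \<notin> {0<..<T}" for t
        using sqi_onD(2)[OF w that] sqi_onD(2)[OF v that] by (simp_all add: j_lin)
    qed (use d in \<open>auto simp: wderiv_def\<close>)
    then show ?thesis unfolding prim_inner[OF sqi_on_integrable[OF v]] .
  qed
  then obtain c where c: "\<And>\<phi>. AE t in lborel. t \<in> {0<..<T} \<longrightarrow> j (w t) \<bullet> j \<phi> = c \<phi> + prim 0 v t \<bullet> \<phi>" by metis
  then have "AE t in lborel. \<forall>\<phi>\<in>D. t \<in> {0<..<T} \<longrightarrow> j (w t) \<bullet> j \<phi> = c \<phi> + prim 0 v t \<bullet> \<phi>"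
    by (simp only: AE_ball_countable[OF D(1)]) blast
  then obtain N where N: "N \<in> null_sets lborel"
    "\<And>t. t \<in> space lborel - N \<Longrightarrow> \<forall>\<phi>\<in>D. t \<in> {0<..<T} \<longrightarrow> j (w t) \<bullet> j \<phi> = c \<phi> + prim 0 v t \<bullet> \<phi>"
    by (rule AE_E3) blast
  show ?thesis
  proof (intro bexI[OF _ N(1)] ballI allI)
    fix s t \<phi> assume st: "s \<in> {0<..<T} - N" "t \<in> {0<..<T} - N"
    have eD: "(j (w t) - j (w s)) \<bullet> j b = (prim 0 v t - prim 0 v s) \<bullet> b" if "b \<in> D" for b
      using bspec[OF N(2)[of s] that] bspec[OF N(2)[of t] that] st by (simp add: inner_diff_left)
    obtain f where f: "\<And>n. f n \<in> D" "f \<longlonglongrightarrow> \<phi>" using D(2)[of \<phi>] unfolding closure_sequential by blast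
    have "(\<lambda>n. (j (w t) - j (w s)) \<bullet> j (f n)) \<longlonglongrightarrow> (j (w t) - j (w s)) \<bullet> j \<phi>"
      by (intro tendsto_inner tendsto_const bounded_linear.tendsto[OF bl f(2)])
    moreover have "(\<lambda>n. (prim 0 v t - prim 0 v s) \<bullet> f n) \<longlonglongrightarrow> (prim 0 v t - prim 0 v s) \<bullet> \<phi>"
      by (intro tendsto_inner tendsto_const f(2))
    ultimately show "(j (w t) - j (w s)) \<bullet> j \<phi> = (prim 0 v t - prim 0 v s) \<bullet> \<phi>"
      using LIMSEQ_unique unfolding eD[OF f(1)] by blast
  qed
qed

text \<open>The integral \<open>A n\<close> of \<theta> against difference quotients of
  \<open>G\<close> is evaluated in two ways. Moved onto \<theta> by a change of variables, the
  quotients produce the left side; factored as difference times sum, they become Steklov averages of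
  \<open>v\<close> paired with \<open>w (t + h n) + w t\<close> and produce the right side.\<close>

lemma energy_weak:
  assumes T: "0 < T" and w: "sqi_on T w" and v: "sqi_on T v" and d: "wderiv T w v"
    and \<theta>: "\<theta> \<in> test_functions {0<..<T}"
  shows "(LINT t|lborel. (norm (j (w t)))\<^sup>2 * deriv \<theta> t) = - (LINT t|lborel. (2 * (v t \<bullet> w t)) * \<theta> t)"
proof -
  obtain N where N: "N \<in> null_sets lborel"
    and inc: "\<And>s t \<phi>. s \<in> {0<..<T} - N \<Longrightarrow> t \<in> {0<..<T} - N \<Longrightarrow>
      (j (w t) - j (w s)) \<bullet> j \<phi> = (prim 0 v t - prim 0 v s) \<bullet> \<phi>"
    using wderiv_increment[OF T w v d] by blast
  note ws = sqi_onD(1)[OF w] and vs = sqi_onD(1)[OF v]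
  note vi = sqi_on_integrable[OF v]
  obtain c d where cd: "0 < c" "c < d" "d < T" "\<And>t. t \<le> c \<or> d \<le> t \<Longrightarrow> \<theta> t = 0"
    using test_support_interval[OF \<theta> T] by blast
  obtain B where B: "0 \<le> B" "\<And>t. \<bar>\<theta> t\<bar> \<le> B" using test_bounded[OF \<theta>] by blast
  obtain B' where B': "0 \<le> B'" "\<And>t. \<bar>deriv \<theta> t\<bar> \<le> B'" using test_bounded[OF test_deriv[OF \<theta>]] by blast
  have \<theta>m: "\<theta> \<in> borel_measurable borel" by (rule smooth_measurable[OF test_smooth[OF \<theta>]])
  have \<theta>'m: "deriv \<theta> \<in> borel_measurable borel" by (rule smooth_measurable[OF test_smooth[OF test_deriv[OF \<theta>]]])
  define G where "G t = (norm (j (w t)))\<^sup>2" for t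
  have Gi: "integrable lborel G" unfolding G_def[abs_def] by (rule sqiD(2)[OF sqi_j[OF ws]])
  have Gm: "G \<in> borel_measurable borel" using borel_measurable_integrable[OF Gi] by simp
  \<comment> \<open>Steps below \<open>T - d\<close> keep \<open>t + h n\<close> inside the time
    interval wherever \<theta> is nonzero.\<close>
  define h where "h n = (T - d) / 2 * (1 / real (Suc n))" for n
  have h0: "0 < h n" for n using cd(3) by (simp add: h_def)
  have hT: "h n < T - d" for n
  proof -
    have "h n \<le> (T - d) / 2 * 1" unfolding h_def using cd(3) by (intro mult_left_mono) simp_all
    also have "\<dots> < T - d" using cd(3) by simp
    finally show ?thesis .
  qed
  have hl: "h \<longlonglongrightarrow> 0"
    using tendsto_mult[OF tendsto_const LIMSEQ_Suc[OF lim_1_over_n], of "(T - d) / 2"] by (simp add: h_def[abs_def])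
  have hr: "filterlim h (at_right 0) sequentially"
    by (rule tendsto_imp_filterlim_at_right[OF hl]) (simp add: h0)
  define A where "A n = (LINT t|lborel. \<theta> t * ((G (t + h n) - G t) / h n))" for n
  have A1: "A n = (LINT t|lborel. G t * ((\<theta> (t - h n) - \<theta> t) / h n))" for n
  proof -
    have i0: "integrable lborel (\<lambda>t. G t * \<theta> t)" by (rule integrable_mult_test[OF Gi \<theta>])
    have Gs: "integrable lborel (\<lambda>t. G (h n + 1 * t))" by (rule lborel_integrable_real_affine[OF Gi]) simp
    have i1: "integrable lborel (\<lambda>t. G (h n + 1 * t) * \<theta> t)" by (rule integrable_mult_test[OF Gs \<theta>])
    have i2: "integrable lborel (\<lambda>t. G (h n + 1 * (- h n + 1 * t)) * \<theta> (- h n + 1 * t))"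
      by (rule lborel_integrable_real_affine[OF i1]) simp
    have "A n = (LINT t|lborel. (1 / h n) * (G (h n + 1 * t) * \<theta> t - G t * \<theta> t))"
      unfolding A_def by (rule Bochner_Integration.integral_cong[OF refl]) (simp add: algebra_simps diff_divide_distrib)
    also have "\<dots> = (1 / h n) * ((LINT t|lborel. G (h n + 1 * t) * \<theta> t) - (LINT t|lborel. G t * \<theta> t))"
      unfolding integral_mult_right_zero Bochner_Integration.integral_diff[OF i1 i0] ..
    also have "(LINT t|lborel. G (h n + 1 * t) * \<theta> t) = (LINT t|lborel. G (h n + 1 * (- h n + 1 * t)) * \<theta> (- h n + 1 * t))"
      using lborel_integral_real_affine[of 1 "\<lambda>t. G (h n + 1 * t) * \<theta> t" "- h n"] by simp
    also have "(1 / h n) * (\<dots> - (LINT t|lborel. G t * \<theta> t))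
       = (LINT t|lborel. (1 / h n) * (G (h n + 1 * (- h n + 1 * t)) * \<theta> (- h n + 1 * t) - G t * \<theta> t))"
      unfolding integral_mult_right_zero Bochner_Integration.integral_diff[OF i2 i0] ..
    also have "\<dots> = (LINT t|lborel. G t * ((\<theta> (t - h n) - \<theta> t) / h n))"
      by (rule Bochner_Integration.integral_cong[OF refl]) (simp add: algebra_simps diff_divide_distrib)
    finally show ?thesis .
  qed
  have lim1: "A \<longlonglongrightarrow> (LINT t|lborel. G t * (- deriv \<theta> t))"
    unfolding A1
  proof (rule integral_dominated_convergence[where w="\<lambda>t. G t * B'"])
    show "(\<lambda>t. G t * - deriv \<theta> t) \<in> borel_measurable lborel"
      using Gm \<theta>'m by (simp add: borel_measurable_times)
    show "(\<lambda>t. G t * ((\<theta> (t - h n) - \<theta> t) / h n)) \<in> borel_measurable lborel" for n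
    proof -
      have [measurable]: "\<theta> \<in> borel_measurable borel" "G \<in> borel_measurable borel" by (rule \<theta>m, rule Gm)
      show ?thesis by measurable
    qed
    show "integrable lborel (\<lambda>t. G t * B')" using Gi by simp
    show "AE t in lborel. (\<lambda>n. G t * ((\<theta> (t - h n) - \<theta> t) / h n)) \<longlonglongrightarrow> G t * - deriv \<theta> t"
    proof (rule AE_I2)
      fix t
      have "((\<lambda>y. (\<theta> y - \<theta> t) / (y - t)) \<longlongrightarrow> deriv \<theta> t) (at t)"
        using smooth_has_deriv[OF test_smooth[OF \<theta>], of t] unfolding has_field_derivative_iff .
      moreover have "filterlim (\<lambda>n. t - h n) (at t) sequentially"
        unfolding filterlim_at
      proof
        show "\<forall>\<^sub>F n in sequentially. t - h n \<in> UNIV \<and> t - h n \<noteq> t"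
          using h0 by (intro always_eventually) (simp add: less_imp_neq[symmetric])
        show "(\<lambda>n. t - h n) \<longlonglongrightarrow> t" using tendsto_diff[OF tendsto_const hl, of t] by simp
      qed
      ultimately have "(\<lambda>n. (\<theta> (t - h n) - \<theta> t) / ((t - h n) - t)) \<longlonglongrightarrow> deriv \<theta> t"
        by (rule filterlim_compose)
      from tendsto_mult[OF tendsto_const tendsto_minus[OF this], of "G t"]
      show "(\<lambda>n. G t * ((\<theta> (t - h n) - \<theta> t) / h n)) \<longlonglongrightarrow> G t * - deriv \<theta> t" by simp
    qed
    show "AE t in lborel. norm (G t * ((\<theta> (t - h n) - \<theta> t) / h n)) \<le> G t * B'" for n
    proof (rule AE_I2)
      fix t
      have "norm (\<theta> (t - h n) - \<theta> t) \<le> B' * norm ((t - h n) - t)"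
        by (rule field_differentiable_bound[of UNIV _ "deriv \<theta>"])
          (use smooth_has_deriv[OF test_smooth[OF \<theta>]] B' in auto)
      then have "\<bar>\<theta> (t - h n) - \<theta> t\<bar> / h n \<le> B'" using h0[of n] by (simp add: field_simps)
      then have "G t * (\<bar>\<theta> (t - h n) - \<theta> t\<bar> / h n) \<le> G t * B'"
        by (rule mult_left_mono) (simp add: G_def)
      then show "norm (G t * ((\<theta> (t - h n) - \<theta> t) / h n)) \<le> G t * B'"
        using h0[of n] by (simp add: abs_mult G_def)
    qed
  qed
  have v0: "v s = 0" if "s \<le> 0" for s using sqi_onD(2)[OF v, of s] that by simp
  have stq: "sqi (steklov 0 (h n) v)" for n by (rule sqi_steklov[OF vs vi v0 h0])
  note mult = sqi_bounded_mult(1)[OF _ \<theta>m B(2)]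
  define W where "W = abs_l2 w"
  have A2: "A n = abs_l2 (\<lambda>t. \<theta> t *\<^sub>R steklov 0 (h n) v t) \<bullet> (shift (h n) W + W)" for n
  proof -
    have "abs_l2 (\<lambda>t. \<theta> t *\<^sub>R steklov 0 (h n) v t) \<bullet> (shift (h n) W + W)
      = (LINT t|lborel. (\<theta> t *\<^sub>R steklov 0 (h n) v t) \<bullet> (w (t + h n) + w t))"
      unfolding W_def shift_abs_l2[OF ws] plus_abs_l2[OF sqi_shift[OF ws] ws]
      by (rule inner_abs_l2[OF mult[OF stq] sqi_add[OF sqi_shift[OF ws] ws]])
    also have "\<dots> = A n"
      unfolding A_def
    proof (rule integral_cong_AE)
      have [measurable]: "w \<in> borel_measurable borel" "G \<in> borel_measurable borel" "\<theta> \<in> borel_measurable borel"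
        "steklov 0 (h n) v \<in> borel_measurable borel"
        by (rule sqiD(1)[OF ws], rule Gm, rule \<theta>m, rule sqiD(1)[OF stq])
      show "(\<lambda>t. (\<theta> t *\<^sub>R steklov 0 (h n) v t) \<bullet> (w (t + h n) + w t)) \<in> borel_measurable lborel"
        "(\<lambda>t. \<theta> t * ((G (t + h n) - G t) / h n)) \<in> borel_measurable lborel" by measurable
      show "AE t in lborel. (\<theta> t *\<^sub>R steklov 0 (h n) v t) \<bullet> (w (t + h n) + w t) = \<theta> t * ((G (t + h n) - G t) / h n)"
        using AE_not_in[OF N] AE_lborel_shift_notin[OF N, of "h n"]
      proof eventually_elim
        case (elim t)
        show ?case
        proof (cases "t \<le> c \<or> d \<le> t")
          case True
          then show ?thesis using cd(4) by simp
        next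
          case False
          then have t: "t \<in> {0<..<T} - N" "t + h n \<in> {0<..<T} - N"
            using cd(1-3) hT[of n] h0[of n] elim by auto
          \<comment> \<open>A difference of two squares: the second factor is \<open>j\<close> of an
            element of \<open>'v\<close>, so the increment formula may be tested with it.\<close>
          have "G (t + h n) - G t = (j (w (t + h n)) - j (w t)) \<bullet> j (w (t + h n) + w t)"
            unfolding G_def power2_norm_eq_inner j_lin
            by (simp add: inner_diff_left inner_diff_right inner_add_right inner_commute)
          also have "\<dots> = (prim 0 v (t + h n) - prim 0 v t) \<bullet> (w (t + h n) + w t)"
            by (rule inc[OF t])
          finally show ?thesis by (simp add: steklov_def)
        qed
      qed
    qed
    finally show ?thesis by simp
  qed
  have st: "(\<lambda>n. abs_l2 (\<lambda>t. \<theta> t *\<^sub>R steklov 0 (h n) v t)) \<longlonglongrightarrow> abs_l2 (\<lambda>t. \<theta> t *\<^sub>R v t)"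
  proof -
    have le: "dist (abs_l2 (\<lambda>t. \<theta> t *\<^sub>R steklov 0 (h n) v t)) (abs_l2 (\<lambda>t. \<theta> t *\<^sub>R v t))
        \<le> B * dist (abs_l2 (steklov 0 (h n) v)) (abs_l2 v)" for n
    proof -
      have "(LINT t|lborel. (norm (\<theta> t *\<^sub>R steklov 0 (h n) v t - \<theta> t *\<^sub>R v t))\<^sup>2)
          \<le> B\<^sup>2 * (LINT t|lborel. (norm (steklov 0 (h n) v t - v t))\<^sup>2)"
        unfolding scaleR_diff_right[symmetric] by (rule sqi_bounded_mult(2)[OF sqi_diff[OF stq vs] \<theta>m B(2)])
      then have "sqrt (LINT t|lborel. (norm (\<theta> t *\<^sub>R steklov 0 (h n) v t - \<theta> t *\<^sub>R v t))\<^sup>2)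
          \<le> sqrt (B\<^sup>2 * (LINT t|lborel. (norm (steklov 0 (h n) v t - v t))\<^sup>2))"
        by (rule real_sqrt_le_mono)
      then show ?thesis
        unfolding dist_abs_l2[OF mult[OF stq] mult[OF vs]] dist_abs_l2[OF stq vs] using B(1)
        by (simp add: real_sqrt_mult)
    qed
    have "((\<lambda>h. abs_l2 (steklov 0 h v)) \<longlongrightarrow> abs_l2 v) (at_right 0)"
      by (rule steklov_tendsto(1)[OF vs vi]) (rule v0)
    from filterlim_compose[OF this hr]
    have "(\<lambda>n. abs_l2 (steklov 0 (h n) v)) \<longlonglongrightarrow> abs_l2 v" .
    from tendsto_mult[OF tendsto_const[of B] iffD1[OF tendsto_dist_iff this]]
    have "(\<lambda>n. B * dist (abs_l2 (steklov 0 (h n) v)) (abs_l2 v)) \<longlonglongrightarrow> 0" by simp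
    then have "(\<lambda>n. dist (abs_l2 (\<lambda>t. \<theta> t *\<^sub>R steklov 0 (h n) v t)) (abs_l2 (\<lambda>t. \<theta> t *\<^sub>R v t))) \<longlonglongrightarrow> 0"
      by (rule tendsto_sandwich[rotated 2, OF tendsto_const])
        (intro always_eventually allI zero_le_dist, intro always_eventually allI le)
    then show ?thesis by (rule iffD2[OF tendsto_dist_iff])
  qed
  have "h \<longlonglongrightarrow> 0 \<and> (\<forall>\<^sub>F n in sequentially. h n \<in> UNIV \<and> h n \<noteq> 0)"
    using hl h0 by (simp add: less_imp_neq[symmetric])
  then have "filterlim h (at 0) sequentially" unfolding filterlim_at by blast
  then have "(\<lambda>n. shift (h n) W) \<longlonglongrightarrow> W" by (rule filterlim_compose[OF shift_tendsto])
  then have "A \<longlonglongrightarrow> abs_l2 (\<lambda>t. \<theta> t *\<^sub>R v t) \<bullet> (W + W)"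
    unfolding A2 by (intro tendsto_inner st tendsto_add tendsto_const)
  then have "(LINT t|lborel. G t * (- deriv \<theta> t)) = abs_l2 (\<lambda>t. \<theta> t *\<^sub>R v t) \<bullet> (W + W)"
    using lim1 LIMSEQ_unique by blast
  also have "\<dots> = (LINT t|lborel. (\<theta> t *\<^sub>R v t) \<bullet> (w t + w t))"
    unfolding W_def plus_abs_l2[OF ws ws] by (rule inner_abs_l2[OF mult[OF vs] sqi_add[OF ws ws]])
  also have "\<dots> = (LINT t|lborel. (2 * (v t \<bullet> w t)) * \<theta> t)"
    by (rule Bochner_Integration.integral_cong[OF refl]) (simp add: inner_add_right algebra_simps)
  finally show ?thesis unfolding G_def mult_minus_right Bochner_Integration.integral_minus by linarith
qed

lemma energy_AE:
  assumes T: "0 < T" and w: "sqi_on T w" and v: "sqi_on T v" and d: "wderiv T w v"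
  shows "\<exists>c. AE t in lborel. t \<in> {0<..<T} \<longrightarrow> (norm (j (w t)))\<^sup>2 = c + prim 0 (\<lambda>t. 2 * (v t \<bullet> w t)) t"
proof (rule du_bois_reymond[OF T])
  show "integrable lborel (\<lambda>t. (norm (j (w t)))\<^sup>2)" by (rule sqiD(2)[OF sqi_j[OF sqi_onD(1)[OF w]]])
  show "integrable lborel (\<lambda>t. 2 * (v t \<bullet> w t))"
    using sqi_inner[OF sqi_onD(1)[OF v] sqi_onD(1)[OF w]] by simp
  show "(norm (j (w t)))\<^sup>2 = 0" "2 * (v t \<bullet> w t) = 0" if "t \<notin> {0<..<T}" for t
    using sqi_onD(2)[OF w that] by (simp_all add: j_lin)
qed (rule energy_weak[OF T w v d])

end

section \<open>The continuous representative\<close>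

text \<open>Supplies good points: a square integrable function has no pointwise bound, but in every
  window, and off any null set, its norm is somewhere controlled by the length of the window. Both
  the continuity in time and the Sobolev embedding start from such a point.\<close>

lemma mean_value_AE:
  fixes w :: "real \<Rightarrow> 'b::sep_hilbert"
  assumes w: "sqi w" and pq: "p < q" and N: "N \<in> null_sets lborel"
  shows "\<exists>r\<in>{p<..<q} - N. (q - p) * (norm (w r))\<^sup>2 \<le> (LINT t|lborel. (norm (w t))\<^sup>2)"
proof (rule ccontr)
  define I where "I = (LINT t|lborel. (norm (w t))\<^sup>2)"
  assume "\<not> (\<exists>r\<in>{p<..<q} - N. (q - p) * (norm (w r))\<^sup>2 \<le> (LINT t|lborel. (norm (w t))\<^sup>2))"
  then have gt: "I < (q - p) * (norm (w r))\<^sup>2" if "r \<in> {p<..<q} - N" for r using that unfolding I_def by (meson linorder_not_le)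
  define f where "f r = indicator {p<..<q} r * ((q - p) * (norm (w r))\<^sup>2) - indicator {p<..<q} r * I" for r
  have i1: "integrable lborel (\<lambda>r. indicator {p<..<q} r * ((q - p) * (norm (w r))\<^sup>2))"
    by (intro integrable_indicator_mult integrable_mult_right sqiD(2)[OF w]) simp
  have i2: "integrable lborel (\<lambda>r. indicator {p<..<q} r * I)"
    by (intro integrable_mult_left integrable_real_indicator) (simp_all add: emeasure_lborel_Ioo_finite)
  have fi: "integrable lborel f" unfolding f_def by (rule Bochner_Integration.integrable_diff[OF i1 i2])
  have nn: "AE r in lborel. 0 \<le> f r" using AE_not_in[OF N]
  proof eventually_elim
    case (elim r)
    show ?case using gt[of r] elim by (cases "r \<in> {p<..<q}") (simp_all add: f_def less_imp_le)
  qed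
  have "(LINT r|lborel. indicator {p<..<q} r * ((q - p) * (norm (w r))\<^sup>2)) \<le> (LINT r|lborel. (q - p) * (norm (w r))\<^sup>2)"
    using pq by (intro integral_mono i1 integrable_mult_right sqiD(2)[OF w]) (simp add: indicator_def)
  also have "\<dots> = (q - p) * I" by (simp add: I_def)
  also have "(q - p) * I = (LINT r|lborel. indicator {p<..<q} r * I)" using pq by simp
  finally have "(LINT r|lborel. f r) \<le> 0"
    unfolding f_def Bochner_Integration.integral_diff[OF i1 i2] by simp
  moreover have "0 \<le> (LINT r|lborel. f r)" by (rule integral_nonneg_AE[OF nn])
  ultimately have "AE r in lborel. f r = 0"
    using integral_nonneg_eq_0_iff_AE[OF fi nn] by simp
  then have "AE r in lborel. r \<notin> {p<..<q}" using AE_not_in[OF N]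
  proof eventually_elim
    case (elim r)
    show ?case using gt[of r] elim by (cases "r \<in> {p<..<q}") (simp_all add: f_def)
  qed
  moreover have "{p<..<q} \<in> sets lborel" by simp
  ultimately have "emeasure lborel {p<..<q} = 0" using AE_iff_null_sets null_setsD1 by blast
  then show False using pq by simp
qed

text \<open>Cauchy-Schwarz on the interval between \<open>s\<close> and \<open>t\<close>; the
  absolute values make it applicable in either order.\<close>

lemma norm_prim_diff_le:
  fixes v :: "real \<Rightarrow> 'b::sep_hilbert"
  assumes v: "sqi v" "integrable lborel v" and st: "a \<le> s" "a \<le> t"
  shows "(norm (prim a v t - prim a v s))\<^sup>2
    \<le> \<bar>t - s\<bar> * \<bar>prim a (\<lambda>r. (norm (v r))\<^sup>2) t - prim a (\<lambda>r. (norm (v r))\<^sup>2) s\<bar>"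
proof -
  have ord: "(norm (prim a v t - prim a v s))\<^sup>2
    \<le> \<bar>t - s\<bar> * \<bar>prim a (\<lambda>r. (norm (v r))\<^sup>2) t - prim a (\<lambda>r. (norm (v r))\<^sup>2) s\<bar>"
    if st: "a \<le> s" "s \<le> t" for s t
  proof -
    have "(norm (LINT r|lborel. indicator {s<..t} r *\<^sub>R v r))\<^sup>2
      \<le> (t - s) * (LINT r|lborel. indicator {s<..t} r * (norm (v r))\<^sup>2)"
      by (rule norm_interval_integral_le[OF st(2) sqiD(1)[OF v(1)] integrable_indicator_mult[OF sqiD(2)[OF v(1)]]]) simp
    then have "(norm (prim a v t - prim a v s))\<^sup>2
      \<le> (t - s) * (prim a (\<lambda>r. (norm (v r))\<^sup>2) t - prim a (\<lambda>r. (norm (v r))\<^sup>2) s)"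
      unfolding prim_diff[OF v(2) st] prim_diff[OF sqiD(2)[OF v(1)] st] by simp
    also have "\<dots> \<le> \<bar>t - s\<bar> * \<bar>prim a (\<lambda>r. (norm (v r))\<^sup>2) t - prim a (\<lambda>r. (norm (v r))\<^sup>2) s\<bar>"
      unfolding abs_mult[symmetric] by (rule abs_ge_self)
    finally show ?thesis .
  qed
  show ?thesis
  proof (cases "s \<le> t")
    case True
    then show ?thesis using ord[OF st(1)] by blast
  next
    case False
    then show ?thesis using ord[OF st(2), of s] by (simp only: norm_minus_commute abs_minus_commute linear)
  qed
qed

lemma uniformly_continuous_prim:
  fixes g :: "real \<Rightarrow> 'b::{banach,second_countable_topology}"
  assumes "integrable lborel g" "0 < e"
  shows "\<exists>d>0. \<forall>s\<in>{0..T}. \<forall>t\<in>{0..T}. \<bar>s - t\<bar> < d \<longrightarrow> norm (prim 0 g s - prim 0 g t) < e"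
proof -
  have "uniformly_continuous_on {0..T} (prim 0 g)"
    by (rule compact_uniformly_continuous[OF prim_continuous[OF assms(1)] compact_Icc])
  from uniformly_continuous_onE[OF this assms(2)] obtain d where
    "0 < d" "\<And>s t. s \<in> {0..T} \<Longrightarrow> t \<in> {0..T} \<Longrightarrow> dist t s < d \<Longrightarrow> dist (prim 0 g t) (prim 0 g s) < e"
    by metis
  then show ?thesis by (auto simp: dist_norm dist_real_def)
qed

context gelfand
begin

text \<open>Off a null set, the squared distance of \<open>j (w x)\<close> and
  \<open>j (w r)\<close> is an increment of \<Gamma> minus twice an increment of the primitive of
  \<open>v\<close> paired with \<open>w r\<close>. The norm of \<open>w r\<close> in
  \<open>'v\<close> has no uniform bound, so \<open>r\<close> is taken as a good point of a window
  of length \<delta>: then \<open>\<delta> * (norm (w r))\<^sup>2\<close> is at most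
  \<open>I\<close>, while the squared increment of the primitive carries a factor \<delta>. Their
  product is small uniformly in time, so \<open>j\<close> of \<open>w\<close> is uniformly
  continuous off the null set and extends to \<open>{0..T}\<close>.\<close>

lemma cont_representative:
  assumes T: "0 < T" and w: "sqi_on T w" and v: "sqi_on T v" and d: "wderiv T w v"
  obtains z where "continuous_on {0..T} z" "AE t in lborel. t \<in> {0<..<T} \<longrightarrow> z t = j (w t)"
    "\<And>s t \<phi>. s \<in> {0..T} \<Longrightarrow> t \<in> {0..T} \<Longrightarrow> (z t - z s) \<bullet> j \<phi> = (prim 0 v t - prim 0 v s) \<bullet> \<phi>"
    "\<And>s t. s \<in> {0..T} \<Longrightarrow> t \<in> {0..T} \<Longrightarrow> (norm (z t))\<^sup>2 - (norm (z s))\<^sup>2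
      = prim 0 (\<lambda>t. 2 * (v t \<bullet> w t)) t - prim 0 (\<lambda>t. 2 * (v t \<bullet> w t)) s"
proof -
  note ws = sqi_onD(1)[OF w] and vs = sqi_onD(1)[OF v] and vi = sqi_on_integrable[OF v]
  obtain N1 where N1: "N1 \<in> null_sets lborel"
    and inc1: "\<And>s t \<phi>. s \<in> {0<..<T} - N1 \<Longrightarrow> t \<in> {0<..<T} - N1 \<Longrightarrow>
      (j (w t) - j (w s)) \<bullet> j \<phi> = (prim 0 v t - prim 0 v s) \<bullet> \<phi>"
    using wderiv_increment[OF T w v d] by blast
  define \<Gamma> where "\<Gamma> = prim 0 (\<lambda>t. 2 * (v t \<bullet> w t))"
  have gi: "integrable lborel (\<lambda>t. 2 * (v t \<bullet> w t))" using sqi_inner[OF vs ws] by simp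
  obtain c where "AE t in lborel. t \<in> {0<..<T} \<longrightarrow> (norm (j (w t)))\<^sup>2 = c + \<Gamma> t"
    using energy_AE[OF T w v d] unfolding \<Gamma>_def by blast
  then obtain N2 where N2: "N2 \<in> null_sets lborel"
    and en2: "\<And>t. t \<in> space lborel - N2 \<Longrightarrow> t \<in> {0<..<T} \<longrightarrow> (norm (j (w t)))\<^sup>2 = c + \<Gamma> t"
    by (rule AE_E3) blast
  define N where "N = N1 \<union> N2"
  have N: "N \<in> null_sets lborel" unfolding N_def using N1 N2 by (rule null_sets.Un)
  define D where "D = {0<..<T} - N"
  have inc: "(j (w t) - j (w s)) \<bullet> j \<phi> = (prim 0 v t - prim 0 v s) \<bullet> \<phi>" if "s \<in> D" "t \<in> D" for s t \<phi>
    using inc1[of s t] that by (simp add: D_def N_def)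
  have en: "(norm (j (w t)))\<^sup>2 = c + \<Gamma> t" if "t \<in> D" for t
    using en2[of t] that by (simp add: D_def N_def)
  have clD: "closure D = {0..T}" unfolding D_def by (rule AE_imp_dense[OF N T])
  have D01: "t \<in> {0..T}" if "t \<in> D" for t using that by (auto simp: D_def)
  define X where "X = prim 0 (\<lambda>r. (norm (v r))\<^sup>2)"
  define I where "I = (LINT t|lborel. (norm (w t))\<^sup>2)"
  have I0: "0 \<le> I" unfolding I_def by simp
  have "uniformly_continuous_on D (\<lambda>t. j (w t))"
    unfolding uniformly_continuous_on_def
  proof (intro allI impI)
    fix e :: real assume e: "0 < e"
    have e16: "0 < e\<^sup>2 / 16" using e by simp
    \<comment> \<open>With this tolerance for \<open>X\<close> the pairing with \<open>w r\<close>
      is at most \<open>e\<^sup>2 / 32\<close>, after multiplication by \<open>I + 1\<close> and a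
      square root; twice that plus \<open>e\<^sup>2 / 16\<close> stays below
      \<open>e\<^sup>2 / 4\<close>.\<close>
    have eX: "0 < (e\<^sup>2 / 32)\<^sup>2 / (I + 1)" using e I0 by (simp add: add_nonneg_pos)
    obtain d1 where d1: "0 < d1" "\<And>s t. s \<in> {0..T} \<Longrightarrow> t \<in> {0..T} \<Longrightarrow> \<bar>s - t\<bar> < d1 \<Longrightarrow> norm (\<Gamma> s - \<Gamma> t) < e\<^sup>2 / 16"
      using uniformly_continuous_prim[OF gi e16, of T] unfolding \<Gamma>_def by blast
    obtain d2 where d2: "0 < d2" "\<And>s t. s \<in> {0..T} \<Longrightarrow> t \<in> {0..T} \<Longrightarrow> \<bar>s - t\<bar> < d2 \<Longrightarrow> norm (X s - X t) < (e\<^sup>2 / 32)\<^sup>2 / (I + 1)"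
      using uniformly_continuous_prim[OF sqiD(2)[OF vs] eX, of T] unfolding X_def by blast
    define \<delta> where "\<delta> = min (min d1 d2) T / 2"
    have \<delta>: "0 < \<delta>" "\<delta> < d1" "\<delta> < d2" "\<delta> < T" using d1(1) d2(1) T by (auto simp: \<delta>_def)
    have "dist (j (w t)) (j (w s)) < e" if st: "s \<in> D" "t \<in> D" "dist t s < \<delta>" for s t
    proof -
      \<comment> \<open>A window of length \<delta> inside \<open>{0..T}\<close> that contains both
        \<open>s\<close> and \<open>t\<close>; near the end \<open>T\<close> it is pushed to the
        left.\<close>
      define p where "p = min (min s t) (T - \<delta>)"
      define q where "q = p + \<delta>"
      have st': "0 < s" "s < T" "0 < t" "t < T" "\<bar>t - s\<bar> < \<delta>"
        using st by (auto simp: D_def dist_real_def)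
      have pq: "0 \<le> p" "q \<le> T" "p < q" "q - p = \<delta>" "p \<le> s" "p \<le> t" "s \<le> q" "t \<le> q"
        using st' \<delta> by (auto simp: p_def q_def)
      obtain r where r: "r \<in> {p<..<q} - N" "(q - p) * (norm (w r))\<^sup>2 \<le> I"
        using mean_value_AE[OF ws pq(3) N] unfolding I_def by blast
      have rD: "r \<in> D" using r(1) pq by (auto simp: D_def)
      have near: "dist (j (w x)) (j (w r)) < e / 2" if x: "x \<in> D" "p \<le> x" "x \<le> q" for x
      proof -
        have xr: "\<bar>x - r\<bar> \<le> \<delta>" using x(2,3) r(1) pq(4) by auto
        have "(norm (j (w x) - j (w r)))\<^sup>2
          = (norm (j (w x)))\<^sup>2 - (norm (j (w r)))\<^sup>2 - 2 * ((j (w x) - j (w r)) \<bullet> j (w r))"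
          unfolding power2_norm_eq_inner by (simp add: inner_diff_left inner_diff_right inner_commute)
        also have "\<dots> = \<Gamma> x - \<Gamma> r - 2 * ((prim 0 v x - prim 0 v r) \<bullet> w r)"
          unfolding en[OF x(1)] en[OF rD] inc[OF rD x(1)] by simp
        finally have 1: "(norm (j (w x) - j (w r)))\<^sup>2 = \<Gamma> x - \<Gamma> r - 2 * ((prim 0 v x - prim 0 v r) \<bullet> w r)" .
        have 2: "\<Gamma> x - \<Gamma> r < e\<^sup>2 / 16"
        proof -
          have "norm (\<Gamma> x - \<Gamma> r) < e\<^sup>2 / 16" by (rule d1(2)[OF D01[OF x(1)] D01[OF rD]]) (use xr \<delta>(2) in linarith)
          then show ?thesis unfolding real_norm_def by linarith
        qed
        define y where "y = norm (prim 0 v x - prim 0 v r)"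
        have y: "y\<^sup>2 \<le> \<bar>x - r\<bar> * \<bar>X x - X r\<bar>"
          unfolding y_def X_def using D01[OF x(1)] D01[OF rD] by (intro norm_prim_diff_le[OF vs vi]) simp_all
        also have "\<dots> \<le> \<delta> * ((e\<^sup>2 / 32)\<^sup>2 / (I + 1))"
        proof (rule mult_mono[OF xr])
          have "norm (X x - X r) < (e\<^sup>2 / 32)\<^sup>2 / (I + 1)"
            by (rule d2(2)[OF D01[OF x(1)] D01[OF rD]]) (use xr \<delta>(3) in linarith)
          then show "\<bar>X x - X r\<bar> \<le> (e\<^sup>2 / 32)\<^sup>2 / (I + 1)" by simp
        qed (use \<delta>(1) in simp_all)
        finally have y2: "y\<^sup>2 \<le> \<delta> * ((e\<^sup>2 / 32)\<^sup>2 / (I + 1))" .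
        have "(y * norm (w r))\<^sup>2 = y\<^sup>2 * (norm (w r))\<^sup>2" by (rule power_mult_distrib)
        also have "\<dots> \<le> \<delta> * ((e\<^sup>2 / 32)\<^sup>2 / (I + 1)) * (norm (w r))\<^sup>2"
          by (rule mult_right_mono[OF y2]) simp
        also have "\<dots> = (e\<^sup>2 / 32)\<^sup>2 / (I + 1) * (\<delta> * (norm (w r))\<^sup>2)" by (simp only: mult_ac)
        also have "\<dots> \<le> (e\<^sup>2 / 32)\<^sup>2 / (I + 1) * (I + 1)"
          using r(2) pq(4) I0 by (intro mult_left_mono) simp_all
        also have "\<dots> = (e\<^sup>2 / 32)\<^sup>2" using I0 by simp
        finally have "y * norm (w r) \<le> e\<^sup>2 / 32" by (rule power2_le_imp_le) simp
        moreover have "\<bar>(prim 0 v x - prim 0 v r) \<bullet> w r\<bar> \<le> y * norm (w r)"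
          unfolding y_def by (rule Cauchy_Schwarz_ineq2)
        ultimately have 3: "\<bar>(prim 0 v x - prim 0 v r) \<bullet> w r\<bar> \<le> e\<^sup>2 / 32" by linarith
        have "(norm (j (w x) - j (w r)))\<^sup>2 < e\<^sup>2 / 4"
          using 1 2 3 zero_le_power2[of e] by linarith
        also have "e\<^sup>2 / 4 = (e / 2)\<^sup>2" by (simp add: power_divide)
        finally show ?thesis unfolding dist_norm by (rule power2_less_imp_less) (use e in simp)
      qed
      have "dist (j (w t)) (j (w s)) \<le> dist (j (w t)) (j (w r)) + dist (j (w s)) (j (w r))"
        by (rule dist_triangle2)
      then show ?thesis using near[OF st(1) pq(5,7)] near[OF st(2) pq(6,8)] by linarith
    qed
    then show "\<exists>d>0. \<forall>x\<in>D. \<forall>x'\<in>D. dist x' x < d \<longrightarrow> dist (j (w x')) (j (w x)) < e"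
      using \<delta>(1) by blast
  qed
  then obtain z where z: "uniformly_continuous_on (closure D) z" "\<And>t. t \<in> D \<Longrightarrow> j (w t) = z t"
    using uniformly_continuous_on_extension_on_closure[of D "\<lambda>t. j (w t)"] by metis
  have zc: "continuous_on {0..T} z" using uniformly_continuous_imp_continuous[OF z(1)] unfolding clD .
  have pc: "continuous_on {0..T} (prim 0 v)" by (rule prim_continuous[OF vi])
  have gc: "continuous_on {0..T} \<Gamma>" unfolding \<Gamma>_def by (rule prim_continuous[OF gi])
  \<comment> \<open>Continuity frees one of the two times from the dense set \<open>D\<close>; a
    common reference time in \<open>D\<close> then frees the other.\<close>
  have wk1: "(z t - z s) \<bullet> j \<phi> - (prim 0 v t - prim 0 v s) \<bullet> \<phi> = 0" if s: "s \<in> D" and t: "t \<in> {0..T}" for s t \<phi>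
  proof (rule continuous_constant_on_closure[of D "\<lambda>t. (z t - z s) \<bullet> j \<phi> - (prim 0 v t - prim 0 v s) \<bullet> \<phi>" 0])
    show "continuous_on (closure D) (\<lambda>t. (z t - z s) \<bullet> j \<phi> - (prim 0 v t - prim 0 v s) \<bullet> \<phi>)"
      unfolding clD by (intro continuous_intros zc pc)
    show "(z t - z s) \<bullet> j \<phi> - (prim 0 v t - prim 0 v s) \<bullet> \<phi> = 0" if "t \<in> D" for t
      using inc[OF s that] z(2)[OF s] z(2)[OF that] by simp
    show "t \<in> closure D" using t clD by simp
  qed
  have wk: "(z t - z s) \<bullet> j \<phi> = (prim 0 v t - prim 0 v s) \<bullet> \<phi>" if "s \<in> {0..T}" "t \<in> {0..T}" for s t \<phi>
  proof -
    have "D \<noteq> {}" using clD T by auto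
    then obtain r where r: "r \<in> D" by blast
    show ?thesis using wk1[OF r that(1), of \<phi>] wk1[OF r that(2), of \<phi>] by (simp add: inner_diff_left)
  qed
  have nrm: "(norm (z t))\<^sup>2 = c + \<Gamma> t" if "t \<in> {0..T}" for t
  proof -
    have "(norm (z t))\<^sup>2 - \<Gamma> t = c"
    proof (rule continuous_constant_on_closure[of D "\<lambda>t. (norm (z t))\<^sup>2 - \<Gamma> t" c])
      show "continuous_on (closure D) (\<lambda>t. (norm (z t))\<^sup>2 - \<Gamma> t)"
        unfolding clD by (intro continuous_intros zc gc)
      show "(norm (z t))\<^sup>2 - \<Gamma> t = c" if "t \<in> D" for t using en[OF that] z(2)[OF that] by simp
      show "t \<in> closure D" using that clD by simp
    qed
    then show ?thesis by simp
  qed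
  have ae: "AE t in lborel. t \<in> {0<..<T} \<longrightarrow> z t = j (w t)"
    using AE_not_in[OF N]
  proof eventually_elim
    case (elim t)
    then show ?case using z(2)[of t] by (simp add: D_def)
  qed
  show ?thesis
    by (rule that[OF zc ae wk]) (use nrm in \<open>simp_all add: \<Gamma>_def\<close>)
qed

end

section \<open>Linear evolution equations\<close>

definition riesz :: "('a::{real_inner,complete_space} \<Rightarrow> real) \<Rightarrow> 'a" where
  "riesz L = (SOME p. \<forall>x. L x = x \<bullet> p)"

lemma riesz:
  fixes L :: "'a::{real_inner,complete_space} \<Rightarrow> real"
  assumes "linear L" "0 \<le> C" "\<And>x. \<bar>L x\<bar> \<le> C * norm x"
  shows "x \<bullet> riesz L = L x" and "norm (riesz L) \<le> C"
proof -
  obtain p where p: "norm p \<le> C" "\<forall>x. L x = x \<bullet> p" using riesz_representation[OF assms] by blast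
  have r: "\<forall>x. L x = x \<bullet> riesz L" unfolding riesz_def by (rule someI[of _ p]) (rule p(2))
  then show "x \<bullet> riesz L = L x" by simp
  have "riesz L = p" using r p(2) by (metis vector_eq_ldot)
  then show "norm (riesz L) \<le> C" using p(1) by simp
qed

lemma continuous_AE_eq:
  fixes y z :: "real \<Rightarrow> 'b::real_normed_vector"
  assumes T: "0 < T" and c: "continuous_on {0..T} y" "continuous_on {0..T} z"
    and ae: "AE t in lborel. t \<in> {0<..<T} \<longrightarrow> y t = z t" and t: "t \<in> {0..T}"
  shows "y t = z t"
proof -
  obtain N where N: "N \<in> null_sets lborel" "\<And>t. t \<in> space lborel - N \<Longrightarrow> t \<in> {0<..<T} \<longrightarrow> y t = z t"
    using ae by (rule AE_E3) blast
  note cl = AE_imp_dense[OF N(1) T]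
  have "y t - z t = 0"
  proof (rule continuous_constant_on_closure[of "{0<..<T} - N" "\<lambda>t. y t - z t" 0])
    show "continuous_on (closure ({0<..<T} - N)) (\<lambda>t. y t - z t)"
      unfolding cl by (intro continuous_intros c)
    show "y t - z t = 0" if "t \<in> {0<..<T} - N" for t using N(2)[of t] that by simp
    show "t \<in> closure ({0<..<T} - N)" using cl t by simp
  qed
  then show ?thesis by simp
qed

text \<open>The problem behind the locale is p' = a(p) with prescribed value at \<open>T\<close>:
  the inequality \<open>coercive\<close> limits the growth of |p|^2 as time decreases. Measurability
  is required along measurable curves, because the form is integrated along them.\<close>

locale evolution = gelfand j for j :: "'v::sep_hilbert \<Rightarrow> 'h::sep_hilbert" +
  fixes a :: "real \<Rightarrow> 'v \<Rightarrow> 'v \<Rightarrow> real" and T \<alpha> \<mu> M :: real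
  assumes T: "0 < T" and \<alpha>: "0 < \<alpha>" and \<mu>: "0 \<le> \<mu>" and M: "0 \<le> M"
    and a_meas: "f \<in> borel_measurable borel \<Longrightarrow> g \<in> borel_measurable borel \<Longrightarrow>
      (\<lambda>t. a t (f t) (g t)) \<in> borel_measurable borel"
    and a_left: "linear (\<lambda>x. a t x y)" and a_right: "linear (a t x)"
    and a_bound: "\<bar>a t x y\<bar> \<le> M * norm x * norm y"
    and coercive: "\<alpha> * (norm x)\<^sup>2 - \<mu> * (norm (j x))\<^sup>2 \<le> a t x x"
begin

text \<open>The transposed operator at a test function with value \<open>u\<close> and derivative
  \<open>u'\<close>, as an element of \<open>'v\<close>. Value and derivative are independent
  arguments, which makes it linear in the pair.\<close>

definition kap :: "real \<Rightarrow> 'v \<Rightarrow> 'v \<Rightarrow> 'v" where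
  "kap t u u' = riesz (\<lambda>x. j x \<bullet> j u' + a t x u)"

lemma kap: "x \<bullet> kap t u u' = j x \<bullet> j u' + a t x u" "norm (kap t u u') \<le> norm u' + M * norm u"
proof -
  have lin: "linear (\<lambda>x. j x \<bullet> j u' + a t x u)"
    by (rule linearI)
      (simp_all add: j_lin inner_add_left linear_add[OF a_left] linear_scale[OF a_left] algebra_simps)
  have C: "0 \<le> norm u' + M * norm u" using M by simp
  have bd: "\<bar>j x \<bullet> j u' + a t x u\<bar> \<le> (norm u' + M * norm u) * norm x" for x
  proof -
    have "\<bar>j x \<bullet> j u'\<bar> \<le> norm (j x) * norm (j u')" by (rule Cauchy_Schwarz_ineq2)
    also have "\<dots> \<le> norm x * norm u'" by (intro mult_mono contr) simp_all
    finally have "\<bar>j x \<bullet> j u'\<bar> \<le> norm x * norm u'" .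
    then have "\<bar>j x \<bullet> j u' + a t x u\<bar> \<le> norm x * norm u' + M * norm x * norm u"
      using a_bound[of t x u] by linarith
    then show ?thesis by (simp add: algebra_simps)
  qed
  show "x \<bullet> kap t u u' = j x \<bullet> j u' + a t x u" unfolding kap_def by (rule riesz(1)[OF lin C bd])
  show "norm (kap t u u') \<le> norm u' + M * norm u" unfolding kap_def by (rule riesz(2)[OF lin C bd])
qed

lemma kap_add: "kap t (u + w) (u' + w') = kap t u u' + kap t w w'"
proof -
  have "\<forall>x. x \<bullet> kap t (u + w) (u' + w') = x \<bullet> (kap t u u' + kap t w w')"
    by (simp add: kap inner_add_right j_lin linear_add[OF a_right])
  then show ?thesis by (simp only: vector_eq_ldot)
qed

lemma kap_scale: "kap t (c *\<^sub>R u) (c *\<^sub>R u') = c *\<^sub>R kap t u u'"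
proof -
  have "\<forall>x. x \<bullet> kap t (c *\<^sub>R u) (c *\<^sub>R u') = x \<bullet> (c *\<^sub>R kap t u u')"
    by (simp add: kap j_lin linear_scale[OF a_right] algebra_simps)
  then show ?thesis by (simp only: vector_eq_ldot)
qed

text \<open>Test functions vanish at \<open>0\<close> but not at \<open>T\<close>: integration by
  parts against the solution leaves exactly the terminal value.\<close>

definition adm :: "(real \<Rightarrow> 'v) \<Rightarrow> (real \<Rightarrow> 'v) \<Rightarrow> bool" where
  "adm \<phi> \<phi>' \<longleftrightarrow> (\<forall>t. (\<phi> has_vector_derivative \<phi>' t) (at t)) \<and> continuous_on UNIV \<phi>' \<and> \<phi> 0 = 0"

lemma adm_continuous: "adm \<phi> \<phi>' \<Longrightarrow> continuous_on UNIV \<phi>" "adm \<phi> \<phi>' \<Longrightarrow> continuous_on UNIV \<phi>'"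
  unfolding adm_def by (auto intro!: continuous_at_imp_continuous_on has_vector_derivative_continuous)

definition Kf :: "(real \<Rightarrow> 'v) \<Rightarrow> (real \<Rightarrow> 'v) \<Rightarrow> real \<Rightarrow> 'v" where
  "Kf \<phi> \<phi>' t = indicator {0<..<T} t *\<^sub>R kap t (\<phi> t) (\<phi>' t)"

lemma continuous_bounded_Icc:
  fixes f :: "real \<Rightarrow> 'b::real_normed_vector"
  assumes "continuous_on UNIV f" obtains B where "0 \<le> B" "\<And>t. t \<in> {0..T} \<Longrightarrow> norm (f t) \<le> B"
proof -
  have "bounded (f ` {0..T})"
    by (intro compact_imp_bounded compact_continuous_image continuous_on_subset[OF assms]) auto
  then obtain B where B: "\<forall>y\<in>f ` {0..T}. norm y \<le> B" unfolding bounded_iff ..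
  have "norm (f t) \<le> max B 0" if "t \<in> {0..T}" for t using bspec[OF B imageI[OF that]] by simp
  then show ?thesis by (intro that[of "max B 0"]) simp_all
qed

lemma sqi_bounded_support:
  fixes f :: "real \<Rightarrow> 'b::sep_hilbert"
  assumes f: "f \<in> borel_measurable borel" and B: "\<And>t. t \<in> {0<..<T} \<Longrightarrow> norm (f t) \<le> B"
    and z: "\<And>t. t \<notin> {0<..<T} \<Longrightarrow> f t = 0"
  shows "sqi f"
proof (rule sqi_bound[OF f])
  show "integrable lborel (\<lambda>t. indicator {0<..<T} t * B\<^sup>2)"
    by (intro integrable_mult_left integrable_real_indicator) (simp_all add: emeasure_lborel_Ioo_finite)
  show "AE t in lborel. (norm (f t))\<^sup>2 \<le> indicator {0<..<T} t * B\<^sup>2"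
  proof (rule AE_I2)
    fix t
    show "(norm (f t))\<^sup>2 \<le> indicator {0<..<T} t * B\<^sup>2"
      using power_mono[OF B norm_ge_zero, of t 2] z[of t] by (cases "t \<in> {0<..<T}") simp_all
  qed
qed

lemma sqi_Kf: assumes ad: "adm \<phi> \<phi>'" shows "sqi (Kf \<phi> \<phi>')"
proof -
  have [measurable]: "\<phi> \<in> borel_measurable borel" "\<phi>' \<in> borel_measurable borel"
    using adm_continuous[OF ad] by (simp_all add: borel_measurable_continuous_onI)
  obtain B where B: "0 \<le> B" "\<And>t. t \<in> {0..T} \<Longrightarrow> norm (\<phi> t) \<le> B"
    using continuous_bounded_Icc[OF adm_continuous(1)[OF ad]] by blast
  obtain B' where B': "0 \<le> B'" "\<And>t. t \<in> {0..T} \<Longrightarrow> norm (\<phi>' t) \<le> B'"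
    using continuous_bounded_Icc[OF adm_continuous(2)[OF ad]] by blast
  show ?thesis
  proof (rule sqi_bounded_support)
    show "Kf \<phi> \<phi>' \<in> borel_measurable borel"
    proof (rule borel_measurable_weak)
      fix x
      have "(\<lambda>t. Kf \<phi> \<phi>' t \<bullet> x) = (\<lambda>t. indicator {0<..<T} t * (j x \<bullet> j (\<phi>' t) + a t x (\<phi> t)))"
        by (rule ext) (simp add: Kf_def kap inner_commute[of _ x])
      moreover have "(\<lambda>t. a t x (\<phi> t)) \<in> borel_measurable borel" by (rule a_meas) measurable
      ultimately show "(\<lambda>t. Kf \<phi> \<phi>' t \<bullet> x) \<in> borel_measurable borel" by simp
    qed
    show "norm (Kf \<phi> \<phi>' t) \<le> B' + M * B" if "t \<in> {0<..<T}" for t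
    proof -
      have "norm (Kf \<phi> \<phi>' t) \<le> norm (\<phi>' t) + M * norm (\<phi> t)" using kap(2) that by (simp add: Kf_def)
      also have "\<dots> \<le> B' + M * B" using B(2)[of t] B'(2)[of t] that M by (intro add_mono mult_left_mono) simp_all
      finally show ?thesis .
    qed
    show "Kf \<phi> \<phi>' t = 0" if "t \<notin> {0<..<T}" for t using that by (simp add: Kf_def)
  qed
qed

text \<open>The a priori bound is obtained by testing with \<open>exp (-2 \<mu> t) *\<^sub>R \<phi> t\<close>, which absorbs the
  zeroth-order term in the Garding inequality.\<close>

lemma a_priori:
  assumes ad: "adm \<phi> \<phi>'"
  shows "norm (j (\<phi> T)) \<le> sqrt (exp (2 * \<mu> * T) / (2 * \<alpha>)) * norm (abs_l2 (Kf \<phi> \<phi>'))"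
proof -
  note ac = adm_continuous[OF ad]
  have jc: "continuous_on A j" for A by (rule linear_continuous_on[OF bl])
  have jcont: "continuous_on UNIV (\<lambda>t. j (\<phi> t))" "continuous_on UNIV (\<lambda>t. j (\<phi>' t))"
    by (rule continuous_on_compose2[OF jc ac(1) subset_UNIV], rule continuous_on_compose2[OF jc ac(2) subset_UNIV])
  define e where "e t = exp (- 2 * \<mu> * t)" for t
  have e0: "0 < e t" for t by (simp add: e_def)
  have e1: "e t \<le> 1" if "0 < t" for t using \<mu> that by (simp add: e_def)
  have ec: "continuous_on UNIV e" unfolding e_def by (intro continuous_intros)
  have em [measurable]: "e \<in> borel_measurable borel" by (rule borel_measurable_continuous_onI[OF ec])
  \<comment> \<open>The derivative of half the weighted square of
    \<open>norm (j (\<phi> t))\<close>; since \<open>\<phi> 0 = 0\<close>, its integral is the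
    boundary term at \<open>T\<close> alone.\<close>
  define f where "f t = e t * (j (\<phi> t) \<bullet> j (\<phi>' t) - \<mu> * (norm (j (\<phi> t)))\<^sup>2)" for t
  have fc: "continuous_on UNIV f" unfolding f_def by (intro continuous_intros ec jcont)
  have F: "((\<lambda>t. e t * ((j (\<phi> t) \<bullet> j (\<phi> t)) / 2)) has_field_derivative f t) (at t)" for t
  proof -
    have "((\<lambda>t. j (\<phi> t)) has_vector_derivative j (\<phi>' t)) (at t)"
      using ad bounded_linear.has_vector_derivative[OF bl] unfolding adm_def by blast
    from bounded_bilinear.has_vector_derivative[OF bounded_bilinear_inner this this]
    have d1: "((\<lambda>t. j (\<phi> t) \<bullet> j (\<phi> t)) has_field_derivative 2 * (j (\<phi> t) \<bullet> j (\<phi>' t))) (at t)"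
      by (simp add: has_real_derivative_iff_has_vector_derivative inner_commute)
    have d2: "(e has_field_derivative (- 2 * \<mu>) * e t) (at t)"
      unfolding e_def by (auto intro!: derivative_eq_intros)
    from DERIV_mult[OF d2 DERIV_cdivide[OF d1, of 2]]
    show ?thesis by (simp add: f_def power2_norm_eq_inner algebra_simps)
  qed
  have I1: "(LINT t|lborel. indicator {0..T} t * f t) = e T * ((norm (j (\<phi> T)))\<^sup>2 / 2)"
    using ftc_lborel[OF less_imp_le[OF T] F fc] ad by (simp add: adm_def j_lin power2_norm_eq_inner)
  have [measurable]: "\<phi> \<in> borel_measurable borel" using ac by (simp add: borel_measurable_continuous_onI)
  define \<eta> where "\<eta> t = indicator {0<..<T} t *\<^sub>R (e t *\<^sub>R \<phi> t)" for t
  obtain B where B: "0 \<le> B" "\<And>t. t \<in> {0..T} \<Longrightarrow> norm (\<phi> t) \<le> B"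
    using continuous_bounded_Icc[OF ac(1)] by blast
  have \<eta>: "sqi \<eta>"
  proof (rule sqi_bounded_support)
    show "\<eta> \<in> borel_measurable borel" unfolding \<eta>_def by measurable
    show "norm (\<eta> t) \<le> B" if "t \<in> {0<..<T}" for t
    proof -
      have "norm (\<eta> t) = e t * norm (\<phi> t)" using that e0[of t] by (simp add: \<eta>_def)
      also have "\<dots> \<le> 1 * B" using e1[of t] e0[of t] B(2)[of t] that by (intro mult_mono) simp_all
      finally show ?thesis by simp
    qed
    show "\<eta> t = 0" if "t \<notin> {0<..<T}" for t using that by (simp add: \<eta>_def)
  qed
  define w where "w t = indicator {0<..<T} t * (e t * (norm (\<phi> t))\<^sup>2)" for t
  have wi: "integrable lborel w"
  proof -
    have "integrable lborel (\<lambda>t. indicator {0..T} t *\<^sub>R (e t * (norm (\<phi> t))\<^sup>2))"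
      by (intro borel_integrable_compact compact_Icc continuous_intros continuous_on_subset[OF ec] continuous_on_subset[OF ac(1)]) auto
    then have "integrable lborel (\<lambda>t. indicator {0<..<T} t * (indicator {0..T} t *\<^sub>R (e t * (norm (\<phi> t))\<^sup>2)))"
      by (rule integrable_indicator_mult) simp
    moreover have "(\<lambda>t. indicator {0<..<T} t * (indicator {0..T} t *\<^sub>R (e t * (norm (\<phi> t))\<^sup>2))) = w"
      by (intro ext) (auto simp: w_def indicator_def)
    ultimately show ?thesis by (simp only:)
  qed
  define A where "A = (LINT t|lborel. w t)"
  have fi: "integrable lborel (\<lambda>t. indicator {0..T} t * f t)"
    using borel_integrable_compact[OF compact_Icc continuous_on_subset[OF fc]] by simp
  \<comment> \<open>The term with \<mu> in \<open>f\<close>, which stems from the weight, is the one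
    that the Garding inequality subtracts; so the integrand on the right dominates \<open>f\<close>
    plus \<open>\<alpha> * w\<close> pointwise.\<close>
  have low: "e T * ((norm (j (\<phi> T)))\<^sup>2 / 2) + \<alpha> * A \<le> abs_l2 \<eta> \<bullet> abs_l2 (Kf \<phi> \<phi>')"
  proof -
    have "e T * ((norm (j (\<phi> T)))\<^sup>2 / 2) + \<alpha> * A = (LINT t|lborel. indicator {0..T} t * f t + \<alpha> * w t)"
      using fi wi I1 by (simp add: A_def)
    also have "\<dots> \<le> (LINT t|lborel. \<eta> t \<bullet> Kf \<phi> \<phi>' t)"
    proof (rule integral_mono_AE)
      show "integrable lborel (\<lambda>t. indicator {0..T} t * f t + \<alpha> * w t)" using fi wi by simp
      show "integrable lborel (\<lambda>t. \<eta> t \<bullet> Kf \<phi> \<phi>' t)" by (rule sqi_inner[OF \<eta> sqi_Kf[OF ad]])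
      show "AE t in lborel. indicator {0..T} t * f t + \<alpha> * w t \<le> \<eta> t \<bullet> Kf \<phi> \<phi>' t"
        using AE_lborel_singleton[of 0] AE_lborel_singleton[of T]
      proof eventually_elim
        case (elim t)
        show ?case
        proof (cases "t \<in> {0<..<T}")
          case True
          have "\<alpha> * (norm (\<phi> t))\<^sup>2 - \<mu> * (norm (j (\<phi> t)))\<^sup>2 \<le> a t (\<phi> t) (\<phi> t)" by (rule coercive)
          then have "e t * (j (\<phi> t) \<bullet> j (\<phi>' t) + (\<alpha> * (norm (\<phi> t))\<^sup>2 - \<mu> * (norm (j (\<phi> t)))\<^sup>2))
            \<le> e t * (j (\<phi> t) \<bullet> j (\<phi>' t) + a t (\<phi> t) (\<phi> t))"
            using e0[of t] by (intro mult_left_mono add_left_mono) simp_all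
          then show ?thesis using True
            by (simp add: f_def w_def \<eta>_def Kf_def kap linear_scale[OF a_left] j_lin algebra_simps)
        next
          case False
          then have "t \<notin> {0..T}" using elim by auto
          then show ?thesis using False by (simp add: w_def \<eta>_def)
        qed
      qed
    qed
    also have "\<dots> = abs_l2 \<eta> \<bullet> abs_l2 (Kf \<phi> \<phi>')" by (rule inner_abs_l2[OF \<eta> sqi_Kf[OF ad], symmetric])
    finally show ?thesis .
  qed
  define n where "n = norm (abs_l2 \<eta>)"
  define k where "k = norm (abs_l2 (Kf \<phi> \<phi>'))"
  have "n\<^sup>2 = (LINT t|lborel. (norm (\<eta> t))\<^sup>2)" unfolding n_def norm_abs_l2[OF \<eta>] by simp
  also have "\<dots> \<le> A" unfolding A_def
  proof (rule integral_mono[OF sqiD(2)[OF \<eta>] wi])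
    fix t
    show "(norm (\<eta> t))\<^sup>2 \<le> w t"
    proof (cases "t \<in> {0<..<T}")
      case True
      then have "(e t)\<^sup>2 \<le> e t" using e1[of t] e0[of t] by (simp add: power2_eq_square mult_left_le)
      then have "(e t)\<^sup>2 * (norm (\<phi> t))\<^sup>2 \<le> e t * (norm (\<phi> t))\<^sup>2" by (rule mult_right_mono) simp
      then show ?thesis using True by (simp add: \<eta>_def w_def power_mult_distrib)
    qed (simp add: \<eta>_def w_def)
  qed
  finally have nA: "n\<^sup>2 \<le> A" .
  have "abs_l2 \<eta> \<bullet> abs_l2 (Kf \<phi> \<phi>') \<le> n * k" unfolding n_def k_def by (rule norm_cauchy_schwarz)
  \<comment> \<open>Young's inequality, weighted so that \<open>\<alpha> * n\<^sup>2\<close> is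
    absorbed by \<open>\<alpha> * A\<close>.\<close>
  also have "n * k \<le> \<alpha> * n\<^sup>2 + k\<^sup>2 / (4 * \<alpha>)"
  proof -
    have "0 \<le> (2 * \<alpha> * n - k)\<^sup>2 / (4 * \<alpha>)" using \<alpha> by simp
    also have "\<dots> = \<alpha> * n\<^sup>2 + k\<^sup>2 / (4 * \<alpha>) - n * k"
      using \<alpha> by (simp add: power2_eq_square field_simps)
    finally show ?thesis by simp
  qed
  also have "\<dots> \<le> \<alpha> * A + k\<^sup>2 / (4 * \<alpha>)" using nA \<alpha> by simp
  finally have "e T * ((norm (j (\<phi> T)))\<^sup>2 / 2) \<le> k\<^sup>2 / (4 * \<alpha>)" using low by linarith
  then have le: "(norm (j (\<phi> T)))\<^sup>2 \<le> exp (2 * \<mu> * T) / (2 * \<alpha>) * k\<^sup>2"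
    using \<alpha> by (simp add: e_def exp_minus field_simps)
  have "norm (j (\<phi> T)) \<le> sqrt (exp (2 * \<mu> * T) / (2 * \<alpha>) * k\<^sup>2)" by (rule real_le_rsqrt[OF le])
  also have "\<dots> = sqrt (exp (2 * \<mu> * T) / (2 * \<alpha>)) * k" unfolding real_sqrt_mult by (simp add: k_def)
  finally show ?thesis by (simp add: k_def)
qed

lemma adm_add: "adm \<phi> \<phi>' \<Longrightarrow> adm \<psi> \<psi>' \<Longrightarrow> adm (\<lambda>t. \<phi> t + \<psi> t) (\<lambda>t. \<phi>' t + \<psi>' t)"
  unfolding adm_def by (auto intro: has_vector_derivative_add continuous_on_add)

lemma adm_scale: "adm \<phi> \<phi>' \<Longrightarrow> adm (\<lambda>t. c *\<^sub>R \<phi> t) (\<lambda>t. c *\<^sub>R \<phi>' t)"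
  unfolding adm_def
  by (auto intro: bounded_linear.has_vector_derivative[OF bounded_linear_scaleR_right] continuous_on_scaleR continuous_on_const)

lemma adm_separated:
  assumes "\<And>t. (\<theta> has_field_derivative \<theta>' t) (at t)" "continuous_on UNIV \<theta>'" "\<theta> 0 = 0"
  shows "adm (\<lambda>t. \<theta> t *\<^sub>R x) (\<lambda>t. \<theta>' t *\<^sub>R x)"
  unfolding adm_def
proof (intro conjI allI)
  fix t
  have "(\<theta> has_vector_derivative \<theta>' t) (at t)"
    using assms(1) by (simp add: has_real_derivative_iff_has_vector_derivative)
  then show "((\<lambda>t. \<theta> t *\<^sub>R x) has_vector_derivative \<theta>' t *\<^sub>R x) (at t)"
    by (rule bounded_linear.has_vector_derivative[OF bounded_linear_scaleR_left])
qed (use assms in \<open>auto intro!: continuous_intros\<close>)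

text \<open>Lions' projection argument: the functional \<open>\<phi> \<mapsto> g \<bullet> j (\<phi> T)\<close> factors through
  \<open>Kf \<phi> \<phi>'\<close> by the a priori bound, so it is represented by some \<open>p\<close> in \<open>L\<^sup>2\<close>.\<close>

lemma lions:
  obtains p where "sqi_on T p"
    "sqrt (LINT t|lborel. (norm (p t))\<^sup>2) \<le> sqrt (exp (2 * \<mu> * T) / (2 * \<alpha>)) * norm g"
    "\<And>\<phi> \<phi>'. adm \<phi> \<phi>' \<Longrightarrow> integrable lborel (\<lambda>t. j (p t) \<bullet> j (\<phi>' t) + a t (p t) (\<phi> t)) \<and>
      (LINT t|lborel. j (p t) \<bullet> j (\<phi>' t) + a t (p t) (\<phi> t)) = g \<bullet> j (\<phi> T)"
proof -
  define C where "C = sqrt (exp (2 * \<mu> * T) / (2 * \<alpha>))"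
  have C0: "0 \<le> C" using \<alpha> by (simp add: C_def)
  \<comment> \<open>A relation, because different admissible pairs might have the same image under
    \<open>Kf\<close>; \<open>riesz_linear_relation\<close> draws well-definedness from the
    bound.\<close>
  define R where "R = {(abs_l2 (Kf \<phi> \<phi>'), g \<bullet> j (\<phi> T)) | \<phi> \<phi>'. adm \<phi> \<phi>'}"
  have RI: "adm \<phi> \<phi>' \<Longrightarrow> (abs_l2 (Kf \<phi> \<phi>'), g \<bullet> j (\<phi> T)) \<in> R" for \<phi> \<phi>' unfolding R_def by blast
  have Kadd: "Kf (\<lambda>t. \<phi> t + \<psi> t) (\<lambda>t. \<phi>' t + \<psi>' t) = (\<lambda>t. Kf \<phi> \<phi>' t + Kf \<psi> \<psi>' t)" for \<phi> \<phi>' \<psi> \<psi>'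
    by (rule ext) (simp add: Kf_def kap_add scaleR_add_right)
  have Ksc: "Kf (\<lambda>t. c *\<^sub>R \<phi> t) (\<lambda>t. c *\<^sub>R \<phi>' t) = (\<lambda>t. c *\<^sub>R Kf \<phi> \<phi>' t)" for c \<phi> \<phi>'
    by (rule ext) (simp add: Kf_def kap_scale)
  have "subspace R"
    unfolding subspace_def
  proof (intro conjI ballI allI)
    have ad0: "adm (\<lambda>_. 0) (\<lambda>_. 0)" by (auto simp: adm_def)
    have "Kf (\<lambda>_. 0) (\<lambda>_. 0) = (\<lambda>_. 0)" using Ksc[of 0 "\<lambda>_. 0" "\<lambda>_. 0"] by simp
    then have "(abs_l2 (Kf (\<lambda>_. 0) (\<lambda>_. 0)), g \<bullet> j 0) = 0" by (simp add: zero_l2.abs_eq[symmetric] j_lin zero_prod_def)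
    then show "0 \<in> R" using RI[OF ad0] by simp
  next
    fix x y assume "x \<in> R" "y \<in> R"
    then obtain \<phi> \<phi>' \<psi> \<psi>' where ad: "adm \<phi> \<phi>'" "adm \<psi> \<psi>'"
      and xy: "x = (abs_l2 (Kf \<phi> \<phi>'), g \<bullet> j (\<phi> T))" "y = (abs_l2 (Kf \<psi> \<psi>'), g \<bullet> j (\<psi> T))"
      unfolding R_def by blast
    have "x + y = (abs_l2 (Kf (\<lambda>t. \<phi> t + \<psi> t) (\<lambda>t. \<phi>' t + \<psi>' t)), g \<bullet> j (\<phi> T + \<psi> T))"
      unfolding xy Kadd by (simp add: plus_abs_l2 sqi_Kf ad j_lin inner_add_right)
    then show "x + y \<in> R" using RI[OF adm_add[OF ad]] by simp
  next
    fix c :: real and x assume "x \<in> R"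
    then obtain \<phi> \<phi>' where ad: "adm \<phi> \<phi>'" and x: "x = (abs_l2 (Kf \<phi> \<phi>'), g \<bullet> j (\<phi> T))"
      unfolding R_def by blast
    have "c *\<^sub>R x = (abs_l2 (Kf (\<lambda>t. c *\<^sub>R \<phi> t) (\<lambda>t. c *\<^sub>R \<phi>' t)), g \<bullet> j (c *\<^sub>R \<phi> T))"
      unfolding x Ksc by (simp add: scaleR_abs_l2 sqi_Kf ad j_lin)
    then show "c *\<^sub>R x \<in> R" using RI[OF adm_scale[OF ad]] by simp
  qed
  moreover have "0 \<le> C * norm g" using C0 by simp
  moreover have "\<bar>l\<bar> \<le> C * norm g * norm x" if xl: "(x, l) \<in> R" for x l
  proof -
    obtain \<phi> \<phi>' where ad: "adm \<phi> \<phi>'" and x: "x = abs_l2 (Kf \<phi> \<phi>')" "l = g \<bullet> j (\<phi> T)"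
      using xl unfolding R_def by blast
    have "\<bar>l\<bar> \<le> norm g * norm (j (\<phi> T))" unfolding x by (rule Cauchy_Schwarz_ineq2)
    also have "\<dots> \<le> norm g * (C * norm x)" unfolding x C_def by (intro mult_left_mono a_priori[OF ad]) simp
    finally show ?thesis by (simp add: mult_ac)
  qed
  ultimately obtain u where u: "norm u \<le> C * norm g" "u \<in> closure (fst ` R)" "\<And>x l. (x, l) \<in> R \<Longrightarrow> l = u \<bullet> x"
    by (rule riesz_linear_relation) blast+
  \<comment> \<open>\<open>Kf \<phi> \<phi>'\<close> vanishes outside the interval, so cutting off
    there changes no pairing and does not increase the norm.\<close>
  define p where "p t = indicator {0<..<T} t *\<^sub>R rep_l2 u t" for t
  have ru: "sqi (rep_l2 u)" by (rule sqi_rep_l2)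
  have ps: "sqi p" unfolding p_def[abs_def] by (rule sqi_indicator_mult[OF ru]) simp
  have p: "sqi_on T p" unfolding sqi_on_def using ps by (simp add: p_def)
  have "(LINT t|lborel. (norm (p t))\<^sup>2) \<le> (LINT t|lborel. (norm (rep_l2 u t))\<^sup>2)"
    by (intro integral_mono sqiD(2)[OF ps] sqiD(2)[OF ru]) (simp add: p_def indicator_def)
  then have "sqrt (LINT t|lborel. (norm (p t))\<^sup>2) \<le> sqrt (LINT t|lborel. (norm (rep_l2 u t))\<^sup>2)"
    by (rule real_sqrt_le_mono)
  also have "\<dots> = norm u" using norm_abs_l2[OF ru] by simp
  finally have pn: "sqrt (LINT t|lborel. (norm (p t))\<^sup>2) \<le> C * norm g" using u(1) by linarith
  have eq: "integrable lborel (\<lambda>t. j (p t) \<bullet> j (\<phi>' t) + a t (p t) (\<phi> t)) \<and>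
      (LINT t|lborel. j (p t) \<bullet> j (\<phi>' t) + a t (p t) (\<phi> t)) = g \<bullet> j (\<phi> T)" if ad: "adm \<phi> \<phi>'" for \<phi> \<phi>'
  proof -
    have e: "(\<lambda>t. rep_l2 u t \<bullet> Kf \<phi> \<phi>' t) = (\<lambda>t. j (p t) \<bullet> j (\<phi>' t) + a t (p t) (\<phi> t))"
    proof
      fix t show "rep_l2 u t \<bullet> Kf \<phi> \<phi>' t = j (p t) \<bullet> j (\<phi>' t) + a t (p t) (\<phi> t)"
        using linear_0[OF a_left] by (cases "t \<in> {0<..<T}") (simp_all add: p_def Kf_def kap j_lin)
    qed
    have "g \<bullet> j (\<phi> T) = u \<bullet> abs_l2 (Kf \<phi> \<phi>')" by (rule u(3)[OF RI[OF ad]])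
    also have "\<dots> = (LINT t|lborel. rep_l2 u t \<bullet> Kf \<phi> \<phi>' t)"
      using inner_abs_l2[OF ru sqi_Kf[OF ad]] by simp
    finally show ?thesis using sqi_inner[OF ru sqi_Kf[OF ad]] unfolding e by simp
  qed
  show ?thesis by (rule that[OF p pn[unfolded C_def] eq])
qed

text \<open>This \<open>v\<close> will be the time derivative of \<open>p\<close>; its pointwise
  bound controls the second half of the norm of W(V).\<close>

lemma form_representation:
  assumes p: "sqi_on T p"
  obtains v where "sqi_on T v" "\<And>t x. v t \<bullet> x = a t (p t) x" "\<And>t. norm (v t) \<le> M * norm (p t)"
proof -
  define v where "v t = riesz (\<lambda>x. a t (p t) x)" for t
  have bd: "\<bar>a t (p t) x\<bar> \<le> M * norm (p t) * norm x" for t x by (rule a_bound)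
  have r: "x \<bullet> v t = a t (p t) x" "norm (v t) \<le> M * norm (p t)" for t x
    unfolding v_def using riesz[OF a_right _ bd] M by simp_all
  have vx: "v t \<bullet> x = a t (p t) x" for t x using r(1) by (simp add: inner_commute)
  note ps = sqi_onD(1)[OF p]
  have vm: "v \<in> borel_measurable borel"
    by (rule borel_measurable_weak) (simp add: vx a_meas sqiD(1)[OF ps])
  have "sqi v"
  proof (rule sqi_bound[OF vm])
    show "integrable lborel (\<lambda>t. M\<^sup>2 * (norm (p t))\<^sup>2)" using sqiD(2)[OF ps] by simp
    show "AE t in lborel. (norm (v t))\<^sup>2 \<le> M\<^sup>2 * (norm (p t))\<^sup>2"
      using power_mono[OF r(2) norm_ge_zero, of _ 2] by (simp add: power_mult_distrib)
  qed
  moreover have "v t = 0" if "t \<notin> {0<..<T}" for t using r(2)[of t] sqi_onD(2)[OF p that] by simp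
  ultimately have "sqi_on T v" by (simp add: sqi_on_def)
  then show ?thesis using vx r(2) by (rule that)
qed

text \<open>Test functions with compact support in the open interval yield the equation. The test
  function \<open>t *\<^sub>R x\<close>, which does not vanish at \<open>T\<close>, yields the
  terminal value after comparison with the primitive formula for the continuous
  representative.\<close>

theorem evolution_exists:
  obtains p v z where "sqi_on T p" "sqi_on T v" "wderiv T p v" "\<And>t x. v t \<bullet> x = a t (p t) x"
    "\<And>t. norm (v t) \<le> M * norm (p t)"
    "sqrt (LINT t|lborel. (norm (p t))\<^sup>2) \<le> sqrt (exp (2 * \<mu> * T) / (2 * \<alpha>)) * norm g"
    "continuous_on {0..T} z" "AE t in lborel. t \<in> {0<..<T} \<longrightarrow> z t = j (p t)" "z T = g"
proof -
  obtain p where p: "sqi_on T p"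
    and pn: "sqrt (LINT t|lborel. (norm (p t))\<^sup>2) \<le> sqrt (exp (2 * \<mu> * T) / (2 * \<alpha>)) * norm g"
    and eq: "\<And>\<phi> \<phi>'. adm \<phi> \<phi>' \<Longrightarrow> integrable lborel (\<lambda>t. j (p t) \<bullet> j (\<phi>' t) + a t (p t) (\<phi> t)) \<and>
      (LINT t|lborel. j (p t) \<bullet> j (\<phi>' t) + a t (p t) (\<phi> t)) = g \<bullet> j (\<phi> T)"
    using lions by blast
  obtain v where v: "sqi_on T v" and va: "\<And>t x. v t \<bullet> x = a t (p t) x" and vn: "\<And>t. norm (v t) \<le> M * norm (p t)"
    using form_representation[OF p] by blast
  have jpi: "integrable lborel (\<lambda>t. j (p t) \<bullet> c)" for c
    using sqi_on_integrable[OF sqi_on_j[OF p]] by simp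
  have vxi: "integrable lborel (\<lambda>t. v t \<bullet> x)" for x using sqi_on_integrable[OF v] by simp
  have wd: "wderiv T p v"
    unfolding wderiv_def
  proof (intro allI ballI)
    fix x \<theta> assume \<theta>: "\<theta> \<in> test_functions {0<..<T}"
    have "adm (\<lambda>t. \<theta> t *\<^sub>R x) (\<lambda>t. deriv \<theta> t *\<^sub>R x)"
      by (rule adm_separated[OF smooth_has_deriv[OF test_smooth[OF \<theta>]]
            smooth_continuous_on[OF smooth_deriv[OF test_smooth[OF \<theta>]]] test_outside[OF \<theta>]]) simp
    from eq[OF this]
    have "(LINT t|lborel. (j (p t) \<bullet> j x) * deriv \<theta> t + (v t \<bullet> x) * \<theta> t) = g \<bullet> j (\<theta> T *\<^sub>R x)"
      by (simp add: va[symmetric] j_lin mult.commute)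
    also have "\<theta> T = 0" by (rule test_outside[OF \<theta>]) simp
    finally show "(LINT t|lborel. (j (p t) \<bullet> j x) * deriv \<theta> t) = - (LINT t|lborel. (v t \<bullet> x) * \<theta> t)"
      using integrable_mult_test[OF jpi test_deriv[OF \<theta>]] integrable_mult_test[OF vxi \<theta>]
      by (simp add: j_lin)
  qed
  obtain z where z: "continuous_on {0..T} z" "AE t in lborel. t \<in> {0<..<T} \<longrightarrow> z t = j (p t)"
    and zw: "\<And>s t \<phi>. s \<in> {0..T} \<Longrightarrow> t \<in> {0..T} \<Longrightarrow> (z t - z s) \<bullet> j \<phi> = (prim 0 v t - prim 0 v s) \<bullet> \<phi>"
    by (rule cont_representative[OF T p v wd]) blast
  have "z T = g"
  proof -
    have "(z T - g) \<bullet> j x = 0" for x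
    proof -
      have "adm (\<lambda>t. t *\<^sub>R x) (\<lambda>t. 1 *\<^sub>R x)" by (rule adm_separated) (auto intro!: derivative_eq_intros)
      from eq[OF this] have ie: "integrable lborel (\<lambda>t. j (p t) \<bullet> j x + (v t \<bullet> x) * t)"
        and e: "(LINT t|lborel. j (p t) \<bullet> j x + (v t \<bullet> x) * t) = T * (g \<bullet> j x)"
        by (simp_all add: va[symmetric] j_lin mult.commute)
      have vti: "integrable lborel (\<lambda>t. (v t \<bullet> x) * t)"
        using Bochner_Integration.integrable_diff[OF ie jpi[of "j x"]] by simp
      \<comment> \<open>The constant in \<open>z t \<bullet> j x = c + prim 0 (\<lambda>t. v t
        \<bullet> x) t\<close>, read off at \<open>t = T\<close>.\<close>
      define c where "c = z T \<bullet> j x - prim 0 (\<lambda>t. v t \<bullet> x) T"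
      have cT: "c = z T \<bullet> j x - (LINT t|lborel. v t \<bullet> x)"
        unfolding c_def by (subst prim_end[where a=0 and b=T and g="\<lambda>t. v t \<bullet> x"]) (use sqi_onD(2)[OF v] in auto)
      have "(LINT t|lborel. j (p t) \<bullet> j x) = (LINT t|lborel. indicator {0<..T} t * c + indicator {0<..T} t * (prim 0 (\<lambda>t. v t \<bullet> x) t * 1))"
      proof (rule integral_cong_AE)
        have [measurable]: "prim 0 (\<lambda>t. v t \<bullet> x) \<in> borel_measurable borel"
          by (rule borel_measurable_continuous_onI) (rule prim_continuous[OF vxi])
        show "(\<lambda>t. j (p t) \<bullet> j x) \<in> borel_measurable lborel" using jpi by (rule borel_measurable_integrable)
        show "(\<lambda>t. indicator {0<..T} t * c + indicator {0<..T} t * (prim 0 (\<lambda>t. v t \<bullet> x) t * 1)) \<in> borel_measurable lborel"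
          by measurable
        show "AE t in lborel. j (p t) \<bullet> j x = indicator {0<..T} t * c + indicator {0<..T} t * (prim 0 (\<lambda>t. v t \<bullet> x) t * 1)"
          using z(2) AE_lborel_singleton[of T]
        proof eventually_elim
          case (elim t)
          show ?case
          proof (cases "t \<in> {0<..<T}")
            case True
            have "(z T - z t) \<bullet> j x = (prim 0 v T - prim 0 v t) \<bullet> x" using True by (intro zw) simp_all
            then have "z t \<bullet> j x = c + prim 0 (\<lambda>t. v t \<bullet> x) t"
              unfolding c_def prim_inner[OF sqi_on_integrable[OF v], symmetric] by (simp add: inner_diff_left)
            then show ?thesis using True elim(1) by simp
          next
            case False
            then have "t \<notin> {0<..T}" using elim(2) by auto
            then show ?thesis using sqi_onD(2)[OF p False] by (simp add: j_lin)
          qed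
        qed
      qed
      also have "\<dots> = T * c + (T * (LINT t|lborel. v t \<bullet> x) - (LINT t|lborel. (v t \<bullet> x) * t))"
      proof -
        have i1: "integrable lborel (\<lambda>t. indicator {0<..T} t * c)"
          using T by (intro integrable_mult_left integrable_real_indicator) simp_all
        have "integrable lborel (\<lambda>t. indicator {0..T} t *\<^sub>R prim 0 (\<lambda>t. v t \<bullet> x) t)"
          by (rule borel_integrable_compact[OF compact_Icc prim_continuous[OF vxi]])
        then have "integrable lborel (\<lambda>t. indicator {0<..T} t * (indicator {0..T} t *\<^sub>R prim 0 (\<lambda>t. v t \<bullet> x) t))"
          by (rule integrable_indicator_mult) simp
        moreover have "(\<lambda>t. indicator {0<..T} t * (indicator {0..T} t *\<^sub>R prim 0 (\<lambda>t. v t \<bullet> x) t))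
            = (\<lambda>t. indicator {0<..T} t * (prim 0 (\<lambda>t. v t \<bullet> x) t * 1))"
          by (intro ext) (auto simp: indicator_def)
        ultimately have i2: "integrable lborel (\<lambda>t. indicator {0<..T} t * (prim 0 (\<lambda>t. v t \<bullet> x) t * 1))" by (simp only:)
        have "(LINT t|lborel. indicator {0<..T} t * (prim 0 (\<lambda>t. v t \<bullet> x) t * 1))
          = T * (LINT s|lborel. v s \<bullet> x) - (LINT s|lborel. (v s \<bullet> x) * s)"
          by (rule integral_prim_by_parts[OF vxi _ T, where \<theta>="\<lambda>t. t"])
            (use sqi_onD(2)[OF v] in \<open>auto intro!: derivative_eq_intros\<close>)
        then show ?thesis using T unfolding Bochner_Integration.integral_add[OF i1 i2] by simp
      qed
      finally have "T * (g \<bullet> j x) = T * c + T * (LINT t|lborel. v t \<bullet> x)"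
        using e jpi[of "j x"] vti by simp
      then have "T * (g \<bullet> j x) = T * (z T \<bullet> j x)" unfolding cT by (simp add: algebra_simps)
      then show ?thesis using T by (simp add: inner_diff_left)
    qed
    then have "z T - g = 0" by (rule dense)
    then show ?thesis by simp
  qed
  then show ?thesis by (rule that[OF p v wd va vn pn z])
qed

text \<open>The energy identity between \<open>t\<close> and \<open>T\<close> and the Garding
  inequality give \<open>Y t \<le> 2 * \<mu> * F t\<close>, a backward Gronwall inequality for the
  tail integral \<open>F\<close>. The weight makes \<open>E\<close> nondecreasing with value zero at
  \<open>T\<close>, so \<open>F\<close> cannot be positive.\<close>

theorem evolution_unique:
  assumes w: "sqi_on T w" and v: "sqi_on T v" and d: "wderiv T w v"
    and eq: "AE t in lborel. t \<in> {0<..<T} \<longrightarrow> (\<forall>x. v t \<bullet> x = a t (w t) x)"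
    and z: "continuous_on {0..T} z" "AE t in lborel. t \<in> {0<..<T} \<longrightarrow> z t = j (w t)" "z T = 0"
    and t: "t \<in> {0..T}"
  shows "z t = 0"
proof -
  obtain y where y: "continuous_on {0..T} y" "AE t in lborel. t \<in> {0<..<T} \<longrightarrow> y t = j (w t)"
    and en: "\<And>s t. s \<in> {0..T} \<Longrightarrow> t \<in> {0..T} \<Longrightarrow> (norm (y t))\<^sup>2 - (norm (y s))\<^sup>2
      = prim 0 (\<lambda>t. 2 * (v t \<bullet> w t)) t - prim 0 (\<lambda>t. 2 * (v t \<bullet> w t)) s"
    by (rule cont_representative[OF T w v d]) blast
  \<comment> \<open>The energy identity comes with its own representative, which agrees with the
    given one by continuity.\<close>
  have "AE t in lborel. t \<in> {0<..<T} \<longrightarrow> y t = z t" using y(2) z(2) by eventually_elim simp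
  then have yz: "y t = z t" if "t \<in> {0..T}" for t by (rule continuous_AE_eq[OF T y(1) z(1) _ that])
  define Y where "Y t = (norm (z t))\<^sup>2" for t
  have Yc: "continuous_on {0..T} Y" unfolding Y_def by (intro continuous_intros z(1))
  have gi: "integrable lborel (\<lambda>t. 2 * (v t \<bullet> w t))"
    using sqi_inner[OF sqi_onD(1)[OF v] sqi_onD(1)[OF w]] by simp
  define F where "F t = integral {t..T} Y" for t
  have bound: "Y t \<le> 2 * \<mu> * F t" if t: "t \<in> {0..T}" for t
  proof -
    have tT: "t \<le> T" "0 \<le> t" using t by simp_all
    have "- Y t = prim 0 (\<lambda>t. 2 * (v t \<bullet> w t)) T - prim 0 (\<lambda>t. 2 * (v t \<bullet> w t)) t"
      using en[OF t, of T] yz[OF t] yz[of T] z(3) T by (simp add: Y_def)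
    also have "\<dots> = (LINT r|lborel. indicator {t<..T} r *\<^sub>R (2 * (v r \<bullet> w r)))"
      by (rule prim_diff[OF gi tT(2) tT(1)])
    finally have 1: "- Y t = (LINT r|lborel. indicator {t<..T} r *\<^sub>R (2 * (v r \<bullet> w r)))" .
    have Yci: "integrable lborel (\<lambda>r. indicator {t..T} r *\<^sub>R Y r)"
      using tT by (intro borel_integrable_compact compact_Icc continuous_on_subset[OF Yc]) auto
    have 2: "(LINT r|lborel. indicator {t..T} r *\<^sub>R Y r) = F t"
      using set_borel_integral_eq_integral(2)[of "{t..T}" Y] Yci
      by (simp add: F_def set_integrable_def set_lebesgue_integral_def)
    have "(LINT r|lborel. (- 2 * \<mu>) * (indicator {t..T} r *\<^sub>R Y r)) \<le> (LINT r|lborel. indicator {t<..T} r *\<^sub>R (2 * (v r \<bullet> w r)))"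
    proof (rule integral_mono_AE)
      show "integrable lborel (\<lambda>r. (- 2 * \<mu>) * (indicator {t..T} r *\<^sub>R Y r))"
        by (rule integrable_mult_right[OF Yci])
      show "integrable lborel (\<lambda>r. indicator {t<..T} r *\<^sub>R (2 * (v r \<bullet> w r)))"
        by (rule integrable_indicator_scaleR[OF gi]) simp
      show "AE r in lborel. (- 2 * \<mu>) * (indicator {t..T} r *\<^sub>R Y r) \<le> indicator {t<..T} r *\<^sub>R (2 * (v r \<bullet> w r))"
        using eq z(2) AE_lborel_singleton[of T] AE_lborel_singleton[of t]
      proof eventually_elim
        case (elim r)
        show ?case
        proof (cases "r \<in> {t<..<T}")
          case True
          then have r: "r \<in> {0<..<T}" using tT by simp
          have "\<alpha> * (norm (w r))\<^sup>2 - \<mu> * (norm (j (w r)))\<^sup>2 \<le> a r (w r) (w r)" by (rule coercive)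
          moreover have "0 \<le> \<alpha> * (norm (w r))\<^sup>2" using \<alpha> by simp
          moreover have "v r \<bullet> w r = a r (w r) (w r)" using elim(1) r by simp
          moreover have "Y r = (norm (j (w r)))\<^sup>2" using elim(2) r by (simp add: Y_def)
          ultimately have "(- 2 * \<mu>) * Y r \<le> 2 * (v r \<bullet> w r)" by simp
          then show ?thesis using True by simp
        next
          case False
          then have "\<not> (t < r \<and> r < T)" by simp
          then have "\<not> (t \<le> r \<and> r \<le> T)" using elim(3,4) by linarith
          then have "indicator {t..T} r = (0::real)" "indicator {t<..T} r = (0::real)" by auto
          then show ?thesis by (simp only: scaleR_zero_left mult_zero_right order_refl)
        qed
      qed
    qed
    also have "(LINT r|lborel. (- 2 * \<mu>) * (indicator {t..T} r *\<^sub>R Y r)) = (- 2 * \<mu>) * F t"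
      by (simp only: integral_mult_right_zero 2)
    finally show ?thesis using 1 by simp
  qed
  have F0: "0 \<le> F t" if "t \<in> {0..T}" for t
    unfolding F_def
    by (rule Henstock_Kurzweil_Integration.integral_nonneg[OF integrable_continuous_real[OF continuous_on_subset[OF Yc]]])
      (use that in \<open>auto simp: Y_def\<close>)
  have Fd: "(F has_field_derivative - Y t) (at t within {0..T})" if "t \<in> {0..T}" for t
    unfolding F_def[abs_def] by (rule integral_has_real_derivative'[OF Yc that])
  define E where "E t = exp (2 * \<mu> * t) * F t" for t
  have Ed: "(E has_field_derivative exp (2 * \<mu> * t) * (2 * \<mu> * F t - Y t)) (at t within {0..T})" if "t \<in> {0..T}" for t
  proof -
    have "((\<lambda>t. exp (2 * \<mu> * t)) has_field_derivative exp (2 * \<mu> * t) * (2 * \<mu>)) (at t within {0..T})"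
      by (auto intro!: derivative_eq_intros)
    from DERIV_mult[OF this Fd[OF that]] show ?thesis unfolding E_def[abs_def] by (simp add: algebra_simps)
  qed
  have "E t \<le> E T"
  proof (cases "t = T")
    case False
    then have tT: "t < T" using t by simp
    have c: "continuous_on {t..T} E"
      using t by (intro continuous_on_subset[OF DERIV_continuous_on[OF Ed]]) auto
    have d: "(E has_field_derivative exp (2 * \<mu> * x) * (2 * \<mu> * F x - Y x)) (at x)"
      and nn: "2 * \<mu> * F x - Y x \<ge> 0" if x: "t < x" "x < T" for x
    proof -
      have x': "x \<in> {0..T}" using x t by auto
      have "at x within {0..T} = at x" by (rule at_within_Icc_at) (use x t in auto)
      then show "(E has_field_derivative exp (2 * \<mu> * x) * (2 * \<mu> * F x - Y x)) (at x)" using Ed[OF x'] by simp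
      show "2 * \<mu> * F x - Y x \<ge> 0" using bound[OF x'] by simp
    qed
    have "E differentiable (at x)" if "t < x" "x < T" for x
      using d[OF that] real_differentiable_def by blast
    from MVT[OF tT c this] obtain l \<xi> where \<xi>: "t < \<xi>" "\<xi> < T" "(E has_field_derivative l) (at \<xi>)"
      "E T - E t = (T - t) * l" by blast
    have "l = exp (2 * \<mu> * \<xi>) * (2 * \<mu> * F \<xi> - Y \<xi>)" by (rule DERIV_unique[OF \<xi>(3) d[OF \<xi>(1,2)]])
    then have "0 \<le> l" using nn[OF \<xi>(1,2)] by simp
    then have "0 \<le> (T - t) * l" using tT by simp
    then show ?thesis using \<xi>(4) by linarith
  qed simp
  also have "E T = 0" by (simp add: E_def F_def)
  finally have "F t \<le> 0" by (simp add: E_def mult_le_0_iff)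
  then have "Y t \<le> 0" using bound[OF t] F0[OF t] \<mu> by simp
  then show ?thesis by (simp add: Y_def)
qed

end

section \<open>The concrete spaces as Hilbert spaces\<close>

lemma lebesgue_measurable_AE:
  fixes f g :: "real \<Rightarrow> 'b::topological_space"
  assumes g: "g \<in> borel_measurable lebesgue" and ae: "AE x in lborel. f x = g x"
  shows "f \<in> borel_measurable lebesgue"
proof (rule measurableI)
  fix A :: "'b set" assume A: "A \<in> sets borel"
  show "f -` A \<inter> space lebesgue \<in> sets lebesgue"
  proof (rule completion.in_sets_AE)
    show "g -` A \<inter> space lebesgue \<in> sets lebesgue" using g A by (rule measurable_sets)
    show "AE x in lebesgue. x \<in> g -` A \<inter> space lebesgue \<longleftrightarrow> x \<in> f -` A \<inter> space lebesgue"
      using AE_completion[OF ae] by eventually_elim simp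
  qed simp
qed simp

section \<open>Translation of \<open>H\<close> into \<open>real l2\<close>\<close>

lemma H_iff: "f \<in> H \<longleftrightarrow> f \<in> borel_measurable lebesgue \<and> integrable lebesgue (\<lambda>x. (f x)\<^sup>2)"
  by (simp add: L2_def lebesgue_on_UNIV_eq)

lemma H_obtain:
  assumes "f \<in> H" shows "\<exists>g. sqi g \<and> (AE x in lborel. f x = g x)"
proof -
  have f: "f \<in> borel_measurable lebesgue" "integrable lebesgue (\<lambda>x. (f x)\<^sup>2)" using assms by (auto simp: H_iff)
  obtain g where g: "g \<in> borel_measurable lborel" "AE x in lborel. f x = g x"
    using completion_ex_borel_measurable_real[OF f(1)] by blast
  have g': "g \<in> borel_measurable borel" using g(1) by simp
  have gl: "g \<in> borel_measurable lebesgue" using g(1) by (rule measurable_completion)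
  have "AE x in lebesgue. (f x)\<^sup>2 = (g x)\<^sup>2" using AE_completion[OF g(2)] by eventually_elim simp
  then have "integrable lebesgue (\<lambda>x. (g x)\<^sup>2)"
    using f gl by (subst integrable_cong_AE[where g="\<lambda>x. (f x)\<^sup>2"]) (auto elim: eventually_mono)
  then have "integrable lborel (\<lambda>x. (g x)\<^sup>2)"
    by (subst (asm) integrable_completion) (simp_all add: g' borel_measurable_power)
  then show ?thesis using g' g(2) by (auto simp: sqi_def)
qed

lemma H_I:
  assumes g: "sqi g" and ae: "AE x in lborel. f x = g x" shows "f \<in> H"
proof -
  have gb: "g \<in> borel_measurable lborel" using sqiD(1)[OF g] by simp
  have gl: "g \<in> borel_measurable lebesgue" using gb by (rule measurable_completion)
  have fl: "f \<in> borel_measurable lebesgue" by (rule lebesgue_measurable_AE[OF gl ae])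
  have "integrable lebesgue (\<lambda>x. (g x)\<^sup>2)"
    by (subst integrable_completion) (use sqiD[OF g] in simp_all)
  moreover have "AE x in lebesgue. (f x)\<^sup>2 = (g x)\<^sup>2" using AE_completion[OF ae] by eventually_elim simp
  ultimately have "integrable lebesgue (\<lambda>x. (f x)\<^sup>2)"
    using fl gl by (subst integrable_cong_AE[where g="\<lambda>x. (g x)\<^sup>2"]) simp_all
  then show ?thesis using fl by (simp add: H_iff)
qed

definition toH :: "(real \<Rightarrow> real) \<Rightarrow> real l2" where
  "toH f = abs_l2 (SOME g. sqi g \<and> (AE x in lborel. f x = g x))"

lemma toH_eq:
  assumes g: "sqi g" and ae: "AE x in lborel. f x = g x" shows "toH f = abs_l2 g"
proof -
  define k where "k = (SOME g. sqi g \<and> (AE x in lborel. f x = g x))"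
  have k: "sqi k \<and> (AE x in lborel. f x = k x)" unfolding k_def by (rule someI[of _ g]) (use g ae in simp)
  then have "AE x in lborel. f x = k x" by simp
  then have "AE x in lborel. k x = g x" using ae by eventually_elim simp
  then show ?thesis unfolding toH_def k_def[symmetric] using k g by (intro abs_l2_eqI) auto
qed

lemma rep_toH: assumes "f \<in> H" shows "AE x in lborel. rep_l2 (toH f) x = f x"
proof -
  obtain g where g: "sqi g" "AE x in lborel. f x = g x" using H_obtain[OF assms] by blast
  show ?thesis unfolding toH_eq[OF g] using rep_abs_l2[OF g(1)] g(2) by eventually_elim simp
qed

lemma rep_l2_H: "rep_l2 u \<in> H" by (rule H_I[OF sqi_rep_l2[of u]]) simp

lemma toH_rep: "toH (rep_l2 u) = u" using toH_eq[OF sqi_rep_l2, of "rep_l2 u" u] by simp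

lemma toH_AE_eq: assumes "f \<in> H" "AE x in lborel. f x = g x" shows "g \<in> H" "toH f = toH g"
proof -
  obtain k where k: "sqi k" "AE x in lborel. f x = k x" using H_obtain[OF assms(1)] by blast
  have gk: "AE x in lborel. g x = k x" using assms(2) k(2) by eventually_elim simp
  show "g \<in> H" by (rule H_I[OF k(1) gk])
  show "toH f = toH g" unfolding toH_eq[OF k] toH_eq[OF k(1) gk] ..
qed

lemma toH_eq_iff: assumes "f \<in> H" "g \<in> H" shows "toH f = toH g \<longleftrightarrow> (AE x in lborel. f x = g x)"
proof
  assume e: "toH f = toH g"
  show "AE x in lborel. f x = g x"
    using rep_toH[OF assms(1)] rep_toH[OF assms(2)] unfolding e by eventually_elim simp
qed (rule toH_AE_eq(2)[OF assms(1)])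

lemma H_add: assumes "f \<in> H" "g \<in> H" shows "(\<lambda>x. f x + g x) \<in> H" "toH (\<lambda>x. f x + g x) = toH f + toH g"
proof -
  obtain k where k: "sqi k" "AE x in lborel. f x = k x" using H_obtain[OF assms(1)] by blast
  obtain l where l: "sqi l" "AE x in lborel. g x = l x" using H_obtain[OF assms(2)] by blast
  have s: "sqi (\<lambda>x. k x + l x)" by (rule sqi_add[OF k(1) l(1)])
  have ae: "AE x in lborel. f x + g x = k x + l x" using k(2) l(2) by eventually_elim simp
  show "(\<lambda>x. f x + g x) \<in> H" by (rule H_I[OF s ae])
  show "toH (\<lambda>x. f x + g x) = toH f + toH g"
    unfolding toH_eq[OF s ae] toH_eq[OF k] toH_eq[OF l] by (rule plus_abs_l2[OF k(1) l(1), symmetric])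
qed

lemma H_scale: assumes "f \<in> H" shows "(\<lambda>x. c * f x) \<in> H" "toH (\<lambda>x. c * f x) = c *\<^sub>R toH f"
proof -
  obtain k where k: "sqi k" "AE x in lborel. f x = k x" using H_obtain[OF assms(1)] by blast
  have s: "sqi (\<lambda>x. c * k x)" using sqi_scaleR[OF k(1), of c] by simp
  have ae: "AE x in lborel. c * f x = c * k x" using k(2) by eventually_elim simp
  show "(\<lambda>x. c * f x) \<in> H" by (rule H_I[OF s ae])
  show "toH (\<lambda>x. c * f x) = c *\<^sub>R toH f"
    unfolding toH_eq[OF s ae] toH_eq[OF k] using scaleR_abs_l2[OF k(1), of c] by simp
qed

lemma H_diff: assumes "f \<in> H" "g \<in> H" shows "(\<lambda>x. f x - g x) \<in> H" "toH (\<lambda>x. f x - g x) = toH f - toH g"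
  using H_add[OF assms(1) H_scale(1)[OF assms(2), of "-1"]] H_scale(2)[OF assms(2), of "-1"] by simp_all

lemma inner_H_eq: assumes "f \<in> H" "g \<in> H" shows "inner_H f g = toH f \<bullet> toH g"
proof -
  obtain k where k: "sqi k" "AE x in lborel. f x = k x" using H_obtain[OF assms(1)] by blast
  obtain l where l: "sqi l" "AE x in lborel. g x = l x" using H_obtain[OF assms(2)] by blast
  have m: "k \<in> borel_measurable lborel" "l \<in> borel_measurable lborel" using sqiD(1)[OF k(1)] sqiD(1)[OF l(1)] by simp_all
  have "inner_H f g = (LINT x|lebesgue. k x * l x)"
    unfolding inner_H_def
  proof (rule integral_cong_AE)
    show "(\<lambda>x. f x * g x) \<in> borel_measurable lebesgue" using assms by (simp add: H_iff borel_measurable_times)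
    show "(\<lambda>x. k x * l x) \<in> borel_measurable lebesgue"
      by (intro borel_measurable_times measurable_completion m)
    show "AE x in lebesgue. f x * g x = k x * l x"
      using AE_completion[OF k(2)] AE_completion[OF l(2)] by eventually_elim simp
  qed
  also have "\<dots> = (LINT x|lborel. k x * l x)"
    by (rule integral_completion) (intro borel_measurable_times m)
  also have "\<dots> = toH f \<bullet> toH g"
    unfolding toH_eq[OF k] toH_eq[OF l] inner_abs_l2[OF k(1) l(1)] by simp
  finally show ?thesis .
qed

lemma norm_H_eq: "f \<in> H \<Longrightarrow> norm_H f = norm (toH f)"
  by (simp add: norm_H_def inner_H_eq norm_eq_sqrt_inner)

lemma test_sqi: assumes "\<theta> \<in> test_functions \<Omega>" shows "sqi \<theta>"
proof -
  obtain B where B: "\<And>x. \<bar>\<theta> x\<bar> \<le> B" using test_bounded[OF assms] by blast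
  show ?thesis
  proof (rule sqi_bound)
    show "\<theta> \<in> borel_measurable borel" by (rule smooth_measurable[OF test_smooth[OF assms]])
    show "integrable lborel (\<lambda>x. B * norm (\<theta> x))" using test_integrable[OF assms] by simp
    show "AE x in lborel. (norm (\<theta> x))\<^sup>2 \<le> B * norm (\<theta> x)"
      unfolding power2_eq_square real_norm_def by (intro AE_I2 mult_right_mono B) simp
  qed
qed

text \<open>Makes the choice in \<open>weak_deriv\<close> harmless. The difference of two candidates
  is orthogonal to all test functions, so the fundamental lemma applies to it.\<close>

lemma weak_deriv_unique:
  assumes O: "open \<Omega>" and f1: "has_weak_deriv \<Omega> f g1" and f2: "has_weak_deriv \<Omega> f g2"
  shows "AE x in lborel. x \<in> \<Omega> \<longrightarrow> g1 x = g2 x"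
proof -
  have Om: "\<Omega> \<in> sets lebesgue" using O by (simp add: lborelD)
  have loc: "integrable lebesgue (\<lambda>x. indicator K x * g x)" if g: "locally_integrable \<Omega> g" and K: "compact K" "K \<subseteq> \<Omega>" for g K
  proof -
    have "integrable (lebesgue_on K) g" using g K by (simp add: locally_integrable_def)
    moreover have "K \<inter> space lebesgue \<in> sets lebesgue" using K(1) by (simp add: borel_compact)
    ultimately show ?thesis by (simp add: integrable_restrict_space)
  qed
  have l1: "locally_integrable \<Omega> g1" and l2: "locally_integrable \<Omega> g2"
    using f1 f2 by (auto simp: has_weak_deriv_def)
  have ti: "integrable lebesgue (\<lambda>x. indicator \<Omega> x * (g x * \<theta> x))" and
    te: "(LINT x|lebesgue_on \<Omega>. g x * \<theta> x) = (LINT x|lebesgue. indicator \<Omega> x * (g x * \<theta> x))"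
    if g: "locally_integrable \<Omega> g" and t: "\<theta> \<in> test_functions \<Omega>" for g \<theta>
  proof -
    obtain K where K: "compact K" "K \<subseteq> \<Omega>" "\<And>x. x \<notin> K \<Longrightarrow> \<theta> x = 0" using t unfolding test_functions_iff by blast
    obtain B where B: "0 \<le> B" "\<And>x. \<bar>\<theta> x\<bar> \<le> B" using test_bounded[OF t] by blast
    have e: "(\<lambda>x. indicator \<Omega> x * (g x * \<theta> x)) = (\<lambda>x. (indicator K x * g x) * \<theta> x)"
    proof
      fix x show "indicator \<Omega> x * (g x * \<theta> x) = (indicator K x * g x) * \<theta> x"
        using K(2) K(3)[of x] by (cases "x \<in> K") auto
    qed
    have \<theta>m: "\<theta> \<in> borel_measurable lebesgue"
      using smooth_measurable[OF test_smooth[OF t]] by (intro measurable_completion) simp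
    show "integrable lebesgue (\<lambda>x. indicator \<Omega> x * (g x * \<theta> x))"
      unfolding e
    proof (rule Bochner_Integration.integrable_bound)
      show "integrable lebesgue (\<lambda>x. norm (indicator K x * g x) * B)"
        using loc[OF g K(1,2)] by (intro integrable_mult_left integrable_norm)
      show "(\<lambda>x. (indicator K x * g x) * \<theta> x) \<in> borel_measurable lebesgue"
        by (intro borel_measurable_times borel_measurable_integrable[OF loc[OF g K(1,2)]] \<theta>m)
      show "AE x in lebesgue. norm (indicator K x * g x * \<theta> x) \<le> norm (norm (indicator K x * g x) * B)"
        using B by (intro AE_I2) (simp add: abs_mult mult_left_mono)
    qed
    show "(LINT x|lebesgue_on \<Omega>. g x * \<theta> x) = (LINT x|lebesgue. indicator \<Omega> x * (g x * \<theta> x))"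
      using Om by (subst integral_restrict_space) simp_all
  qed
  have "AE x in lborel. x \<in> \<Omega> \<longrightarrow> indicator \<Omega> x * (g1 x - g2 x) = 0"
  proof (rule fundamental_lemma[OF O])
    fix a b :: real assume ab: "{a..b} \<subseteq> \<Omega>"
    have "(\<lambda>x. indicator {a..b} x * (indicator \<Omega> x * (g1 x - g2 x)))
      = (\<lambda>x. indicator {a..b} x * g1 x - indicator {a..b} x * g2 x)"
      using ab by (intro ext) (auto simp: indicator_def)
    then show "integrable lebesgue (\<lambda>x. indicator {a..b} x * (indicator \<Omega> x * (g1 x - g2 x)))"
      using loc[OF l1 compact_Icc ab] loc[OF l2 compact_Icc ab] by simp
  next
    fix \<theta> assume t: "\<theta> \<in> test_functions \<Omega>"
    have "(LINT x|lebesgue_on \<Omega>. g1 x * \<theta> x) = (LINT x|lebesgue_on \<Omega>. g2 x * \<theta> x)"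
      using f1 f2 t by (simp add: has_weak_deriv_def)
    then have "(LINT x|lebesgue. indicator \<Omega> x * (g1 x * \<theta> x)) - (LINT x|lebesgue. indicator \<Omega> x * (g2 x * \<theta> x)) = 0"
      by (simp add: te[OF l1 t] te[OF l2 t])
    then show "(LINT x|lebesgue. indicator \<Omega> x * (g1 x - g2 x) * \<theta> x) = 0"
      unfolding Bochner_Integration.integral_diff[OF ti[OF l1 t] ti[OF l2 t], symmetric]
      by (simp add: algebra_simps)
  qed
  then show ?thesis by eventually_elim simp
qed

lemma H_locally_integrable:
  assumes f: "f \<in> H" shows "locally_integrable UNIV f"
  unfolding locally_integrable_def
proof (intro allI impI)
  fix K :: "real set" assume K: "compact K \<and> K \<subseteq> UNIV"
  have Ks: "K \<in> sets lebesgue" using K by (simp add: borel_compact)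
  have fm: "f \<in> borel_measurable lebesgue" "integrable lebesgue (\<lambda>x. (f x)\<^sup>2)" using f by (auto simp: H_iff)
  have fin: "emeasure lebesgue K < \<infinity>" using fmeasurableD2[OF lmeasurable_compact] K by (simp add: less_top)
  have "integrable lebesgue (\<lambda>x. indicator K x * f x)"
  proof (rule Bochner_Integration.integrable_bound)
    show "integrable lebesgue (\<lambda>x. indicator K x + (f x)\<^sup>2)"
      using fm(2) Ks fin by (intro Bochner_Integration.integrable_add integrable_real_indicator)
    show "(\<lambda>x. indicator K x * f x) \<in> borel_measurable lebesgue"
      using fm(1) Ks by (intro borel_measurable_times borel_measurable_indicator)
    show "AE x in lebesgue. norm (indicator K x * f x) \<le> norm (indicator K x + (f x)\<^sup>2)"
    proof (rule AE_I2)
      fix x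
      have "\<bar>f x\<bar> \<le> 1 + (f x)\<^sup>2"
        using sum_squares_bound[of "\<bar>f x\<bar>" 1] abs_ge_zero[of "f x"] unfolding power_one mult_1_right power2_abs by linarith
      then show "norm (indicator K x * f x) \<le> norm (indicator K x + (f x)\<^sup>2)" by (simp add: indicator_def)
    qed
  qed
  then show "integrable (lebesgue_on K) f" using Ks by (simp add: integrable_restrict_space)
qed

lemma has_weak_deriv_UNIV_iff:
  assumes f: "f \<in> H" and g: "g \<in> H"
  shows "has_weak_deriv UNIV f g \<longleftrightarrow> (\<forall>\<theta>\<in>test_functions UNIV. toH f \<bullet> abs_l2 (deriv \<theta>) = - (toH g \<bullet> abs_l2 \<theta>))"
proof -
  have e: "(LINT x|lebesgue_on UNIV. h x * \<theta> x) = toH h \<bullet> abs_l2 \<theta>" if "h \<in> H" "\<theta> \<in> test_functions UNIV" for h \<theta>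
  proof -
    have s: "sqi \<theta>" by (rule test_sqi[OF that(2)])
    have "\<theta> \<in> H" "toH \<theta> = abs_l2 \<theta>" by (rule H_I[OF s], simp, rule toH_eq[OF s], simp)
    then show ?thesis using inner_H_eq[OF that(1), of \<theta>] by (simp add: inner_H_def lebesgue_on_UNIV_eq)
  qed
  show ?thesis unfolding has_weak_deriv_def
    using H_locally_integrable[OF f] H_locally_integrable[OF g] e[OF f test_deriv] e[OF g] by simp
qed

text \<open>The weak derivative as orthogonality relations between pairs: each test function imposes
  one continuous linear condition, so the graph is closed and inherits completeness from the
  product.\<close>

definition sobolev_graph :: "(real l2 \<times> real l2) set" where
  "sobolev_graph = {(f, g). \<forall>\<theta>\<in>test_functions UNIV. f \<bullet> abs_l2 (deriv \<theta>) = - (g \<bullet> abs_l2 \<theta>)}"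

lemma subspace_sobolev: "subspace sobolev_graph"
  unfolding subspace_def sobolev_graph_def by (auto simp: inner_add_left zero_prod_def)

lemma closed_sobolev: "closed sobolev_graph"
proof -
  have "sobolev_graph = (\<Inter>\<theta>\<in>test_functions UNIV. {z. fst z \<bullet> abs_l2 (deriv \<theta>) = - (snd z \<bullet> abs_l2 \<theta>)})"
    by (auto simp: sobolev_graph_def)
  also have "closed \<dots>" by (intro closed_INT ballI closed_Collect_eq continuous_intros)
  finally show ?thesis .
qed

typedef vq = sobolev_graph morphisms rep_vq abs_vq
  using subspace_0[OF subspace_sobolev] by blast

setup_lifting type_definition_vq

instantiation vq :: real_vector
begin

lift_definition zero_vq :: vq is 0 by (rule subspace_0[OF subspace_sobolev])
lift_definition plus_vq :: "vq \<Rightarrow> vq \<Rightarrow> vq" is "(+)" by (rule subspace_add[OF subspace_sobolev])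
lift_definition minus_vq :: "vq \<Rightarrow> vq \<Rightarrow> vq" is "(-)" by (rule subspace_diff[OF subspace_sobolev])
lift_definition uminus_vq :: "vq \<Rightarrow> vq" is uminus by (rule subspace_neg[OF subspace_sobolev])
lift_definition scaleR_vq :: "real \<Rightarrow> vq \<Rightarrow> vq" is "(*\<^sub>R)" by (rule subspace_scale[OF subspace_sobolev])

instance by standard (transfer; simp add: algebra_simps)+

end

instantiation vq :: real_inner
begin

definition inner_vq :: "vq \<Rightarrow> vq \<Rightarrow> real" where "inner_vq x y = rep_vq x \<bullet> rep_vq y"

definition norm_vq :: "vq \<Rightarrow> real" where "norm_vq x = sqrt (x \<bullet> x)"

definition dist_vq :: "vq \<Rightarrow> vq \<Rightarrow> real" where "dist_vq x y = norm (x - y)"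

definition sgn_vq :: "vq \<Rightarrow> vq" where "sgn_vq x = x /\<^sub>R norm x"

definition uniformity_vq :: "(vq \<times> vq) filter"
  where "uniformity_vq = (INF e\<in>{0 <..}. principal {(x, y). dist x y < e})"

definition open_vq :: "vq set \<Rightarrow> bool"
  where "open_vq S \<longleftrightarrow> (\<forall>x\<in>S. \<forall>\<^sub>F (x', y) in uniformity. x' = x \<longrightarrow> y \<in> S)"

instance
proof
  fix x y z :: vq and r :: real
  show "dist x y = norm (x - y)" by (rule dist_vq_def)
  show "sgn x = x /\<^sub>R norm x" by (rule sgn_vq_def)
  show "(uniformity :: (vq \<times> vq) filter) = (INF e\<in>{0 <..}. principal {(x, y). dist x y < e})"
    by (rule uniformity_vq_def)
  show "open S = (\<forall>x\<in>S. \<forall>\<^sub>F (x', y) in uniformity. x' = x \<longrightarrow> y \<in> S)" for S :: "vq set"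
    by (rule open_vq_def)
  show "norm x = sqrt (x \<bullet> x)" by (rule norm_vq_def)
  show "x \<bullet> y = y \<bullet> x" by (simp add: inner_vq_def inner_commute)
  show "(x + y) \<bullet> z = x \<bullet> z + y \<bullet> z" by (simp add: inner_vq_def plus_vq.rep_eq inner_add_left)
  show "r *\<^sub>R x \<bullet> y = r * (x \<bullet> y)" by (simp add: inner_vq_def scaleR_vq.rep_eq)
  show "0 \<le> x \<bullet> x" by (simp add: inner_vq_def)
  show "(x \<bullet> x = 0) = (x = 0)" by (simp add: inner_vq_def zero_vq.rep_eq flip: rep_vq_inject)
qed

end

lemma norm_rep_vq: "norm (rep_vq x) = norm x"
  by (simp add: norm_eq_sqrt_inner inner_vq_def)

lemma dist_rep_vq: "dist (rep_vq x) (rep_vq y) = dist x y"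
  unfolding dist_norm minus_vq.rep_eq[symmetric] norm_rep_vq ..

instance vq :: complete_space
proof
  fix X :: "nat \<Rightarrow> vq" assume "Cauchy X"
  then have "Cauchy (\<lambda>n. rep_vq (X n))" by (simp add: Cauchy_def dist_rep_vq)
  then obtain l where l: "(\<lambda>n. rep_vq (X n)) \<longlonglongrightarrow> l" using convergent_eq_Cauchy by blast
  then have "l \<in> sobolev_graph"
    using closed_sequentially[OF closed_sobolev _ l] rep_vq by blast
  then have "rep_vq (abs_vq l) = l" by (rule abs_vq_inverse)
  then have "(\<lambda>n. dist (X n) (abs_vq l)) \<longlonglongrightarrow> 0"
    using iffD1[OF tendsto_dist_iff l] unfolding dist_rep_vq[symmetric] by (simp only:)
  then have "X \<longlonglongrightarrow> abs_vq l" by (rule iffD2[OF tendsto_dist_iff])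
  then show "convergent X" by (rule convergentI)
qed

instance vq :: banach ..

instance vq :: second_countable_topology
proof
  obtain D :: "(real l2 \<times> real l2) set" where D: "countable D" "\<And>x. x \<in> closure D"
    using countable_dense_closure by blast
  \<comment> \<open>Seen in the product, these are the orthogonal projections of the dense set onto
    the graph; an element of the graph orthogonal to all of them is orthogonal to
    \<open>D\<close>.\<close>
  define B where "B = (\<lambda>d. riesz (\<lambda>x::vq. rep_vq x \<bullet> d)) ` D"
  have r: "x \<bullet> riesz (\<lambda>x::vq. rep_vq x \<bullet> d) = rep_vq x \<bullet> d" for x d
  proof (rule riesz(1)[where C="norm d"])
    show "linear (\<lambda>x::vq. rep_vq x \<bullet> d)"
      by (rule linearI) (simp_all add: plus_vq.rep_eq scaleR_vq.rep_eq inner_add_left)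
    show "\<bar>rep_vq x \<bullet> d\<bar> \<le> norm d * norm x" for x
      using Cauchy_Schwarz_ineq2[of "rep_vq x" d] by (simp add: norm_rep_vq mult.commute)
  qed simp
  have "countable B" unfolding B_def using D(1) by simp
  moreover have "x = 0" if x: "\<And>b. b \<in> B \<Longrightarrow> x \<bullet> b = 0" for x
  proof -
    have z: "rep_vq x \<bullet> d = 0" if "d \<in> D" for d using x[of "riesz (\<lambda>x. rep_vq x \<bullet> d)"] r[of x d] that by (simp add: B_def)
    obtain f where f: "\<And>n. f n \<in> D" "f \<longlonglongrightarrow> rep_vq x" using D(2)[of "rep_vq x"] unfolding closure_sequential by blast
    have "(\<lambda>n. rep_vq x \<bullet> f n) \<longlonglongrightarrow> rep_vq x \<bullet> rep_vq x" by (intro tendsto_inner tendsto_const f)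
    then have "rep_vq x \<bullet> rep_vq x = 0" using z[OF f(1)] by (simp add: LIMSEQ_const_iff)
    then have "x \<bullet> x = 0" by (simp add: inner_vq_def)
    then show ?thesis by simp
  qed
  ultimately obtain E :: "vq set" where "countable E" "\<And>x. x \<in> closure E"
    using total_imp_countable_dense[of B] by blast
  then show "\<exists>B::vq set set. countable B \<and> open = generate_topology B" by (rule dense_imp_countable_subbasis)
qed

instance vq :: sep_hilbert ..

definition jq :: "vq \<Rightarrow> real l2" where "jq x = fst (rep_vq x)"
definition dq :: "vq \<Rightarrow> real l2" where "dq x = snd (rep_vq x)"

lemma jq_dq_lin: "jq (x + y) = jq x + jq y" "dq (x + y) = dq x + dq y" "jq (c *\<^sub>R x) = c *\<^sub>R jq x" "dq (c *\<^sub>R x) = c *\<^sub>R dq x"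
  "jq (x - y) = jq x - jq y" "dq (x - y) = dq x - dq y"
  by (simp_all add: jq_def dq_def plus_vq.rep_eq scaleR_vq.rep_eq minus_vq.rep_eq)

lemma inner_vq: "x \<bullet> y = jq x \<bullet> jq y + dq x \<bullet> dq y"
  by (simp add: inner_vq_def jq_def dq_def inner_prod_def)

lemma norm_vq_square: "(norm x)\<^sup>2 = (norm (jq x))\<^sup>2 + (norm (dq x))\<^sup>2"
  by (simp add: power2_norm_eq_inner inner_vq)

lemma norm_jq_le: "norm (jq x) \<le> norm x" and norm_dq_le: "norm (dq x) \<le> norm x"
  by (rule power2_le_imp_le; simp add: norm_vq_square)+

lemma vq_eqI: "jq x = jq y \<Longrightarrow> dq x = dq y \<Longrightarrow> x = y"
  by (simp add: jq_def dq_def prod_eq_iff flip: rep_vq_inject)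

lemma vq_weak: "\<theta> \<in> test_functions UNIV \<Longrightarrow> jq x \<bullet> abs_l2 (deriv \<theta>) = - (dq x \<bullet> abs_l2 \<theta>)"
  using rep_vq[of x] by (auto simp: sobolev_graph_def jq_def dq_def split: prod.splits)

lemma vq_exists:
  assumes "\<And>\<theta>. \<theta> \<in> test_functions UNIV \<Longrightarrow> f \<bullet> abs_l2 (deriv \<theta>) = - (g \<bullet> abs_l2 \<theta>)"
  shows "jq (abs_vq (f, g)) = f" "dq (abs_vq (f, g)) = g"
  using abs_vq_inverse[of "(f, g)"] assms by (simp_all add: jq_def dq_def sobolev_graph_def)

section \<open>Translation of \<open>V\<close> into \<open>vq\<close>\<close>

lemma V_weak_deriv:
  assumes f: "f \<in> V"
  shows "f \<in> H" "Dx f \<in> H" "has_weak_deriv UNIV f (Dx f)"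
proof -
  obtain g where g: "f \<in> H" "g \<in> H" "has_weak_deriv UNIV f g" using f by (auto simp: H1_def)
  show "f \<in> H" by (rule g(1))
  show w: "has_weak_deriv UNIV f (Dx f)" unfolding weak_deriv_def by (rule someI[of _ g]) (rule g(3))
  have "AE x in lborel. g x = Dx f x" using weak_deriv_unique[OF open_UNIV g(3) w] by simp
  then show "Dx f \<in> H" by (rule toH_AE_eq(1)[OF g(2)])
qed

definition toV :: "(real \<Rightarrow> real) \<Rightarrow> vq" where "toV f = abs_vq (toH f, toH (Dx f))"

lemma toV: assumes f: "f \<in> V" shows "jq (toV f) = toH f" "dq (toV f) = toH (Dx f)"
proof -
  note w = V_weak_deriv[OF f]
  show "jq (toV f) = toH f" "dq (toV f) = toH (Dx f)"
    unfolding toV_def using vq_exists[of "toH f" "toH (Dx f)"] w(3) has_weak_deriv_UNIV_iff[OF w(1,2)] by simp_all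
qed

text \<open>The class of \<open>f\<close> determines its weak derivative, so an element of
  \<open>V\<close> is recognised by its \<open>jq\<close> component alone.\<close>

lemma V_I:
  assumes f: "f \<in> H" and x: "toH f = jq x" shows "f \<in> V" "toV f = x"
proof -
  have g: "rep_l2 (dq x) \<in> H" by (rule rep_l2_H)
  have w: "has_weak_deriv UNIV f (rep_l2 (dq x))"
    unfolding has_weak_deriv_UNIV_iff[OF f g] x toH_rep using vq_weak by blast
  show fV: "f \<in> V" using f g w by (auto simp: H1_def)
  have "AE y in lborel. rep_l2 (dq x) y = Dx f y"
    using weak_deriv_unique[OF open_UNIV w V_weak_deriv(3)[OF fV]] by simp
  then have "toH (Dx f) = dq x" using toH_AE_eq(2)[OF g] toH_rep[of "dq x"] by simp
  then show "toV f = x" by (intro vq_eqI) (simp_all add: toV[OF fV] x)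
qed

definition repV :: "vq \<Rightarrow> real \<Rightarrow> real" where "repV x = rep_l2 (jq x)"

lemma repV: "repV x \<in> V" "toV (repV x) = x"
  using V_I[of "repV x" x] by (simp_all add: repV_def rep_l2_H toH_rep)

lemma norm_V_eq: assumes "f \<in> V" shows "norm_V f = norm (toV f)"
proof -
  note w = V_weak_deriv[OF assms]
  have "(norm_V f)\<^sup>2 = (norm (toV f))\<^sup>2"
    by (simp add: norm_V_def norm_H_eq w norm_vq_square toV[OF assms])
  then show ?thesis by (simp add: norm_V_def)
qed

lemma V_add: assumes "f \<in> V" "g \<in> V" shows "(\<lambda>x. f x + g x) \<in> V" "toV (\<lambda>x. f x + g x) = toV f + toV g"
proof -
  have "toH (\<lambda>x. f x + g x) = jq (toV f + toV g)"
    using assms by (simp add: H_add V_weak_deriv jq_dq_lin toV)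
  then show "(\<lambda>x. f x + g x) \<in> V" "toV (\<lambda>x. f x + g x) = toV f + toV g"
    by (rule V_I[OF H_add(1)[OF V_weak_deriv(1)[OF assms(1)] V_weak_deriv(1)[OF assms(2)]]])+
qed

lemma V_scale: assumes "f \<in> V" shows "(\<lambda>x. c * f x) \<in> V" "toV (\<lambda>x. c * f x) = c *\<^sub>R toV f"
proof -
  have "toH (\<lambda>x. c * f x) = jq (c *\<^sub>R toV f)"
    using assms by (simp add: H_scale V_weak_deriv jq_dq_lin toV)
  then show "(\<lambda>x. c * f x) \<in> V" "toV (\<lambda>x. c * f x) = c *\<^sub>R toV f"
    by (rule V_I[OF H_scale(1)[OF V_weak_deriv(1)[OF assms(1)]]])+
qed

lemma V_diff: assumes "f \<in> V" "g \<in> V" shows "(\<lambda>x. f x - g x) \<in> V" "toV (\<lambda>x. f x - g x) = toV f - toV g"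
  using V_add[OF assms(1) V_scale(1)[OF assms(2), of "-1"]] V_scale(2)[OF assms(2), of "-1"] by simp_all

text \<open>Every test function together with its derivative lies in the graph, by integration by
  parts on the line; orthogonality to \<open>V\<close> thus contains the hypothesis of the
  fundamental lemma.\<close>

lemma jq_dense:
  assumes z: "\<And>x. u \<bullet> jq x = 0" shows "u = 0"
proof -
  have r: "sqi (rep_l2 u)" by (rule sqi_rep_l2)
  have "AE x in lborel. x \<in> UNIV \<longrightarrow> rep_l2 u x = 0"
  proof (rule fundamental_lemma[OF open_UNIV])
    show "integrable lebesgue (\<lambda>x. indicator {a..b} x * rep_l2 u x)" for a b
    proof -
      have "integrable (lebesgue_on {a..b}) (rep_l2 u)"
        using H_locally_integrable[OF rep_l2_H] by (simp add: locally_integrable_def)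
      then show ?thesis by (simp add: integrable_restrict_space)
    qed
    fix \<theta> :: "real \<Rightarrow> real" assume t: "\<theta> \<in> test_functions UNIV"
    have s: "sqi \<theta>" "sqi (deriv \<theta>)" using test_sqi[OF t] test_sqi[OF test_deriv[OF t]] by simp_all
    have "abs_l2 \<theta> \<bullet> abs_l2 (deriv \<eta>) = - (abs_l2 (deriv \<theta>) \<bullet> abs_l2 \<eta>)" if e: "\<eta> \<in> test_functions UNIV" for \<eta>
    proof -
      have "(LINT x|lborel. \<theta> x * deriv \<eta> x) + (LINT x|lborel. deriv \<theta> x * \<eta> x)
          = (LINT x|lborel. \<theta> x * deriv \<eta> x + deriv \<theta> x * \<eta> x)"
        by (rule Bochner_Integration.integral_add[symmetric, OF integrable_mult_test[OF test_integrable[OF t] test_deriv[OF e]]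
              integrable_mult_test[OF test_integrable[OF test_deriv[OF t]] e]])
      also have "\<dots> = 0"
      proof -
        obtain K where K: "compact K" "\<And>x. x \<notin> K \<Longrightarrow> \<theta> x = 0" using t unfolding test_functions_iff by blast
        obtain R where R: "\<forall>x\<in>K. norm x \<le> R" using compact_imp_bounded[OF K(1)] unfolding bounded_iff ..
        \<comment> \<open>Strictly beyond the support, so that the boundary terms at
          \<open>m\<close> and \<open>-m\<close> vanish.\<close>
        define m where "m = max R 0 + 1"
        have out: "\<theta> x = 0" "deriv \<theta> x = 0" if "x \<notin> {-m<..<m}" for x
        proof -
          have "x \<notin> K"
          proof
            assume "x \<in> K"
            then have "\<bar>x\<bar> \<le> R" using R by simp
            moreover have "R < m" by (simp add: m_def)
            ultimately have "x \<in> {-m<..<m}" by auto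
            then show False using that by blast
          qed
          then show "\<theta> x = 0" by (rule K(2))
          show "deriv \<theta> x = 0" by (rule test_deriv_outside[OF K(1) K(2) \<open>x \<notin> K\<close>])
        qed
        have "(\<lambda>x. \<theta> x * deriv \<eta> x + deriv \<theta> x * \<eta> x) = (\<lambda>x. indicator {-m..m} x * (\<theta> x * deriv \<eta> x + deriv \<theta> x * \<eta> x))"
        proof
          fix x show "\<theta> x * deriv \<eta> x + deriv \<theta> x * \<eta> x = indicator {-m..m} x * (\<theta> x * deriv \<eta> x + deriv \<theta> x * \<eta> x)"
            using out[of x] by (cases "x \<in> {-m..m}") auto
        qed
        moreover have "(LINT x|lborel. indicator {-m..m} x * (\<theta> x * deriv \<eta> x + deriv \<theta> x * \<eta> x)) = \<theta> m * \<eta> m - \<theta> (-m) * \<eta> (-m)"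
        proof (rule ftc_lborel)
          show "-m \<le> m" by (simp add: m_def)
          show "((\<lambda>x. \<theta> x * \<eta> x) has_field_derivative \<theta> x * deriv \<eta> x + deriv \<theta> x * \<eta> x) (at x)" for x
            using DERIV_mult[OF smooth_has_deriv[OF test_smooth[OF t]] smooth_has_deriv[OF test_smooth[OF e]], of x]
            by (simp add: algebra_simps)
          show "continuous_on UNIV (\<lambda>x. \<theta> x * deriv \<eta> x + deriv \<theta> x * \<eta> x)"
            by (intro continuous_on_add continuous_on_mult smooth_continuous_on smooth_deriv test_smooth[OF t] test_smooth[OF e])
        qed
        moreover have "\<theta> m = 0" "\<theta> (-m) = 0" using out(1)[of m] out(1)[of "-m"] by simp_all
        ultimately show ?thesis by simp
      qed
      finally show ?thesis
        using inner_abs_l2[OF s(1) test_sqi[OF test_deriv[OF e]]] inner_abs_l2[OF s(2) test_sqi[OF e]] by simp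
    qed
    from vq_exists(1)[OF this] z[of "abs_vq (abs_l2 \<theta>, abs_l2 (deriv \<theta>))"]
    have "u \<bullet> abs_l2 \<theta> = 0" by simp
    then have 0: "(LINT x|lborel. rep_l2 u x * \<theta> x) = 0" using inner_abs_l2[OF r s(1)] by simp
    show "(LINT x|lebesgue. rep_l2 u x * \<theta> x) = 0"
      by (subst integral_completion) (use 0 sqiD(1)[OF r] sqiD(1)[OF s(1)] in \<open>simp_all add: borel_measurable_times\<close>)
  qed
  then have "abs_l2 (rep_l2 u) = abs_l2 (\<lambda>_. 0)" by (intro abs_l2_eqI r) (auto elim: eventually_mono)
  then show ?thesis by (simp add: zero_l2.abs_eq)
qed

interpretation V: gelfand jq
proof (rule gelfand.intro)
  show "bounded_linear jq"
    by (rule bounded_linear_intro[of _ 1]) (simp_all add: jq_dq_lin norm_jq_le)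
qed (rule norm_jq_le, rule jq_dense)

section \<open>Sobolev embedding and the dual space\<close>

lemma prim_bounds:
  fixes g :: "real \<Rightarrow> real"
  assumes g: "integrable lborel g" "\<And>t. 0 \<le> g t"
  shows "0 \<le> prim a g t" "prim a g t \<le> (LINT t|lborel. g t)"
proof -
  have i: "integrable lborel (\<lambda>s. indicator {a<..t} s *\<^sub>R g s)" by (rule integrable_indicator_scaleR[OF g(1)]) simp
  show "0 \<le> prim a g t" unfolding prim_def by (rule Bochner_Integration.integral_nonneg) (simp add: g(2))
  show "prim a g t \<le> (LINT t|lborel. g t)" unfolding prim_def
    by (rule integral_mono[OF i g(1)]) (simp add: indicator_def g(2))
qed

text \<open>In an interval of length \<open>2\<close> some point \<open>r\<close> satisfies
  \<open>\<bar>f r\<bar> \<le> norm x\<close>. From there \<open>f\<close> changes by an integral of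
  its derivative, at most \<open>2 * norm x\<close> with the crude bound
  \<open>\<bar>t - r\<bar> \<le> 4\<close>, which explains the constant \<open>3\<close>. Length
  \<open>2\<close> lets the intervals with integer left end cover the line.\<close>

lemma sobolev_interval:
  fixes x :: vq and a :: real
  shows "AE t in lborel. t \<in> {a<..<a + 2} \<longrightarrow> \<bar>rep_l2 (jq x) t\<bar> \<le> 3 * norm x"
proof -
  define I where "I = {a<..<a + 2}"
  define f where "f = rep_l2 (jq x)"
  define g where "g = rep_l2 (dq x)"
  have f: "sqi f" and g: "sqi g" unfolding f_def g_def by (rule sqi_rep_l2)+
  define fi where "fi t = indicator I t * f t" for t
  define gi where "gi t = indicator I t * g t" for t
  have fi: "sqi fi" using sqi_indicator_mult[OF f, of I] by (simp add: fi_def[abs_def] I_def)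
  have gi: "sqi gi" using sqi_indicator_mult[OF g, of I] by (simp add: gi_def[abs_def] I_def)
  have gint: "integrable lborel gi" "integrable lborel fi"
    using sqi_interval_integrable[OF g, of a "a+2"] sqi_interval_integrable[OF f, of a "a+2"]
    by (simp_all add: gi_def[abs_def] fi_def[abs_def] I_def)
  have "\<exists>c. AE t in lborel. t \<in> {a<..<a + 2} \<longrightarrow> fi t = c + prim a gi t"
  proof (rule du_bois_reymond)
    fix \<theta> assume t: "\<theta> \<in> test_functions {a<..<a + 2}"
    have t': "\<theta> \<in> test_functions UNIV" using test_mono[OF _ t] by blast
    have "(\<lambda>t. fi t * deriv \<theta> t) = (\<lambda>t. f t \<bullet> deriv \<theta> t)"
    proof
      fix s show "fi s * deriv \<theta> s = f s \<bullet> deriv \<theta> s"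
        using test_outside[OF test_deriv[OF t], of s] by (cases "s \<in> I") (simp_all add: fi_def I_def)
    qed
    then have "(LINT t|lborel. fi t * deriv \<theta> t) = jq x \<bullet> abs_l2 (deriv \<theta>)"
      using inner_abs_l2[OF f test_sqi[OF test_deriv[OF t]]] by (simp add: f_def)
    also have "\<dots> = - (dq x \<bullet> abs_l2 \<theta>)" by (rule vq_weak[OF t'])
    also have "dq x \<bullet> abs_l2 \<theta> = (LINT t|lborel. gi t * \<theta> t)"
    proof -
      have "(\<lambda>t. gi t * \<theta> t) = (\<lambda>t. g t \<bullet> \<theta> t)"
      proof
        fix s show "gi s * \<theta> s = g s \<bullet> \<theta> s"
          using test_outside[OF t, of s] by (cases "s \<in> I") (simp_all add: gi_def I_def)
      qed
      then show ?thesis using inner_abs_l2[OF g test_sqi[OF t]] by (simp add: g_def)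
    qed
    finally show "(LINT t|lborel. fi t * deriv \<theta> t) = - (LINT t|lborel. gi t * \<theta> t)" .
  next
    show "integrable lborel fi" "integrable lborel gi" by (rule gint)+
  qed (simp_all add: fi_def gi_def I_def)
  then obtain c where "AE t in lborel. t \<in> {a<..<a + 2} \<longrightarrow> fi t = c + prim a gi t" by blast
  then obtain N where N: "N \<in> null_sets lborel"
    "\<And>t. t \<in> space lborel - N \<Longrightarrow> t \<in> {a<..<a + 2} \<longrightarrow> fi t = c + prim a gi t"
    by (rule AE_E3) blast
  have fN: "f t = c + prim a gi t" if "t \<in> {a<..<a + 2} - N" for t
    using N(2)[of t] that by (simp add: fi_def I_def)
  have nf: "(LINT t|lborel. (norm (f t))\<^sup>2) \<le> (norm x)\<^sup>2"
  proof -
    have "norm (jq x) = sqrt (LINT t|lborel. (norm (f t))\<^sup>2)" using norm_abs_l2[OF f] by (simp add: f_def)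
    then have "(LINT t|lborel. (norm (f t))\<^sup>2) = (norm (jq x))\<^sup>2" by simp
    then show ?thesis using power_mono[OF norm_jq_le norm_ge_zero, of x 2] by simp
  qed
  have ng: "(LINT t|lborel. (norm (gi t))\<^sup>2) \<le> (norm x)\<^sup>2"
  proof -
    have "(LINT t|lborel. (norm (gi t))\<^sup>2) \<le> (LINT t|lborel. (norm (g t))\<^sup>2)"
      by (rule integral_mono[OF sqiD(2)[OF gi] sqiD(2)[OF g]]) (simp add: gi_def indicator_def)
    also have "\<dots> = (norm (dq x))\<^sup>2" using norm_abs_l2[OF g] by (simp add: g_def)
    finally show ?thesis using power_mono[OF norm_dq_le norm_ge_zero, of x 2] by (rule order_trans)
  qed
  obtain r where r: "r \<in> {a<..<a + 2} - N" "(a + 2 - a) * (norm (f r))\<^sup>2 \<le> (LINT t|lborel. (norm (f t))\<^sup>2)"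
    using mean_value_AE[OF f _ N(1), of a "a + 2"] by auto
  have "2 * (norm (f r))\<^sup>2 \<le> (LINT t|lborel. (norm (f t))\<^sup>2)" using r(2) by simp
  then have "(norm (f r))\<^sup>2 \<le> (norm x)\<^sup>2" using nf zero_le_power2[of "norm (f r)"] by linarith
  then have fr: "\<bar>f r\<bar> \<le> norm x" using power2_le_imp_le[of "norm (f r)" "norm x"] by simp
  have main: "\<bar>f t\<bar> \<le> 3 * norm x" if t: "t \<in> {a<..<a + 2} - N" for t
  proof -
    define X where "X = prim a (\<lambda>s. (norm (gi s))\<^sup>2)"
    have Xb: "0 \<le> X s" "X s \<le> (norm x)\<^sup>2" for s
      using prim_bounds[OF sqiD(2)[OF gi], of a s] ng by (simp_all add: X_def)
    have "(norm (prim a gi t - prim a gi r))\<^sup>2 \<le> \<bar>t - r\<bar> * \<bar>X t - X r\<bar>"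
      unfolding X_def using t r(1) by (intro norm_prim_diff_le[OF gi gint(1)]) simp_all
    also have "\<dots> \<le> 4 * (norm x)\<^sup>2"
    proof (rule mult_mono)
      show "\<bar>t - r\<bar> \<le> 4" using t r(1) by auto
      show "\<bar>X t - X r\<bar> \<le> (norm x)\<^sup>2" using Xb[of t] Xb[of r] by linarith
    qed simp_all
    also have "\<dots> = (2 * norm x)\<^sup>2" by (simp add: power_mult_distrib)
    finally have "norm (prim a gi t - prim a gi r) \<le> 2 * norm x" by (rule power2_le_imp_le) simp
    moreover have "f t - f r = prim a gi t - prim a gi r" using fN[OF t] fN[OF r(1)] by simp
    ultimately show ?thesis using fr unfolding real_norm_def by linarith
  qed
  show ?thesis using AE_not_in[OF N(1)]
  proof eventually_elim
    case (elim t)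
    then show ?case using main[of t] by (simp add: f_def)
  qed
qed

lemma sobolev: "AE t in lborel. \<bar>rep_l2 (jq x) t\<bar> \<le> 3 * norm x"
proof -
  have "AE t in lborel. \<forall>k::int. t \<in> {of_int k<..<of_int k + 2} \<longrightarrow> \<bar>rep_l2 (jq x) t\<bar> \<le> 3 * norm x"
    unfolding AE_all_countable by (intro allI sobolev_interval)
  then show ?thesis
  proof eventually_elim
    case (elim t)
    have "t \<in> {of_int (\<lfloor>t\<rfloor> - 1)<..<of_int (\<lfloor>t\<rfloor> - 1) + 2}" by simp linarith
    then show ?case using elim by blast
  qed
qed

lemma rep_l2_lin:
  "AE t in lborel. rep_l2 (u + v) t = rep_l2 u t + rep_l2 v t"
  "AE t in lborel. rep_l2 (c *\<^sub>R u) t = c *\<^sub>R rep_l2 u t"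
  using rep_abs_l2[OF sqi_add[OF sqi_rep_l2[of u] sqi_rep_l2[of v]]] rep_abs_l2[OF sqi_scaleR[OF sqi_rep_l2[of u], of c]]
  by (simp_all add: plus_abs_l2[symmetric] scaleR_abs_l2[symmetric] sqi_rep_l2)

definition mulf :: "vq \<Rightarrow> real l2 \<Rightarrow> real \<Rightarrow> real" where "mulf y h t = rep_l2 (jq y) t * rep_l2 h t"

definition mulq :: "vq \<Rightarrow> real l2 \<Rightarrow> real l2" where "mulq y h = abs_l2 (mulf y h)"

lemma mulf: "sqi (mulf y h)" "norm (mulq y h) \<le> 3 * norm y * norm h"
proof -
  have m [measurable]: "rep_l2 (jq y) \<in> borel_measurable borel" "rep_l2 h \<in> borel_measurable borel"
    by (rule sqiD(1)[OF sqi_rep_l2])+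
  have hi: "integrable lborel (\<lambda>t. (3 * norm y)\<^sup>2 * (norm (rep_l2 h t))\<^sup>2)"
    using sqiD(2)[OF sqi_rep_l2[of h]] by simp
  have b: "AE t in lborel. (norm (mulf y h t))\<^sup>2 \<le> (3 * norm y)\<^sup>2 * (norm (rep_l2 h t))\<^sup>2"
    using sobolev[of y]
  proof eventually_elim
    case (elim t)
    then have "\<bar>rep_l2 (jq y) t\<bar>\<^sup>2 \<le> (3 * norm y)\<^sup>2" by (intro power_mono) simp_all
    from mult_right_mono[OF this, of "\<bar>rep_l2 h t\<bar>\<^sup>2"]
    show ?case by (simp add: mulf_def power_mult_distrib)
  qed
  show s: "sqi (mulf y h)"
    by (rule sqi_bound[OF _ hi b]) (simp add: mulf_def[abs_def])
  have "norm (mulq y h) = sqrt (LINT t|lborel. (norm (mulf y h t))\<^sup>2)" unfolding mulq_def by (rule norm_abs_l2[OF s])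
  also have "\<dots> \<le> sqrt (LINT t|lborel. (3 * norm y)\<^sup>2 * (norm (rep_l2 h t))\<^sup>2)"
    by (intro real_sqrt_le_mono integral_mono_AE[OF sqiD(2)[OF s] hi b])
  also have "\<dots> = 3 * norm y * norm h"
    using norm_abs_l2[OF sqi_rep_l2[of h]] by (simp add: real_sqrt_mult)
  finally show "norm (mulq y h) \<le> 3 * norm y * norm h" .
qed

text \<open>Boundedness is the Sobolev embedding; the resulting joint continuity is the source of
  the measurability in time of \<open>adj_form\<close>.\<close>

lemma mulq_bilinear: "bounded_bilinear mulq"
proof
  fix y y' :: vq and h h' :: "real l2" and r :: real
  show "mulq (y + y') h = mulq y h + mulq y' h"
    unfolding mulq_def plus_abs_l2[OF mulf(1) mulf(1)]
  proof (rule abs_l2_eqI[OF mulf(1) sqi_add[OF mulf(1) mulf(1)]])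
    show "AE t in lborel. mulf (y + y') h t = mulf y h t + mulf y' h t"
      using rep_l2_lin(1)[of "jq y" "jq y'"] by eventually_elim (simp add: mulf_def jq_dq_lin algebra_simps)
  qed
  show "mulq y (h + h') = mulq y h + mulq y h'"
    unfolding mulq_def plus_abs_l2[OF mulf(1) mulf(1)]
  proof (rule abs_l2_eqI[OF mulf(1) sqi_add[OF mulf(1) mulf(1)]])
    show "AE t in lborel. mulf y (h + h') t = mulf y h t + mulf y h' t"
      using rep_l2_lin(1)[of h h'] by eventually_elim (simp add: mulf_def algebra_simps)
  qed
  show "mulq (r *\<^sub>R y) h = r *\<^sub>R mulq y h"
    unfolding mulq_def scaleR_abs_l2[OF mulf(1)]
  proof (rule abs_l2_eqI[OF mulf(1) sqi_scaleR[OF mulf(1)]])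
    show "AE t in lborel. mulf (r *\<^sub>R y) h t = r *\<^sub>R mulf y h t"
      using rep_l2_lin(2)[of r "jq y"] by eventually_elim (simp add: mulf_def jq_dq_lin)
  qed
  show "mulq y (r *\<^sub>R h) = r *\<^sub>R mulq y h"
    unfolding mulq_def scaleR_abs_l2[OF mulf(1)]
  proof (rule abs_l2_eqI[OF mulf(1) sqi_scaleR[OF mulf(1)]])
    show "AE t in lborel. mulf y (r *\<^sub>R h) t = r *\<^sub>R mulf y h t"
      using rep_l2_lin(2)[of r h] by eventually_elim (simp add: mulf_def)
  qed
  show "\<exists>K. \<forall>y h. norm (mulq y h) \<le> norm y * norm h * K"
    using mulf(2) by (intro exI[of _ 3]) (simp add: mult_ac)
qed

lemma inner_H_product:
  assumes y: "y \<in> V" and h: "h \<in> H" and \<phi>: "\<phi> \<in> H"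
  shows "inner_H (\<lambda>x. y x * h x) \<phi> = mulq (toV y) (toH h) \<bullet> toH \<phi>"
proof -
  have ae: "AE x in lborel. y x * h x = mulf (toV y) (toH h) x"
    using rep_toH[OF V_weak_deriv(1)[OF y]] rep_toH[OF h]
    by eventually_elim (simp add: mulf_def toV[OF y])
  have "(\<lambda>x. y x * h x) \<in> H" by (rule H_I[OF mulf(1) ae])
  moreover have "toH (\<lambda>x. y x * h x) = mulq (toV y) (toH h)" unfolding mulq_def by (rule toH_eq[OF mulf(1) ae])
  ultimately show ?thesis using inner_H_eq[OF _ \<phi>] by simp
qed

section \<open>The dual of \<open>V\<close> through Riesz' theorem\<close>

definition toVd :: "((real \<Rightarrow> real) \<Rightarrow> real) \<Rightarrow> vq" where "toVd F = riesz (\<lambda>x. F (repV x))"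

definition fromVd :: "vq \<Rightarrow> (real \<Rightarrow> real) \<Rightarrow> real" where "fromVd R f = toV f \<bullet> R"

text \<open>Boundedness forces a functional to vanish on functions of zero norm, so its value
  depends only on the class; evaluation at the representatives \<open>repV x\<close> is therefore
  linear on \<open>vq\<close> and Riesz' theorem applies.\<close>

lemma V_dual_toV:
  assumes F: "F \<in> V_dual" and f: "f \<in> V" shows "F f = toV f \<bullet> toVd F"
proof -
  have add: "\<And>f g. f \<in> V \<Longrightarrow> g \<in> V \<Longrightarrow> F (\<lambda>x. f x + g x) = F f + F g"
    and sc: "\<And>c f. f \<in> V \<Longrightarrow> F (\<lambda>x. c * f x) = c * F f"
    using F by (auto simp: V_dual_def)
  obtain C0 where C0: "\<And>f. f \<in> V \<Longrightarrow> \<bar>F f\<bar> \<le> C0 * norm_V f"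
  proof -
    have "\<exists>C. \<forall>f\<in>V. \<bar>F f\<bar> \<le> C * norm_V f" using F by (simp add: V_dual_def)
    then show ?thesis using that by blast
  qed
  define C where "C = max C0 0"
  have C: "\<bar>F f\<bar> \<le> C * norm (toV f)" if "f \<in> V" for f
  proof -
    have "\<bar>F f\<bar> \<le> C0 * norm (toV f)" using C0[OF that] norm_V_eq[OF that] by simp
    also have "\<dots> \<le> C * norm (toV f)" by (intro mult_right_mono) (simp_all add: C_def)
    finally show ?thesis .
  qed
  have inv: "F f = F (repV (toV f))" if f: "f \<in> V" for f
  proof -
    define g where "g = (\<lambda>x. f x - repV (toV f) x)"
    have g: "g \<in> V" "toV g = 0" unfolding g_def using V_diff[OF f repV(1)] by (simp_all add: repV(2))
    have "F g = 0" using C[OF g(1)] g(2) by simp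
    then have "F (\<lambda>x. g x + repV (toV f) x) = F (repV (toV f))" using add[OF g(1) repV(1)] by simp
    then show ?thesis by (simp add: g_def)
  qed
  have "linear (\<lambda>x. F (repV x))"
  proof (rule linearI)
    fix x y
    have "F (repV x) + F (repV y) = F (\<lambda>t. repV x t + repV y t)" by (rule add[OF repV(1) repV(1), symmetric])
    also have "\<dots> = F (repV (x + y))"
      using inv[OF V_add(1)[OF repV(1) repV(1)], of x y] by (simp add: V_add(2) repV)
    finally show "F (repV (x + y)) = F (repV x) + F (repV y)" by simp
  next
    fix c x
    have "c * F (repV x) = F (\<lambda>t. c * repV x t)" by (rule sc[OF repV(1), symmetric])
    also have "\<dots> = F (repV (c *\<^sub>R x))"
      using inv[OF V_scale(1)[OF repV(1)], of c x] by (simp add: V_scale(2) repV)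
    finally show "F (repV (c *\<^sub>R x)) = c *\<^sub>R F (repV x)" by simp
  qed
  moreover have "\<bar>F (repV x)\<bar> \<le> C * norm x" for x using C[OF repV(1), of x] by (simp add: repV)
  moreover have "0 \<le> C" by (simp add: C_def)
  ultimately have "toV f \<bullet> riesz (\<lambda>x. F (repV x)) = F (repV (toV f))" by (intro riesz(1))
  then show ?thesis unfolding inv[OF f] toVd_def by simp
qed

lemma toVd_unique:
  assumes F: "F \<in> V_dual" and R: "\<And>f. f \<in> V \<Longrightarrow> F f = toV f \<bullet> R" shows "toVd F = R"
proof -
  have "\<forall>x. x \<bullet> toVd F = x \<bullet> R"
  proof
    fix x show "x \<bullet> toVd F = x \<bullet> R" using V_dual_toV[OF F repV(1), of x] R[OF repV(1), of x] by (simp add: repV)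
  qed
  then show ?thesis by (simp only: vector_eq_ldot)
qed

lemma V_dual_I:
  assumes "\<And>f. f \<in> V \<Longrightarrow> F f = toV f \<bullet> R" shows "F \<in> V_dual" "toVd F = R"
proof -
  show FV: "F \<in> V_dual" unfolding V_dual_def
  proof (intro CollectI conjI ballI allI exI)
    fix f g assume "f \<in> V" "g \<in> V"
    then show "F (\<lambda>x. f x + g x) = F f + F g" by (simp add: assms V_add inner_add_left)
  next
    fix c f assume "f \<in> V"
    then show "F (\<lambda>x. c * f x) = c * F f" by (simp add: assms V_scale)
  next
    fix f assume f: "f \<in> V"
    show "\<bar>F f\<bar> \<le> norm R * norm_V f"
      using Cauchy_Schwarz_ineq2[of "toV f" R] by (simp add: assms[OF f] norm_V_eq[OF f] mult.commute)
  qed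
  show "toVd F = R" by (rule toVd_unique[OF FV assms])
qed

lemma fromVd: "fromVd R \<in> V_dual" "toVd (fromVd R) = R"
  using V_dual_I[of "fromVd R" R] by (simp_all add: fromVd_def)

lemma V_dual_diff:
  assumes "F \<in> V_dual" "G \<in> V_dual"
  shows "(\<lambda>a. F a - G a) \<in> V_dual" "toVd (\<lambda>a. F a - G a) = toVd F - toVd G"
  using V_dual_I[of "\<lambda>a. F a - G a" "toVd F - toVd G"] V_dual_toV[OF assms(1)] V_dual_toV[OF assms(2)]
  by (simp_all add: inner_diff_right)

lemma norm_V_dual_eq: assumes F: "F \<in> V_dual" shows "norm_V_dual F = norm (toVd F)"
proof -
  define R where "R = toVd F"
  have up: "\<bar>F f\<bar> \<le> norm R" if f: "f \<in> V" "norm_V f \<le> 1" for f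
  proof -
    have "\<bar>F f\<bar> \<le> norm (toV f) * norm R" unfolding V_dual_toV[OF F f(1)] R_def by (rule Cauchy_Schwarz_ineq2)
    also have "\<dots> \<le> 1 * norm R" using f norm_V_eq[OF f(1)] by (intro mult_right_mono) simp_all
    finally show ?thesis by simp
  qed
  \<comment> \<open>For \<open>R = 0\<close> division by zero gives \<open>u = 0\<close>, which
    still attains the supremum.\<close>
  define u where "u = R /\<^sub>R norm R"
  have u1: "norm u \<le> 1" by (cases "R = 0") (simp_all add: u_def)
  have uV: "repV u \<in> V" "norm_V (repV u) \<le> 1" using norm_V_eq[OF repV(1), of u] u1 by (simp_all add: repV)
  have "F (repV u) = norm R"
    unfolding V_dual_toV[OF F repV(1)] repV(2) R_def[symmetric]
    by (cases "R = 0") (simp_all add: u_def power2_norm_eq_inner[symmetric] power2_eq_square)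
  moreover have "bdd_above ((\<lambda>f. \<bar>F f\<bar>) ` {f \<in> V. norm_V f \<le> 1})"
    using up by (intro bdd_aboveI2[of _ _ "norm R"]) auto
  then have "\<bar>F (repV u)\<bar> \<le> norm_V_dual F"
    unfolding norm_V_dual_def using uV by (intro cSUP_upper) simp_all
  ultimately have "norm R \<le> norm_V_dual F" by simp
  moreover have "norm_V_dual F \<le> norm R"
    unfolding norm_V_dual_def using uV up by (intro cSUP_least) auto
  ultimately show ?thesis by (simp add: R_def)
qed

section \<open>Bochner spaces\<close>

lemma completion_borel_representative:
  fixes f :: "'x \<Rightarrow> 'b::{banach,second_countable_topology}"
  assumes f: "f \<in> borel_measurable (completion M)"
  shows "\<exists>g\<in>borel_measurable M. AE x in M. f x = g x"
proof -
  obtain F where F: "\<And>i. simple_function (completion M) (F i)" "\<And>x. x \<in> space M \<Longrightarrow> (\<lambda>i. F i x) \<longlonglongrightarrow> f x"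
    using borel_measurable_implies_sequence_metric[OF f, of 0] by auto
  have "\<exists>G. simple_function M G \<and> (AE x in M. F i x = G x)" for i
    using completion_ex_simple_function[OF F(1)] by blast
  then obtain G where G: "\<And>i. simple_function M (G i)" "\<And>i. AE x in M. F i x = G i x" by metis
  have [measurable]: "G i \<in> borel_measurable M" for i using G(1) by (rule borel_measurable_simple_function)
  define g where "g x = lim (\<lambda>i. G i x)" for x
  have "g \<in> borel_measurable M" unfolding g_def by (rule borel_measurable_lim_metric) measurable
  moreover have "AE x in M. f x = g x"
  proof -
    have "AE x in M. \<forall>i. F i x = G i x" using G(2) by (simp add: AE_all_countable)
    then show ?thesis using AE_space
    proof eventually_elim
      case (elim x)
      have "(\<lambda>i. G i x) \<longlonglongrightarrow> f x" using F(2)[OF elim(2)] elim(1) by simp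
      then show ?case by (simp add: g_def limI)
    qed
  qed
  ultimately show ?thesis by blast
qed

lemma AE_time: "(AE t in time_measure T. P t) \<longleftrightarrow> (AE t in lborel. t \<in> {0<..<T} \<longrightarrow> P t)"
proof -
  have "(AE t in time_measure T. P t) \<longleftrightarrow> (AE t in lebesgue. t \<in> {0<..<T} \<longrightarrow> P t)"
    by (rule AE_restrict_space_iff) simp
  then show ?thesis by (simp add: AE_completion_iff)
qed

lemma integrable_time_iff:
  fixes f :: "real \<Rightarrow> real"
  shows "integrable (time_measure T) f \<longleftrightarrow> integrable lebesgue (\<lambda>t. indicator {0<..<T} t * f t)"
  by (subst integrable_restrict_space) simp_all

lemma integral_time:
  fixes f :: "real \<Rightarrow> real"
  shows "(LINT t|time_measure T. f t) = (LINT t|lebesgue. indicator {0<..<T} t * f t)"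
  by (subst integral_restrict_space) simp_all

lemma integral_time_AE:
  fixes f F :: "real \<Rightarrow> real"
  assumes F: "integrable lborel F" and ae: "AE t in lborel. indicator {0<..<T} t * f t = F t"
  shows "integrable (time_measure T) f" "(LINT t|time_measure T. f t) = (LINT t|lborel. F t)"
proof -
  have Fm: "F \<in> borel_measurable lborel" using F by (rule borel_measurable_integrable)
  have Fl: "F \<in> borel_measurable lebesgue" using Fm by (rule measurable_completion)
  have fl: "(\<lambda>t. indicator {0<..<T} t * f t) \<in> borel_measurable lebesgue"
    by (rule lebesgue_measurable_AE[OF Fl ae])
  have ael: "AE t in lebesgue. indicator {0<..<T} t * f t = F t" by (rule AE_completion[OF ae])
  show "integrable (time_measure T) f"
    unfolding integrable_time_iff integrable_cong_AE[OF fl Fl ael] using F integrable_completion[OF Fm] by blast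
  show "(LINT t|time_measure T. f t) = (LINT t|lborel. F t)"
    unfolding integral_time integral_cong_AE[OF fl Fl ael] by (rule integral_completion[OF Fm])
qed

text \<open>To be interpreted for \<open>V\<close> and for its dual: \<tau> sends a representative
  to its class and \<sigma> picks a representative, so that the passage between curves of
  representatives and curves in a Hilbert space is done once for both.\<close>

locale bochner_model =
  fixes X :: "('a \<Rightarrow> real) set" and N :: "('a \<Rightarrow> real) \<Rightarrow> real"
    and \<tau> :: "('a \<Rightarrow> real) \<Rightarrow> 'b::sep_hilbert" and \<sigma> :: "'b \<Rightarrow> 'a \<Rightarrow> real"
  assumes N_diff: "f \<in> X \<Longrightarrow> g \<in> X \<Longrightarrow> N (\<lambda>a. f a - g a) = norm (\<tau> f - \<tau> g)"
    and N_norm: "f \<in> X \<Longrightarrow> N f = norm (\<tau> f)"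
    and \<sigma>_in: "\<sigma> b \<in> X" and \<tau>_\<sigma>: "\<tau> (\<sigma> b) = b"
begin

definition models :: "real \<Rightarrow> (real \<Rightarrow> 'a \<Rightarrow> real) \<Rightarrow> (real \<Rightarrow> 'b) \<Rightarrow> bool" where
  "models T w W \<longleftrightarrow> sqi_on T W \<and> (AE t in lborel. t \<in> {0<..<T} \<longrightarrow> w t \<in> X \<and> \<tau> (w t) = W t)"

lemma models_norm:
  assumes "models T w W"
  shows "bochner_L2_norm T N w = sqrt (LINT t|lborel. (norm (W t))\<^sup>2)"
proof -
  have W: "sqi_on T W" and ae: "AE t in lborel. t \<in> {0<..<T} \<longrightarrow> w t \<in> X \<and> \<tau> (w t) = W t"
    using assms by (auto simp: models_def)
  have "AE t in lborel. indicator {0<..<T} t * (N (w t))\<^sup>2 = (norm (W t))\<^sup>2"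
    using ae
  proof eventually_elim
    case (elim t)
    then show ?case using N_norm[of "w t"] sqi_onD(2)[OF W, of t] by (cases "t \<in> {0<..<T}") simp_all
  qed
  from integral_time_AE(2)[OF sqiD(2)[OF sqi_onD(1)[OF W]] this]
  show ?thesis by (simp add: bochner_L2_norm_def)
qed

text \<open>Under \<tau> the approximating simple functions become simple functions with values in a
  Hilbert space, whose almost everywhere limit is Lebesgue measurable; a Borel version of it, cut
  off outside the interval, is the model.\<close>

lemma models_exists:
  assumes w: "w \<in> bochner_L2 T X N"
  shows "\<exists>W. models T w W"
proof -
  have wX: "AE t in time_measure T. w t \<in> X" and wi: "integrable (time_measure T) (\<lambda>t. (N (w t))\<^sup>2)"
    and wm: "strongly_measurable T X N w"
    using w by (auto simp: bochner_L2_def)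
  obtain s where s': "\<forall>n. simple_function (time_measure T) (s n) \<and> (\<forall>t\<in>{0<..<T}. s n t \<in> X)"
    and sl: "AE t in time_measure T. (\<lambda>n. N (\<lambda>a. s n t a - w t a)) \<longlonglongrightarrow> 0"
    using wm unfolding strongly_measurable_def by blast
  have s: "\<And>n. simple_function (time_measure T) (s n)" "\<And>n t. t \<in> {0<..<T} \<Longrightarrow> s n t \<in> X"
    using s' by blast+
  define S where "S n t = indicator {0<..<T} t *\<^sub>R \<tau> (s n t)" for n t
  have Sm: "S n \<in> borel_measurable lebesgue" for n
  proof -
    have "simple_function (time_measure T) (\<lambda>t. \<tau> (s n t))"
      by (rule simple_function_compose1[OF s(1)])
    then have "(\<lambda>t. \<tau> (s n t)) \<in> borel_measurable (time_measure T)" by (rule borel_measurable_simple_function)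
    then show ?thesis unfolding S_def[abs_def] by (subst (asm) borel_measurable_restrict_space_iff) simp_all
  qed
  \<comment> \<open>Where the sequence diverges \<open>lim\<close> is an arbitrary value; such times
    form a null set.\<close>
  define f where "f t = lim (\<lambda>n. S n t)" for t
  have fm: "f \<in> borel_measurable lebesgue" unfolding f_def
    by (rule borel_measurable_lim_metric) (rule Sm)
  obtain g where g: "g \<in> borel_measurable lborel" "AE t in lborel. f t = g t"
    using completion_borel_representative[OF fm] by blast
  define W where "W t = indicator {0<..<T} t *\<^sub>R g t" for t
  have Wm: "W \<in> borel_measurable borel" using g(1) unfolding W_def[abs_def] by simp
  have ae: "AE t in lborel. t \<in> {0<..<T} \<longrightarrow> w t \<in> X \<and> \<tau> (w t) = W t"
    using wX[unfolded AE_time] sl[unfolded AE_time] g(2)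
  proof eventually_elim
    case (elim t)
    show ?case
    proof
      assume t: "t \<in> {0<..<T}"
      then have wt: "w t \<in> X" and l: "(\<lambda>n. N (\<lambda>a. s n t a - w t a)) \<longlonglongrightarrow> 0" using elim by simp_all
      have "(\<lambda>n. dist (\<tau> (s n t)) (\<tau> (w t))) \<longlonglongrightarrow> 0"
        using l unfolding N_diff[OF s(2)[OF t] wt] dist_norm .
      then have "(\<lambda>n. \<tau> (s n t)) \<longlonglongrightarrow> \<tau> (w t)" by (rule iffD2[OF tendsto_dist_iff])
      then have "(\<lambda>n. S n t) \<longlonglongrightarrow> \<tau> (w t)" using t by (simp add: S_def)
      then have "f t = \<tau> (w t)" unfolding f_def by (rule limI)
      then show "w t \<in> X \<and> \<tau> (w t) = W t" using wt t elim(3) by (simp add: W_def)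
    qed
  qed
  have "sqi W"
    unfolding sqi_def
  proof
    show "W \<in> borel_measurable borel" by (rule Wm)
    have m: "(\<lambda>t. (norm (W t))\<^sup>2) \<in> borel_measurable lborel" using Wm by simp
    have i: "integrable lebesgue (\<lambda>t. indicator {0<..<T} t * (N (w t))\<^sup>2)"
      using wi unfolding integrable_time_iff .
    have "AE t in lborel. (norm (W t))\<^sup>2 = indicator {0<..<T} t * (N (w t))\<^sup>2"
      using ae
    proof eventually_elim
      case (elim t)
      then show ?case using N_norm[of "w t"] by (cases "t \<in> {0<..<T}") (simp_all add: W_def)
    qed
    then have "integrable lebesgue (\<lambda>t. (norm (W t))\<^sup>2)"
      using integrable_cong_AE[OF measurable_completion[OF m] borel_measurable_integrable[OF i] AE_completion] i by blast
    then show "integrable lborel (\<lambda>t. (norm (W t))\<^sup>2)" using integrable_completion[OF m] by blast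
  qed
  then show ?thesis using ae by (intro exI[of _ W]) (simp add: models_def sqi_on_def W_def)
qed

lemma bochner_of_model:
  assumes W: "sqi_on T W"
  shows "(\<lambda>t. \<sigma> (W t)) \<in> bochner_L2 T X N" "models T (\<lambda>t. \<sigma> (W t)) W"
proof -
  show "models T (\<lambda>t. \<sigma> (W t)) W" using W by (simp add: models_def \<sigma>_in \<tau>_\<sigma>)
  have "W \<in> borel_measurable lborel" using sqiD(1)[OF sqi_onD(1)[OF W]] by simp
  then have "W \<in> borel_measurable (time_measure T)"
    by (intro measurable_restrict_space1 measurable_completion)
  then obtain F where F: "\<And>i. simple_function (time_measure T) (F i)" "\<And>t. t \<in> space (time_measure T) \<Longrightarrow> (\<lambda>i. F i t) \<longlonglongrightarrow> W t"
    using borel_measurable_implies_sequence_metric[of W "time_measure T" 0] by blast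
  have sm: "strongly_measurable T X N (\<lambda>t. \<sigma> (W t))"
    unfolding strongly_measurable_def
  proof (intro exI[of _ "\<lambda>n t. \<sigma> (F n t)"] conjI allI ballI)
    show "simple_function (time_measure T) (\<lambda>t. \<sigma> (F n t))" for n by (rule simple_function_compose1[OF F(1)])
    show "\<sigma> (F n t) \<in> X" for n t by (rule \<sigma>_in)
    show "AE t in time_measure T. (\<lambda>n. N (\<lambda>a. \<sigma> (F n t) a - \<sigma> (W t) a)) \<longlonglongrightarrow> 0"
    proof (rule AE_I2)
      fix t assume "t \<in> space (time_measure T)"
      from iffD1[OF tendsto_dist_iff F(2)[OF this]]
      show "(\<lambda>n. N (\<lambda>a. \<sigma> (F n t) a - \<sigma> (W t) a)) \<longlonglongrightarrow> 0"
        unfolding N_diff[OF \<sigma>_in \<sigma>_in] \<tau>_\<sigma> dist_norm .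
    qed
  qed
  have "integrable (time_measure T) (\<lambda>t. (N (\<sigma> (W t)))\<^sup>2)"
  proof (rule integral_time_AE(1)[OF sqiD(2)[OF sqi_onD(1)[OF W]]])
    show "AE t in lborel. indicator {0<..<T} t * (N (\<sigma> (W t)))\<^sup>2 = (norm (W t))\<^sup>2"
    proof (rule AE_I2)
      fix t show "indicator {0<..<T} t * (N (\<sigma> (W t)))\<^sup>2 = (norm (W t))\<^sup>2"
        using sqi_onD(2)[OF W, of t] by (cases "t \<in> {0<..<T}") (simp_all add: N_norm \<sigma>_in \<tau>_\<sigma>)
    qed
  qed
  then show "(\<lambda>t. \<sigma> (W t)) \<in> bochner_L2 T X N" using sm by (simp add: bochner_L2_def \<sigma>_in)
qed

end

interpretation VB: bochner_model V norm_V toV repV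
proof
  show "norm_V (\<lambda>a. f a - g a) = norm (toV f - toV g)" if "f \<in> V" "g \<in> V" for f g
    using norm_V_eq[OF V_diff(1)[OF that]] V_diff(2)[OF that] by simp
qed (simp_all add: norm_V_eq repV)

interpretation VdB: bochner_model V_dual norm_V_dual toVd fromVd
proof
  show "norm_V_dual (\<lambda>a. f a - g a) = norm (toVd f - toVd g)" if "f \<in> V_dual" "g \<in> V_dual" for f g
    using norm_V_dual_eq[OF V_dual_diff(1)[OF that]] V_dual_diff(2)[OF that] by simp
qed (simp_all add: norm_V_dual_eq fromVd)

text \<open>Bridges the definition, with Lebesgue measure on the interval, and the calculus of
  integrable functions on the line that vanish outside it.\<close>

lemma has_weak_deriv_time:
  fixes f g F G :: "real \<Rightarrow> real"
  assumes F: "integrable lborel F" "\<And>t. t \<notin> {0<..<T} \<Longrightarrow> F t = 0" and f: "AE t in lborel. t \<in> {0<..<T} \<longrightarrow> f t = F t"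
    and G: "integrable lborel G" "\<And>t. t \<notin> {0<..<T} \<Longrightarrow> G t = 0" and g: "AE t in lborel. t \<in> {0<..<T} \<longrightarrow> g t = G t"
  shows "has_weak_deriv {0<..<T} f g \<longleftrightarrow>
    (\<forall>\<theta>\<in>test_functions {0<..<T}. (LINT t|lborel. F t * deriv \<theta> t) = - (LINT t|lborel. G t * \<theta> t))"
proof -
  have loc: "locally_integrable {0<..<T} h" if H: "integrable lborel H" and h: "AE t in lborel. t \<in> {0<..<T} \<longrightarrow> h t = H t" for h H
    unfolding locally_integrable_def
  proof (intro allI impI)
    fix K assume K: "compact K \<and> K \<subseteq> {0<..<T}"
    have Kb: "K \<in> sets borel" using K by (simp add: borel_compact)
    have i: "integrable lborel (\<lambda>t. indicator K t * H t)" by (rule integrable_indicator_mult[OF H Kb])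
    have ae: "AE t in lborel. indicator K t * h t = indicator K t * H t"
      using h by eventually_elim (use K in \<open>auto simp: indicator_def\<close>)
    have m: "(\<lambda>t. indicator K t * H t) \<in> borel_measurable lborel" using i by (rule borel_measurable_integrable)
    have ml: "(\<lambda>t. indicator K t * H t) \<in> borel_measurable lebesgue" using m by (rule measurable_completion)
    have "integrable lebesgue (\<lambda>t. indicator K t * h t)"
      using integrable_cong_AE[OF lebesgue_measurable_AE[OF ml ae] ml AE_completion[OF ae]] i integrable_completion[OF m] by blast
    then show "integrable (lebesgue_on K) h" using Kb by (simp add: integrable_restrict_space)
  qed
  have int: "(LINT t|lebesgue_on {0<..<T}. h t * \<theta> t) = (LINT t|lborel. H t * \<theta> t)"
    if H: "integrable lborel H" "\<And>t. t \<notin> {0<..<T} \<Longrightarrow> H t = 0" and h: "AE t in lborel. t \<in> {0<..<T} \<longrightarrow> h t = H t"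
      and t: "\<theta> \<in> test_functions {0<..<T}" for h H \<theta>
  proof (rule integral_time_AE(2)[OF integrable_mult_test[OF H(1) t]])
    show "AE t in lborel. indicator {0<..<T} t * (h t * \<theta> t) = H t * \<theta> t"
      using h
    proof eventually_elim
      case (elim t)
      then show ?case using H(2)[of t] by (cases "t \<in> {0<..<T}") simp_all
    qed
  qed
  show ?thesis
    unfolding has_weak_deriv_def
    using loc[OF F(1) f] loc[OF G(1) g] int[OF F f test_deriv] int[OF G g] by simp
qed

lemma has_time_deriv_iff:
  assumes W: "VB.models T w W" and R: "VdB.models T v R"
  shows "has_time_deriv T w v \<longleftrightarrow> V.wderiv T W R"
proof -
  have Ws: "sqi_on T W" and wW: "AE t in lborel. t \<in> {0<..<T} \<longrightarrow> w t \<in> V \<and> toV (w t) = W t"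
    using W by (auto simp: VB.models_def)
  have Rs: "sqi_on T R" and vR: "AE t in lborel. t \<in> {0<..<T} \<longrightarrow> v t \<in> V_dual \<and> toVd (v t) = R t"
    using R by (auto simp: VdB.models_def)
  have eq: "has_weak_deriv {0<..<T} (\<lambda>t. inner_H (w t) \<phi>) (\<lambda>t. v t \<phi>) \<longleftrightarrow>
      (\<forall>\<theta>\<in>test_functions {0<..<T}. (LINT t|lborel. (jq (W t) \<bullet> jq (toV \<phi>)) * deriv \<theta> t) = - (LINT t|lborel. (R t \<bullet> toV \<phi>) * \<theta> t))"
    if \<phi>: "\<phi> \<in> V" for \<phi>
  proof (rule has_weak_deriv_time)
    show "integrable lborel (\<lambda>t. jq (W t) \<bullet> jq (toV \<phi>))" "integrable lborel (\<lambda>t. R t \<bullet> toV \<phi>)"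
      using sqi_on_integrable[OF V.sqi_on_j[OF Ws]] sqi_on_integrable[OF Rs] by simp_all
    show "jq (W t) \<bullet> jq (toV \<phi>) = 0" "R t \<bullet> toV \<phi> = 0" if "t \<notin> {0<..<T}" for t
      using sqi_onD(2)[OF Ws that] sqi_onD(2)[OF Rs that] by (simp_all add: V.j_lin)
    show "AE t in lborel. t \<in> {0<..<T} \<longrightarrow> inner_H (w t) \<phi> = jq (W t) \<bullet> jq (toV \<phi>)"
      using wW
    proof eventually_elim
      case (elim t)
      show ?case
      proof
        assume "t \<in> {0<..<T}"
        then have wt: "w t \<in> V" "toV (w t) = W t" using elim by simp_all
        have "inner_H (w t) \<phi> = toH (w t) \<bullet> toH \<phi>"
          by (rule inner_H_eq[OF V_weak_deriv(1)[OF wt(1)] V_weak_deriv(1)[OF \<phi>]])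
        then show "inner_H (w t) \<phi> = jq (W t) \<bullet> jq (toV \<phi>)"
          unfolding wt(2)[symmetric] toV(1)[OF wt(1)] toV(1)[OF \<phi>] .
      qed
    qed
    show "AE t in lborel. t \<in> {0<..<T} \<longrightarrow> v t \<phi> = R t \<bullet> toV \<phi>"
      using vR
    proof eventually_elim
      case (elim t)
      then show ?case using V_dual_toV[OF _ \<phi>, of "v t"] by (simp add: inner_commute)
    qed
  qed
  show ?thesis
  proof
    assume h: "has_time_deriv T w v"
    show "V.wderiv T W R" unfolding V.wderiv_def
    proof
      fix x
      have "has_weak_deriv {0<..<T} (\<lambda>t. inner_H (w t) (repV x)) (\<lambda>t. v t (repV x))"
        using h repV(1) unfolding has_time_deriv_def by blast
      then show "\<forall>\<theta>\<in>test_functions {0<..<T}. (LINT t|lborel. (jq (W t) \<bullet> jq x) * deriv \<theta> t) = - (LINT t|lborel. (R t \<bullet> x) * \<theta> t)"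
        unfolding eq[OF repV(1)] repV(2) .
    qed
  next
    assume h: "V.wderiv T W R"
    show "has_time_deriv T w v" unfolding has_time_deriv_def
    proof
      fix \<phi> assume "\<phi> \<in> V"
      from eq[OF this] show "has_weak_deriv {0<..<T} (\<lambda>t. inner_H (w t) \<phi>) (\<lambda>t. v t \<phi>)"
        using h unfolding V.wderiv_def by blast
    qed
  qed
qed

text \<open>Needed because \<open>time_deriv\<close> is a choice. The fundamental lemma handles each
  scalar component, and a countable dense set of directions gives equality of the vectors.\<close>

lemma wderiv_unique:
  assumes R: "sqi_on T R" "sqi_on T R'" and d: "V.wderiv T W R" "V.wderiv T W R'"
  shows "AE t in lborel. R t = R' t"
proof -
  define Q where "Q t = R t - R' t" for t
  have Qi: "integrable lborel Q" unfolding Q_def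
    by (rule Bochner_Integration.integrable_diff[OF sqi_on_integrable[OF R(1)] sqi_on_integrable[OF R(2)]])
  have ae: "AE t in lborel. Q t \<bullet> x = 0" for x
  proof -
    have Qx: "integrable lborel (\<lambda>t. Q t \<bullet> x)" using Qi by simp
    have Qm: "(\<lambda>t. Q t \<bullet> x) \<in> borel_measurable borel" using borel_measurable_integrable[OF Qx] by simp
    have "AE t in lborel. t \<in> {0<..<T} \<longrightarrow> Q t \<bullet> x = 0"
    proof (rule fundamental_lemma[OF open_greaterThanLessThan])
      show "integrable lebesgue (\<lambda>t. indicator {a..b} t * (Q t \<bullet> x))" for a b
      proof (subst integrable_completion)
        show i: "integrable lborel (\<lambda>t. indicator {a..b} t * (Q t \<bullet> x))" by (rule integrable_indicator_mult[OF Qx]) simp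
        show "(\<lambda>t. indicator {a..b} t * (Q t \<bullet> x)) \<in> borel_measurable lborel" by (rule borel_measurable_integrable[OF i])
      qed
      fix \<theta> assume t: "\<theta> \<in> test_functions {0<..<T}"
      have Rx: "integrable lborel (\<lambda>t. R t \<bullet> x)" "integrable lborel (\<lambda>t. R' t \<bullet> x)"
        using sqi_on_integrable[OF R(1)] sqi_on_integrable[OF R(2)] by simp_all
      note i = integrable_mult_test[OF Rx(1) t] integrable_mult_test[OF Rx(2) t]
      have "(LINT t|lborel. (R t \<bullet> x) * \<theta> t) = (LINT t|lborel. (R' t \<bullet> x) * \<theta> t)"
        using bspec[OF spec[OF d(1)[unfolded V.wderiv_def], of x] t] bspec[OF spec[OF d(2)[unfolded V.wderiv_def], of x] t]
        by linarith
      then have "(LINT t|lborel. (Q t \<bullet> x) * \<theta> t) = 0"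
        unfolding Q_def inner_diff_left left_diff_distrib Bochner_Integration.integral_diff[OF i] by simp
      then show "(LINT t|lebesgue. (Q t \<bullet> x) * \<theta> t) = 0"
        by (subst integral_completion[OF borel_measurable_integrable[OF integrable_mult_test[OF Qx t]]])
    qed
    then show ?thesis
    proof eventually_elim
      case (elim t)
      then show ?case using sqi_onD(2)[OF R(1), of t] sqi_onD(2)[OF R(2), of t]
        by (cases "t \<in> {0<..<T}") (simp_all add: Q_def)
    qed
  qed
  obtain D :: "vq set" where D: "countable D" "\<And>x. x \<in> closure D" using countable_dense_closure by blast
  have "AE t in lborel. \<forall>x\<in>D. Q t \<bullet> x = 0" by (simp only: AE_ball_countable[OF D(1)] ae) simp
  then show ?thesis
  proof eventually_elim
    case (elim t)
    obtain f where f: "\<And>n. f n \<in> D" "f \<longlonglongrightarrow> Q t" using D(2)[of "Q t"] unfolding closure_sequential by blast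
    have "(\<lambda>n. Q t \<bullet> f n) \<longlonglongrightarrow> Q t \<bullet> Q t" by (intro tendsto_inner tendsto_const f)
    then have "Q t \<bullet> Q t = 0" using elim f(1) by (simp add: LIMSEQ_const_iff)
    then show ?case by (simp add: Q_def)
  qed
qed

section \<open>The adjoint Burgers equation\<close>

lemma W_space_models:
  assumes "w \<in> W_space T"
  obtains W v R where "VB.models T w W" "VdB.models T v R" "has_time_deriv T w v" "V.wderiv T W R"
proof -
  obtain v where w: "w \<in> bochner_L2 T V norm_V" and v: "v \<in> bochner_L2 T V_dual norm_V_dual" "has_time_deriv T w v"
    using assms by (auto simp: W_space_def)
  obtain W where W: "VB.models T w W" using VB.models_exists[OF w] by blast
  obtain R where R: "VdB.models T v R" using VdB.models_exists[OF v(1)] by blast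
  show ?thesis by (rule that[OF W R v(2)]) (use has_time_deriv_iff[OF W R] v(2) in blast)
qed

text \<open>\<open>time_deriv\<close> selects some derivative; its model agrees almost everywhere
  with the known \<open>R\<close>, so the norm can be computed from \<open>R\<close>.\<close>

lemma models_norm_time_deriv:
  assumes w: "w \<in> W_space T" and W: "VB.models T w W" and R: "sqi_on T R" "V.wderiv T W R"
  shows "bochner_L2_norm T norm_V_dual (time_deriv T w) = sqrt (LINT t|lborel. (norm (R t))\<^sup>2)"
proof -
  define v where "v = time_deriv T w"
  have v: "v \<in> bochner_L2 T V_dual norm_V_dual \<and> has_time_deriv T w v"
  proof -
    have "\<exists>v. v \<in> bochner_L2 T V_dual norm_V_dual \<and> has_time_deriv T w v" using w by (auto simp: W_space_def)
    then show ?thesis unfolding v_def time_deriv_def by (rule someI_ex)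
  qed
  obtain S where S: "VdB.models T v S" using VdB.models_exists v by blast
  have Sw: "sqi_on T S" "V.wderiv T W S" using S has_time_deriv_iff[OF W S] v by (auto simp: VdB.models_def)
  have ae: "AE t in lborel. S t = R t" by (rule wderiv_unique[OF Sw(1) R(1) Sw(2) R(2)])
  have "(LINT t|lborel. (norm (S t))\<^sup>2) = (LINT t|lborel. (norm (R t))\<^sup>2)"
  proof (rule integral_cong_AE)
    show "(\<lambda>t. (norm (S t))\<^sup>2) \<in> borel_measurable lborel" "(\<lambda>t. (norm (R t))\<^sup>2) \<in> borel_measurable lborel"
      using sqiD(2)[OF sqi_onD(1)[OF Sw(1)]] sqiD(2)[OF sqi_onD(1)[OF R(1)]] by (simp_all only: borel_measurable_integrable)
    show "AE t in lborel. (norm (S t))\<^sup>2 = (norm (R t))\<^sup>2" using ae by eventually_elim simp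
  qed
  then show ?thesis using VdB.models_norm[OF S] by (simp add: v_def)
qed

lemma eq_ae_models:
  assumes "VB.models T w W"
    and "AE t in lborel. t \<in> {0<..<T} \<longrightarrow> f t \<in> H"
  shows "eq_ae T f w \<longleftrightarrow> (AE t in lborel. t \<in> {0<..<T} \<longrightarrow> toH (f t) = jq (W t))"
proof -
  have wW: "AE t in lborel. t \<in> {0<..<T} \<longrightarrow> w t \<in> V \<and> toV (w t) = W t"
    using assms(1) by (auto simp: VB.models_def)
  have "AE t in lborel. t \<in> {0<..<T} \<longrightarrow> ((AE x in lebesgue. f t x = w t x) \<longleftrightarrow> toH (f t) = jq (W t))"
    using wW assms(2)
  proof eventually_elim
    case (elim t)
    show ?case
    proof
      assume t: "t \<in> {0<..<T}"
      then have wt: "w t \<in> V" "toV (w t) = W t" and ft: "f t \<in> H" using elim by simp_all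
      show "(AE x in lebesgue. f t x = w t x) \<longleftrightarrow> toH (f t) = jq (W t)"
        unfolding AE_completion_iff wt(2)[symmetric] toV(1)[OF wt(1)]
        by (rule toH_eq_iff[OF ft V_weak_deriv(1)[OF wt(1)], symmetric])
    qed
  qed
  then show ?thesis unfolding eq_ae_def AE_time
    by (intro iffI; elim AE_mp) (auto elim: eventually_mono)
qed

text \<open>\<open>cont_rep\<close> is a choice as well. Representatives of the continuous curve
  \<open>z\<close> show that there is something to choose, and two continuous curves that agree
  almost everywhere agree at every time, the endpoints included.\<close>

lemma cont_rep:
  assumes T: "0 < T" and W: "VB.models T w W"
    and z: "continuous_on {0..T} z" "AE t in lborel. t \<in> {0<..<T} \<longrightarrow> z t = jq (W t)" and t: "t \<in> {0..T}"
  shows "cont_rep T w t \<in> H" "toH (cont_rep T w t) = z t"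
proof -
  have r: "is_cont_rep T w (\<lambda>t. rep_l2 (z t))"
    unfolding is_cont_rep_def
  proof (intro conjI ballI)
    show "rep_l2 (z t) \<in> H" for t by (rule rep_l2_H)
    fix s assume s: "s \<in> {0..T}"
    have "norm_H (\<lambda>x. rep_l2 (z t) x - rep_l2 (z s) x) = dist (z t) (z s)" for t
      using norm_H_eq[OF H_diff(1)[OF rep_l2_H[of "z t"] rep_l2_H[of "z s"]]]
      by (simp add: H_diff(2)[OF rep_l2_H rep_l2_H] toH_rep dist_norm)
    moreover have "(z \<longlongrightarrow> z s) (at s within {0..T})" using z(1) s by (simp add: continuous_on)
    ultimately show "((\<lambda>t. norm_H (\<lambda>x. rep_l2 (z t) x - rep_l2 (z s) x)) \<longlongrightarrow> 0) (at s within {0..T})"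
      using iffD1[OF tendsto_dist_iff] by simp
  next
    show "eq_ae T (\<lambda>t. rep_l2 (z t)) w"
      by (subst eq_ae_models[OF W]) (use z(2) in \<open>simp_all add: rep_l2_H toH_rep\<close>)
  qed
  define y where "y = cont_rep T w"
  have y: "is_cont_rep T w y" unfolding y_def cont_rep_def by (rule someI[of _ "\<lambda>t. rep_l2 (z t)"]) (rule r)
  have yH: "y t \<in> H" if "t \<in> {0..T}" for t using y that by (auto simp: is_cont_rep_def)
  show "cont_rep T w t \<in> H" using yH[OF t] by (simp add: y_def)
  have "continuous_on {0..T} (\<lambda>t. toH (y t))"
    unfolding continuous_on
  proof
    fix s assume s: "s \<in> {0..T}"
    have "((\<lambda>t. norm_H (\<lambda>x. y t x - y s x)) \<longlongrightarrow> 0) (at s within {0..T})"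
      using y s by (auto simp: is_cont_rep_def)
    moreover have "\<forall>\<^sub>F t in at s within {0..T}. norm_H (\<lambda>x. y t x - y s x) = dist (toH (y t)) (toH (y s))"
      unfolding eventually_at_filter
      using norm_H_eq[OF H_diff(1)[OF yH yH[OF s]]] H_diff(2)[OF yH yH[OF s]]
      by (intro always_eventually) (simp add: dist_norm)
    ultimately have "((\<lambda>t. dist (toH (y t)) (toH (y s))) \<longlongrightarrow> 0) (at s within {0..T})"
      by (rule Lim_transform_eventually)
    then show "((\<lambda>t. toH (y t)) \<longlongrightarrow> toH (y s)) (at s within {0..T})" by (rule iffD2[OF tendsto_dist_iff])
  qed
  moreover have "AE t in lborel. t \<in> {0<..<T} \<longrightarrow> toH (y t) = z t"
  proof -
    have "eq_ae T y w" using y by (simp add: is_cont_rep_def)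
    then have "AE t in lborel. t \<in> {0<..<T} \<longrightarrow> toH (y t) = jq (W t)"
      by (subst (asm) eq_ae_models[OF W]) (use yH in \<open>auto intro!: AE_I2\<close>)
    then show ?thesis using z(2) by eventually_elim simp
  qed
  ultimately show "toH (cont_rep T w t) = z t"
    unfolding y_def by (rule continuous_AE_eq[OF T _ z(1) _ t])
qed

text \<open>The adjoint equation solved for the time derivative, which fixes the signs of diffusion
  and transport.\<close>

definition adj_form :: "real \<Rightarrow> (real \<Rightarrow> vq) \<Rightarrow> real \<Rightarrow> vq \<Rightarrow> vq \<Rightarrow> real" where
  "adj_form \<nu> Y t x \<phi> = \<nu> * (dq x \<bullet> dq \<phi>) - mulq (Y t) (dq x) \<bullet> jq \<phi>"

lemma dq_measurable [measurable]: "dq \<in> borel_measurable borel"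
proof -
  have "bounded_linear dq" by (rule bounded_linear_intro[of _ 1]) (simp_all add: jq_dq_lin norm_dq_le)
  then show ?thesis by (intro borel_measurable_continuous_onI linear_continuous_on)
qed

text \<open>The Sobolev bound estimates the transport term by \<open>3 * C * d * k\<close>, where
  \<open>d\<close> and \<open>k\<close> are the norms of derivative and function. Young's inequality
  spends half of the diffusion on it and leaves \<open>\<nu> / 2\<close> as coercivity constant; the
  summand \<open>\<nu> / 2\<close> in the next constant completes \<open>d\<^sup>2\<close> to the
  full norm of \<open>V\<close>.\<close>

lemma adj_evolution:
  assumes T: "0 < T" and \<nu>: "0 < \<nu>" and Y: "Y \<in> borel_measurable borel" and C: "0 \<le> C" "\<And>t. norm (Y t) \<le> C"
  shows "evolution jq (adj_form \<nu> Y) T (\<nu> / 2) (\<nu> / 2 + (3 * C)\<^sup>2 / (2 * \<nu>)) (\<nu> + 3 * C)"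
proof -
  interpret mulq: bounded_bilinear mulq by (rule mulq_bilinear)
  have b: "\<bar>mulq (Y t) (dq x) \<bullet> jq \<phi>\<bar> \<le> 3 * C * norm (dq x) * norm (jq \<phi>)" for t x \<phi>
  proof -
    have "\<bar>mulq (Y t) (dq x) \<bullet> jq \<phi>\<bar> \<le> norm (mulq (Y t) (dq x)) * norm (jq \<phi>)" by (rule Cauchy_Schwarz_ineq2)
    also have "\<dots> \<le> (3 * norm (Y t) * norm (dq x)) * norm (jq \<phi>)" by (intro mult_right_mono mulf(2)) simp
    also have "\<dots> \<le> (3 * C * norm (dq x)) * norm (jq \<phi>)" by (intro mult_right_mono mult_left_mono C(2)) simp_all
    finally show ?thesis .
  qed
  show ?thesis
  proof (intro evolution.intro evolution_axioms.intro V.gelfand_axioms)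
    show "0 < T" "0 < \<nu> / 2" "0 \<le> \<nu> / 2 + (3 * C)\<^sup>2 / (2 * \<nu>)" "0 \<le> \<nu> + 3 * C" using T \<nu> C by simp_all
    show "(\<lambda>t. adj_form \<nu> Y t (f t) (g t)) \<in> borel_measurable borel"
      if f [measurable]: "f \<in> borel_measurable borel" and g [measurable]: "g \<in> borel_measurable borel" for f g
    proof -
      \<comment> \<open>Joint continuity of the product makes it measurable along measurable
        curves.\<close>
      have c: "continuous_on UNIV (\<lambda>p. mulq (fst p) (snd p))"
        by (intro mulq.continuous_on continuous_intros)
      have [measurable]: "(\<lambda>t. mulq (Y t) (dq (f t))) \<in> borel_measurable borel"
        by (rule borel_measurable_continuous_Pair[OF Y _ c]) measurable
      show ?thesis unfolding adj_form_def by measurable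
    qed
    show "linear (\<lambda>x. adj_form \<nu> Y t x \<phi>)" for t \<phi>
      by (rule linearI)
        (simp_all add: adj_form_def jq_dq_lin mulq.add_right mulq.scaleR_right inner_add_left algebra_simps)
    show "linear (adj_form \<nu> Y t x)" for t x
      by (rule linearI) (simp_all add: adj_form_def jq_dq_lin inner_add_right algebra_simps)
    show "\<bar>adj_form \<nu> Y t x \<phi>\<bar> \<le> (\<nu> + 3 * C) * norm x * norm \<phi>" for t x \<phi>
    proof -
      have "\<bar>dq x \<bullet> dq \<phi>\<bar> \<le> norm (dq x) * norm (dq \<phi>)" by (rule Cauchy_Schwarz_ineq2)
      also have "\<dots> \<le> norm x * norm \<phi>" by (intro mult_mono norm_dq_le) simp_all
      finally have 1: "\<bar>\<nu> * (dq x \<bullet> dq \<phi>)\<bar> \<le> \<nu> * (norm x * norm \<phi>)" using \<nu> by (simp add: abs_mult)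
      have "3 * C * norm (dq x) * norm (jq \<phi>) \<le> 3 * C * norm x * norm \<phi>"
        using C(1) by (intro mult_mono norm_dq_le norm_jq_le) simp_all
      then have "\<bar>adj_form \<nu> Y t x \<phi>\<bar> \<le> \<nu> * (norm x * norm \<phi>) + 3 * C * norm x * norm \<phi>"
        using 1 b[of t x \<phi>] unfolding adj_form_def by linarith
      then show ?thesis by (simp add: algebra_simps)
    qed
    show "\<nu> / 2 * (norm x)\<^sup>2 - (\<nu> / 2 + (3 * C)\<^sup>2 / (2 * \<nu>)) * (norm (jq x))\<^sup>2 \<le> adj_form \<nu> Y t x x" for t x
    proof -
      define d where "d = norm (dq x)"
      define k where "k = norm (jq x)"
      have "0 \<le> (\<nu> * d - 3 * C * k)\<^sup>2 / (2 * \<nu>)" using \<nu> by simp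
      also have "\<dots> = \<nu> / 2 * d\<^sup>2 + (3 * C)\<^sup>2 / (2 * \<nu>) * k\<^sup>2 - 3 * C * d * k"
        using \<nu> by (simp add: power2_eq_square field_simps)
      finally have "3 * C * d * k \<le> \<nu> / 2 * d\<^sup>2 + (3 * C)\<^sup>2 / (2 * \<nu>) * k\<^sup>2" by simp
      moreover have "mulq (Y t) (dq x) \<bullet> jq x \<le> 3 * C * d * k" using b[of t x x] unfolding d_def k_def by linarith
      moreover have dd: "dq x \<bullet> dq x = d\<^sup>2" by (simp add: d_def power2_norm_eq_inner)
      ultimately have "\<nu> * d\<^sup>2 - (\<nu> / 2 * d\<^sup>2 + (3 * C)\<^sup>2 / (2 * \<nu>) * k\<^sup>2) \<le> adj_form \<nu> Y t x x"
        unfolding adj_form_def dd by linarith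
      moreover have "(norm x)\<^sup>2 = k\<^sup>2 + d\<^sup>2" by (simp add: norm_vq_square d_def k_def)
      ultimately show ?thesis unfolding k_def[symmetric] by (simp add: algebra_simps)
    qed
  qed
qed

text \<open>The equation contains the chosen \<open>weak_deriv\<close>, which by uniqueness is
  \<open>v t \<phi>\<close> almost everywhere; all other terms depend only on the classes of
  \<open>q t\<close>, \<open>y t\<close> and \<phi>.\<close>

lemma adjoint_equation_iff:
  assumes Q: "VB.models T q Q" and R: "VdB.models T v R" and d: "has_time_deriv T q v"
    and Y: "AE t in lborel. t \<in> {0<..<T} \<longrightarrow> y t \<in> V \<and> toV (y t) = Y t" and \<phi>: "\<phi> \<in> V"
  shows "(AE t in time_measure T.
        weak_deriv {0<..<T} (\<lambda>s. inner_H (q s) \<phi>) t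
          + inner_H (\<lambda>x. y t x * Dx (q t) x) \<phi>
          - \<nu> * inner_H (Dx (q t)) (Dx \<phi>) = 0)
    \<longleftrightarrow> (AE t in lborel. t \<in> {0<..<T} \<longrightarrow> R t \<bullet> toV \<phi> = adj_form \<nu> Y t (Q t) (toV \<phi>))"
proof -
  have qQ: "AE t in lborel. t \<in> {0<..<T} \<longrightarrow> q t \<in> V \<and> toV (q t) = Q t" using Q by (auto simp: VB.models_def)
  have vR: "AE t in lborel. t \<in> {0<..<T} \<longrightarrow> v t \<in> V_dual \<and> toVd (v t) = R t" using R by (auto simp: VdB.models_def)
  have hw: "has_weak_deriv {0<..<T} (\<lambda>t. inner_H (q t) \<phi>) (\<lambda>t. v t \<phi>)" using d \<phi> by (simp add: has_time_deriv_def)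
  have "has_weak_deriv {0<..<T} (\<lambda>t. inner_H (q t) \<phi>) (weak_deriv {0<..<T} (\<lambda>t. inner_H (q t) \<phi>))"
    unfolding weak_deriv_def by (rule someI[of _ "\<lambda>t. v t \<phi>"]) (rule hw)
  from weak_deriv_unique[OF open_greaterThanLessThan this hw]
  have wd: "AE t in lborel. t \<in> {0<..<T} \<longrightarrow> weak_deriv {0<..<T} (\<lambda>t. inner_H (q t) \<phi>) t = v t \<phi>" .
  note \<phi>' = V_weak_deriv[OF \<phi>]
  have "AE t in lborel. t \<in> {0<..<T} \<longrightarrow>
      (weak_deriv {0<..<T} (\<lambda>s. inner_H (q s) \<phi>) t + inner_H (\<lambda>x. y t x * Dx (q t) x) \<phi>
          - \<nu> * inner_H (Dx (q t)) (Dx \<phi>) = 0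
      \<longleftrightarrow> R t \<bullet> toV \<phi> = adj_form \<nu> Y t (Q t) (toV \<phi>))"
    using wd qQ vR Y
  proof eventually_elim
    case (elim t)
    show ?case
    proof
      assume t: "t \<in> {0<..<T}"
      then have q: "q t \<in> V" "toV (q t) = Q t" and v: "v t \<in> V_dual" "toVd (v t) = R t"
        and y: "y t \<in> V" "toV (y t) = Y t"
        and w: "weak_deriv {0<..<T} (\<lambda>t. inner_H (q t) \<phi>) t = v t \<phi>" using elim by simp_all
      have 1: "v t \<phi> = R t \<bullet> toV \<phi>" using V_dual_toV[OF v(1) \<phi>] v(2) by (simp add: inner_commute)
      have 2: "inner_H (\<lambda>x. y t x * Dx (q t) x) \<phi> = mulq (Y t) (dq (Q t)) \<bullet> jq (toV \<phi>)"
        using inner_H_product[OF y(1) V_weak_deriv(2)[OF q(1)] \<phi>'(1)] toV(2)[OF q(1)] toV(1)[OF \<phi>] y(2) q(2) by simp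
      have 3: "inner_H (Dx (q t)) (Dx \<phi>) = dq (Q t) \<bullet> dq (toV \<phi>)"
        using inner_H_eq[OF V_weak_deriv(2)[OF q(1)] \<phi>'(2)] toV(2)[OF q(1)] toV(2)[OF \<phi>] q(2) by simp
      show "weak_deriv {0<..<T} (\<lambda>s. inner_H (q s) \<phi>) t + inner_H (\<lambda>x. y t x * Dx (q t) x) \<phi>
          - \<nu> * inner_H (Dx (q t)) (Dx \<phi>) = 0
        \<longleftrightarrow> R t \<bullet> toV \<phi> = adj_form \<nu> Y t (Q t) (toV \<phi>)"
        unfolding w 1 2 3 adj_form_def by argo
    qed
  qed
  then show ?thesis unfolding AE_time by (intro iffI; elim AE_mp) (auto elim: eventually_mono)
qed

lemma terminal_iff:
  assumes "f \<in> H" "g \<in> H" shows "(\<forall>\<psi>\<in>H. inner_H f \<psi> = inner_H g \<psi>) \<longleftrightarrow> toH f = toH g"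
proof
  assume a: "\<forall>\<psi>\<in>H. inner_H f \<psi> = inner_H g \<psi>"
  have "\<forall>u. toH f \<bullet> u = toH g \<bullet> u"
  proof
    fix u show "toH f \<bullet> u = toH g \<bullet> u"
      using bspec[OF a rep_l2_H[of u]] by (simp add: inner_H_eq assms rep_l2_H toH_rep)
  qed
  then show "toH f = toH g" by (simp only: vector_eq_rdot)
qed (simp add: inner_H_eq assms)

text \<open>The exceptional set of times may depend on the test function; a countable dense set of
  test functions and continuity of both sides leave one exceptional set for all of them.\<close>

lemma evolution_equation_all:
  assumes E: "evolution jq a T \<alpha> \<mu> M"
    and eq: "\<And>\<phi>. \<phi> \<in> V \<Longrightarrow> AE t in lborel. t \<in> {0<..<T} \<longrightarrow> R t \<bullet> toV \<phi> = a t (Q t) (toV \<phi>)"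
  shows "AE t in lborel. t \<in> {0<..<T} \<longrightarrow> (\<forall>x. R t \<bullet> x = a t (Q t) x)"
proof -
  interpret E: evolution jq a T \<alpha> \<mu> M by (rule E)
  obtain D :: "vq set" where D: "countable D" "\<And>x. x \<in> closure D" using countable_dense_closure by blast
  have "AE t in lborel. t \<in> {0<..<T} \<longrightarrow> R t \<bullet> x = a t (Q t) x" for x
    using eq[OF repV(1), of x] by (simp add: repV)
  then have "AE t in lborel. \<forall>x\<in>D. t \<in> {0<..<T} \<longrightarrow> R t \<bullet> x = a t (Q t) x"
    by (simp only: AE_ball_countable[OF D(1)]) blast
  then show ?thesis
  proof eventually_elim
    case (elim t)
    show ?case
    proof (intro impI allI)
      fix x assume t: "t \<in> {0<..<T}"
      have bl: "bounded_linear (a t (Q t))"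
      proof (rule bounded_linear_intro[of _ "M * norm (Q t)"])
        show "norm (a t (Q t) x) \<le> norm x * (M * norm (Q t))" for x
          using E.a_bound[of t "Q t" x] by (simp add: mult_ac)
      qed (simp_all add: linear_add[OF E.a_right] linear_scale[OF E.a_right])
      obtain f where f: "\<And>n. f n \<in> D" "f \<longlonglongrightarrow> x" using D(2)[of x] unfolding closure_sequential by blast
      have "(\<lambda>n. R t \<bullet> f n) \<longlonglongrightarrow> R t \<bullet> x" by (intro tendsto_inner tendsto_const f)
      moreover have "R t \<bullet> f n = a t (Q t) (f n)" for n using elim f(1) t by blast
      moreover have "(\<lambda>n. a t (Q t) (f n)) \<longlonglongrightarrow> a t (Q t) x" by (rule bounded_linear.tendsto[OF bl f(2)])
      ultimately show "R t \<bullet> x = a t (Q t) x" using LIMSEQ_unique by simp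
    qed
  qed
qed

theorem theorem2p6:
  fixes T \<nu> ul uu :: real
    and \<kappa> u y0 :: "real \<Rightarrow> real"
    and y :: "real \<Rightarrow> real \<Rightarrow> real"
  assumes "T > 0" and "\<nu> > 0" and "ul \<le> uu"
    and "\<kappa> \<in> test_functions UNIV"
    and "u \<in> U_ad T ul uu"
    and "y0 \<in> V_bounded_support"
    and "y \<in> W_space T" and "y \<in> bochner_Linf T V norm_V"
    and "state_solution T \<nu> \<kappa> u y0 y"
  shows "\<exists>C>0. \<forall>yd\<in>H_compact_support.
           \<exists>p\<in>W_space T. adjoint_solution T \<nu> y yd p \<and>
             (\<forall>q\<in>W_space T. adjoint_solution T \<nu> y yd q \<longrightarrow> eq_ae T q p) \<and>
             W_norm T p \<le> C * norm_H (\<lambda>x. cont_rep T y T x - yd x)"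
proof -
  note T = \<open>T > 0\<close> and \<nu> = \<open>\<nu> > 0\<close>
  have T0: "T \<in> {0..T}" using T by simp
  obtain Z vy Ry where Z: "VB.models T y Z" and Ry: "VdB.models T vy Ry" and wy: "V.wderiv T Z Ry"
    using W_space_models[OF assms(7)] by blast
  have Zs: "sqi_on T Z" and Zy: "AE t in lborel. t \<in> {0<..<T} \<longrightarrow> y t \<in> V \<and> toV (y t) = Z t"
    using Z by (auto simp: VB.models_def)
  have Rys: "sqi_on T Ry" using Ry by (simp add: VdB.models_def)
  obtain zy where zy: "continuous_on {0..T} zy" "AE t in lborel. t \<in> {0<..<T} \<longrightarrow> zy t = jq (Z t)"
    by (rule V.cont_representative[OF T Zs Rys wy])
  define yT where "yT = cont_rep T y T"
  have yT: "yT \<in> H" unfolding yT_def by (rule cont_rep(1)[OF T Z zy T0])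
  obtain C0 where C0: "AE t in time_measure T. norm_V (y t) \<le> C0"
    using assms(8) by (auto simp: bochner_Linf_def)
  define C where "C = max C0 0"
  \<comment> \<open>\<open>adj_evolution\<close> asks for a bound at every time, whereas
    \<open>y\<close> is bounded only almost everywhere; at the exceptional times \<open>Z t\<close>
    is replaced by zero.\<close>
  define Y where "Y t = (if norm (Z t) \<le> C then Z t else 0)" for t
  have Zm [measurable]: "Z \<in> borel_measurable borel" by (rule sqiD(1)[OF sqi_onD(1)[OF Zs]])
  have Ym: "Y \<in> borel_measurable borel" unfolding Y_def[abs_def] by measurable
  have C: "0 \<le> C" "\<And>t. norm (Y t) \<le> C" by (simp_all add: C_def Y_def)
  have Y: "AE t in lborel. t \<in> {0<..<T} \<longrightarrow> y t \<in> V \<and> toV (y t) = Y t"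
    using Zy C0[unfolded AE_time]
  proof eventually_elim
    case (elim t)
    then show ?case using norm_V_eq[of "y t"] by (auto simp: Y_def C_def)
  qed
  define \<mu> where "\<mu> = \<nu> / 2 + (3 * C)\<^sup>2 / (2 * \<nu>)"
  define M where "M = \<nu> + 3 * C"
  define a where "a = adj_form \<nu> Y"
  have ev: "evolution jq a T (\<nu> / 2) \<mu> M"
    unfolding a_def \<mu>_def M_def by (rule adj_evolution[OF T \<nu> Ym C])
  interpret E: evolution jq a T "\<nu> / 2" \<mu> M by (rule ev)
  define K where "K = sqrt (exp (2 * \<mu> * T) / (2 * (\<nu> / 2)))"
  have K0: "0 \<le> K" using \<nu> by (simp add: K_def)
  \<comment> \<open>\<open>K\<close> bounds \<open>p\<close> in \<open>L\<^sup>2(V)\<close> and the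
    form bound \<open>M\<close> controls the derivative by \<open>M\<close> times that, whence the
    square root; the added \<open>1\<close> only makes the constant positive. All of it is fixed
    before \<open>yd\<close>.\<close>
  show ?thesis
  proof (intro exI[of _ "sqrt (1 + M\<^sup>2) * K + 1"] conjI ballI)
    show "0 < sqrt (1 + M\<^sup>2) * K + 1" using K0 by (simp add: add_nonneg_pos)
    fix yd assume "yd \<in> H_compact_support"
    then have yd: "yd \<in> H" by (simp add: H_compact_support_def)
    define g where "g = toH (\<lambda>x. yd x - yT x)"
    have gH: "(\<lambda>x. yd x - yT x) \<in> H" by (rule H_diff(1)[OF yd yT])
    obtain p v z where p: "sqi_on T p" and v: "sqi_on T v" and wd: "V.wderiv T p v"
      and va: "\<And>t x. v t \<bullet> x = a t (p t) x" and vn: "\<And>t. norm (v t) \<le> M * norm (p t)"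
      and pn: "sqrt (LINT t|lborel. (norm (p t))\<^sup>2) \<le> K * norm g"
      and z: "continuous_on {0..T} z" "AE t in lborel. t \<in> {0<..<T} \<longrightarrow> z t = jq (p t)" "z T = g"
      by (rule E.evolution_exists[where g = g, folded K_def]) (rule that)
    define P where "P t = repV (p t)" for t
    define P' where "P' t = fromVd (v t)" for t
    have P: "P \<in> bochner_L2 T V norm_V" "VB.models T P p"
      unfolding P_def[abs_def] by (rule VB.bochner_of_model[OF p])+
    have P': "P' \<in> bochner_L2 T V_dual norm_V_dual" "VdB.models T P' v"
      unfolding P'_def[abs_def] by (rule VdB.bochner_of_model[OF v])+
    have Pd: "has_time_deriv T P P'" using has_time_deriv_iff[OF P(2) P'(2)] wd by blast
    have PW: "P \<in> W_space T" using P(1) P'(1) Pd by (auto simp: W_space_def)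
    \<comment> \<open>Stated for an arbitrary \<open>q\<close>, since it serves the constructed
      solution as well as its competitors.\<close>
    have terminal: "(\<forall>\<psi>\<in>H. inner_H (cont_rep T q T) \<psi> = inner_H (\<lambda>x. yd x - cont_rep T y T x) \<psi>) \<longleftrightarrow> zq T = g"
      if "VB.models T q Q" "continuous_on {0..T} zq" "AE t in lborel. t \<in> {0<..<T} \<longrightarrow> zq t = jq (Q t)" for q Q zq
      using terminal_iff[OF cont_rep(1)[OF T that T0] gH] cont_rep(2)[OF T that T0] by (simp add: g_def yT_def)
    show "\<exists>p\<in>W_space T. adjoint_solution T \<nu> y yd p \<and>
             (\<forall>q\<in>W_space T. adjoint_solution T \<nu> y yd q \<longrightarrow> eq_ae T q p) \<and>
             W_norm T p \<le> (sqrt (1 + M\<^sup>2) * K + 1) * norm_H (\<lambda>x. cont_rep T y T x - yd x)"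
    proof (intro bexI[of _ P] conjI ballI impI)
      show "P \<in> W_space T" by (rule PW)
      show "adjoint_solution T \<nu> y yd P"
        unfolding adjoint_solution_def
      proof (intro conjI)
        show "\<forall>\<phi>\<in>V. AE t in time_measure T.
            weak_deriv {0<..<T} (\<lambda>s. inner_H (P s) \<phi>) t + inner_H (\<lambda>x. y t x * Dx (P t) x) \<phi>
              - \<nu> * inner_H (Dx (P t)) (Dx \<phi>) = 0"
        proof
          fix \<phi> assume \<phi>: "\<phi> \<in> V"
          show "AE t in time_measure T.
            weak_deriv {0<..<T} (\<lambda>s. inner_H (P s) \<phi>) t + inner_H (\<lambda>x. y t x * Dx (P t) x) \<phi>
              - \<nu> * inner_H (Dx (P t)) (Dx \<phi>) = 0"
            unfolding adjoint_equation_iff[OF P(2) P'(2) Pd Y \<phi>] by (simp add: va a_def)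
        qed
        show "\<forall>\<psi>\<in>H. inner_H (cont_rep T P T) \<psi> = inner_H (\<lambda>x. yd x - cont_rep T y T x) \<psi>"
          using terminal[OF P(2) z(1,2)] z(3) by blast
      qed
    next
      fix q assume q: "q \<in> W_space T" and qa: "adjoint_solution T \<nu> y yd q"
      obtain Q vq Rq where Q: "VB.models T q Q" and Rq: "VdB.models T vq Rq"
        and qd: "has_time_deriv T q vq" and wq: "V.wderiv T Q Rq"
        using W_space_models[OF q] by blast
      have Qs: "sqi_on T Q" and qQ: "AE t in lborel. t \<in> {0<..<T} \<longrightarrow> q t \<in> V \<and> toV (q t) = Q t"
        using Q by (auto simp: VB.models_def)
      have Rs: "sqi_on T Rq" using Rq by (simp add: VdB.models_def)
      obtain zq where zq: "continuous_on {0..T} zq" "AE t in lborel. t \<in> {0<..<T} \<longrightarrow> zq t = jq (Q t)"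
        by (rule V.cont_representative[OF T Qs Rs wq])
      have zqT: "zq T = g" using qa terminal[OF Q zq] unfolding adjoint_solution_def by blast
      have eqQ: "AE t in lborel. t \<in> {0<..<T} \<longrightarrow> (\<forall>x. Rq t \<bullet> x = a t (Q t) x)"
      proof (rule evolution_equation_all[OF ev])
        fix \<phi> assume \<phi>: "\<phi> \<in> V"
        show "AE t in lborel. t \<in> {0<..<T} \<longrightarrow> Rq t \<bullet> toV \<phi> = a t (Q t) (toV \<phi>)"
          unfolding a_def adjoint_equation_iff[OF Q Rq qd Y \<phi>, symmetric]
          using qa \<phi> unfolding adjoint_solution_def by blast
      qed
      \<comment> \<open>The difference of two solutions solves the same equation with terminal value
        zero, so \<open>evolution_unique\<close> applies to it.\<close>
      define D where "D t = Q t - p t" for t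
      define S where "S t = Rq t - v t" for t
      have Ds: "sqi_on T D" "sqi_on T S"
        using Qs p Rs v by (simp_all add: sqi_on_def D_def[abs_def] S_def[abs_def] sqi_diff)
      have "V.wderiv T D S"
        unfolding V.wderiv_def
      proof (intro allI ballI)
        fix x \<theta> assume t: "\<theta> \<in> test_functions {0<..<T}"
        have i: "integrable lborel (\<lambda>t. jq (w t) \<bullet> c)" "integrable lborel (\<lambda>t. w t \<bullet> x)" if "sqi_on T w" for w c
          using sqi_on_integrable[OF V.sqi_on_j[OF that]] sqi_on_integrable[OF that] by simp_all
        have "(LINT t|lborel. jq (D t) \<bullet> jq x * deriv \<theta> t)
          = (LINT t|lborel. jq (Q t) \<bullet> jq x * deriv \<theta> t) - (LINT t|lborel. jq (p t) \<bullet> jq x * deriv \<theta> t)"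
          unfolding D_def jq_dq_lin inner_diff_left left_diff_distrib
          by (rule Bochner_Integration.integral_diff[OF integrable_mult_test[OF i(1)[OF Qs] test_deriv[OF t]]
                integrable_mult_test[OF i(1)[OF p] test_deriv[OF t]]])
        also have "\<dots> = - (LINT t|lborel. Rq t \<bullet> x * \<theta> t) - - (LINT t|lborel. v t \<bullet> x * \<theta> t)"
          using wq wd t unfolding V.wderiv_def by simp
        also have "\<dots> = - ((LINT t|lborel. Rq t \<bullet> x * \<theta> t) - (LINT t|lborel. v t \<bullet> x * \<theta> t))" by simp
        also have "(LINT t|lborel. Rq t \<bullet> x * \<theta> t) - (LINT t|lborel. v t \<bullet> x * \<theta> t) = (LINT t|lborel. S t \<bullet> x * \<theta> t)"
          unfolding S_def inner_diff_left left_diff_distrib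
          by (rule Bochner_Integration.integral_diff[symmetric, OF integrable_mult_test[OF i(2)[OF Rs] t]
                integrable_mult_test[OF i(2)[OF v] t]])
        finally show "(LINT t|lborel. jq (D t) \<bullet> jq x * deriv \<theta> t) = - (LINT t|lborel. S t \<bullet> x * \<theta> t)" .
      qed
      moreover have "AE t in lborel. t \<in> {0<..<T} \<longrightarrow> (\<forall>x. S t \<bullet> x = a t (D t) x)"
        using eqQ
      proof eventually_elim
        case (elim t)
        then show ?case by (simp add: S_def D_def inner_diff_left va linear_diff[OF E.a_left])
      qed
      moreover have "continuous_on {0..T} (\<lambda>t. zq t - z t)" by (intro continuous_on_diff zq z)
      moreover have "AE t in lborel. t \<in> {0<..<T} \<longrightarrow> zq t - z t = jq (D t)"
        using zq(2) z(2) by eventually_elim (simp add: D_def jq_dq_lin)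
      moreover have "zq T - z T = 0" by (simp add: zqT z(3))
      ultimately have zz: "zq t - z t = 0" if "t \<in> {0..T}" for t
        using E.evolution_unique[OF Ds] that by blast
      show "eq_ae T q P"
      proof (subst eq_ae_models[OF P(2)])
        show "AE t in lborel. t \<in> {0<..<T} \<longrightarrow> q t \<in> H"
          using qQ by eventually_elim (simp add: V_weak_deriv)
        show "AE t in lborel. t \<in> {0<..<T} \<longrightarrow> toH (q t) = jq (p t)"
          using qQ zq(2) z(2)
        proof eventually_elim
          case (elim t)
          then show ?case using zz[of t] toV(1)[of "q t"] by auto
        qed
      qed
    next
      define A where "A = sqrt (LINT t|lborel. (norm (p t))\<^sup>2)"
      define B where "B = sqrt (LINT t|lborel. (norm (v t))\<^sup>2)"
      have M0: "0 \<le> M" by (rule E.M)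
      have "(LINT t|lborel. (norm (v t))\<^sup>2) \<le> (LINT t|lborel. M\<^sup>2 * (norm (p t))\<^sup>2)"
      proof (rule integral_mono[OF sqiD(2)[OF sqi_onD(1)[OF v]]])
        show "integrable lborel (\<lambda>t. M\<^sup>2 * (norm (p t))\<^sup>2)" using sqiD(2)[OF sqi_onD(1)[OF p]] by simp
        show "(norm (v t))\<^sup>2 \<le> M\<^sup>2 * (norm (p t))\<^sup>2" for t
          using power_mono[OF vn norm_ge_zero, of t 2] by (simp add: power_mult_distrib)
      qed
      then have B2: "B\<^sup>2 \<le> M\<^sup>2 * A\<^sup>2" by (simp add: A_def B_def)
      have "W_norm T P = sqrt (A\<^sup>2 + B\<^sup>2)"
        unfolding W_norm_def VB.models_norm[OF P(2)] models_norm_time_deriv[OF PW P(2) v wd] A_def B_def ..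
      also have "\<dots> \<le> sqrt ((1 + M\<^sup>2) * A\<^sup>2)"
        using B2 by (intro real_sqrt_le_mono) (simp add: algebra_simps)
      also have "\<dots> = sqrt (1 + M\<^sup>2) * A" by (simp add: real_sqrt_mult A_def)
      also have "\<dots> \<le> sqrt (1 + M\<^sup>2) * (K * norm g)" using pn by (intro mult_left_mono) (simp_all add: A_def)
      also have "\<dots> \<le> (sqrt (1 + M\<^sup>2) * K + 1) * norm g" by (simp add: algebra_simps)
      also have "norm g = norm_H (\<lambda>x. cont_rep T y T x - yd x)"
        using norm_H_eq[OF H_diff(1)[OF yT yd]] H_diff(2)[OF yT yd] H_diff(2)[OF yd yT]
        by (simp add: g_def yT_def norm_minus_commute)
      finally show "W_norm T P \<le> (sqrt (1 + M\<^sup>2) * K + 1) * norm_H (\<lambda>x. cont_rep T y T x - yd x)" .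
    qed
  qed
qed

end
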